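(* Let $f:[1,+\infty)\to[1,+\infty)$ be a smooth, monotonically increasing function such that $t\mapsto f(t)/t^{1/2}$ is decreasing, and assume $\frac{1}{g(t)}:=\int_t^\infty\frac{da}{a f(a)}<\infty$. Let $\Omega\subset\mathbb{C}^n$ be a bounded pseudoconvex domain with $C^2$ boundary having the $f$-Property. Then there exists a plurisubharmonic function $\rho$, continuous on $\overline\Omega$, such that (1) $z\in\Omega$ if and only if $\rho(z)<0$, and $b\Omega=\{z:\rho(z)=0\}$; (2) $i\partial\bar\partial\rho(X,\bar X)\ge|X|^2$ on $\Omega$ in the sense of distributions, for every $X\in T^{1,0}\mathbb{C}^n$; (3) there is a constant $C>0$ with $|\rho(z)-\rho(z')|\le C\,g(|z-z'|^{-1})^{-2}$ for all $z,z'\in\overline\Omega$ with $0<|z-z'|\le1$, i.e. $\rho\in\Lambda^{g^2}(\overline\Omega)$.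
   Context: $f$-Property: Let $r$ be a defining function of $\Omega$. $\Omega$ has the $f$-Property if there exist a neighborhood $U$ of $b\Omega$ and a family $\{\phi_\delta\}_{0<\delta<1}$ such that (i) each $\phi_\delta$ is plurisubharmonic and $C^2$ on $U$ with $-1\le\phi_\delta\le0$; (ii) for all $z\in U\cap\{z\in\Omega:-\delta<r(z)<0\}$, $i\partial\bar\partial\phi_\delta(z)\ge c f(\delta^{-1})^2\mathrm{Id}$ and $|D\phi_\delta(z)|\le C\delta^{-1}$, with $c,C>0$ independent of $\delta$. $\Lambda^{g^2}(\overline\Omega)$ is the space of bounded functions $u$ on $\overline\Omega$ with $\sup_{0<|z-w|\le1}g(|z-w|^{-1})^2|u(z)-u(w)|<\infty$. *)

theory Defs
  imports "HOL-Analysis.Analysis"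
begin

fun dirder :: "'a::real_normed_vector set \<Rightarrow> ('a \<Rightarrow> real) \<Rightarrow> 'a list \<Rightarrow> 'a \<Rightarrow> real" where
  "dirder S f [] = f"
| "dirder S f (v # vs) = (\<lambda>x. frechet_derivative (dirder S f vs) (at x within S) v)"

definition Ck_on :: "nat \<Rightarrow> 'a::real_normed_vector set \<Rightarrow> ('a \<Rightarrow> real) \<Rightarrow> bool" where
  "Ck_on k S f \<longleftrightarrow>
     (\<forall>vs. length vs < k \<longrightarrow> (\<forall>x\<in>S. dirder S f vs differentiable (at x within S))) \<and>
     (\<forall>vs. length vs = k \<longrightarrow> continuous_on S (dirder S f vs))"

definition smooth_on :: "'a::real_normed_vector set \<Rightarrow> ('a \<Rightarrow> real) \<Rightarrow> bool" where
  "smooth_on S f \<longleftrightarrow> (\<forall>k. Ck_on k S f)"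

definition cscale :: "complex \<Rightarrow> complex^'n \<Rightarrow> complex^'n" where
  "cscale c X = (\<chi> j. c * X $ j)"

text \<open>Levi form (complex Hessian) i ddbar phi (X, conj X) = sum_{j,k} phi_{z_j zbar_k} X_j conj X_k,
  written out in real terms: (D^2 phi[X,X] + D^2 phi[iX,iX]) / 4.\<close>
definition levi :: "(complex^'n) set \<Rightarrow> (complex^'n \<Rightarrow> real) \<Rightarrow> complex^'n \<Rightarrow> complex^'n \<Rightarrow> real" where
  "levi U \<phi> z X = (dirder U \<phi> [X, X] z + dirder U \<phi> [cscale \<i> X, cscale \<i> X] z) / 4"

definition usc_on :: "'a::topological_space set \<Rightarrow> ('a \<Rightarrow> real) \<Rightarrow> bool" where
  "usc_on U u \<longleftrightarrow> (\<forall>x\<in>U. \<forall>e>0. \<forall>\<^sub>F y in at x within U. u y < u x + e)"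

definition psh :: "(complex^'n) set \<Rightarrow> (complex^'n \<Rightarrow> real) \<Rightarrow> bool" where
  "psh U u \<longleftrightarrow> usc_on U u \<and>
     (\<forall>a b. (\<forall>w. cmod w \<le> 1 \<longrightarrow> a + cscale w b \<in> U) \<longrightarrow>
        u a \<le> (1 / (2 * pi)) * integral {0 .. 2 * pi} (\<lambda>\<theta>. u (a + cscale (cis \<theta>) b)))"

definition domain :: "(complex^'n) set \<Rightarrow> bool" where
  "domain \<Omega> \<longleftrightarrow> open \<Omega> \<and> connected \<Omega> \<and> \<Omega> \<noteq> {}"

definition pseudoconvex :: "(complex^'n) set \<Rightarrow> bool" where
  "pseudoconvex \<Omega> \<longleftrightarrow> (\<exists>\<psi>. continuous_on \<Omega> \<psi> \<and> psh \<Omega> \<psi> \<and>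
      (\<forall>c. compact {z\<in>\<Omega>. \<psi> z \<le> c}))"

definition defining_function :: "(complex^'n) set \<Rightarrow> (complex^'n \<Rightarrow> real) \<Rightarrow> bool" where
  "defining_function \<Omega> r \<longleftrightarrow> Ck_on 2 UNIV r \<and> \<Omega> = {z. r z < 0} \<and>
      (\<forall>z\<in>frontier \<Omega>. \<exists>v. dirder UNIV r [v] z \<noteq> 0)"

definition f_property :: "(complex^'n) set \<Rightarrow> (complex^'n \<Rightarrow> real) \<Rightarrow> (real \<Rightarrow> real) \<Rightarrow> bool" where
  "f_property \<Omega> r f \<longleftrightarrow>
     (\<exists>U c C \<phi>. open U \<and> frontier \<Omega> \<subseteq> U \<and> c > 0 \<and> C > 0 \<and>
        (\<forall>\<delta>::real. 0 < \<delta> \<and> \<delta> < 1 \<longrightarrow>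
           psh U (\<phi> \<delta>) \<and> Ck_on 2 U (\<phi> \<delta>) \<and> (\<forall>z\<in>U. -1 \<le> \<phi> \<delta> z \<and> \<phi> \<delta> z \<le> 0) \<and>
           (\<forall>z\<in>U \<inter> {z\<in>\<Omega>. - \<delta> < r z \<and> r z < 0}.
              (\<forall>X. levi U (\<phi> \<delta>) z X \<ge> c * (f (1 / \<delta>))\<^sup>2 * (norm X)\<^sup>2) \<and>
              (\<forall>v. \<bar>dirder U (\<phi> \<delta>) [v] z\<bar> \<le> C / \<delta> * norm v))))"

definition gfun :: "(real \<Rightarrow> real) \<Rightarrow> real \<Rightarrow> real" where
  "gfun f t = 1 / (LINT a:{t..}|lborel. 1 / (a * f a))"

end

(*
  Let d be the distance to the complement, delta_k = 2^-k, a_k = f(2^k)^-2 and m_k = a_k / delta_k. The function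
  a_k phi_{delta_k} has a Levi form bounded below and takes values in [-a_k, 0], but only on a strip of width delta_k.
  Near a boundary point p with inner normal nu it is transplanted: by Oka's lemma -log E is plurisubharmonic for
  E(z) = d(z + D nu), and z + (D - E(z)) nu lies on the boundary up to second order, so phi may be evaluated at
  z + (D - E(z) + const) nu, a point of the strip. Since E is only the modulus of a holomorphic function on a disc,
  the imaginary part is absorbed by a supremum over imaginary translations, and the loss is paid for by M D^2 / E
  with M comparable to m_k. This gives on a patch of size L_k about p a strictly plurisubharmonic function equal to
  -M_k D_k d / (D_k + d) up to an error a_k.

  The solution is the maximum of all patches of all levels and of |z|^2 - const. A patch loses against its neighbours
  near its lateral boundary because of a term -|z - p|^2, and against the previous level at depth sqrt(delta_k D_k)
  because M_k / m_k exceeds M_{k-1} / m_{k-1} by a multiple of sqrt(delta_k / D_k); these increments are summable by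
  the integrability of 1 / (a f(a)). At depth delta_k the maximum has size a_k and slope m_k, hence modulus of continuity
  f(1/s)^-2, which g(1/s)^-2 dominates.
*)
theory Submission
  imports Defs "HOL-Computational_Algebra.Polynomial"
begin

section \<open>Averages over the unit circle\<close>

text \<open>Two constraints fix the scales. The lateral term at distance \<open>L k\<close> must
  beat a few multiples of \<open>a k\<close>, so \<open>L k\<close> is a multiple of the square root
  of \<open>a k\<close>, which is \<open>1 / F k\<close>. Transplantation errs by about
  \<open>D k * (L k)\<^sup>2\<close>, because the normal turns over a patch, and this must be a
  small part of \<open>\<delta> k\<close>; hence \<open>D k\<close> is at most a multiple of
  \<open>1 / m k\<close>. The relative loss \<open>sqrt (\<delta> k / D k)\<close> then has size
  \<open>1 / F k + sqrt (F k / 2 ^ k)\<close>. The supremum over imaginary translations and the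
  maximum over patches leave a merely continuous function, so its Levi form is bounded below in the
  viscosity sense, by averages over infinitesimal circles (\<open>sm\<close>). Such a bound along
  complex lines integrates to the sub-mean value inequality on all closed discs, from which both
  plurisubharmonicity and the distributional inequality follow.\<close>

definition cavg :: "(complex \<Rightarrow> real) \<Rightarrow> real" where
  "cavg g = (1 / (2 * pi)) * integral {0 .. 2 * pi} (\<lambda>\<theta>. g (cis \<theta>))"

lemma cis_in_sphere [simp]: "cis t \<in> sphere 0 1"
  by simp

lemma continuous_on_circle:
  assumes "continuous_on (sphere 0 1) g"
  shows "continuous_on A (\<lambda>t. g (cis t))"
  by (rule continuous_on_compose2[OF assms]) (auto intro!: continuous_intros)

lemma integrable_circle:
  fixes g :: "complex \<Rightarrow> real"
  assumes "continuous_on (sphere 0 1) g"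
  shows "(\<lambda>t. g (cis t)) integrable_on {a..b}"
  by (rule integrable_continuous_real[OF continuous_on_circle[OF assms]])

lemma cavg_cong: "(\<And>w. cmod w = 1 \<Longrightarrow> f w = g w) \<Longrightarrow> cavg f = cavg g"
  unfolding cavg_def by (auto intro!: integral_cong)

lemma cavg_const [simp]: "cavg (\<lambda>_. c) = c"
  unfolding cavg_def by simp

lemma cavg_add:
  assumes "continuous_on (sphere 0 1) f" "continuous_on (sphere 0 1) g"
  shows "cavg (\<lambda>w. f w + g w) = cavg f + cavg g"
  unfolding cavg_def using assms
  by (simp add: integral_add integrable_circle distrib_left add_divide_distrib)

lemma cavg_cmult: "cavg (\<lambda>w. c * f w) = c * cavg f"
  unfolding cavg_def by simp

lemma cavg_diff:
  assumes "continuous_on (sphere 0 1) f" "continuous_on (sphere 0 1) g"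
  shows "cavg (\<lambda>w. f w - g w) = cavg f - cavg g"
  unfolding cavg_def using assms
  by (simp add: integral_diff integrable_circle right_diff_distrib diff_divide_distrib)

lemma cavg_mono:
  assumes "continuous_on (sphere 0 1) f" "continuous_on (sphere 0 1) g"
    and "\<And>w. cmod w = 1 \<Longrightarrow> f w \<le> g w"
  shows "cavg f \<le> cavg g"
  unfolding cavg_def using assms
  by (intro mult_left_mono integral_le integrable_circle) auto

lemma cavg_abs_le:
  assumes "continuous_on (sphere 0 1) f" "continuous_on (sphere 0 1) g"
    and "\<And>w. cmod w = 1 \<Longrightarrow> \<bar>f w\<bar> \<le> g w"
  shows "\<bar>cavg f\<bar> \<le> cavg g"
proof -
  have "cavg f \<le> cavg g"
    by (rule cavg_mono[OF assms(1,2)]) (use assms(3) abs_le_iff in blast)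
  moreover have "cavg (\<lambda>w. -1 * f w) \<le> cavg g"
  proof (rule cavg_mono)
    show "- 1 * f w \<le> g w" if "cmod w = 1" for w using assms(3)[OF that] by linarith
  qed (use assms in \<open>auto intro!: continuous_intros\<close>)
  ultimately show ?thesis using cavg_cmult[of "-1" f] by simp
qed

lemma cavg_Re_power:
  assumes "n > 0"
  shows "cavg (\<lambda>w. Re (c * w ^ n)) = 0"
proof -
  have "((\<lambda>t. Re c * cos (n * t) - Im c * sin (n * t)) has_integral
     ((Re c * sin (n * (2 * pi)) + Im c * cos (n * (2 * pi))) / n - (Re c * sin (real n * 0) + Im c * cos (real n * 0)) / n)) {0..2*pi}"
    by (rule fundamental_theorem_of_calculus)
       (use assms in \<open>auto intro!: derivative_eq_intros simp: has_real_derivative_iff_has_vector_derivative[symmetric] field_simps\<close>)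
  moreover have "sin (n * (2 * pi)) = 0" "cos (n * (2 * pi)) = 1"
    using sin_npi[of "2*n"] cos_npi[of "2*n"] by (simp_all add: mult.assoc mult.left_commute)
  ultimately have "((\<lambda>t. Re c * cos (n * t) - Im c * sin (n * t)) has_integral 0) {0..2*pi}"
    by simp
  moreover have "Re (c * cis t ^ n) = Re c * cos (n * t) - Im c * sin (n * t)" for t :: real
    by (simp only: Complex.DeMoivre times_complex.sel cis.sel)
  ultimately have "integral {0..2*pi} (\<lambda>t. Re (c * cis t ^ n)) = 0"
    by (simp only: integral_unique)
  then show ?thesis by (simp add: cavg_def)
qed

lemma continuous_on_poly_complex [continuous_intros]:
  fixes p :: "complex poly"
  shows "continuous_on A f \<Longrightarrow> continuous_on A (\<lambda>x. poly p (f x))"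
  by (induction p) (auto intro!: continuous_intros)

text \<open>The factor \<open>w ^ n\<close> lets the induction over coefficients close:
  \<open>pCons a p\<close> at \<open>n\<close> splits into a monomial of degree \<open>n\<close> and
  \<open>p\<close> at \<open>Suc n\<close>, which has mean zero.\<close>

lemma cavg_Re_power_poly:
  "cavg (\<lambda>w. Re (w ^ n * poly p w)) = (if n = 0 then Re (poly p 0) else 0)"
proof (induction p arbitrary: n)
  case 0 then show ?case by simp
next
  case (pCons a p)
  have "cavg (\<lambda>w. Re (w ^ n * poly (pCons a p) w)) = cavg (\<lambda>w. Re (a * w ^ n) + Re (w ^ Suc n * poly p w))"
    by (rule cavg_cong) (simp add: algebra_simps)
  also have "\<dots> = cavg (\<lambda>w. Re (a * w ^ n)) + cavg (\<lambda>w. Re (w ^ Suc n * poly p w))"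
    by (rule cavg_add) (auto intro!: continuous_intros)
  also have "\<dots> = (if n = 0 then Re a else 0)"
    using pCons.IH[of "Suc n"] cavg_Re_power[of n a] by auto
  finally show ?case by simp
qed

lemma cavg_Re_poly [simp]: "cavg (\<lambda>w. Re (poly p w)) = Re (poly p 0)"
  using cavg_Re_power_poly[of 0 p] by simp

lemma cavg_Re_poly_disc: "cavg (\<lambda>w. Re (poly p (z + t * w))) = Re (poly p z)"
  using cavg_Re_poly[of "pcompose p [:z, t:]"] by (simp add: poly_pcompose algebra_simps)

text \<open>A polynomial without constant term has a square without constant term, so real and
  imaginary part have the same mean square on the circle.\<close>
lemma cavg_Re_Im_square:
  "cavg (\<lambda>w. (Im (poly p w - poly p 0))\<^sup>2) = cavg (\<lambda>w. (Re (poly p w - poly p 0))\<^sup>2)"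
proof -
  let ?q = "p - [:poly p 0:]"
  have "cavg (\<lambda>w. Re (poly (?q * ?q) w)) = 0" by (subst cavg_Re_poly) simp
  moreover have "cavg (\<lambda>w. Re (poly (?q * ?q) w)) =
      cavg (\<lambda>w. (Re (poly p w - poly p 0))\<^sup>2 - (Im (poly p w - poly p 0))\<^sup>2)"
    by (rule cavg_cong) (simp add: power2_eq_square algebra_simps)
  moreover have "\<dots> = cavg (\<lambda>w. (Re (poly p w - poly p 0))\<^sup>2) - cavg (\<lambda>w. (Im (poly p w - poly p 0))\<^sup>2)"
    by (rule cavg_diff) (auto intro!: continuous_intros)
  ultimately show ?thesis by simp
qed

text \<open>Truncated Schwarz kernel: its sum over all powers is \<open>(v + \<rho>w)/(v - \<rho>w)\<close>, and the real part of that
  is the Poisson kernel.\<close>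
definition schwarz :: "real \<Rightarrow> nat \<Rightarrow> complex \<Rightarrow> complex" where
  "schwarz \<rho> N u = 1 + 2 * (\<Sum>k=1..N. (\<rho> * u) ^ k)"

lemma schwarz_eq:
  assumes "0 < \<rho>" "\<rho> < 1" "cmod u = 1"
  shows "schwarz \<rho> N u = (1 + \<rho> * u) / (1 - \<rho> * u) - 2 * (\<rho> * u) ^ Suc N / (1 - \<rho> * u)"
proof -
  let ?q = "of_real \<rho> * u"
  have "cmod ?q < 1" using assms by (simp add: norm_mult)
  then have ne: "1 - ?q \<noteq> 0" by auto
  have "(1 - x) * (\<Sum>k=1..N. x ^ k) = x - x ^ Suc N" for x :: complex
  proof (induction N)
    case (Suc N)
    have "(1 - x) * (\<Sum>k=1..Suc N. x ^ k) = (1 - x) * (\<Sum>k=1..N. x ^ k) + (1 - x) * x ^ Suc N"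
      by (simp add: distrib_left)
    with Suc show ?case by (simp add: algebra_simps)
  qed simp
  from this[of ?q] have "(1 - ?q) * (\<Sum>k=1..N. ?q ^ k) = ?q - ?q ^ Suc N" .
  moreover have "(1 - ?q) * (1 + 2 * S) = (1 - ?q) + 2 * ((1 - ?q) * S)" for S
    by (simp add: algebra_simps)
  ultimately have "(1 - ?q) * schwarz \<rho> N u = (1 + ?q) - 2 * ?q ^ Suc N"
    unfolding schwarz_def by simp
  with ne show ?thesis unfolding diff_divide_distrib[symmetric] by (simp add: eq_divide_eq mult.commute)
qed

lemma cmod_one_minus_ge:
  assumes "0 < \<rho>" "\<rho> < 1" "cmod u = 1"
  shows "1 - \<rho> \<le> cmod (1 - of_real \<rho> * u)" "cmod (1 - u) \<le> 2 * cmod (1 - of_real \<rho> * u)"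
proof -
  have "cmod (1::complex) - cmod (of_real \<rho> * u) \<le> cmod (1 - of_real \<rho> * u)" by (rule norm_triangle_ineq2)
  then show 1: "1 - \<rho> \<le> cmod (1 - of_real \<rho> * u)" using assms by (simp add: norm_mult)
  have "cmod (1 - u) \<le> cmod (1 - of_real \<rho> * u) + cmod (of_real \<rho> * u - u)"
    using norm_triangle_ineq[of "1 - of_real \<rho> * u" "of_real \<rho> * u - u"] by simp
  also have "of_real \<rho> * u - u = of_real (\<rho> - 1) * u" by (simp add: algebra_simps)
  also have "cmod (of_real (\<rho> - 1) * u) = 1 - \<rho>" using assms unfolding norm_mult norm_of_real by simp
  finally show "cmod (1 - u) \<le> 2 * cmod (1 - of_real \<rho> * u)" using 1 by simp
qed

text \<open>Three properties of the kernel, up to the truncation error \<beta>: its real part is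
  almost the positive Poisson kernel \<open>P\<close>; its modulus is at most of order
  \<open>1 / cmod (1 - u)\<close>, which controls harmonic conjugates of Lipschitz data; and
  \<open>P\<close> concentrates near \<open>u = 1\<close> as \<rho> tends to 1.\<close>

lemma schwarz_bounds:
  assumes "0 < \<rho>" "\<rho> < 1" "cmod u = 1" and \<beta>: "2 * \<rho> ^ Suc N / (1 - \<rho>) \<le> \<beta>"
  defines "P \<equiv> (1 - \<rho>\<^sup>2) / (cmod (1 - of_real \<rho> * u))\<^sup>2"
  shows "\<bar>Re (schwarz \<rho> N u) - P\<bar> \<le> \<beta>"
    and "cmod (1 - u) * cmod (schwarz \<rho> N u) \<le> 4 + 2 * \<beta>"
    and "(cmod (1 - u))\<^sup>2 * P \<le> 4 * (1 - \<rho>\<^sup>2)"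
    and "0 \<le> P"
proof -
  let ?q = "of_real \<rho> * u"
  have q: "cmod ?q = \<rho>" using assms by (simp add: norm_mult)
  have pos: "cmod (1 - ?q) > 0" using cmod_one_minus_ge(1)[OF assms(1-3)] assms by linarith
  have err: "cmod (2 * ?q ^ Suc N / (1 - ?q)) \<le> \<beta>"
  proof -
    have "cmod (2 * ?q ^ Suc N / (1 - ?q)) = 2 * \<rho> ^ Suc N / cmod (1 - ?q)"
      by (simp add: norm_mult norm_divide norm_power q del: power_Suc) (use assms(1) in \<open>simp add: assms(3)\<close>)
    also have "\<dots> \<le> 2 * \<rho> ^ Suc N / (1 - \<rho>)"
      by (rule divide_left_mono[OF cmod_one_minus_ge(1)[OF assms(1-3)] _ mult_pos_pos[OF pos]])
         (use assms in auto)
    finally show ?thesis using \<beta> by simp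
  qed
  have ReP: "Re ((1 + ?q) / (1 - ?q)) = P"
  proof -
    have "Re ((1 + ?q) / (1 - ?q)) = Re ((1 + ?q) * cnj (1 - ?q)) / (cmod (1 - ?q))\<^sup>2"
      by (subst complex_div_cnj) (simp only: Re_divide_of_real flip: of_real_power)
    also have "Re ((1 + ?q) * cnj (1 - ?q)) = 1 - (cmod ?q)\<^sup>2"
      by (simp add: cmod_power2) (simp add: algebra_simps power2_eq_square)
    finally show ?thesis by (simp add: q P_def)
  qed
  have "Re (schwarz \<rho> N u) - P = - Re (2 * ?q ^ Suc N / (1 - ?q))"
    unfolding schwarz_eq[OF assms(1-3)] minus_complex.sel ReP by simp
  then show "\<bar>Re (schwarz \<rho> N u) - P\<bar> \<le> \<beta>"
    using err abs_Re_le_cmod[of "2 * ?q ^ Suc N / (1 - ?q)"] by linarith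
  have h2: "cmod (1 - u) \<le> 2" using norm_triangle_ineq4[of 1 u] assms by simp
  have "cmod (1 - u) * cmod ((1 + ?q) / (1 - ?q)) \<le> 4"
  proof -
    have "cmod (1 + ?q) \<le> 2" using norm_triangle_ineq[of 1 ?q] q assms by simp
    then have "cmod (1 - u) * cmod (1 + ?q) \<le> (2 * cmod (1 - ?q)) * 2"
      by (intro mult_mono cmod_one_minus_ge(2)[OF assms(1-3)]) auto
    then show ?thesis using pos by (simp add: norm_divide field_simps)
  qed
  moreover have "cmod (1 - u) * cmod (2 * ?q ^ Suc N / (1 - ?q)) \<le> 2 * \<beta>"
    by (intro mult_mono h2 err) auto
  moreover have "cmod (schwarz \<rho> N u) \<le> cmod ((1 + ?q) / (1 - ?q)) + cmod (2 * ?q ^ Suc N / (1 - ?q))"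
    unfolding schwarz_eq[OF assms(1-3)] by (rule norm_triangle_ineq4)
  then have "cmod (1 - u) * cmod (schwarz \<rho> N u) \<le>
     cmod (1 - u) * (cmod ((1 + ?q) / (1 - ?q)) + cmod (2 * ?q ^ Suc N / (1 - ?q)))"
    by (rule mult_left_mono) simp
  ultimately show "cmod (1 - u) * cmod (schwarz \<rho> N u) \<le> 4 + 2 * \<beta>"
    by (simp add: distrib_left)
  have r2: "0 \<le> 1 - \<rho>\<^sup>2" using assms by (simp add: power_le_one)
  then show "0 \<le> P" unfolding P_def by simp
  have "(cmod (1 - u))\<^sup>2 \<le> (2 * cmod (1 - ?q))\<^sup>2"
    by (intro power_mono cmod_one_minus_ge(2)[OF assms(1-3)]) auto
  then have "(cmod (1 - u))\<^sup>2 * (1 - \<rho>\<^sup>2) \<le> (4 * (cmod (1 - ?q))\<^sup>2) * (1 - \<rho>\<^sup>2)"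
    by (intro mult_right_mono) (use r2 in \<open>auto simp: power_mult_distrib\<close>)
  then show "(cmod (1 - u))\<^sup>2 * P \<le> 4 * (1 - \<rho>\<^sup>2)"
    using pos unfolding P_def by (simp add: field_simps)
qed

lemma cavg_Re_schwarz:
  "cavg (\<lambda>v. Re (\<alpha> * schwarz \<rho> N (w * cnj v))) = Re \<alpha>"
proof -
  \<comment> \<open>As a function of \<open>v\<close> the kernel is a polynomial in
    \<open>cnj v\<close>; conjugation makes it a polynomial in \<open>v\<close>, whose mean is its
    value at 0.\<close>
  let ?p = "smult (cnj \<alpha>) (1 + (\<Sum>k=1..N. monom (2 * (\<rho> * cnj w) ^ k) k))"
  have "cavg (\<lambda>v. Re (\<alpha> * schwarz \<rho> N (w * cnj v))) = cavg (\<lambda>v. Re (poly ?p v))"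
  proof (rule cavg_cong)
    fix v :: complex
    have "cnj (\<alpha> * schwarz \<rho> N (w * cnj v)) = poly ?p v"
      unfolding schwarz_def
      by (simp add: poly_sum poly_monom sum_distrib_left power_mult_distrib mult_ac)
    then show "Re (\<alpha> * schwarz \<rho> N (w * cnj v)) = Re (poly ?p v)"
      by (metis complex_cnj_cnj cnj.simps(1))
  qed
  also have "\<dots> = Re (poly ?p 0)" by (rule cavg_Re_poly)
  also have "\<dots> = Re \<alpha>" by (simp add: poly_sum poly_monom power_0_left)
  finally show ?thesis .
qed

lemma cavg_sum:
  assumes "\<And>k. k \<in> K \<Longrightarrow> continuous_on (sphere 0 1) (f k)"
  shows "cavg (\<lambda>w. \<Sum>k\<in>K. f k w) = (\<Sum>k\<in>K. cavg (f k))"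
proof (cases "finite K")
  case True
  then show ?thesis using assms
    by (induction K) (auto simp: cavg_add continuous_on_sum)
qed simp

lemma continuous_on_schwarz [continuous_intros]:
  "continuous_on A f \<Longrightarrow> continuous_on A (\<lambda>x. schwarz \<rho> N (f x))"
  unfolding schwarz_def by (auto intro!: continuous_intros)

text \<open>Expanding the kernel in powers of \<open>w\<close> shows that the integral is a
  polynomial whose coefficients are Fourier coefficients of \<open>b\<close>. The factor \<alpha> is
  carried along because \<open>cavg\<close> is real valued: varying it recovers both parts of
  \<open>poly p w\<close>.\<close>

lemma schwarz_integral_poly:
  assumes b: "continuous_on (sphere 0 1) b"
  obtains p where "\<And>\<alpha> w. Re (\<alpha> * poly p w) = cavg (\<lambda>v. b v * Re (\<alpha> * schwarz \<rho> N (w * cnj v)))"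
proof -
  define c where "c k = Complex (cavg (\<lambda>v. b v * Re (cnj v ^ k))) (cavg (\<lambda>v. b v * Im (cnj v ^ k)))" for k
  have cont: "continuous_on (sphere 0 1) (\<lambda>v. b v * Re (\<beta> * cnj v ^ k))"
    "continuous_on (sphere 0 1) (\<lambda>v. b v * Re (cnj v ^ k))"
    "continuous_on (sphere 0 1) (\<lambda>v. b v * Im (cnj v ^ k))" for \<beta> k
    by (auto intro!: continuous_intros b)
  have c: "Re (\<beta> * c k) = cavg (\<lambda>v. b v * Re (\<beta> * cnj v ^ k))" for \<beta> k
  proof -
    have "cavg (\<lambda>v. b v * Re (\<beta> * cnj v ^ k)) =
       cavg (\<lambda>v. Re \<beta> * (b v * Re (cnj v ^ k)) - Im \<beta> * (b v * Im (cnj v ^ k)))"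
      by (rule cavg_cong) (simp add: algebra_simps)
    also have "\<dots> = Re (\<beta> * c k)"
      using cont by (subst cavg_diff) (auto intro!: continuous_intros simp: cavg_cmult c_def b)
    finally show ?thesis by simp
  qed
  define p where "p = [:c 0:] + (\<Sum>k=1..N. monom (2 * \<rho> ^ k * c k) k)"
  show ?thesis
  proof
    fix \<alpha> w
    have "Re (\<alpha> * poly p w) = Re (\<alpha> * c 0) + (\<Sum>k=1..N. Re ((\<alpha> * 2 * \<rho> ^ k * w ^ k) * c k))"
      by (simp add: p_def poly_sum poly_monom distrib_left sum_distrib_left mult_ac)
    also have "\<dots> = cavg (\<lambda>v. b v * Re (\<alpha> * cnj v ^ 0)) +
        cavg (\<lambda>v. \<Sum>k=1..N. b v * Re ((\<alpha> * 2 * \<rho> ^ k * w ^ k) * cnj v ^ k))"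
      unfolding c by (subst cavg_sum) (auto intro!: continuous_intros b)
    also have "\<dots> = cavg (\<lambda>v. b v * Re (\<alpha> * cnj v ^ 0) +
        (\<Sum>k=1..N. b v * Re ((\<alpha> * 2 * \<rho> ^ k * w ^ k) * cnj v ^ k)))"
      by (rule cavg_add[symmetric]) (auto intro!: continuous_intros b)
    also have "\<dots> = cavg (\<lambda>v. b v * Re (\<alpha> * schwarz \<rho> N (w * cnj v)))"
    proof (rule cavg_cong)
      fix v
      have "\<alpha> * schwarz \<rho> N (w * cnj v) = \<alpha> * cnj v ^ 0 + (\<Sum>k=1..N. (\<alpha> * 2 * \<rho> ^ k * w ^ k) * cnj v ^ k)"
        unfolding schwarz_def by (simp add: distrib_left sum_distrib_left power_mult_distrib mult_ac)
      then show "b v * Re (\<alpha> * cnj v ^ 0) + (\<Sum>k=1..N. b v * Re ((\<alpha> * 2 * \<rho> ^ k * w ^ k) * cnj v ^ k))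
         = b v * Re (\<alpha> * schwarz \<rho> N (w * cnj v))"
        by (simp only: Re_sum plus_complex.sel distrib_left sum_distrib_left)
    qed
    finally show "Re (\<alpha> * poly p w) = cavg (\<lambda>v. b v * Re (\<alpha> * schwarz \<rho> N (w * cnj v)))" .
  qed
qed

lemma cmod_eq_Re_unimodular:
  obtains \<alpha> where "cmod \<alpha> = 1" "Re (\<alpha> * z) = cmod z"
proof (cases "z = 0")
  case False
  then have "Re (cnj z / cmod z * z) = cmod z"
    by (simp add: complex_norm_square[symmetric] power2_eq_square field_simps)
  then show ?thesis using that[of "cnj z / cmod z"] False by (simp add: norm_divide)
qed (use that[of 1] in simp)

text \<open>A polynomial substitute for the harmonic extension of \<open>b\<close> together with its
  conjugate. The value at 0 is the mean without any error. The last clause bounds the imaginary part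
  as well: Lipschitz data of constant \<Lambda> have a conjugate of order \<Lambda>, uniformly in
  \<epsilon>.\<close>

lemma harmonic_approx:
  assumes b: "continuous_on (sphere 0 1) b" and "\<epsilon> > 0"
  obtains p where "\<And>w. cmod w = 1 \<Longrightarrow> \<bar>Re (poly p w) - b w\<bar> \<le> \<epsilon>"
    and "poly p 0 = complex_of_real (cavg b)"
    and "\<And>\<Lambda> w. (\<And>v w. cmod v = 1 \<Longrightarrow> cmod w = 1 \<Longrightarrow> \<bar>b v - b w\<bar> \<le> \<Lambda> * cmod (v - w)) \<Longrightarrow>
        cmod w = 1 \<Longrightarrow> cmod (poly p w - b w) \<le> 5 * \<Lambda>"
proof -
  have comp: "compact (sphere (0::complex) 1)" by simp
  obtain B where B: "B > 0" "\<And>w. cmod w = 1 \<Longrightarrow> \<bar>b w\<bar> \<le> B"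
    using compact_imp_bounded[OF compact_continuous_image[OF b comp]]
    unfolding bounded_pos by auto
  obtain \<eta> where \<eta>: "\<eta> > 0" "\<And>v w. cmod v = 1 \<Longrightarrow> cmod w = 1 \<Longrightarrow> cmod (v - w) < \<eta> \<Longrightarrow> \<bar>b v - b w\<bar> < \<epsilon>/4"
    using compact_uniformly_continuous[OF b comp] \<open>\<epsilon> > 0\<close>
    unfolding uniformly_continuous_on_def dist_norm
    by (metis divide_pos_pos mem_sphere_0 real_norm_def zero_less_numeral)
  \<comment> \<open>The oscillation of \<open>b\<close> is at most \<epsilon>/4 within distance
    \<eta> and at most \<open>2 * B\<close> beyond; the quadratic term covers the second
    case.\<close>
  define C where "C = 2 * B / \<eta>\<^sup>2"
  have C: "C > 0" using B \<eta> by (simp add: C_def)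
  have bC: "\<bar>b v - b w\<bar> \<le> \<epsilon>/4 + C * (cmod (v - w))\<^sup>2" if "cmod v = 1" "cmod w = 1" for v w
  proof (cases "cmod (v - w) < \<eta>")
    case True then show ?thesis using \<eta>(2)[OF that True] C by (smt (verit) zero_le_power2 mult_nonneg_nonneg)
  next
    case False
    then have "\<eta>\<^sup>2 \<le> (cmod (v - w))\<^sup>2" using \<eta> by (intro power_mono) auto
    then have "C * \<eta>\<^sup>2 \<le> C * (cmod (v - w))\<^sup>2" using C by (intro mult_left_mono) auto
    moreover have "C * \<eta>\<^sup>2 = 2 * B" using \<eta> by (simp add: C_def)
    ultimately show ?thesis using B(2)[OF that(1)] B(2)[OF that(2)] \<open>\<epsilon> > 0\<close> by linarith
  qed
  have "\<forall>\<^sub>F x in at_left 1. 4 * C * (1 - x\<^sup>2) < \<epsilon>/4"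
  proof (rule order_tendstoD)
    show "((\<lambda>x. 4 * C * (1 - x\<^sup>2)) \<longlongrightarrow> 4 * C * (1 - 1\<^sup>2)) (at_left 1)" by (intro tendsto_intros)
  qed (use \<open>\<epsilon> > 0\<close> in simp)
  moreover have "\<forall>\<^sub>F x::real in at_left 1. 0 < x \<and> x < 1"
    by (rule eventually_at_leftI[of 0]) auto
  \<comment> \<open>By concentration of the Poisson kernel the quadratic term contributes at most
    \<open>4 * C * (1 - \<rho>\<^sup>2)\<close>.\<close>
  ultimately obtain \<rho> where \<rho>: "0 < \<rho>" "\<rho> < 1" "4 * C * (1 - \<rho>\<^sup>2) < \<epsilon>/4"
    using eventually_happens'[OF trivial_limit_at_left_real eventually_conj] by blast
  define \<beta> where "\<beta> = min (1/2) (\<epsilon> / (16 * B))"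
  have \<beta>: "\<beta> > 0" "\<beta> \<le> 1/2" "2 * B * (2 * \<beta>) \<le> \<epsilon>/4" using B \<open>\<epsilon> > 0\<close> by (auto simp: \<beta>_def min_def field_simps)
  have "(\<lambda>N. 2 * \<rho> ^ Suc N / (1 - \<rho>)) \<longlonglongrightarrow> 2 * 0 / (1 - \<rho>)"
    by (intro tendsto_intros LIMSEQ_Suc LIMSEQ_power_zero) (use \<rho> in auto)
  then have "\<forall>\<^sub>F N in sequentially. 2 * \<rho> ^ Suc N / (1 - \<rho>) < \<beta>"
    using \<beta> by (intro order_tendstoD) auto
  then obtain N where N: "2 * \<rho> ^ Suc N / (1 - \<rho>) \<le> \<beta>"
    by (meson eventually_sequentially less_imp_le order_refl)
  obtain p where p: "\<And>\<alpha> w. Re (\<alpha> * poly p w) = cavg (\<lambda>v. b v * Re (\<alpha> * schwarz \<rho> N (w * cnj v)))"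
    using schwarz_integral_poly[OF b] by blast
  have diff: "Re (\<alpha> * (poly p w - b w)) = cavg (\<lambda>v. (b v - b w) * Re (\<alpha> * schwarz \<rho> N (w * cnj v)))" for \<alpha> w
  proof -
    have "Re (\<alpha> * (poly p w - b w)) = cavg (\<lambda>v. b v * Re (\<alpha> * schwarz \<rho> N (w * cnj v)))
        - b w * cavg (\<lambda>v. Re (\<alpha> * schwarz \<rho> N (w * cnj v)))"
      unfolding cavg_Re_schwarz p[symmetric] by (simp add: right_diff_distrib mult.commute)
    also have "\<dots> = cavg (\<lambda>v. b v * Re (\<alpha> * schwarz \<rho> N (w * cnj v)) - b w * Re (\<alpha> * schwarz \<rho> N (w * cnj v)))"
      by (subst cavg_diff) (auto intro!: continuous_intros b simp: cavg_cmult[symmetric])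
    finally show ?thesis by (simp add: left_diff_distrib)
  qed
  have dist: "cmod (v - w) = cmod (1 - w * cnj v)" if "cmod v = 1" for v w
  proof -
    have "v * cnj v = 1" using that by (metis complex_norm_square of_real_1 one_power2)
    then have "1 - w * cnj v = (v - w) * cnj v" by (simp add: algebra_simps)
    then show ?thesis using that by (simp add: norm_mult)
  qed
  show ?thesis
  proof (rule that)
    fix w :: complex assume w: "cmod w = 1"
    let ?P = "\<lambda>v. (1 - \<rho>\<^sup>2) / (cmod (1 - of_real \<rho> * (w * cnj v)))\<^sup>2"
    let ?S = "\<lambda>v. Re (schwarz \<rho> N (w * cnj v))"
    have "\<bar>Re (poly p w) - b w\<bar> = \<bar>cavg (\<lambda>v. (b v - b w) * ?S v)\<bar>"
      using diff[of 1 w] by simp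
    \<comment> \<open>The truncated kernel may change sign, so the bound is a multiple of the kernel
      itself plus constants: its mean is known exactly because the kernel has mean 1.\<close>
    also have "\<dots> \<le> cavg (\<lambda>v. \<epsilon>/4 * ?S v + (\<epsilon>/4 * (2 * \<beta>) + \<epsilon>/4 + \<epsilon>/4))"
    proof (rule cavg_abs_le)
      fix v :: complex assume v: "cmod v = 1"
      have u: "cmod (w * cnj v) = 1" using v w by (simp add: norm_mult)
      note sb = schwarz_bounds[OF \<rho>(1,2) u N]
      have "\<bar>b v - b w\<bar> * \<bar>?S v\<bar> \<le> \<bar>b v - b w\<bar> * (?P v + \<beta>)"
        using sb(1,4) by (intro mult_left_mono) auto
      also have "\<dots> = \<bar>b v - b w\<bar> * ?P v + \<bar>b v - b w\<bar> * \<beta>" by (simp add: distrib_left)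
      also have "\<bar>b v - b w\<bar> * ?P v \<le> (\<epsilon>/4 + C * (cmod (v - w))\<^sup>2) * ?P v"
        by (rule mult_right_mono[OF bC[OF v w] sb(4)])
      also have "\<dots> = \<epsilon>/4 * ?P v + C * ((cmod (1 - w * cnj v))\<^sup>2 * ?P v)"
        by (simp only: dist[OF v] distrib_right mult.assoc)
      also have "C * ((cmod (1 - w * cnj v))\<^sup>2 * ?P v) \<le> C * (4 * (1 - \<rho>\<^sup>2))"
        using C by (intro mult_left_mono sb(3)) auto
      also have "C * (4 * (1 - \<rho>\<^sup>2)) \<le> \<epsilon>/4" using \<rho>(3) by argo
      also have "\<epsilon>/4 * ?P v \<le> \<epsilon>/4 * (?S v + \<beta>)"
        using sb(1) \<open>\<epsilon> > 0\<close> by (intro mult_left_mono) auto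
      also have "\<bar>b v - b w\<bar> * \<beta> \<le> (2 * B) * (2 * \<beta>)"
        using B(2)[OF v] B(2)[OF w] \<beta> B by (intro mult_mono) auto
      also have "(2 * B) * (2 * \<beta>) \<le> \<epsilon>/4" by (rule \<beta>(3))
      finally show "\<bar>(b v - b w) * ?S v\<bar> \<le> \<epsilon>/4 * ?S v + (\<epsilon>/4 * (2 * \<beta>) + \<epsilon>/4 + \<epsilon>/4)"
        using mult_pos_pos[OF \<beta>(1) \<open>\<epsilon> > 0\<close>] unfolding abs_mult by (simp add: algebra_simps)
    qed (auto intro!: continuous_intros b)
    also have "\<dots> = \<epsilon>/4 + (\<epsilon>/4 * (2 * \<beta>) + \<epsilon>/4 + \<epsilon>/4)"
      by (subst cavg_add, (auto intro!: continuous_intros)[2])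
         (use cavg_Re_schwarz[of 1 \<rho> N w] in \<open>simp only: cavg_cmult cavg_const mult_1\<close>, simp)
    also have "\<dots> \<le> \<epsilon>"
    proof -
      have "\<epsilon>/4 * (2 * \<beta>) \<le> \<epsilon>/4 * 1" by (rule mult_left_mono) (use \<beta> \<open>\<epsilon> > 0\<close> in auto)
      then show ?thesis by linarith
    qed
    finally show "\<bar>Re (poly p w) - b w\<bar> \<le> \<epsilon>" .
  next
    have "Re (1 * poly p 0) = cavg b" "Re (- \<i> * poly p 0) = cavg (\<lambda>v. b v * 0)"
      unfolding p by (simp_all add: schwarz_def power_0_left)
    then show "poly p 0 = of_real (cavg b)" by (simp add: complex_eq_iff)
  next
    fix \<Lambda> w
    assume L: "\<And>v w. cmod v = 1 \<Longrightarrow> cmod w = 1 \<Longrightarrow> \<bar>b v - b w\<bar> \<le> \<Lambda> * cmod (v - w)" and w: "cmod w = 1"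
    have "0 \<le> \<Lambda>" using L[of 1 "-1"] by (simp add: zero_le_mult_iff)
    \<comment> \<open>Rotating by \<alpha> turns the modulus into a real part, to which the integral
      formula applies; the Lipschitz factor \<open>cmod (v - w)\<close> cancels the singularity of
      the kernel.\<close>
    obtain \<alpha> where \<alpha>: "cmod \<alpha> = 1" "Re (\<alpha> * (poly p w - b w)) = cmod (poly p w - b w)"
      by (rule cmod_eq_Re_unimodular)
    have "cmod (poly p w - b w) \<le> \<bar>cavg (\<lambda>v. (b v - b w) * Re (\<alpha> * schwarz \<rho> N (w * cnj v)))\<bar>"
      using \<alpha>(2) diff[of \<alpha> w] by simp
    also have "\<dots> \<le> cavg (\<lambda>v. 5 * \<Lambda>)"
    proof (rule cavg_abs_le)
      fix v :: complex assume v: "cmod v = 1"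
      have u: "cmod (w * cnj v) = 1" using v w by (simp add: norm_mult)
      have "\<bar>(b v - b w) * Re (\<alpha> * schwarz \<rho> N (w * cnj v))\<bar> \<le> (\<Lambda> * cmod (v - w)) * cmod (schwarz \<rho> N (w * cnj v))"
        unfolding abs_mult using abs_Re_le_cmod[of "\<alpha> * schwarz \<rho> N (w * cnj v)"]
        by (intro mult_mono L v w) (auto simp: norm_mult \<alpha> \<open>0 \<le> \<Lambda>\<close>)
      also have "\<dots> = \<Lambda> * (cmod (1 - w * cnj v) * cmod (schwarz \<rho> N (w * cnj v)))" by (simp add: dist[OF v])
      also have "\<dots> \<le> \<Lambda> * 5"
        using schwarz_bounds(2)[OF \<rho>(1,2) u N] \<beta> by (intro mult_left_mono) (auto simp: \<open>0 \<le> \<Lambda>\<close>)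
      finally show "\<bar>(b v - b w) * Re (\<alpha> * schwarz \<rho> N (w * cnj v))\<bar> \<le> 5 * \<Lambda>" by simp
    qed (auto intro!: continuous_intros b)
    finally show "cmod (poly p w - b w) \<le> 5 * \<Lambda>" by simp
  qed
qed

section \<open>The asymptotic sub-mean value property\<close>

lemma cscale_add_left: "cscale (c + d) X = cscale c X + cscale d X"
  and cscale_diff_left: "cscale (c - d) X = cscale c X - cscale d X"
  and cscale_add_right: "cscale c (X + Y) = cscale c X + cscale c Y"
  and cscale_minus_left: "cscale (- c) X = - cscale c X"
  and cscale_minus_right: "cscale c (- X) = - cscale c X"
  and cscale_cscale: "cscale c (cscale d X) = cscale (c * d) X"
  by (simp_all add: cscale_def vec_eq_iff algebra_simps)

lemma cscale_0 [simp]: "cscale 0 X = 0" "cscale c 0 = 0"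
  and cscale_1 [simp]: "cscale 1 X = X"
  and cscale_of_real: "cscale (of_real r) X = r *\<^sub>R X"
  and cscale_scaleR: "cscale (r *\<^sub>R c) X = r *\<^sub>R cscale c X"
  and cscale_scaleR_right: "cscale c (r *\<^sub>R X) = r *\<^sub>R cscale c X"
  by (simp_all add: cscale_def vec_eq_iff complex_eq_iff algebra_simps)

lemma cscale_of_real_mult: "cscale (of_real t * v) Y = cscale v (t *\<^sub>R Y)"
  by (simp add: cscale_def vec_eq_iff complex_eq_iff algebra_simps)

lemma norm_cscale [simp]: "norm (cscale c X) = cmod c * norm X"
  by (simp add: cscale_def norm_vec_def L2_set_def norm_mult power_mult_distrib sum_distrib_left[symmetric] real_sqrt_mult)

lemma bounded_bilinear_cscale: "bounded_bilinear cscale"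
  by standard (auto simp: cscale_add_left cscale_add_right cscale_scaleR cscale_scaleR_right intro!: exI[of _ 1])

lemmas continuous_on_cscale [continuous_intros] = bounded_bilinear.continuous_on[OF bounded_bilinear_cscale]

definition hdot :: "complex^'n \<Rightarrow> complex^'n \<Rightarrow> complex" where
  "hdot A B = (\<Sum>j\<in>UNIV. cnj (A $ j) * B $ j)"

lemma inner_eq_hdot: "inner A B = Re (hdot A B)"
  by (simp add: inner_vec_def hdot_def inner_complex_def)

lemma hdot_cscale: "hdot A (cscale c B) = c * hdot A B"
  by (simp add: hdot_def cscale_def algebra_simps sum_distrib_left)

lemma inner_cscale: "inner A (cscale c B) = Re (c * hdot A B)"
  by (simp add: inner_eq_hdot hdot_cscale)

lemma inner_cscale_i [simp]: "inner A (cscale \<i> A) = 0"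
  by (simp add: inner_vec_def cscale_def inner_complex_def algebra_simps)

text \<open>Pythagoras: the cross term is twice the real part of the Hermitian product of
  \<open>F 0\<close> with \<open>F w - F 0\<close>, a polynomial in \<open>w\<close> vanishing at 0,
  so it has mean zero.\<close>

lemma cavg_norm_sq_poly_disc:
  fixes a b X :: "complex^'n" and G :: "complex poly"
  defines "F \<equiv> \<lambda>w. a + cscale w b + cscale (poly G w) X"
  shows "cavg (\<lambda>w. (norm (F w))\<^sup>2) = (norm (F 0))\<^sup>2 + cavg (\<lambda>w. (norm (F w - F 0))\<^sup>2)"
proof -
  let ?p = "[:0, 2 * hdot (F 0) b:] + smult (2 * hdot (F 0) X) (G - [:poly G 0:])"
  have "cavg (\<lambda>w. (norm (F w))\<^sup>2) = cavg (\<lambda>w. (norm (F 0))\<^sup>2 + (norm (F w - F 0))\<^sup>2 + Re (poly ?p w))"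
  proof (rule cavg_cong)
    fix w
    have "F w - F 0 = cscale w b + cscale (poly G w - poly G 0) X"
      by (simp add: F_def cscale_diff_left)
    then have "2 * inner (F 0) (F w - F 0) = Re (poly ?p w)"
      by (simp add: inner_add_right inner_cscale algebra_simps)
    moreover have "(norm (F w))\<^sup>2 = (norm (F 0 + (F w - F 0)))\<^sup>2" by simp
    moreover have "\<dots> = (norm (F 0))\<^sup>2 + (norm (F w - F 0))\<^sup>2 + 2 * inner (F 0) (F w - F 0)"
      by (simp add: power2_norm_eq_inner inner_add_left inner_add_right inner_commute algebra_simps)
    ultimately show "(norm (F w))\<^sup>2 = (norm (F 0))\<^sup>2 + (norm (F w - F 0))\<^sup>2 + Re (poly ?p w)" by simp
  qed
  also have "\<dots> = (norm (F 0))\<^sup>2 + cavg (\<lambda>w. (norm (F w - F 0))\<^sup>2) + Re (poly ?p 0)"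
    by (subst cavg_add, force intro!: continuous_intros simp: F_def, force intro!: continuous_intros,
        subst cavg_add) (auto intro!: continuous_intros simp: F_def simp del: poly_add poly_smult poly_diff)
  finally show ?thesis by simp
qed

lemma cavg_norm_sq_disc: "cavg (\<lambda>w. (norm (a + cscale w b))\<^sup>2) = (norm a)\<^sup>2 + (norm b)\<^sup>2"
proof -
  have "cavg (\<lambda>w. (norm (a + cscale w b))\<^sup>2) = (norm a)\<^sup>2 + cavg (\<lambda>w. (norm (cscale w b))\<^sup>2)"
    using cavg_norm_sq_poly_disc[of a b 0 0] by simp
  also have "cavg (\<lambda>w. (norm (cscale w b))\<^sup>2) = cavg (\<lambda>w. (norm b)\<^sup>2)" by (rule cavg_cong) simp
  finally show ?thesis by simp
qed

lemma cavg_cmod_sq_disc: "cavg (\<lambda>v. (cmod (w + of_real t * v))\<^sup>2) = (cmod w)\<^sup>2 + t\<^sup>2"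
proof -
  let ?p = "[:of_real ((cmod w)\<^sup>2 + t\<^sup>2), 2 * of_real t * cnj w:]"
  have "cavg (\<lambda>v. (cmod (w + of_real t * v))\<^sup>2) = cavg (\<lambda>v. Re (poly ?p v))"
  proof (rule cavg_cong)
    fix v :: complex assume "cmod v = 1"
    then have *: "(Re v)\<^sup>2 + (Im v)\<^sup>2 = 1" by (simp add: cmod_def)
    have "(cmod (w + of_real t * v))\<^sup>2 = (cmod w)\<^sup>2 + t\<^sup>2 * ((Re v)\<^sup>2 + (Im v)\<^sup>2) + 2 * t * (Re w * Re v + Im w * Im v)"
      unfolding cmod_power2 by (simp add: power2_eq_square algebra_simps)
    then show "(cmod (w + of_real t * v))\<^sup>2 = Re (poly ?p v)"
      unfolding * by (simp add: algebra_simps)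
  qed
  then show ?thesis by (simp only: cavg_Re_poly) simp
qed

text \<open>One radius for each \<epsilon> suffices, and it may lose \<epsilon> times its square:
  the maximum principle below adds a multiple of the squared modulus, whose gain on a circle has the
  same order. This is weak enough to be checked pointwise from second order expansions.\<close>

definition asub :: "(complex \<Rightarrow> real) \<Rightarrow> complex \<Rightarrow> bool" where
  "asub g w \<longleftrightarrow> (\<forall>\<epsilon>>0. \<exists>t>0. t < 1 - cmod w \<and> g w - \<epsilon> * t\<^sup>2 \<le> cavg (\<lambda>v. g (w + of_real t * v)))"

lemma continuous_on_small_circle:
  assumes "continuous_on (cball 0 1) g" "t \<ge> 0" "t \<le> 1 - cmod w"
  shows "continuous_on (sphere 0 1) (\<lambda>v. g (w + of_real t * v))"
proof (rule continuous_on_compose2[OF assms(1)])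
  show "(\<lambda>v. w + of_real t * v) ` sphere 0 1 \<subseteq> cball 0 1"
  proof clarsimp
    fix v :: complex assume "cmod v = 1"
    then show "cmod (w + of_real t * v) \<le> 1"
      using norm_triangle_ineq[of w "of_real t * v"] assms by (simp add: norm_mult)
  qed
qed (auto intro!: continuous_intros)

text \<open>Adding \<sigma> times the squared modulus, with \<sigma> half of the excess over
  \<open>m\<close>, keeps the maximum in the interior. There the added term gains
  \<open>\<sigma> * t\<^sup>2\<close> on a small circle against an error of half that, so the
  average would exceed the maximum.\<close>

lemma asub_max_principle:
  assumes cont: "continuous_on (cball 0 1) g"
    and sub: "\<And>w. cmod w < 1 \<Longrightarrow> asub g w"
    and bd: "\<And>w. cmod w = 1 \<Longrightarrow> g w \<le> m" and w1: "cmod w1 \<le> 1"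
  shows "g w1 \<le> m"
proof (rule ccontr)
  assume "\<not> g w1 \<le> m"
  define \<sigma> where "\<sigma> = (g w1 - m) / 2"
  have \<sigma>: "\<sigma> > 0" using \<open>\<not> g w1 \<le> m\<close> by (simp add: \<sigma>_def)
  define h where "h w = g w + \<sigma> * (cmod w)\<^sup>2" for w
  have hc: "continuous_on (cball 0 1) h" unfolding h_def by (intro continuous_intros cont)
  obtain w0 where w0: "cmod w0 \<le> 1" "\<And>w. cmod w \<le> 1 \<Longrightarrow> h w \<le> h w0"
    using continuous_attains_sup[OF compact_cball _ hc] by auto
  have "g w1 \<le> h w1" using \<sigma> by (simp add: h_def)
  with w0(2)[OF w1] have "m + \<sigma> < h w0" using \<sigma> by (simp add: \<sigma>_def field_simps)
  moreover have "h w \<le> m + \<sigma>" if "cmod w = 1" for w using bd[OF that] that by (simp add: h_def)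
  ultimately have "cmod w0 < 1" using w0(1) by (metis leD le_less)
  then obtain t where t: "t > 0" "t < 1 - cmod w0" "g w0 - \<sigma>/2 * t\<^sup>2 \<le> cavg (\<lambda>v. g (w0 + of_real t * v))"
    using sub[of w0] \<sigma> unfolding asub_def by (meson half_gt_zero)
  note c = continuous_on_small_circle[OF _ less_imp_le[OF t(1)] less_imp_le[OF t(2)]]
  have "cavg (\<lambda>v. h (w0 + of_real t * v)) = cavg (\<lambda>v. g (w0 + of_real t * v)) + \<sigma> * ((cmod w0)\<^sup>2 + t\<^sup>2)"
    unfolding h_def
    by (subst cavg_add) (auto intro!: continuous_intros c[OF cont] simp: cavg_cmult cavg_cmod_sq_disc)
  moreover have "\<dots> \<ge> h w0 + \<sigma> * t\<^sup>2 / 2" using t(3) by (simp add: h_def algebra_simps)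
  moreover have "h w0 + \<sigma> * t\<^sup>2 / 2 > h w0" using \<sigma> t(1) by simp
  ultimately have "h w0 < cavg (\<lambda>v. h (w0 + of_real t * v))" by linarith
  moreover have "cavg (\<lambda>v. h (w0 + of_real t * v)) \<le> cavg (\<lambda>v. h w0)"
  proof (rule cavg_mono[OF c[OF hc]])
    fix v :: complex assume "cmod v = 1"
    then have "cmod (w0 + of_real t * v) \<le> 1"
      using norm_triangle_ineq[of w0 "of_real t * v"] t by (simp add: norm_mult)
    then show "h (w0 + of_real t * v) \<le> h w0" by (rule w0(2))
  qed auto
  ultimately show False by simp
qed

text \<open>Compare with \<open>Re p\<close> for a polynomial \<open>p\<close> approximating
  \<open>g\<close> on the circle: subtracting it preserves \<open>asub\<close>, and its value at 0
  is the mean of \<open>g\<close>.\<close>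

lemma asub_submean:
  assumes cont: "continuous_on (cball 0 1) g"
    and sub: "\<And>w. cmod w < 1 \<Longrightarrow> asub g w"
  shows "g 0 \<le> cavg g"
proof (rule field_le_epsilon)
  fix e :: real assume e: "e > 0"
  have cs: "continuous_on (sphere 0 1) g" by (rule continuous_on_subset[OF cont]) auto
  obtain p where p: "\<And>w. cmod w = 1 \<Longrightarrow> \<bar>Re (poly p w) - g w\<bar> \<le> e" "poly p 0 = complex_of_real (cavg g)"
    using harmonic_approx[OF cs e] by metis
  have "g 0 - Re (poly p 0) \<le> e"
  proof (rule asub_max_principle[where g = "\<lambda>w. g w - Re (poly p w)"])
    show "continuous_on (cball 0 1) (\<lambda>w. g w - Re (poly p w))" by (intro continuous_intros cont)
    show "asub (\<lambda>w. g w - Re (poly p w)) w" if w: "cmod w < 1" for w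
      unfolding asub_def
    proof (intro allI impI)
      fix \<epsilon> :: real assume "\<epsilon> > 0"
      then obtain t where t: "t > 0" "t < 1 - cmod w" "g w - \<epsilon> * t\<^sup>2 \<le> cavg (\<lambda>v. g (w + of_real t * v))"
        using sub[OF w] unfolding asub_def by blast
      have "cavg (\<lambda>v. g (w + of_real t * v) - Re (poly p (w + of_real t * v))) =
          cavg (\<lambda>v. g (w + of_real t * v)) - Re (poly p w)"
        using t by (subst cavg_diff) (auto intro!: continuous_intros continuous_on_small_circle cont simp: cavg_Re_poly_disc)
      with t show "\<exists>t>0. t < 1 - cmod w \<and> g w - Re (poly p w) - \<epsilon> * t\<^sup>2
          \<le> cavg (\<lambda>v. g (w + of_real t * v) - Re (poly p (w + of_real t * v)))"
        by (intro exI[of _ t]) auto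
    qed
    show "g w - Re (poly p w) \<le> e" if "cmod w = 1" for w using p(1)[OF that] by linarith
  qed simp
  with p(2) show "g 0 \<le> cavg g + e" by simp
qed

text \<open>Lower bound \<open>c\<close> for the Levi form of \<open>u\<close> at \<open>z\<close>, phrased with infinitesimal circles so that it passes from a
  function to any larger one touching it at \<open>z\<close>; in particular it survives maxima.\<close>
definition sm :: "(complex^'n \<Rightarrow> real) \<Rightarrow> real \<Rightarrow> complex^'n \<Rightarrow> bool" where
  "sm u c z \<longleftrightarrow> (\<forall>Y. \<forall>\<epsilon>>0. \<forall>\<^sub>F t in at_right 0.
      u z + (c * (norm Y)\<^sup>2 - \<epsilon>) * t\<^sup>2 \<le> cavg (\<lambda>v. u (z + cscale (of_real t * v) Y)))"

lemma continuous_on_disc: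
  assumes "continuous_on U u" "\<And>w. cmod w \<le> 1 \<Longrightarrow> a + cscale w b \<in> U"
  shows "continuous_on (cball 0 1) (\<lambda>w. u (a + cscale w b))"
  by (rule continuous_on_compose2[OF assms(1)]) (use assms(2) in \<open>auto intro!: continuous_intros\<close>)

lemma continuous_on_ball_circle:
  assumes "continuous_on (ball z r) u" "cmod c * norm Y < r"
  shows "continuous_on (sphere 0 1) (\<lambda>v. u (z + cscale (c * v) Y))"
  by (rule continuous_on_compose2[OF assms(1)]) (use assms(2) in \<open>auto intro!: continuous_intros simp: dist_norm norm_mult\<close>)

lemma eventually_small: "(0::real) < r \<Longrightarrow> \<forall>\<^sub>F t in at_right 0. 0 < t \<and> t * c < r"
proof -
  assume r: "0 < r"
  have "\<forall>\<^sub>F t in at_right 0. t * c < r"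
  proof (rule order_tendstoD)
    show "((\<lambda>t. t * c) \<longlongrightarrow> 0 * c) (at_right 0)" by (intro tendsto_intros)
  qed (use r in simp)
  with eventually_at_right_less[of 0] show "\<forall>\<^sub>F t in at_right 0. 0 < t \<and> t * c < r"
    by eventually_elim auto
qed

text \<open>Along the disc the bound \<open>c\<close> is used up by subtracting
  \<open>c * (norm b)\<^sup>2 * (cmod w)\<^sup>2\<close>, which leaves \<open>asub\<close>; on the
  unit circle the subtracted term is the constant that reappears as the gain.\<close>

lemma sm_submean_disc:
  assumes U: "open U" "continuous_on U u" and s: "\<And>z. z \<in> U \<Longrightarrow> sm u c z"
    and disc: "\<And>w. cmod w \<le> 1 \<Longrightarrow> a + cscale w b \<in> U"
  shows "u a + c * (norm b)\<^sup>2 \<le> cavg (\<lambda>w. u (a + cscale w b))"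
proof -
  define g where "g w = u (a + cscale w b) - c * (norm b)\<^sup>2 * (cmod w)\<^sup>2" for w
  have gc: "continuous_on (cball 0 1) g"
    unfolding g_def by (intro continuous_intros continuous_on_disc[OF U(2) disc])
  have "asub g w" if w: "cmod w < 1" for w
    unfolding asub_def
  proof (intro allI impI)
    fix \<epsilon> :: real assume "\<epsilon> > 0"
    have "a + cscale w b \<in> U" using disc w by simp
    then have "\<forall>\<^sub>F t in at_right 0. u (a + cscale w b) + (c * (norm b)\<^sup>2 - \<epsilon>) * t\<^sup>2 \<le>
        cavg (\<lambda>v. u (a + cscale w b + cscale (of_real t * v) b))"
      using s \<open>\<epsilon> > 0\<close> unfolding sm_def by blast
    moreover have "\<forall>\<^sub>F t in at_right 0. 0 < t \<and> t * 1 < 1 - cmod w"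
      by (rule eventually_small) (use w in simp)
    ultimately have "\<forall>\<^sub>F t in at_right 0. t > 0 \<and> t < 1 - cmod w \<and>
        g w - \<epsilon> * t\<^sup>2 \<le> cavg (\<lambda>v. g (w + of_real t * v))"
    proof eventually_elim
      case (elim t)
      have "cavg (\<lambda>v. g (w + of_real t * v)) = cavg (\<lambda>v. u (a + cscale (w + of_real t * v) b)) - c * (norm b)\<^sup>2 * ((cmod w)\<^sup>2 + t\<^sup>2)"
        unfolding g_def using elim
        by (subst cavg_diff) (auto intro!: continuous_intros simp: cavg_cmult cavg_cmod_sq_disc
            continuous_on_small_circle[OF continuous_on_disc[OF U(2) disc]])
      with elim show ?case by (simp add: g_def cscale_add_left add.assoc algebra_simps)
    qed
    then show "\<exists>t>0. t < 1 - cmod w \<and> g w - \<epsilon> * t\<^sup>2 \<le> cavg (\<lambda>v. g (w + of_real t * v))"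
      using eventually_happens'[OF trivial_limit_at_right_real] by blast
  qed
  from asub_submean[OF gc this] have "u a \<le> cavg g" by (simp add: g_def)
  also have "cavg g = cavg (\<lambda>w. u (a + cscale w b) - c * (norm b)\<^sup>2)"
    by (rule cavg_cong) (simp add: g_def)
  also have "\<dots> = cavg (\<lambda>w. u (a + cscale w b)) - c * (norm b)\<^sup>2"
    by (subst cavg_diff) (auto intro!: continuous_on_subset[OF continuous_on_disc[OF U(2) disc]])
  finally show ?thesis by simp
qed

lemma sm_mono_at:
  assumes "sm u c z" "open V" "z \<in> V" "continuous_on V u" "continuous_on V v" "u z = v z"
    and le: "\<And>x. x \<in> V \<Longrightarrow> u x \<le> v x"
  shows "sm v c z"
  unfolding sm_def
proof (intro allI impI)
  fix Y and \<epsilon> :: real assume "\<epsilon> > 0"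
  obtain r where r: "r > 0" "ball z r \<subseteq> V" using assms(2,3) openE by blast
  have "\<forall>\<^sub>F t in at_right 0. u z + (c * (norm Y)\<^sup>2 - \<epsilon>) * t\<^sup>2 \<le> cavg (\<lambda>v. u (z + cscale (of_real t * v) Y))"
    using assms(1) \<open>\<epsilon> > 0\<close> unfolding sm_def by blast
  with eventually_small[OF r(1), of "norm Y"]
  show "\<forall>\<^sub>F t in at_right 0. v z + (c * (norm Y)\<^sup>2 - \<epsilon>) * t\<^sup>2 \<le> cavg (\<lambda>w. v (z + cscale (of_real t * w) Y))"
  proof eventually_elim
    case (elim t)
    have "cavg (\<lambda>v. u (z + cscale (of_real t * v) Y)) \<le> cavg (\<lambda>w. v (z + cscale (of_real t * w) Y))"
    proof (rule cavg_mono)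
      show "continuous_on (sphere 0 1) (\<lambda>v. u (z + cscale (of_real t * v) Y))"
        "continuous_on (sphere 0 1) (\<lambda>w. v (z + cscale (of_real t * w) Y))"
        using elim assms(4,5) r(2) by (auto intro!: continuous_on_ball_circle[of z r] intro: continuous_on_subset)
      fix w :: complex assume "cmod w = 1"
      then have "z + cscale (of_real t * w) Y \<in> ball z r" using elim by (simp add: dist_norm norm_mult)
      then show "u (z + cscale (of_real t * w) Y) \<le> v (z + cscale (of_real t * w) Y)" using r(2) le by blast
    qed
    with elim assms(6) show ?case by simp
  qed
qed

text \<open>Squared distances have exact circle averages, so the bound shifts by \<open>k\<close>
  for either sign; negative values serve to penalise the distance from a patch centre.\<close>

lemma sm_add_norm_sq:
  assumes "sm u c z" "open V" "z \<in> V" "continuous_on V u"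
  shows "sm (\<lambda>x. u x + k * (norm (x - p))\<^sup>2 + l) (c + k) z"
  unfolding sm_def
proof (intro allI impI)
  fix Y and \<epsilon> :: real assume "\<epsilon> > 0"
  obtain r where r: "r > 0" "ball z r \<subseteq> V" using assms(2,3) openE by blast
  have "\<forall>\<^sub>F t in at_right 0. u z + (c * (norm Y)\<^sup>2 - \<epsilon>) * t\<^sup>2 \<le> cavg (\<lambda>v. u (z + cscale (of_real t * v) Y))"
    using assms(1) \<open>\<epsilon> > 0\<close> unfolding sm_def by blast
  with eventually_small[OF r(1), of "norm Y"]
  show "\<forall>\<^sub>F t in at_right 0. u z + k * (norm (z - p))\<^sup>2 + l + ((c + k) * (norm Y)\<^sup>2 - \<epsilon>) * t\<^sup>2
     \<le> cavg (\<lambda>w. u (z + cscale (of_real t * w) Y) + k * (norm (z + cscale (of_real t * w) Y - p))\<^sup>2 + l)"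
  proof eventually_elim
    case (elim t)
    have c1: "continuous_on (sphere 0 1) (\<lambda>v. u (z + cscale (of_real t * v) Y))"
      using elim assms(4) r(2) by (auto intro!: continuous_on_ball_circle[of z r] intro: continuous_on_subset)
    have "cavg (\<lambda>w. (norm (z + cscale (of_real t * w) Y - p))\<^sup>2) = cavg (\<lambda>w. (norm ((z - p) + cscale w (t *\<^sub>R Y)))\<^sup>2)"
      unfolding cscale_of_real_mult by (simp add: add_diff_eq diff_add_eq)
    also have "\<dots> = (norm (z - p))\<^sup>2 + t\<^sup>2 * (norm Y)\<^sup>2"
      unfolding cavg_norm_sq_disc by (simp add: power_mult_distrib)
    finally have n: "cavg (\<lambda>w. (norm (z + cscale (of_real t * w) Y - p))\<^sup>2) = (norm (z - p))\<^sup>2 + t\<^sup>2 * (norm Y)\<^sup>2" .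
    have "cavg (\<lambda>w. u (z + cscale (of_real t * w) Y) + k * (norm (z + cscale (of_real t * w) Y - p))\<^sup>2 + l)
      = cavg (\<lambda>w. u (z + cscale (of_real t * w) Y)) + k * ((norm (z - p))\<^sup>2 + t\<^sup>2 * (norm Y)\<^sup>2) + l"
      by (subst cavg_add, (auto intro!: continuous_intros c1)[2])
         (subst cavg_add, auto intro!: continuous_intros c1 simp: cavg_cmult n)
    with elim show ?case by (simp add: algebra_simps)
  qed
qed

lemma sm_weaken:
  assumes "sm u c z" "c' \<le> c"
  shows "sm u c' z"
  unfolding sm_def
proof (intro allI impI)
  fix Y and \<epsilon> :: real assume "\<epsilon> > 0"
  have "\<forall>\<^sub>F t in at_right 0. u z + (c * (norm Y)\<^sup>2 - \<epsilon>) * t\<^sup>2 \<le> cavg (\<lambda>v. u (z + cscale (of_real t * v) Y))"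
    using assms(1) \<open>\<epsilon> > 0\<close> unfolding sm_def by blast
  then show "\<forall>\<^sub>F t in at_right 0. u z + (c' * (norm Y)\<^sup>2 - \<epsilon>) * t\<^sup>2 \<le> cavg (\<lambda>v. u (z + cscale (of_real t * v) Y))"
  proof eventually_elim
    case (elim t)
    have "(c' * (norm Y)\<^sup>2 - \<epsilon>) * t\<^sup>2 \<le> (c * (norm Y)\<^sup>2 - \<epsilon>) * t\<^sup>2"
      using assms(2) by (intro mult_right_mono diff_right_mono) auto
    with elim show ?case by linarith
  qed
qed

section \<open>Second order expansions along discs\<close>

lemma Ck2_dirder:
  assumes "open U" "Ck_on 2 U u" "x \<in> U"
  shows "(u has_derivative (\<lambda>v. dirder U u [v] x)) (at x)"
    and "(dirder U u [w] has_derivative (\<lambda>v. dirder U u [v, w] x)) (at x)"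
    and "continuous_on U (dirder U u [v, w])"
proof -
  have k: "dirder U u vs differentiable (at x within U)" if "length vs < 2" for vs
    using conjunct1[OF assms(2)[unfolded Ck_on_def], rule_format, OF that assms(3)] .
  have at: "at x within U = at x" by (rule at_within_open[OF assms(3,1)])
  have "u differentiable (at x within U)" using k[of "[]"] by simp
  then show "(u has_derivative (\<lambda>v. dirder U u [v] x)) (at x)"
    unfolding frechet_derivative_works at by (simp only: dirder.simps at)
  have "dirder U u [w] differentiable (at x within U)" by (rule k) simp
  then have "(dirder U u [w] has_derivative frechet_derivative (dirder U u [w]) (at x within U)) (at x)"
    unfolding frechet_derivative_works at by (simp only: at)
  then show "(dirder U u [w] has_derivative (\<lambda>v. dirder U u [v, w] x)) (at x)"
    by (simp only: dirder.simps(2)[of U u _ "[w]"])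
  have "length [v, w] = 2" by simp
  then show "continuous_on U (dirder U u [v, w])"
    using conjunct2[OF assms(2)[unfolded Ck_on_def], rule_format, of "[v, w]"] by (simp del: dirder.simps)
qed

lemma Ck2_dirder_continuous:
  assumes "open U" "Ck_on 2 U u"
  shows "continuous_on U (dirder U u [w])" "continuous_on U u"
  by (rule continuous_at_imp_continuous_on, rule ballI, rule has_derivative_continuous, erule Ck2_dirder[OF assms])+

lemma Ck2_dirder_linear:
  assumes "open U" "Ck_on 2 U u" "x \<in> U"
  shows "dirder U u [a *\<^sub>R v + b *\<^sub>R w] x = a * dirder U u [v] x + b * dirder U u [w] x"
    and "dirder U u [a *\<^sub>R v + b *\<^sub>R w, y] x = a * dirder U u [v, y] x + b * dirder U u [w, y] x"
proof -
  have "linear (\<lambda>v. dirder U u [v] x)" "linear (\<lambda>v. dirder U u [v, y] x)"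
    by (rule has_derivative_linear[OF Ck2_dirder(1)[OF assms]], rule has_derivative_linear[OF Ck2_dirder(2)[OF assms]])
  then show "dirder U u [a *\<^sub>R v + b *\<^sub>R w] x = a * dirder U u [v] x + b * dirder U u [w] x"
    "dirder U u [a *\<^sub>R v + b *\<^sub>R w, y] x = a * dirder U u [v, y] x + b * dirder U u [w, y] x"
    by (simp_all add: linear_iff del: dirder.simps)
qed

text \<open>Taylor expansion along each radius. Averaging over directions kills the first order term
  and, in the quadratic form in \<open>Re v\<close> and \<open>Im v\<close>, everything but half the
  trace; that half trace is twice the Levi form.\<close>

lemma cavg_taylor:
  assumes U: "open U" "Ck_on 2 U u" and t: "0 < t"
    and disc: "\<And>x. norm (x - z) \<le> t * norm Y \<Longrightarrow> x \<in> U"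
    and var: "\<And>x a b. norm (x - z) \<le> t * norm Y \<Longrightarrow> a \<in> {Y, cscale \<i> Y} \<Longrightarrow> b \<in> {Y, cscale \<i> Y} \<Longrightarrow>
      \<bar>dirder U u [a, b] x - dirder U u [a, b] z\<bar> \<le> \<epsilon>"
  shows "\<bar>cavg (\<lambda>v. u (z + cscale (of_real t * v) Y)) - u z - levi U u z Y * t\<^sup>2\<bar> \<le> \<epsilon> * t\<^sup>2"
proof -
  let ?I = "cscale \<i> Y"
  define D1 where "D1 v x = Re v * dirder U u [Y] x + Im v * dirder U u [?I] x" for v x
  define D2 where "D2 v x = (Re v)\<^sup>2 * dirder U u [Y, Y] x + Re v * Im v * dirder U u [Y, ?I] x
     + Im v * Re v * dirder U u [?I, Y] x + (Im v)\<^sup>2 * dirder U u [?I, ?I] x" for v x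
  have pt: "norm (z + s *\<^sub>R cscale v Y - z) \<le> t * norm Y" if "cmod v = 1" "0 \<le> s" "s \<le> t" for s v
    using that by (simp add: mult_right_mono)
  have e: "cscale v Y = Re v *\<^sub>R Y + Im v *\<^sub>R ?I" for v
    by (simp add: cscale_def vec_eq_iff complex_eq_iff)
  have lin1: "dirder U u [h *\<^sub>R cscale v Y] x = h * D1 v x"
    and lin2: "dirder U u [h *\<^sub>R cscale v Y, b] x = h * (Re v * dirder U u [Y, b] x + Im v * dirder U u [?I, b] x)"
    if "x \<in> U" for h v x b
  proof -
    have "h *\<^sub>R cscale v Y = (h * Re v) *\<^sub>R Y + (h * Im v) *\<^sub>R ?I"
      unfolding e[of v] by (simp add: scaleR_add_right)
    then show "dirder U u [h *\<^sub>R cscale v Y] x = h * D1 v x"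
      "dirder U u [h *\<^sub>R cscale v Y, b] x = h * (Re v * dirder U u [Y, b] x + Im v * dirder U u [?I, b] x)"
      by (simp_all only: D1_def Ck2_dirder_linear[OF U that] distrib_left mult.assoc)
  qed
  have key: "\<bar>u (z + cscale (of_real t * v) Y) - (u z + D1 v z * t + D2 v z / 2 * t\<^sup>2)\<bar> \<le> \<epsilon> * t\<^sup>2" if v: "cmod v = 1" for v
  proof -
    let ?x = "\<lambda>s. z + s *\<^sub>R cscale v Y"
    define g where "g m s = (if m = 0 then u (?x s) else if m = Suc 0 then D1 v (?x s) else D2 v (?x s))" for m :: nat and s
    have xU: "?x s \<in> U" if "0 \<le> s" "s \<le> t" for s using disc pt[OF v that] by blast
    have dx: "(?x has_derivative (\<lambda>h. h *\<^sub>R cscale v Y)) (at s)" for s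
      by (auto intro!: derivative_eq_intros)
    have d1: "DERIV (\<lambda>s. u (?x s)) s :> D1 v (?x s)" if "0 \<le> s" "s \<le> t" for s
    proof -
      have "((\<lambda>s. u (?x s)) has_derivative (\<lambda>h. dirder U u [h *\<^sub>R cscale v Y] (?x s))) (at s)"
        by (rule has_derivative_compose[OF dx Ck2_dirder(1)[OF U xU[OF that]]])
      moreover have "dirder U u [h *\<^sub>R cscale v Y] (?x s) = h * D1 v (?x s)" for h
        by (rule lin1[OF xU[OF that]])
      ultimately show ?thesis by (simp add: has_field_derivative_def mult.commute[of _ "D1 v (?x s)"] del: dirder.simps)
    qed
    have d1': "((\<lambda>s. dirder U u [b] (?x s)) has_derivative (\<lambda>h. h * (Re v * dirder U u [Y, b] (?x s) + Im v * dirder U u [?I, b] (?x s)))) (at s)"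
      if "0 \<le> s" "s \<le> t" for s b
    proof -
      have "((\<lambda>s. dirder U u [b] (?x s)) has_derivative (\<lambda>h. dirder U u [h *\<^sub>R cscale v Y, b] (?x s))) (at s)"
        by (rule has_derivative_compose[OF dx Ck2_dirder(2)[OF U xU[OF that]]])
      moreover have "dirder U u [h *\<^sub>R cscale v Y, b] (?x s) = h * (Re v * dirder U u [Y, b] (?x s) + Im v * dirder U u [?I, b] (?x s))" for h
        by (rule lin2[OF xU[OF that]])
      ultimately show ?thesis by (simp del: dirder.simps)
    qed
    have d2: "DERIV (\<lambda>s. D1 v (?x s)) s :> D2 v (?x s)" if "0 \<le> s" "s \<le> t" for s
      unfolding has_field_derivative_def D1_def
      by (rule has_derivative_eq_rhs[OF has_derivative_add[OF has_derivative_mult_right has_derivative_mult_right, OF d1' d1', OF that that]])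
         (auto simp: fun_eq_iff D2_def power2_eq_square algebra_simps simp del: dirder.simps)
    have "\<exists>s. 0 < s \<and> s \<le> t \<and> g 0 t = (\<Sum>m<2. g m 0 / fact m * t ^ m) + g 2 s / fact 2 * t ^ 2"
    proof (rule Maclaurin2[OF t refl], intro allI impI)
      fix m s assume "m < (2::nat) \<and> 0 \<le> s \<and> s \<le> t"
      then show "DERIV (g m) s :> g (Suc m) s"
        using d1[of s] d2[of s] unfolding g_def by (cases m) (auto simp: less_2_cases_iff)
    qed
    then obtain s where s: "0 < s" "s \<le> t" "g 0 t = (\<Sum>m<2. g m 0 / fact m * t ^ m) + g 2 s / fact 2 * t ^ 2" by blast
    have gt: "u (z + cscale (of_real t * v) Y) = u z + D1 v z * t + D2 v (?x s) / 2 * t\<^sup>2"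
      using s(3) by (simp add: g_def numeral_2_eq_2 cscale_of_real_mult cscale_scaleR_right del: dirder.simps)
    \<comment> \<open>This is \<open>(\<bar>Re v\<bar> + \<bar>Im v\<bar>)\<^sup>2 \<le> 2\<close>
      on the circle; the factor 1/2 of the Taylor remainder then leaves exactly \<epsilon>.\<close>
    have ab: "\<bar>Re v\<bar> * \<bar>Im v\<bar> * 2 + (Re v)\<^sup>2 + (Im v)\<^sup>2 \<le> 2"
    proof -
      have "(Re v)\<^sup>2 + (Im v)\<^sup>2 = 1" using v by (simp add: cmod_def)
      moreover have "0 \<le> (\<bar>Re v\<bar> - \<bar>Im v\<bar>)\<^sup>2" by simp
      ultimately show ?thesis by (simp add: power2_diff)
    qed
    have \<epsilon>0: "\<epsilon> \<ge> 0" using var[of z Y Y] t by simp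
    have vv: "\<bar>dirder U u [a, b] (?x s) - dirder U u [a, b] z\<bar> \<le> \<epsilon>" if "a \<in> {Y, ?I}" "b \<in> {Y, ?I}" for a b
      by (rule var[OF pt[OF v less_imp_le[OF s(1)] s(2)] that])
    have "D2 v (?x s) - D2 v z = (Re v)\<^sup>2 * (dirder U u [Y, Y] (?x s) - dirder U u [Y, Y] z)
       + Re v * Im v * (dirder U u [Y, ?I] (?x s) - dirder U u [Y, ?I] z)
       + Im v * Re v * (dirder U u [?I, Y] (?x s) - dirder U u [?I, Y] z)
       + (Im v)\<^sup>2 * (dirder U u [?I, ?I] (?x s) - dirder U u [?I, ?I] z)"
      by (simp add: D2_def algebra_simps del: dirder.simps)
    also have "\<bar>\<dots>\<bar> \<le> (Re v)\<^sup>2 * \<epsilon> + \<bar>Re v\<bar> * \<bar>Im v\<bar> * \<epsilon> + \<bar>Im v\<bar> * \<bar>Re v\<bar> * \<epsilon> + (Im v)\<^sup>2 * \<epsilon>"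
      by (intro order_trans[OF abs_triangle_ineq] add_mono)
         (auto simp: abs_mult simp del: dirder.simps intro!: mult_left_mono mult_mono vv)
    also have "\<dots> = (\<bar>Re v\<bar> * \<bar>Im v\<bar> * 2 + (Re v)\<^sup>2 + (Im v)\<^sup>2) * \<epsilon>" by (simp add: algebra_simps)
    also have "\<dots> \<le> 2 * \<epsilon>" by (rule mult_right_mono[OF ab \<epsilon>0])
    finally have "\<bar>D2 v (?x s) - D2 v z\<bar> \<le> 2 * \<epsilon>" .
    then have "\<bar>(D2 v (?x s) - D2 v z) / 2 * t\<^sup>2\<bar> \<le> \<epsilon> * t\<^sup>2"
      using mult_right_mono[of _ "2 * \<epsilon>" "t\<^sup>2"] by (fastforce simp: abs_mult)
    then show ?thesis unfolding gt by (simp add: algebra_simps diff_divide_distrib)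
  qed
  have cu: "continuous_on (sphere 0 1) (\<lambda>v. u (z + cscale (of_real t * v) Y))"
    by (rule continuous_on_compose2[OF Ck2_dirder_continuous(2)[OF U]])
       (use t in \<open>auto intro!: continuous_intros disc simp: norm_mult\<close>)
  have cD: "continuous_on (sphere 0 1) (\<lambda>v. D1 v z)" "continuous_on (sphere 0 1) (\<lambda>v. D2 v z)"
    by (auto simp: D1_def D2_def intro!: continuous_intros)
  have "cavg (\<lambda>v. D1 v z) = cavg (\<lambda>v. Re (Complex (dirder U u [Y] z) (- dirder U u [?I] z) * v ^ 1))"
    by (rule cavg_cong) (simp add: D1_def del: dirder.simps)
  then have a1: "cavg (\<lambda>v. D1 v z) = 0" by (simp only: cavg_Re_power)
  let ?A = "dirder U u [Y, Y] z" and ?C = "dirder U u [?I, ?I] z" and ?B = "dirder U u [Y, ?I] z + dirder U u [?I, Y] z"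
  \<comment> \<open>On the circle a quadratic form is its half trace plus the real part of a
    multiple of \<open>v ^ 2\<close>.\<close>
  have "cavg (\<lambda>v. D2 v z) = cavg (\<lambda>v. (?A + ?C) / 2 + Re (Complex ((?A - ?C) / 2) (- ?B / 2) * v ^ 2))"
  proof (rule cavg_cong)
    fix v assume "cmod v = 1"
    then have v: "(Re v)\<^sup>2 + (Im v)\<^sup>2 = 1" by (simp add: cmod_def)
    have "(?A + ?C) / 2 = (?A + ?C) / 2 * ((Re v)\<^sup>2 + (Im v)\<^sup>2)" unfolding v by simp
    moreover have "(?A + ?C) / 2 * ((Re v)\<^sup>2 + (Im v)\<^sup>2) + Re (Complex ((?A - ?C) / 2) (- ?B / 2) * v ^ 2) = D2 v z"
      by (simp add: D2_def power2_eq_square field_simps del: dirder.simps)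
    ultimately show "D2 v z = (?A + ?C) / 2 + Re (Complex ((?A - ?C) / 2) (- ?B / 2) * v ^ 2)" by linarith
  qed
  also have "\<dots> = (?A + ?C) / 2"
    by (subst cavg_add) (auto intro!: continuous_intros simp del: dirder.simps times_complex.sel simp: cavg_Re_power)
  finally have a2: "cavg (\<lambda>v. D2 v z) = 2 * levi U u z Y" by (simp add: levi_def del: dirder.simps)
  have key': "\<bar>u (z + cscale (of_real t * v) Y) - (u z + t * D1 v z + t\<^sup>2 / 2 * D2 v z)\<bar> \<le> \<epsilon> * t\<^sup>2" if "cmod v = 1" for v
    using key[OF that] by (simp add: mult.commute)
  have "\<bar>cavg (\<lambda>v. u (z + cscale (of_real t * v) Y) - (u z + t * D1 v z + t\<^sup>2 / 2 * D2 v z))\<bar> \<le> cavg (\<lambda>v. \<epsilon> * t\<^sup>2)"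
    by (rule cavg_abs_le[OF _ _ key']) (auto intro!: continuous_intros cu cD)
  also have "cavg (\<lambda>v. u (z + cscale (of_real t * v) Y) - (u z + t * D1 v z + t\<^sup>2 / 2 * D2 v z)) =
     cavg (\<lambda>v. u (z + cscale (of_real t * v) Y)) - cavg (\<lambda>v. u z + t * D1 v z + t\<^sup>2 / 2 * D2 v z)"
    by (rule cavg_diff[OF cu]) (auto intro!: continuous_intros cD)
  also have "cavg (\<lambda>v. u z + t * D1 v z + t\<^sup>2 / 2 * D2 v z) = u z + t * cavg (\<lambda>v. D1 v z) + t\<^sup>2 / 2 * cavg (\<lambda>v. D2 v z)"
    by (subst cavg_add, (auto intro!: continuous_intros cD)[2])
       (subst cavg_add, (auto intro!: continuous_intros cD)[2], simp only: cavg_cmult cavg_const)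
  finally show ?thesis unfolding a1 a2 by (simp add: algebra_simps)
qed

lemma isCont_eventually_nhds:
  assumes "isCont f z" "e > 0"
  shows "\<forall>\<^sub>F x in nhds z. dist (f x) (f z) < e"
proof -
  have "(f \<longlongrightarrow> f z) (nhds z)" using assms(1) by (simp only: isCont_def tendsto_at_iff_tendsto_nhds)
  then show ?thesis using assms(2) by (rule tendstoD)
qed

lemma sm_levi:
  assumes U: "open U" "Ck_on 2 U u" "z \<in> U" and levi: "\<And>X. levi U u z X \<ge> c * (norm X)\<^sup>2"
  shows "sm u c z"
  unfolding sm_def
proof (intro allI impI)
  fix Y and \<epsilon> :: real assume \<epsilon>: "\<epsilon> > 0"
  have "\<forall>\<^sub>F x in nhds z. \<bar>dirder U u [a, b] x - dirder U u [a, b] z\<bar> < \<epsilon>" for a b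
  proof -
    have "isCont (dirder U u [a, b]) z"
      using Ck2_dirder(3)[OF U] U by (simp add: continuous_on_eq_continuous_at del: dirder.simps)
    from isCont_eventually_nhds[OF this \<epsilon>] show ?thesis unfolding dist_real_def .
  qed
  then have "\<forall>\<^sub>F x in nhds z. x \<in> U \<and> (\<forall>a\<in>{Y, cscale \<i> Y}. \<forall>b\<in>{Y, cscale \<i> Y}. \<bar>dirder U u [a, b] x - dirder U u [a, b] z\<bar> < \<epsilon>)"
    using U by (auto simp: eventually_conj_iff eventually_nhds_in_open simp del: dirder.simps)
  then obtain r where r: "r > 0" "\<And>x. dist x z < r \<Longrightarrow> x \<in> U \<and> (\<forall>a\<in>{Y, cscale \<i> Y}. \<forall>b\<in>{Y, cscale \<i> Y}. \<bar>dirder U u [a, b] x - dirder U u [a, b] z\<bar> < \<epsilon>)"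
    unfolding eventually_nhds_metric by blast
  show "\<forall>\<^sub>F t in at_right 0. u z + (c * (norm Y)\<^sup>2 - \<epsilon>) * t\<^sup>2 \<le> cavg (\<lambda>v. u (z + cscale (of_real t * v) Y))"
    using eventually_small[OF r(1), of "norm Y"]
  proof eventually_elim
    case (elim t)
    have *: "dist x z < r" if "norm (x - z) \<le> t * norm Y" for x
      using that elim by (simp add: dist_norm)
    have "\<bar>cavg (\<lambda>v. u (z + cscale (of_real t * v) Y)) - u z - levi U u z Y * t\<^sup>2\<bar> \<le> \<epsilon> * t\<^sup>2"
    proof (rule cavg_taylor[OF U(1,2)])
      show "0 < t" using elim by simp
      show "x \<in> U" if "norm (x - z) \<le> t * norm Y" for x using r(2)[OF *[OF that]] by blast
      show "\<bar>dirder U u [a, b] x - dirder U u [a, b] z\<bar> \<le> \<epsilon>"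
        if "norm (x - z) \<le> t * norm Y" "a \<in> {Y, cscale \<i> Y}" "b \<in> {Y, cscale \<i> Y}" for x a b
        using r(2)[OF *[OF that(1)]] that(2,3) less_imp_le by blast
    qed
    moreover have "c * (norm Y)\<^sup>2 * t\<^sup>2 \<le> levi U u z Y * t\<^sup>2" by (intro mult_right_mono levi) auto
    ultimately show ?case by (simp add: algebra_simps)
  qed
qed

text \<open>Strict differentiability: increments between any two points near \<open>p\<close>, not
  just from \<open>p\<close>. A curved disc and its tangent disc at parameter \<open>t\<close> lie
  at distance of order t from \<open>p\<close> and of order t^2 from each other; the strict form
  makes the error in comparing them o(t^2).\<close>

definition sdiff :: "('a::euclidean_space \<Rightarrow> real) \<Rightarrow> 'a \<Rightarrow> bool" where
  "sdiff u p \<longleftrightarrow> (\<exists>A. bounded_linear A \<and> (\<forall>\<epsilon>>0. \<exists>\<eta>>0. \<forall>x\<in>ball p \<eta>. \<forall>y\<in>ball p \<eta>.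
      \<bar>u y - u x - A (y - x)\<bar> \<le> \<epsilon> * norm (y - x)))"

lemma Re_mult_of_real: "Re (c * (of_real r * z)) = r * Re (c * z)"
  by (simp add: algebra_simps)

lemma sdiffI:
  fixes u :: "'a::euclidean_space \<Rightarrow> real"
  assumes U: "open U" "p \<in> U" and d: "\<And>x. x \<in> U \<Longrightarrow> (u has_derivative D x) (at x)"
    and c: "\<And>v. continuous_on U (\<lambda>x. D x v)"
  shows "sdiff u p"
  unfolding sdiff_def
proof (rule exI[of _ "D p"], intro conjI allI impI)
  show bl: "bounded_linear (D p)" using d[OF U(2)] by (rule has_derivative_bounded_linear)
  fix \<epsilon> :: real assume \<epsilon>: "\<epsilon> > 0"
  have "continuous_on U (\<lambda>x. \<Sum>b\<in>Basis. \<bar>D x b - D p b\<bar>)" by (intro continuous_intros c)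
  then have "isCont (\<lambda>x. \<Sum>b\<in>Basis. \<bar>D x b - D p b\<bar>) p" using U by (simp add: continuous_on_eq_continuous_at)
  from isCont_eventually_nhds[OF this \<epsilon>] eventually_nhds_in_open[OF U] have "\<forall>\<^sub>F x in nhds p. x \<in> U \<and> (\<Sum>b\<in>Basis. \<bar>D x b - D p b\<bar>) < \<epsilon>"
    by eventually_elim (simp add: dist_real_def)
  then obtain \<eta> where \<eta>: "\<eta> > 0" "\<And>x. dist x p < \<eta> \<Longrightarrow> x \<in> U \<and> (\<Sum>b\<in>Basis. \<bar>D x b - D p b\<bar>) < \<epsilon>"
    unfolding eventually_nhds_metric by blast
  have "\<bar>u y - u x - D p (y - x)\<bar> \<le> \<epsilon> * norm (y - x)" if xy: "x \<in> ball p \<eta>" "y \<in> ball p \<eta>" for x y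
  proof -
    have "norm ((u y - D p y) - (u x - D p x)) \<le> \<epsilon> * norm (y - x)"
    proof (rule differentiable_bound[where f' = "\<lambda>w v. D w v - D p v", OF convex_ball _ _ xy(2,1)])
      fix w assume w: "w \<in> ball p \<eta>"
      then have w': "w \<in> U" "(\<Sum>b\<in>Basis. \<bar>D w b - D p b\<bar>) < \<epsilon>" using \<eta>(2)[of w] by (auto simp: dist_commute)
      show "((\<lambda>y. u y - D p y) has_derivative (\<lambda>v. D w v - D p v)) (at w within ball p \<eta>)"
        by (intro has_derivative_diff has_derivative_at_withinI[OF d[OF w'(1)]] bounded_linear_imp_has_derivative bl)
      have lin: "linear (\<lambda>v. D w v - D p v)"
        using has_derivative_linear[OF d[OF w'(1)]] bl by (intro linear_compose_sub) (auto simp: bounded_linear.linear)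
      show "onorm (\<lambda>v. D w v - D p v) \<le> \<epsilon>"
      proof (rule onorm_le)
        fix v
        have "D w v - D p v = (\<Sum>b\<in>Basis. (v \<bullet> b) * (D w b - D p b))"
          using linear_sum[OF lin, of "\<lambda>b. (v \<bullet> b) *\<^sub>R b" Basis] linear_scale[OF lin] by (simp add: euclidean_representation)
        also have "norm \<dots> \<le> (\<Sum>b\<in>Basis. norm v * \<bar>D w b - D p b\<bar>)"
          by (rule sum_norm_le) (auto simp: abs_mult intro!: mult_right_mono Basis_le_norm)
        also have "\<dots> \<le> \<epsilon> * norm v" using mult_left_mono[OF less_imp_le[OF w'(2)] norm_ge_zero[of v]]
            by (simp add: sum_distrib_left[symmetric] mult.commute)
        finally show "norm (D w v - D p v) \<le> \<epsilon> * norm v" .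
      qed
    qed
    moreover have "D p (y - x) = D p y - D p x" using bl by (simp add: bounded_linear.linear linear_diff)
    ultimately show ?thesis by (simp add: algebra_simps)
  qed
  with \<eta>(1) show "\<exists>\<eta>>0. \<forall>x\<in>ball p \<eta>. \<forall>y\<in>ball p \<eta>. \<bar>u y - u x - D p (y - x)\<bar> \<le> \<epsilon> * norm (y - x)" by blast
qed

lemma sdiff_Ck2: "open U \<Longrightarrow> Ck_on 2 U u \<Longrightarrow> p \<in> U \<Longrightarrow> sdiff u p"
  by (rule sdiffI[where D = "\<lambda>x v. dirder U u [v] x"])
     (auto intro: Ck2_dirder(1) Ck2_dirder_continuous simp del: dirder.simps)

lemma sdiff_cont_ball:
  assumes "sdiff u p"
  obtains \<eta> where "\<eta> > 0" "continuous_on (ball p \<eta>) u"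
proof -
  obtain A \<eta> where A: "bounded_linear A" and \<eta>: "\<eta> > 0" "\<And>x y. x \<in> ball p \<eta> \<Longrightarrow> y \<in> ball p \<eta> \<Longrightarrow> \<bar>u y - u x - A (y - x)\<bar> \<le> 1 * norm (y - x)"
    using assms unfolding sdiff_def by (metis zero_less_one)
  obtain B where B: "\<And>x. norm (A x) \<le> norm x * B" using bounded_linear.bounded[OF A] by blast
  have "(\<bar>B\<bar> + 1)-lipschitz_on (ball p \<eta>) u"
  proof (rule lipschitz_onI)
    fix x y assume "x \<in> ball p \<eta>" "y \<in> ball p \<eta>"
    from \<eta>(2)[OF this(2,1)] B[of "x - y"] have "\<bar>u x - u y\<bar> \<le> norm (x - y) * B + norm (x - y)" by simp
    also have "\<dots> \<le> (\<bar>B\<bar> + 1) * norm (x - y)"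
      using mult_right_mono[OF abs_ge_self[of B] norm_ge_zero[of "x - y"]] by (simp add: algebra_simps)
    finally show "dist (u x) (u y) \<le> (\<bar>B\<bar> + 1) * dist x y" by (simp add: dist_norm)
  qed simp
  then show ?thesis using that[OF \<eta>(1)] lipschitz_on_continuous_on by blast
qed

text \<open>A strictly differentiable function sees a holomorphic disc and its tangent disc as equal up to
  second order, because the quadratic term of the disc has mean value zero.\<close>
lemma sm_along_disc:
  fixes a b X :: "complex^'n" and G :: "complex poly"
  defines "F \<equiv> \<lambda>w. a + cscale w b + cscale (poly G w) X"
  assumes sd: "sdiff u (F w0)" and s: "sm u 0 (F w0)" and \<epsilon>: "\<epsilon> > 0"
  shows "\<forall>\<^sub>F t in at_right 0. u (F w0) - \<epsilon> * t\<^sup>2 \<le> cavg (\<lambda>v. u (F (w0 + of_real t * v)))"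
proof -
  let ?p = "F w0"
  \<comment> \<open>Expansion of the disc at \<open>w0\<close>: \<open>g1\<close> will give its
    tangent \<open>Y\<close>, \<open>g2\<close> the quadratic coefficient \<open>Z\<close>, and
    \<open>q\<close> is the cubic remainder.\<close>
  obtain g0 g1 g2 q where q: "pcompose G [:w0, 1:] = pCons g0 (pCons g1 (pCons g2 q))"
    by (metis pCons_cases)
  have G: "poly G (w0 + h) = g0 + g1 * h + g2 * h\<^sup>2 + h ^ 3 * poly q h" for h
    using arg_cong[OF q, of "\<lambda>p. poly p h"] by (simp add: poly_pcompose algebra_simps power2_eq_square power3_eq_cube)
  define Y Z where "Y = b + cscale g1 X" and "Z = cscale g2 X"
  have F: "F (w0 + h) = (?p + cscale h Y) + (cscale (h\<^sup>2) Z + cscale (h ^ 3 * poly q h) X)" for h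
  proof -
    have "poly G (w0 + h) = poly G w0 + (h * g1 + (h\<^sup>2 * g2 + h ^ 3 * poly q h))"
      using G[of 0] G[of h] by (simp add: mult.commute)
    then have "F (w0 + h) = a + (cscale w0 b + cscale h b) + (cscale (poly G w0) X +
        (cscale (h * g1) X + (cscale (h\<^sup>2 * g2) X + cscale (h ^ 3 * poly q h) X)))"
      by (simp only: F_def cscale_add_left)
    moreover have "cscale h Y = cscale h b + cscale (h * g1) X" "cscale (h\<^sup>2) Z = cscale (h\<^sup>2 * g2) X"
      by (simp_all only: Y_def Z_def cscale_add_right cscale_cscale)
    ultimately show ?thesis by (simp only: F_def add_ac)
  qed
  have "bounded ((\<lambda>h. cscale (poly q h) X) ` cball 0 1)"
    by (intro compact_imp_bounded compact_continuous_image continuous_intros compact_cball)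
  then obtain B where B: "B > 0" "\<And>h. cmod h \<le> 1 \<Longrightarrow> norm (cscale (poly q h) X) \<le> B"
    unfolding bounded_pos by (metis image_eqI mem_cball_0)
  define K where "K = norm Z + B"
  have K: "K > 0" using B by (simp add: K_def add_nonneg_pos)
  obtain A where A: "bounded_linear A" and Aeps: "\<And>\<epsilon>. \<epsilon> > 0 \<Longrightarrow> \<exists>\<eta>>0. \<forall>x\<in>ball ?p \<eta>. \<forall>y\<in>ball ?p \<eta>. \<bar>u y - u x - A (y - x)\<bar> \<le> \<epsilon> * norm (y - x)"
    using sd unfolding sdiff_def by blast
  obtain CA where CA: "CA > 0" "\<And>x. \<bar>A x\<bar> \<le> norm x * CA" using bounded_linear.pos_bounded[OF A] by auto
  \<comment> \<open>There are three losses of \<epsilon>/3: on the tangent disc, in strict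
    differentiability over a displacement of at most \<open>K * t\<^sup>2\<close>, and in the linear
    part applied to the cubic remainder.\<close>
  define \<epsilon>' where "\<epsilon>' = \<epsilon> / (3 * K)"
  have \<epsilon>': "\<epsilon>' > 0" using \<epsilon> K by (simp add: \<epsilon>'_def)
  obtain \<eta> where \<eta>: "\<eta> > 0" "\<And>x y. x \<in> ball ?p \<eta> \<Longrightarrow> y \<in> ball ?p \<eta> \<Longrightarrow> \<bar>u y - u x - A (y - x)\<bar> \<le> \<epsilon>' * norm (y - x)"
    using Aeps[OF \<epsilon>'] by blast
  obtain \<eta>1 where \<eta>1: "\<eta>1 > 0" "continuous_on (ball ?p \<eta>1) u" using sdiff_cont_ball[OF sd] .
  have ev: "\<forall>\<^sub>F t in at_right 0. u ?p + (0 * (norm Y)\<^sup>2 - \<epsilon>/3) * t\<^sup>2 \<le> cavg (\<lambda>v. u (?p + cscale (of_real t * v) Y))"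
    using s \<epsilon> unfolding sm_def by (meson divide_pos_pos zero_less_numeral)
  have r: "min \<eta> \<eta>1 > 0" using \<eta> \<eta>1 by simp
  have eB: "\<epsilon> / 3 > 0" "(1::real) > 0" using \<epsilon> by auto
  show ?thesis
    using ev eventually_small[OF r, of "norm Y + K"] eventually_small[OF eB(1), of "CA * B"] eventually_small[OF eB(2), of 1]
  proof eventually_elim
    case (elim t)
    then have t: "0 < t" "t \<le> 1" "t * (norm Y + K) < \<eta>" "t * (norm Y + K) < \<eta>1" "t * (CA * B) < \<epsilon> / 3" by auto
    have kb: "norm (cscale ((of_real t * v)\<^sup>2) Z + cscale ((of_real t * v) ^ 3 * poly q (of_real t * v)) X) \<le> t\<^sup>2 * K"
      and kr: "norm (cscale ((of_real t * v) ^ 3 * poly q (of_real t * v)) X) \<le> t ^ 3 * B"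
      if v: "cmod v = 1" for v
    proof -
      have "cmod (of_real t * v) \<le> 1" using t v by (simp add: norm_mult)
      from B(2)[OF this] show 1: "norm (cscale ((of_real t * v) ^ 3 * poly q (of_real t * v)) X) \<le> t ^ 3 * B"
        using t v mult_left_mono[of _ B "t ^ 3"] by (simp add: norm_mult norm_power mult.assoc)
      have "t ^ 3 * B \<le> t\<^sup>2 * B" using t B by (intro mult_right_mono power_decreasing) auto
      moreover have "norm (cscale ((of_real t * v)\<^sup>2) Z) = t\<^sup>2 * norm Z"
        using v t by (simp add: norm_mult norm_power)
      ultimately have "norm (cscale ((of_real t * v)\<^sup>2) Z) + norm (cscale ((of_real t * v) ^ 3 * poly q (of_real t * v)) X) \<le> t\<^sup>2 * K"
        using 1 unfolding K_def distrib_left by linarith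
      then show "norm (cscale ((of_real t * v)\<^sup>2) Z + cscale ((of_real t * v) ^ 3 * poly q (of_real t * v)) X) \<le> t\<^sup>2 * K"
        using norm_triangle_ineq order_trans by blast
    qed
    have tK: "t\<^sup>2 * K \<le> t * K" using t K by (simp add: power2_eq_square mult_left_le_one_le)
    have inb: "?p + cscale (of_real t * v) Y \<in> ball ?p \<eta>" "?p + cscale (of_real t * v) Y \<in> ball ?p \<eta>1"
      "F (w0 + of_real t * v) \<in> ball ?p \<eta>" "F (w0 + of_real t * v) \<in> ball ?p \<eta>1" if v: "cmod v = 1" for v
    proof -
      let ?k = "cscale ((of_real t * v)\<^sup>2) Z + cscale ((of_real t * v) ^ 3 * poly q (of_real t * v)) X"
      have n1: "norm (cscale (of_real t * v) Y) = t * norm Y" using v t by (simp add: norm_mult)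
      have n2: "norm (cscale (of_real t * v) Y + ?k) \<le> t * (norm Y + K)"
        using norm_triangle_ineq[of "cscale (of_real t * v) Y" ?k] kb[OF v] tK n1 unfolding distrib_left by linarith
      have n3: "t * norm Y \<le> t * (norm Y + K)" using t K by (intro mult_left_mono) auto
      have F': "dist ?p (F (w0 + of_real t * v)) = norm (cscale (of_real t * v) Y + ?k)"
      proof -
        have "dist (F (w0 + of_real t * v)) ?p = norm (cscale (of_real t * v) Y + ?k)"
          unfolding dist_norm F by (simp only: add.assoc add_diff_cancel_left')
        then show ?thesis by (simp only: dist_commute)
      qed
      show "?p + cscale (of_real t * v) Y \<in> ball ?p \<eta>" "?p + cscale (of_real t * v) Y \<in> ball ?p \<eta>1"
        using n1 le_less_trans[OF n3 t(3)] le_less_trans[OF n3 t(4)]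
        by (simp_all add: dist_norm del: norm_cscale)
      show "F (w0 + of_real t * v) \<in> ball ?p \<eta>" "F (w0 + of_real t * v) \<in> ball ?p \<eta>1"
        unfolding mem_ball F' using n2 t by auto
    qed
    have c1: "continuous_on (sphere 0 1) (\<lambda>v. u (?p + cscale (of_real t * v) Y))"
      by (rule continuous_on_compose2[OF \<eta>1(2)]) (use inb(2) in \<open>auto intro!: continuous_intros\<close>)
    have c2: "continuous_on (sphere 0 1) (\<lambda>v. u (F (w0 + of_real t * v)))"
      by (rule continuous_on_compose2[OF \<eta>1(2)]) (use inb(4) in \<open>auto intro!: continuous_intros simp: F_def\<close>)
    have lin: "linear A" using A by (rule bounded_linear.linear)
    let ?c = "Complex (A Z) (- A (cscale \<i> Z))"
    \<comment> \<open>On the complex line of \<open>Z\<close> the real linear map \<open>A\<close>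
      is the real part of a complex multiple, so the \<open>v ^ 2\<close> term of the disc
      contributes mean zero.\<close>
    have AZ: "A (cscale h Z) = Re (?c * h)" for h
    proof -
      have "cscale h Z = Re h *\<^sub>R Z + Im h *\<^sub>R cscale \<i> Z"
        by (simp add: cscale_def vec_eq_iff complex_eq_iff)
      then show ?thesis by (simp add: linear_add[OF lin] linear_scale[OF lin] algebra_simps)
    qed
    have "cavg (\<lambda>v. u (?p + cscale (of_real t * v) Y) + t\<^sup>2 * Re (?c * v ^ 2) - (2 * \<epsilon> / 3) * t\<^sup>2)
        \<le> cavg (\<lambda>v. u (F (w0 + of_real t * v)))"
    proof (rule cavg_mono[OF _ c2])
      show "continuous_on (sphere 0 1) (\<lambda>v. u (?p + cscale (of_real t * v) Y) + t\<^sup>2 * Re (?c * v ^ 2) - (2 * \<epsilon> / 3) * t\<^sup>2)"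
        by (intro continuous_intros c1)
      fix v :: complex assume v: "cmod v = 1"
      let ?r = "cscale ((of_real t * v) ^ 3 * poly q (of_real t * v)) X"
      let ?k = "cscale ((of_real t * v)\<^sup>2) Z + ?r"
      have Fx: "F (w0 + of_real t * v) - (?p + cscale (of_real t * v) Y) = ?k" unfolding F by simp
      have "\<bar>u (F (w0 + of_real t * v)) - u (?p + cscale (of_real t * v) Y) - A ?k\<bar> \<le> \<epsilon>' * norm ?k"
        using \<eta>(2)[OF inb(1,3)[OF v]] unfolding Fx .
      also have "\<dots> \<le> \<epsilon>' * (t\<^sup>2 * K)" using kb[OF v] \<epsilon>' by (intro mult_left_mono) auto
      also have "\<dots> = \<epsilon> / 3 * t\<^sup>2" using K by (simp add: \<epsilon>'_def)
      finally have 1: "\<bar>u (F (w0 + of_real t * v)) - u (?p + cscale (of_real t * v) Y) - A ?k\<bar> \<le> \<epsilon> / 3 * t\<^sup>2" .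
      have "\<bar>A ?r\<bar> \<le> t ^ 3 * B * CA" using CA(2)[of ?r] mult_right_mono[OF kr[OF v], of CA] CA(1) by linarith
      also have "\<dots> = t\<^sup>2 * (t * (CA * B))" by (simp add: power2_eq_square power3_eq_cube)
      also have "\<dots> \<le> t\<^sup>2 * (\<epsilon> / 3)" using t by (intro mult_left_mono) auto
      finally have 2: "\<bar>A ?r\<bar> \<le> \<epsilon> / 3 * t\<^sup>2" by (simp add: mult.commute)
      have "(of_real t * v)\<^sup>2 = of_real (t\<^sup>2) * v\<^sup>2" by (simp add: power_mult_distrib)
      then have "A (cscale ((of_real t * v)\<^sup>2) Z) = t\<^sup>2 * Re (?c * v ^ 2)"
        using AZ[of "(of_real t * v)\<^sup>2"] Re_mult_of_real[of ?c "t\<^sup>2" "v\<^sup>2"] by simp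
      then have "A ?k = t\<^sup>2 * Re (?c * v ^ 2) + A ?r" by (simp only: linear_add[OF lin])
      with 1 2 show "u (?p + cscale (of_real t * v) Y) + t\<^sup>2 * Re (?c * v ^ 2) - (2 * \<epsilon> / 3) * t\<^sup>2 \<le> u (F (w0 + of_real t * v))"
        by linarith
    qed
    also have "cavg (\<lambda>v. u (?p + cscale (of_real t * v) Y) + t\<^sup>2 * Re (?c * v ^ 2) - (2 * \<epsilon> / 3) * t\<^sup>2) =
        cavg (\<lambda>v. u (?p + cscale (of_real t * v) Y)) - (2 * \<epsilon> / 3) * t\<^sup>2"
    proof -
      have c3: "continuous_on (sphere 0 1) (\<lambda>v. t\<^sup>2 * Re (?c * v ^ 2))" by (intro continuous_intros)
      have "cavg (\<lambda>v. t\<^sup>2 * Re (?c * v ^ 2)) = 0" by (simp only: cavg_cmult cavg_Re_power zero_less_numeral mult_zero_right)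
      then show ?thesis
        using cavg_diff[OF continuous_on_add[OF c1 c3] continuous_on_const, of "2 * \<epsilon> / 3 * t\<^sup>2"]
        by (simp only: cavg_add[OF c1 c3] cavg_const add_0_right)
    qed
    finally show ?case using elim(1) by (simp add: algebra_simps)
  qed
qed

lemma sm_asub_disc:
  fixes a b X :: "complex^'n" and G :: "complex poly"
  defines "F \<equiv> \<lambda>w. a + cscale w b + cscale (poly G w) X"
  assumes "sdiff u (F w0)" "sm u 0 (F w0)" "cmod w0 < 1"
  shows "asub (\<lambda>w. u (F w)) w0"
  unfolding asub_def
proof (intro allI impI)
  fix \<epsilon> :: real assume "\<epsilon> > 0"
  have r: "1 - cmod w0 > 0" using assms by simp
  from sm_along_disc[OF assms(2,3)[unfolded F_def] \<open>\<epsilon> > 0\<close>] eventually_small[OF r, of 1]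
  have "\<forall>\<^sub>F t in at_right 0. t > 0 \<and> t < 1 - cmod w0 \<and> u (F w0) - \<epsilon> * t\<^sup>2 \<le> cavg (\<lambda>v. u (F (w0 + of_real t * v)))"
    by eventually_elim (auto simp: F_def)
  then show "\<exists>t>0. t < 1 - cmod w0 \<and> u (F w0) - \<epsilon> * t\<^sup>2 \<le> cavg (\<lambda>v. u (F (w0 + of_real t * v)))"
    using eventually_happens'[OF trivial_limit_at_right_real] by blast
qed

section \<open>Oka's lemma\<close>

lemma sq_max_taylor:
  fixes t s :: real
  shows "\<bar>(max 0 (t + s))\<^sup>2 - (max 0 t)\<^sup>2 - 2 * max 0 t * s\<bar> \<le> s\<^sup>2"
proof -
  consider "t \<ge> 0" "t + s \<ge> 0" | "t \<ge> 0" "t + s < 0" | "t < 0" "t + s \<ge> 0" | "t < 0" "t + s < 0" by linarith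
  then show ?thesis
  proof cases
    case 1 then show ?thesis by (simp add: max_def power2_eq_square algebra_simps)
  next
    case 2
    have "(t + s)\<^sup>2 \<ge> 0" by simp
    moreover have "t * (t + 2 * s) \<le> 0" using 2 by (intro mult_nonneg_nonpos) auto
    ultimately show ?thesis using 2 by (simp add: max_def power2_eq_square algebra_simps)
  next
    case 3
    have "(t + s)\<^sup>2 \<le> s\<^sup>2" using 3 by (intro power_mono) auto
    then show ?thesis using 3 by (simp add: max_def)
  next
    case 4 then show ?thesis by (simp add: max_def)
  qed
qed

text \<open>A C1 kernel, compactly supported for \<beta> > 0; the square makes its gradient
  Lipschitz across the edge of the support, with the explicit expansion that \<open>sdiff\<close>
  asks for.\<close>

definition bump :: "real \<Rightarrow> 'a::euclidean_space \<Rightarrow> real" where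
  "bump \<beta> x = (max 0 (1 - \<beta> * (norm x)\<^sup>2))\<^sup>2"

lemma bump_nonneg: "0 \<le> bump \<beta> x"
  by (simp add: bump_def)

lemma continuous_on_bump [continuous_intros]:
  "continuous_on A f \<Longrightarrow> continuous_on A (\<lambda>x. bump \<beta> (f x))"
  unfolding bump_def by (intro continuous_intros)

text \<open>The gradient is frozen at \<open>a0\<close> instead of \<open>a\<close>: the error
  \<open>norm h * (norm h + norm (a - a0))\<close> is the one that strict differentiability at a
  point tolerates, where both arguments vary.\<close>

lemma bump_taylor:
  fixes a h a0 :: "'a::euclidean_space"
  assumes "\<beta> > 0" "norm a \<le> R" "norm a0 \<le> R" "norm h \<le> 1" "R \<ge> 1"
  shows "\<bar>bump \<beta> (a - h) - bump \<beta> a - (4 * \<beta> * max 0 (1 - \<beta> * (norm a0)\<^sup>2)) * (a0 \<bullet> h)\<bar>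
     \<le> (9 * \<beta>\<^sup>2 * R\<^sup>2 + 4 * \<beta> + 8 * \<beta>\<^sup>2 * R\<^sup>2) * norm h * (norm h + norm (a - a0))"
proof -
  define w w0 s where "w = 1 - \<beta> * (norm a)\<^sup>2" and "w0 = 1 - \<beta> * (norm a0)\<^sup>2" and "s = \<beta> * (2 * (a \<bullet> h) - (norm h)\<^sup>2)"
  have ws: "1 - \<beta> * (norm (a - h))\<^sup>2 = w + s"
    by (simp add: w_def s_def power2_norm_eq_inner inner_diff_left inner_diff_right inner_commute algebra_simps)
  have w1: "max 0 w \<le> 1" "max 0 w0 \<le> 1" "0 \<le> max 0 w" "0 \<le> max 0 w0" using assms by (auto simp: w_def w0_def)
  have ah: "\<bar>a \<bullet> h\<bar> \<le> R * norm h"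
    using Cauchy_Schwarz_ineq2[of a h] mult_right_mono[OF assms(2), of "norm h"] by simp
  have hh: "(norm h)\<^sup>2 \<le> R * norm h"
    using assms mult_right_mono[of "norm h" R "norm h"] by (simp add: power2_eq_square)
  have "\<bar>s\<bar> = \<beta> * \<bar>2 * (a \<bullet> h) - (norm h)\<^sup>2\<bar>" using assms(1) by (simp add: s_def abs_mult)
  also have "\<dots> \<le> \<beta> * (3 * (R * norm h))" using ah hh assms(1) zero_le_power2[of "norm h"] by (intro mult_left_mono) linarith+
  finally have s1: "\<bar>s\<bar> \<le> 3 * \<beta> * R * norm h" by simp
  have "s\<^sup>2 \<le> (3 * \<beta> * R * norm h)\<^sup>2" using power_mono[OF s1, of 2] by simp
  also have "\<dots> = 9 * \<beta>\<^sup>2 * R\<^sup>2 * norm h * norm h" by (simp add: power2_eq_square)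
  also have "\<dots> \<le> 9 * \<beta>\<^sup>2 * R\<^sup>2 * norm h * (norm h + norm (a - a0))"
    by (intro mult_left_mono) auto
  finally have s2: "s\<^sup>2 \<le> 9 * \<beta>\<^sup>2 * R\<^sup>2 * norm h * (norm h + norm (a - a0))" .
  have t1: "\<bar>bump \<beta> (a - h) - bump \<beta> a - 2 * max 0 w * s\<bar> \<le> s\<^sup>2"
    unfolding bump_def ws using sq_max_taylor[of w s] by (simp add: w_def)
  have "2 * max 0 w * s - (4 * \<beta> * max 0 w0) * (a0 \<bullet> h) =
     4 * \<beta> * (max 0 w * ((a - a0) \<bullet> h)) + 4 * \<beta> * ((max 0 w - max 0 w0) * (a0 \<bullet> h)) - 2 * \<beta> * (max 0 w * (norm h)\<^sup>2)"
    by (simp add: s_def inner_diff_left algebra_simps)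
  moreover have "\<bar>max 0 w * ((a - a0) \<bullet> h)\<bar> \<le> norm (a - a0) * norm h"
    unfolding abs_mult using w1 Cauchy_Schwarz_ineq2[of "a - a0" h]
    by (smt (verit) mult_left_le_one_le abs_ge_zero)
  then have "\<bar>4 * \<beta> * (max 0 w * ((a - a0) \<bullet> h))\<bar> \<le> 4 * \<beta> * (norm (a - a0) * norm h)"
    using assms(1) by (simp add: abs_mult)
  moreover have "\<bar>4 * \<beta> * ((max 0 w - max 0 w0) * (a0 \<bullet> h))\<bar> \<le> 4 * \<beta> * (2 * \<beta> * R * norm (a - a0) * (R * norm h))"
  proof -
    have "(norm a)\<^sup>2 - (norm a0)\<^sup>2 = (norm a + norm a0) * (norm a - norm a0)" by (simp add: power2_eq_square algebra_simps)
    then have "\<bar>(norm a)\<^sup>2 - (norm a0)\<^sup>2\<bar> = (norm a + norm a0) * \<bar>norm a - norm a0\<bar>" by (simp add: abs_mult)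
    also have "\<dots> \<le> (2 * R) * norm (a - a0)"
      using assms norm_triangle_ineq3[of a a0] by (intro mult_mono) auto
    finally have q: "\<bar>(norm a)\<^sup>2 - (norm a0)\<^sup>2\<bar> \<le> 2 * R * norm (a - a0)" .
    have "\<bar>max 0 w - max 0 w0\<bar> \<le> \<bar>w - w0\<bar>" by (auto simp: max_def)
    also have "\<dots> = \<beta> * \<bar>(norm a)\<^sup>2 - (norm a0)\<^sup>2\<bar>"
    proof -
      have "w - w0 = - (\<beta> * ((norm a)\<^sup>2 - (norm a0)\<^sup>2))" by (simp add: w_def w0_def algebra_simps)
      then show ?thesis using assms(1) by (simp only: abs_minus_cancel abs_mult abs_of_pos)
    qed
    also have "\<dots> \<le> \<beta> * (2 * R * norm (a - a0))" using q assms(1) by (intro mult_left_mono) auto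
    finally have m: "\<bar>max 0 w - max 0 w0\<bar> \<le> 2 * \<beta> * R * norm (a - a0)" by simp
    have "\<bar>a0 \<bullet> h\<bar> \<le> R * norm h"
      using Cauchy_Schwarz_ineq2[of a0 h] mult_right_mono[OF assms(3), of "norm h"] by simp
    with m have "\<bar>max 0 w - max 0 w0\<bar> * \<bar>a0 \<bullet> h\<bar> \<le> 2 * \<beta> * R * norm (a - a0) * (R * norm h)"
      using assms by (intro mult_mono) auto
    then have "4 * \<beta> * (\<bar>max 0 w - max 0 w0\<bar> * \<bar>a0 \<bullet> h\<bar>) \<le> 4 * \<beta> * (2 * \<beta> * R * norm (a - a0) * (R * norm h))"
      using assms(1) by (intro mult_left_mono) auto
    then show ?thesis using assms(1) by (simp add: abs_mult)
  qed
  moreover have "\<bar>2 * \<beta> * (max 0 w * (norm h)\<^sup>2)\<bar> \<le> 4 * \<beta> * (norm h * norm h)"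
  proof -
    have "max 0 w * (norm h)\<^sup>2 \<le> 1 * (norm h)\<^sup>2" using w1 by (intro mult_right_mono) auto
    then have "2 * \<beta> * (max 0 w * (norm h)\<^sup>2) \<le> 4 * \<beta> * (norm h)\<^sup>2"
      using assms(1) w1 by (intro mult_mono) auto
    then show ?thesis using assms(1) w1 by (simp add: abs_mult power2_eq_square)
  qed
  ultimately have "\<bar>2 * max 0 w * s - (4 * \<beta> * max 0 w0) * (a0 \<bullet> h)\<bar> \<le>
     4 * \<beta> * (norm (a - a0) * norm h) + 4 * \<beta> * (2 * \<beta> * R * norm (a - a0) * (R * norm h)) + 4 * \<beta> * (norm h * norm h)"
    by linarith
  also have "\<dots> = 4 * \<beta> * norm h * (norm h + norm (a - a0)) + 8 * \<beta>\<^sup>2 * R\<^sup>2 * norm h * norm (a - a0)"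
    by (simp add: power2_eq_square algebra_simps)
  also have "\<dots> \<le> 4 * \<beta> * norm h * (norm h + norm (a - a0)) + 8 * \<beta>\<^sup>2 * R\<^sup>2 * norm h * (norm h + norm (a - a0))"
    by (intro add_left_mono mult_left_mono) auto
  finally show ?thesis using t1 s2 unfolding w0_def[symmetric] by (simp only: distrib_right)
qed

text \<open>Convolution with \<open>bump\<close>: it commutes with circle averages, uniform
  continuity gives closeness, and the kernel supplies \<open>sdiff\<close>, which opens the way from
  the affine discs of \<open>psh\<close> to polynomial discs.\<close>

lemma psh_smoothing:
  fixes \<psi> :: "complex^'n \<Rightarrow> real"
  assumes \<Omega>: "open \<Omega>" "continuous_on \<Omega> \<psi>" "psh \<Omega> \<psi>" and K: "compact K" "K \<subseteq> \<Omega>" and \<sigma>: "\<sigma> > 0"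
  obtains u where "\<And>z. z \<in> K \<Longrightarrow> sdiff u z" "\<And>z. z \<in> K \<Longrightarrow> sm u 0 z" "\<And>z. z \<in> K \<Longrightarrow> \<bar>u z - \<psi> z\<bar> \<le> \<sigma>"
proof -
  obtain R0 where R0: "R0 > 0" "\<And>x y. x \<in> K \<Longrightarrow> dist x y \<le> R0 \<Longrightarrow> y \<in> \<Omega>"
  proof (cases "K = {}")
    case False
    obtain e where "e > 0" "(\<Union>x\<in>K. cball x e) \<subseteq> \<Omega>"
      using compact_subset_open_imp_cball_epsilon_subset[OF K(1) \<Omega>(1) K(2)] by blast
    then show ?thesis by (intro that[of e]) force+
  qed (use that[of 1] in auto)
  define K' where "K' = (\<Union>x\<in>K. cball x R0)"
  have K'c: "compact K'"
    unfolding K'_def using compact_minkowski_sum_cball[OF K(1)] by simp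
  have K'\<Omega>: "K' \<subseteq> \<Omega>" using R0(2) by (auto simp: K'_def)
  obtain \<eta> where \<eta>: "\<eta> > 0" "\<And>x y. x \<in> K' \<Longrightarrow> y \<in> K' \<Longrightarrow> dist x y < \<eta> \<Longrightarrow> dist (\<psi> x) (\<psi> y) < \<sigma>"
    using compact_uniformly_continuous[OF continuous_on_subset[OF \<Omega>(2) K'\<Omega>] K'c] \<sigma>
    unfolding uniformly_continuous_on_def by (metis dist_commute)
  define d where "d = real DIM(complex^'n)"
  have d: "d > 0" by (simp add: d_def)
  \<comment> \<open>Half the side of the integration cube \<open>Q\<close>: its vectors have norm at
    most \<open>d * \<epsilon>\<close>, which must stay below both the modulus \<eta> and the room
    \<open>R0\<close> around \<open>K\<close>.\<close>
  define \<epsilon> where "\<epsilon> = min (min \<eta> R0) 1 / (8 * (d + 1))"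
  have \<epsilon>: "\<epsilon> > 0" "\<epsilon> \<le> 1" "d * \<epsilon> < \<eta>" "d * \<epsilon> \<le> R0 / 8" "\<epsilon> \<le> R0 / 8"
  proof -
    let ?m = "min (min \<eta> R0) 1"
    have m: "?m > 0" "?m \<le> \<eta>" "?m \<le> R0" "?m \<le> 1" using \<eta> R0 by auto
    show 1: "\<epsilon> > 0" using m(1) d by (simp add: \<epsilon>_def)
    have "\<epsilon> * (8 * (d + 1)) = ?m" using d by (simp add: \<epsilon>_def)
    then have "8 * (d * \<epsilon>) + 8 * \<epsilon> = ?m" by (simp add: algebra_simps)
    moreover have "d * \<epsilon> > 0" using 1 d by simp
    ultimately show "\<epsilon> \<le> 1" "d * \<epsilon> < \<eta>" "d * \<epsilon> \<le> R0 / 8" "\<epsilon> \<le> R0 / 8" using 1 m by linarith+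
  qed
  define e :: "complex^'n" where "e = \<epsilon> *\<^sub>R One"
  define Q where "Q = cbox (- e) e"
  have Qn: "norm v \<le> d * \<epsilon>" if "v \<in> Q" for v
  proof -
    have "norm v \<le> (\<Sum>b\<in>Basis. \<bar>v \<bullet> b\<bar>)" by (rule norm_le_l1)
    also have "\<dots> \<le> (\<Sum>b\<in>(Basis::(complex^'n) set). \<epsilon>)"
      using that by (intro sum_mono) (force simp: Q_def e_def mem_box abs_le_iff)
    finally show ?thesis by (simp add: d_def)
  qed
  have QI: "v \<in> Q" if "norm v \<le> \<epsilon>" for v
    using that Basis_le_norm[of _ v] unfolding Q_def e_def mem_box
    by (fastforce simp: abs_le_iff)
  \<comment> \<open>With this \<beta> the kernel lives in the ball of radius \<epsilon>/2, so the
    cube around a point still contains its support when the centre moves by less than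
    \<epsilon>/2.\<close>
  define \<beta> where "\<beta> = 4 / \<epsilon>\<^sup>2"
  have \<beta>: "\<beta> > 0" using \<epsilon> by (simp add: \<beta>_def)
  have supp: "norm v \<le> \<epsilon> / 2" if "bump \<beta> v \<noteq> 0" for v :: "complex^'n"
  proof -
    have "1 - \<beta> * (norm v)\<^sup>2 > 0" using that by (simp add: bump_def max_def split: if_splits)
    then have "(norm v)\<^sup>2 \<le> (\<epsilon> / 2)\<^sup>2" using \<epsilon> by (simp add: \<beta>_def field_simps)
    then show ?thesis using \<epsilon> by (simp add: power2_le_iff_abs_le)
  qed
  define \<kappa> where "\<kappa> = integral Q (bump \<beta>)"
  have contb: "continuous_on S (bump \<beta>)" for S :: "(complex^'n) set"
    using continuous_on_bump[OF continuous_on_id] by simp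
  have bint: "bump \<beta> integrable_on Q" unfolding Q_def by (rule integrable_continuous[OF contb])
  have \<kappa>: "\<kappa> > 0"
  proof -
    have "\<kappa> \<ge> 0" unfolding \<kappa>_def by (rule integral_nonneg[OF bint]) (simp add: bump_nonneg)
    moreover have "\<kappa> \<noteq> 0"
    proof
      assume "\<kappa> = 0"
      then have "(bump \<beta> has_integral 0) Q" using bint integrable_integral unfolding \<kappa>_def by metis
      moreover have "box (- e) e \<noteq> {}" using \<epsilon> by (simp add: box_ne_empty e_def)
      moreover have "0 \<in> cbox (- e) e" using \<epsilon> by (simp add: mem_box e_def)
      ultimately have "bump \<beta> (0::complex^'n) = 0"
        unfolding Q_def using has_integral_0_cbox_imp_0[OF contb bump_nonneg] by blast
      then show False by (simp add: bump_def)
    qed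
    ultimately show ?thesis by simp
  qed
  define u where "u z = (1 / \<kappa>) * integral Q (\<lambda>v. bump \<beta> v * \<psi> (z + v))" for z
  have near: "z + v \<in> K'" if "x \<in> K" "dist x z \<le> R0 / 4" "norm v \<le> R0 / 2" for x z v
  proof -
    have "dist x (z + v) \<le> dist x z + norm v"
      using dist_triangle[of x "z + v" z] by (simp add: dist_norm)
    also have "\<dots> \<le> R0" using that R0 by simp
    finally show ?thesis using that unfolding K'_def by auto
  qed
  have Q8: "norm v \<le> R0 / 8" if "v \<in> Q" for v using Qn[OF that] \<epsilon> by simp
  have cg: "continuous_on Q (\<lambda>v. bump \<beta> v * \<psi> (z + v))" if "x \<in> K" "dist x z \<le> R0 / 4" for x z
  proof (intro continuous_intros continuous_on_compose2[OF \<Omega>(2)])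
    show "(+) z ` Q \<subseteq> \<Omega>" using near[OF that] Q8 K'\<Omega> R0 by force
  qed
  show ?thesis
  proof (rule that[of u])
    fix z assume z: "z \<in> K"
    have zQ: "z + v \<in> K'" if "v \<in> Q" for v using near[OF z, of z v] Q8[OF that] R0 by simp
    have c1: "continuous_on Q (\<lambda>v. bump \<beta> v * \<psi> (z + v))" using cg[OF z, of z] R0 by simp
    have zK': "z \<in> K'" using z R0 by (force simp: K'_def)
    have "\<kappa> * (u z - \<psi> z) = integral Q (\<lambda>v. bump \<beta> v * \<psi> (z + v)) - integral Q (\<lambda>v. bump \<beta> v * \<psi> z)"
      using \<kappa> by (simp add: u_def \<kappa>_def right_diff_distrib)
    also have "\<dots> = integral Q (\<lambda>v. bump \<beta> v * \<psi> (z + v) - bump \<beta> v * \<psi> z)"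
      unfolding Q_def by (rule integral_diff[symmetric]; rule integrable_continuous)
        (use c1[unfolded Q_def] in \<open>auto intro!: continuous_intros\<close>)
    also have "norm \<dots> \<le> integral Q (\<lambda>v. bump \<beta> v * \<sigma>)"
      unfolding Q_def
    proof (rule integral_norm_bound_integral; (rule integrable_continuous)?)
      fix v assume "v \<in> cbox (- e) e"
      then have v: "v \<in> Q" by (simp add: Q_def)
      have "dist (z + v) z < \<eta>" using Qn[OF v] \<epsilon> by (simp add: dist_norm)
      from \<eta>(2)[OF zQ[OF v] zK' this] have "\<bar>\<psi> (z + v) - \<psi> z\<bar> \<le> \<sigma>" by (simp add: dist_real_def)
      then show "norm (bump \<beta> v * \<psi> (z + v) - bump \<beta> v * \<psi> z) \<le> bump \<beta> v * \<sigma>"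
        by (simp add: right_diff_distrib[symmetric] abs_mult bump_nonneg mult_left_mono)
    qed (use c1[unfolded Q_def] in \<open>auto intro!: continuous_intros\<close>)
    also have "\<dots> = \<kappa> * \<sigma>" by (simp add: \<kappa>_def)
    finally show "\<bar>u z - \<psi> z\<bar> \<le> \<sigma>" using \<kappa> by (simp add: abs_mult)
  next
    fix z assume z: "z \<in> K"
    show "sm u 0 z"
      unfolding sm_def
    proof (intro allI impI)
      fix Y and \<epsilon>' :: real assume "\<epsilon>' > 0"
      have r: "R0 / 4 > 0" using R0 by simp
      show "\<forall>\<^sub>F t in at_right 0. u z + (0 * (norm Y)\<^sup>2 - \<epsilon>') * t\<^sup>2 \<le> cavg (\<lambda>v. u (z + cscale (of_real t * v) Y))"
        using eventually_small[OF r, of "norm Y"]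
      proof eventually_elim
        case (elim t)
        define f where "f \<theta> v = bump \<beta> v * \<psi> (z + cscale (of_real t * cis \<theta>) Y + v)" for \<theta> v
        have pt: "z + cscale (of_real t * w) Y + v \<in> \<Omega>" if "v \<in> Q" "cmod w \<le> 1" for v w
        proof -
          have "t * (cmod w * norm Y) \<le> t * (1 * norm Y)"
            using that elim by (intro mult_left_mono mult_right_mono) auto
          then have "dist z (z + cscale (of_real t * w) Y) \<le> R0 / 4"
          proof -
            have "dist z (z + cscale (of_real t * w) Y) = t * (cmod w * norm Y)"
              using elim by (simp add: dist_norm norm_mult)
            with \<open>t * (cmod w * norm Y) \<le> t * (1 * norm Y)\<close> elim show ?thesis by linarith
          qed
          from near[OF z this, of v] show ?thesis using Q8[OF that(1)] R0 K'\<Omega> by auto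
        qed
        have cf: "continuous_on (cbox (0, - e) (2 * pi, e)) (\<lambda>(\<theta>, v). f \<theta> v)"
          unfolding f_def split_beta
          by (intro continuous_intros continuous_on_compose2[OF \<Omega>(2)])
             (use pt in \<open>auto simp: Q_def cbox_Pair_eq\<close>)
        have "2 * pi * \<kappa> * cavg (\<lambda>v. u (z + cscale (of_real t * v) Y)) = integral (cbox 0 (2*pi)) (\<lambda>\<theta>. integral (cbox (- e) e) (f \<theta>))"
          using \<kappa> by (simp add: cavg_def u_def f_def[abs_def] Q_def)
        also have "\<dots> = integral (cbox (- e) e) (\<lambda>v. integral (cbox 0 (2*pi)) (\<lambda>\<theta>. f \<theta> v))"
          by (rule integral_swap_continuous[OF cf])
        also have "\<dots> \<ge> integral (cbox (- e) e) (\<lambda>v. 2 * pi * (bump \<beta> v * \<psi> (z + v)))"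
        proof (rule integral_le)
          show "(\<lambda>v. 2 * pi * (bump \<beta> v * \<psi> (z + v))) integrable_on cbox (- e) e"
            by (rule integrable_continuous) (use cg[OF z, of z] R0 in \<open>auto intro!: continuous_intros simp: Q_def\<close>)
          have cf': "continuous_on (cbox (- e, 0) (e, 2 * pi)) (\<lambda>(v, \<theta>). f \<theta> v)"
            unfolding f_def split_beta
            by (intro continuous_intros continuous_on_compose2[OF \<Omega>(2)])
               (use pt in \<open>auto simp: Q_def cbox_Pair_eq\<close>)
          show "(\<lambda>v. integral (cbox 0 (2*pi)) (\<lambda>\<theta>. f \<theta> v)) integrable_on cbox (- e) e"
            by (rule integrable_continuous, rule integral_continuous_on_param) (use cf' in \<open>simp add: cbox_Pair_eq\<close>)
          fix v assume "v \<in> cbox (- e) e"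
          then have v: "v \<in> Q" by (simp add: Q_def)
          have "\<psi> (z + v) \<le> (1 / (2 * pi)) * integral {0..2*pi} (\<lambda>\<theta>. \<psi> ((z + v) + cscale (cis \<theta>) (t *\<^sub>R Y)))"
          proof -
            have "\<forall>w. cmod w \<le> 1 \<longrightarrow> (z + v) + cscale w (t *\<^sub>R Y) \<in> \<Omega>"
              using pt[OF v] by (simp add: cscale_of_real_mult add_ac)
            then show ?thesis using \<Omega>(3) unfolding psh_def by blast
          qed
          then have "2 * pi * \<psi> (z + v) \<le> integral {0..2*pi} (\<lambda>\<theta>. \<psi> ((z + v) + cscale (cis \<theta>) (t *\<^sub>R Y)))"
            by (simp add: field_simps)
          then have "bump \<beta> v * (2 * pi * \<psi> (z + v)) \<le> bump \<beta> v * integral {0..2*pi} (\<lambda>\<theta>. \<psi> ((z + v) + cscale (cis \<theta>) (t *\<^sub>R Y)))"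
            by (rule mult_left_mono) (rule bump_nonneg)
          then show "2 * pi * (bump \<beta> v * \<psi> (z + v)) \<le> integral (cbox 0 (2*pi)) (\<lambda>\<theta>. f \<theta> v)"
            unfolding f_def cscale_of_real_mult by (simp add: add_ac mult_ac)
        qed
        also have "integral (cbox (- e) e) (\<lambda>v. 2 * pi * (bump \<beta> v * \<psi> (z + v))) = 2 * pi * \<kappa> * u z"
          using \<kappa> by (simp add: u_def Q_def)
        finally have "u z \<le> cavg (\<lambda>v. u (z + cscale (of_real t * v) Y))" using \<kappa> by simp
        moreover have "0 \<le> \<epsilon>' * t\<^sup>2" using \<open>\<epsilon>' > 0\<close> by simp
        ultimately show ?case by simp
      qed
    qed
  next
    fix p assume p: "p \<in> K"
    define g where "g z y = bump \<beta> (y - z) * \<psi> y" for z y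
    have pQ: "p + v \<in> \<Omega>" if "v \<in> Q" for v using near[OF p, of p v] Q8[OF that] R0 K'\<Omega> by auto
    have memt: "y \<in> cbox (x - e) (x + e) \<longleftrightarrow> y - x \<in> Q" for x y
      by (auto simp: Q_def mem_box inner_diff_left inner_add_left algebra_simps)
    have c\<psi>: "continuous_on (cbox (p - e) (p + e)) \<psi>"
      by (rule continuous_on_subset[OF \<Omega>(2)]) (use pQ memt in force)
    \<comment> \<open>Over a cube fixed at \<open>p\<close> the dependence on \<open>z\<close> sits
      only in the kernel, so that differentiating in \<open>z\<close> never touches \<psi>.\<close>
    have uz: "u z = (1 / \<kappa>) * integral (cbox (p - e) (p + e)) (g z)" if z: "dist p z < \<epsilon> / 2" for z
    proof -
      have "integral Q (\<lambda>v. bump \<beta> v * \<psi> (z + v)) = integral (cbox (z - e) (z + e)) (g z)"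
        using integral_shift_cbox[of "z - e" z "z + e" "g z"] by (simp add: g_def Q_def add.commute)
      also have "\<dots> = integral UNIV (\<lambda>y. if y \<in> cbox (z - e) (z + e) then g z y else 0)"
        by (simp only: integral_restrict_UNIV)
      also have "(\<lambda>y. if y \<in> cbox (z - e) (z + e) then g z y else 0) = (\<lambda>y. if y \<in> cbox (p - e) (p + e) then g z y else 0)"
      proof
        fix y
        have "y - z \<in> Q \<and> y - p \<in> Q" if "g z y \<noteq> 0"
        proof -
          have n: "norm (y - z) \<le> \<epsilon> / 2" using that supp[of "y - z"] by (auto simp: g_def)
          have "norm (y - p) \<le> norm (y - z) + dist p z"
            using norm_triangle_ineq[of "y - z" "z - p"] by (simp add: dist_norm norm_minus_commute)
          then show ?thesis using n z QI[of "y - z"] QI[of "y - p"] \<epsilon> by simp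
        qed
        then show "(if y \<in> cbox (z - e) (z + e) then g z y else 0) = (if y \<in> cbox (p - e) (p + e) then g z y else 0)"
          unfolding memt by (cases "g z y = 0") auto
      qed
      also have "integral UNIV \<dots> = integral (cbox (p - e) (p + e)) (g z)"
        by (simp only: integral_restrict_UNIV)
      finally show ?thesis by (simp add: u_def)
    qed
    let ?P = "cbox (p - e) (p + e)"
    obtain M where M: "M > 0" "\<And>y. y \<in> ?P \<Longrightarrow> \<bar>\<psi> y\<bar> \<le> M"
      using compact_imp_bounded[OF compact_continuous_image[OF c\<psi> compact_cbox]]
      unfolding bounded_pos by auto
    \<comment> \<open>The gradient of the kernel with respect to its centre, at centre
      \<open>p\<close>.\<close>
    define G where "G y = (4 * \<beta> * max 0 (1 - \<beta> * (norm (y - p))\<^sup>2)) *\<^sub>R (y - p)" for y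
    define A where "A h = (1 / \<kappa>) * integral ?P (\<lambda>y. \<psi> y * (G y \<bullet> h))" for h
    have cG: "continuous_on S G" for S unfolding G_def by (intro continuous_intros)
    have intG: "(\<lambda>y. \<psi> y * (G y \<bullet> h)) integrable_on ?P" for h
      by (rule integrable_continuous) (intro continuous_intros c\<psi> cG)
    have linA: "linear A"
    proof (rule linearI)
      fix h k and r :: real
      have "integral ?P (\<lambda>y. \<psi> y * (G y \<bullet> (h + k))) = integral ?P (\<lambda>y. \<psi> y * (G y \<bullet> h) + \<psi> y * (G y \<bullet> k))"
        by (simp add: inner_add_right distrib_left)
      also have "\<dots> = integral ?P (\<lambda>y. \<psi> y * (G y \<bullet> h)) + integral ?P (\<lambda>y. \<psi> y * (G y \<bullet> k))"
        by (rule integral_add[OF intG intG])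
      finally show "A (h + k) = A h + A k" by (simp add: A_def distrib_left add_divide_distrib)
      have "integral ?P (\<lambda>y. \<psi> y * (G y \<bullet> (r *\<^sub>R h))) = integral ?P (\<lambda>y. r * (\<psi> y * (G y \<bullet> h)))"
        by (simp add: mult_ac)
      then show "A (r *\<^sub>R h) = r *\<^sub>R A h" by (simp add: A_def)
    qed
    define R where "R = d + 2"
    define C where "C = 9 * \<beta>\<^sup>2 * R\<^sup>2 + 4 * \<beta> + 8 * \<beta>\<^sup>2 * R\<^sup>2"
    have C: "C > 0" using \<beta> by (simp add: C_def add_pos_nonneg add_nonneg_pos)
    define V where "V = integral ?P (\<lambda>y. M)"
    have V0: "V \<ge> 0" unfolding V_def using M by (intro integral_nonneg) auto
    show "sdiff u p"
      unfolding sdiff_def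
    proof (rule exI[of _ A], intro conjI allI impI)
      show "bounded_linear A" using linA by (rule linear_bounded_pos[THEN exE]) (auto simp: linA intro: linear_conv_bounded_linear[THEN iffD1])
      fix \<epsilon>' :: real assume \<epsilon>': "\<epsilon>' > 0"
      define \<eta>' where "\<eta>' = min (\<epsilon> / 2) (\<epsilon>' * \<kappa> / (3 * C * (V + 1)))"
      have \<eta>': "\<eta>' > 0" "\<eta>' \<le> \<epsilon> / 2" "3 * C * V * \<eta>' \<le> \<epsilon>' * \<kappa>"
      proof -
        show "\<eta>' > 0" "\<eta>' \<le> \<epsilon> / 2" using \<epsilon> \<epsilon>' \<kappa> C V0 by (auto simp: \<eta>'_def)
        have "3 * C * V * \<eta>' \<le> 3 * C * (V + 1) * (\<epsilon>' * \<kappa> / (3 * C * (V + 1)))"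
          using C V0 \<epsilon> \<epsilon>' \<kappa> by (intro mult_mono) (auto simp: \<eta>'_def)
        also have "\<dots> = \<epsilon>' * \<kappa>" using C V0 by simp
        finally show "3 * C * V * \<eta>' \<le> \<epsilon>' * \<kappa>" .
      qed
      have "\<bar>u y - u x - A (y - x)\<bar> \<le> \<epsilon>' * norm (y - x)" if x: "x \<in> ball p \<eta>'" and y: "y \<in> ball p \<eta>'" for x y
      proof -
        have hx: "dist p x < \<epsilon> / 2" "dist p y < \<epsilon> / 2" using x y \<eta>' by auto
        have ig: "g z integrable_on ?P" for z
          unfolding g_def by (rule integrable_continuous) (intro continuous_intros c\<psi>)
        have hn: "norm (y - x) \<le> 2 * \<eta>'" "norm (x - p) \<le> \<eta>'"
          using x y dist_triangle[of x y p] by (auto simp: dist_norm norm_minus_commute)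
        have "\<kappa> * (u y - u x - A (y - x)) = integral ?P (g y) - integral ?P (g x) - integral ?P (\<lambda>q. \<psi> q * (G q \<bullet> (y - x)))"
          using \<kappa> by (simp add: uz[OF hx(1)] uz[OF hx(2)] A_def right_diff_distrib)
        also have "\<dots> = integral ?P (\<lambda>q. g y q - g x q - \<psi> q * (G q \<bullet> (y - x)))"
          by (simp add: integral_diff ig intG integrable_diff)
        also have "norm \<dots> \<le> integral ?P (\<lambda>q. M * (3 * C * \<eta>' * norm (y - x)))"
        proof (rule integral_norm_bound_integral)
          show "(\<lambda>q. g y q - g x q - \<psi> q * (G q \<bullet> (y - x))) integrable_on ?P"
            by (intro integrable_diff ig intG)
          fix q assume q: "q \<in> ?P"
          then have "q - p \<in> Q" by (simp add: memt)
          moreover have "d * \<epsilon> \<le> d" using d \<epsilon> by (simp add: mult_left_le)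
          ultimately have n0: "norm (q - p) \<le> R" "norm (q - p) \<le> d" using Qn[of "q - p"] unfolding R_def by linarith+
          have n1: "norm (q - x) \<le> R"
            using norm_triangle_ineq[of "q - p" "p - x"] n0(2) hn(2) \<eta>' \<epsilon> by (simp add: R_def norm_minus_commute)
          have "\<bar>bump \<beta> ((q - x) - (y - x)) - bump \<beta> (q - x) - (4 * \<beta> * max 0 (1 - \<beta> * (norm (q - p))\<^sup>2)) * ((q - p) \<bullet> (y - x))\<bar>
            \<le> C * norm (y - x) * (norm (y - x) + norm ((q - x) - (q - p)))"
            unfolding C_def by (rule bump_taylor[OF \<beta> n1 n0(1)]) (use hn \<eta>' \<epsilon> d in \<open>auto simp: R_def\<close>)
          also have "\<dots> \<le> C * norm (y - x) * (3 * \<eta>')"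
            using C hn by (intro mult_left_mono) (auto simp: norm_minus_commute)
          finally have b: "\<bar>bump \<beta> (q - y) - bump \<beta> (q - x) - G q \<bullet> (y - x)\<bar> \<le> 3 * C * \<eta>' * norm (y - x)"
            by (simp add: G_def algebra_simps)
          have "\<bar>g y q - g x q - \<psi> q * (G q \<bullet> (y - x))\<bar> = \<bar>\<psi> q\<bar> * \<bar>bump \<beta> (q - y) - bump \<beta> (q - x) - G q \<bullet> (y - x)\<bar>"
            by (simp add: g_def abs_mult[symmetric] algebra_simps)
          also have "\<dots> \<le> M * (3 * C * \<eta>' * norm (y - x))" using M(2)[OF q] M(1) b by (intro mult_mono) auto
          finally show "norm (g y q - g x q - \<psi> q * (G q \<bullet> (y - x))) \<le> M * (3 * C * \<eta>' * norm (y - x))" by simp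
        qed auto
        also have "\<dots> = (3 * C * V * \<eta>') * norm (y - x)" by (simp add: V_def)
        also have "\<dots> \<le> \<epsilon>' * \<kappa> * norm (y - x)" by (rule mult_right_mono[OF \<eta>'(3)]) simp
        finally show ?thesis using \<kappa> by (simp add: abs_mult mult_ac)
      qed
      with \<eta>'(1) show "\<exists>\<eta>>0. \<forall>x\<in>ball p \<eta>. \<forall>y\<in>ball p \<eta>. \<bar>u y - u x - A (y - x)\<bar> \<le> \<epsilon>' * norm (y - x)" by blast
    qed
  qed
qed


text \<open>\<open>psh\<close> speaks of affine discs. Smoothing on the compact image of the curved
  disc makes the function strictly differentiable there, so the composition is \<open>asub\<close>
  and the maximum principle applies up to \<open>e\<close>.\<close>

lemma psh_disc_max:
  fixes \<psi> :: "complex^'n \<Rightarrow> real" and G :: "complex poly"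
  defines "F \<equiv> \<lambda>a b X w. a + cscale w b + cscale (poly G w) X"
  assumes \<Omega>: "open \<Omega>" "continuous_on \<Omega> \<psi>" "psh \<Omega> \<psi>"
    and disc: "\<And>w. cmod w \<le> 1 \<Longrightarrow> F a b X w \<in> \<Omega>" and m: "\<And>w. cmod w = 1 \<Longrightarrow> \<psi> (F a b X w) \<le> m"
    and w: "cmod w \<le> 1"
  shows "\<psi> (F a b X w) \<le> m"
proof (rule field_le_epsilon)
  fix e :: real assume e: "e > 0"
  let ?F = "F a b X"
  have cF: "continuous_on S ?F" for S unfolding F_def by (intro continuous_intros)
  have K: "compact (?F ` cball 0 1)" "?F ` cball 0 1 \<subseteq> \<Omega>"
    using disc by (auto intro!: compact_continuous_image[OF cF])
  have e2: "e / 2 > 0" using e by simp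
  obtain u where u: "\<And>z. z \<in> ?F ` cball 0 1 \<Longrightarrow> sdiff u z" "\<And>z. z \<in> ?F ` cball 0 1 \<Longrightarrow> sm u 0 z"
    "\<And>z. z \<in> ?F ` cball 0 1 \<Longrightarrow> \<bar>u z - \<psi> z\<bar> \<le> e / 2"
    using psh_smoothing[OF \<Omega> K e2] by blast
  have mem: "?F v \<in> ?F ` cball 0 1" if "cmod v \<le> 1" for v using that by simp
  have "u (?F w) \<le> m + e / 2"
  proof (rule asub_max_principle[where g = "\<lambda>w. u (?F w)", OF _ _ _ w])
    show "continuous_on (cball 0 1) (\<lambda>w. u (?F w))"
    proof (rule continuous_on_compose2[OF _ cF subset_refl], rule continuous_at_imp_continuous_on, rule ballI)
      fix z assume "z \<in> ?F ` cball 0 1"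
      from sdiff_cont_ball[OF u(1)[OF this]] obtain \<eta> where "\<eta> > 0" "continuous_on (ball z \<eta>) u" .
      then show "isCont u z" using continuous_on_eq_continuous_at[OF open_ball] by force
    qed
    show "asub (\<lambda>w. u (?F w)) v" if "cmod v < 1" for v
      using sm_asub_disc[of u a v b G X] u(1,2)[OF mem[OF less_imp_le[OF that]]] that by (simp add: F_def)
    show "u (?F v) \<le> m + e / 2" if "cmod v = 1" for v
      using m[OF that] u(3)[OF mem[OF eq_refl[OF that]]] by linarith
  qed
  with u(3)[OF mem[OF w]] show "\<psi> (?F w) \<le> m + e" by linarith
qed

text \<open>Keeps the discs in Oka's lemma polynomial: the factor \<open>exp (p w)\<close> is
  replaced by a Taylor polynomial of \<open>exp\<close> composed with \<open>p\<close>.\<close>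

lemma exp_poly_approx:
  fixes p :: "complex poly"
  assumes "\<epsilon> > 0"
  obtains G where "\<And>w. cmod w \<le> 1 \<Longrightarrow> cmod (poly G w - exp (poly p w)) \<le> \<epsilon>"
proof -
  have "bounded (poly p ` cball 0 1)"
    by (intro compact_imp_bounded compact_continuous_image continuous_intros compact_cball)
  then obtain R where R: "R > 0" "\<And>w. cmod w \<le> 1 \<Longrightarrow> cmod (poly p w) \<le> R"
    unfolding bounded_pos by (metis image_eqI mem_cball_0)
  have "(\<lambda>n. inverse (fact n) * R ^ n) \<longlonglongrightarrow> 0"
    by (rule summable_LIMSEQ_zero[OF summable_exp])
  then have "(\<lambda>n. exp R * R * (inverse (fact n) * R ^ n)) \<longlonglongrightarrow> exp R * R * 0"
    by (intro tendsto_intros)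
  then have "\<forall>\<^sub>F n in sequentially. exp R * R * (inverse (fact n) * R ^ n) < \<epsilon>"
    using assms by (intro order_tendstoD) auto
  then obtain n where n: "exp R * R * (inverse (fact n) * R ^ n) < \<epsilon>"
    by (meson eventually_sequentially order_refl)
  define G where "G = pcompose (\<Sum>k\<le>n. monom (1 / fact k) k) p"
  show ?thesis
  proof (rule that[of G])
    fix w :: complex assume w: "cmod w \<le> 1"
    have "poly G w = (\<Sum>k\<le>n. poly p w ^ k / fact k)"
      by (simp add: G_def poly_pcompose poly_sum poly_monom)
    then have "cmod (poly G w - exp (poly p w)) = cmod (exp (poly p w) - (\<Sum>k\<le>n. poly p w ^ k / fact k))"
      by (simp add: norm_minus_commute)
    also have "\<dots> \<le> exp \<bar>Re (poly p w)\<bar> * cmod (poly p w) ^ Suc n / fact n" by (rule Taylor_exp)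
    also have "\<dots> \<le> exp R * R ^ Suc n / fact n"
      using R(2)[OF w] abs_Re_le_cmod[of "poly p w"] R(1)
      by (intro divide_right_mono mult_mono power_mono) auto
    also have "\<dots> = exp R * R * (inverse (fact n) * R ^ n)" by (simp add: field_simps)
    finally show "cmod (poly G w - exp (poly p w)) \<le> \<epsilon>" using n by simp
  qed
qed

section \<open>The distance to the complement and Oka's lemma\<close>

lemma ball_infdist_subset:
  assumes "dist x y < infdist x (- S)"
  shows "y \<in> S"
  using infdist_le[of y "- S" x] assms by (rule_tac ccontr) auto

lemma le_infdist_complement:
  fixes a :: "'a::heine_borel"
  assumes "open S" "- S \<noteq> {}" "\<And>y. dist a y \<le> r \<Longrightarrow> y \<in> S"
  shows "r \<le> infdist a (- S)"
proof (rule ccontr)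
  assume "\<not> r \<le> infdist a (- S)"
  obtain y where "y \<in> - S" "infdist a (- S) = dist a y"
    using infdist_attains_inf[of "- S" a] assms by auto
  with assms(3)[of y] \<open>\<not> r \<le> infdist a (- S)\<close> show False by auto
qed

lemma infdist_complement_pos:
  assumes "open S" "- S \<noteq> {}" "a \<in> S"
  shows "0 < infdist a (- S)"
  using infdist_pos_not_in_closed[of "- S" a] assms by auto

text \<open>Oka's lemma. If \<open>exp (Re p) < dist\<close> on the circle, the discs \<open>a + w b + \<tau> exp (p w) X\<close> with
  \<open>0 \<le> \<tau> \<le> 1\<close> cannot leave \<open>\<Omega>\<close>, since the exhaustion function stays bounded on them by the maximum principle.\<close>
lemma oka:
  fixes \<Omega> :: "(complex^'n) set"
  assumes \<Omega>: "open \<Omega>" "pseudoconvex \<Omega>" "- \<Omega> \<noteq> {}"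
    and disc: "\<And>w. cmod w \<le> 1 \<Longrightarrow> a + cscale w b \<in> \<Omega>"
  shows "- ln (infdist a (- \<Omega>)) \<le> cavg (\<lambda>w. - ln (infdist (a + cscale w b) (- \<Omega>)))"
proof -
  obtain \<psi> where \<psi>: "continuous_on \<Omega> \<psi>" "psh \<Omega> \<psi>" "\<And>c. compact {z\<in>\<Omega>. \<psi> z \<le> c}"
    using \<Omega>(2) unfolding pseudoconvex_def by blast
  let ?d = "\<lambda>z. infdist z (- \<Omega>)"
  define l where "l w = ln (?d (a + cscale w b))" for w
  have dpos: "?d (a + cscale w b) > 0" if "cmod w \<le> 1" for w
    by (rule infdist_complement_pos[OF \<Omega>(1,3) disc[OF that]])
  have cl: "continuous_on (sphere 0 1) l"
    unfolding l_def
  proof (intro continuous_intros ballI)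
    show "?d (a + cscale w b) \<noteq> 0" if "w \<in> sphere 0 1" for w using dpos[of w] that by simp
  qed
  have "cavg l \<le> ln (?d a) + e" if e: "e > 0" for e
  proof -
    obtain p where p: "\<And>w. cmod w = 1 \<Longrightarrow> \<bar>Re (poly p w) - l w\<bar> \<le> e / 4" "poly p 0 = complex_of_real (cavg l)"
      using harmonic_approx[OF cl, of "e / 4"] e by (metis zero_less_divide_iff zero_less_numeral)
    \<comment> \<open>Lowering by \<open>e / 2\<close> beats the approximation error
      \<open>e / 4\<close> and leaves room \<open>e / 8\<close> for replacing \<open>exp\<close> by
      \<open>G\<close>; at 0 the total loss stays below \<open>e\<close>.\<close>
    define p' where "p' = p - [:of_real (e / 2):]"
    have "bounded (poly p' ` cball 0 1)"
      by (intro compact_imp_bounded compact_continuous_image continuous_intros compact_cball)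
    then obtain R where R: "R > 0" "\<And>w. cmod w \<le> 1 \<Longrightarrow> cmod (poly p' w) \<le> R"
      unfolding bounded_pos by (metis image_eqI mem_cball_0)
    \<comment> \<open>The absolute error \<mu> acts as a relative one, since
      \<open>exp (Re (poly p' w))\<close> is at least \<open>exp (- R)\<close> on the disc.\<close>
    define \<mu> where "\<mu> = exp (- R) * min (exp (e / 8) - 1) (1 - exp (- e / 4))"
    have \<mu>: "\<mu> > 0" using e by (simp add: \<mu>_def)
    obtain G where G: "\<And>w. cmod w \<le> 1 \<Longrightarrow> cmod (poly G w - exp (poly p' w)) \<le> \<mu>"
      using exp_poly_approx[OF \<mu>] by blast
    have ex: "exp (- R) \<le> exp (Re (poly p' w))" if "cmod w \<le> 1" for w
      using R(2)[OF that] abs_Re_le_cmod[of "poly p' w"] by simp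
    have Gle: "cmod (poly G w) < ?d (a + cscale w b)" if w: "cmod w = 1" for w
    proof -
      have "cmod (poly G w) \<le> cmod (exp (poly p' w)) + \<mu>"
        using G[of w] w norm_triangle_ineq[of "exp (poly p' w)" "poly G w - exp (poly p' w)"] by simp
      also have "cmod (exp (poly p' w)) = exp (Re (poly p' w))" by (rule norm_exp_eq_Re)
      also have "\<mu> \<le> exp (- R) * (exp (e / 8) - 1)" unfolding \<mu>_def by (intro mult_left_mono) auto
      also have "\<dots> \<le> exp (Re (poly p' w)) * (exp (e / 8) - 1)"
        using ex[of w] w e by (intro mult_right_mono) auto
      also have "exp (Re (poly p' w)) + exp (Re (poly p' w)) * (exp (e / 8) - 1) = exp (Re (poly p' w) + e / 8)"
        by (simp add: exp_add algebra_simps)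
      also have "\<dots> < exp (l w)" using abs_le_D1[OF p(1)[OF w]] e by (simp add: p'_def)
      also have "\<dots> = ?d (a + cscale w b)" unfolding l_def using dpos w by simp
      finally show ?thesis by simp
    qed
    have G0: "exp (cavg l - e) \<le> cmod (poly G 0)"
    proof -
      have "exp (Re (poly p' 0)) - \<mu> \<le> cmod (poly G 0)"
        using G[of 0] norm_triangle_ineq2[of "exp (poly p' 0)" "poly G 0"] by (simp add: norm_exp_eq_Re norm_minus_commute)
      moreover have "\<mu> \<le> exp (- R) * (1 - exp (- e / 4))" unfolding \<mu>_def by (intro mult_left_mono) auto
      moreover have "\<dots> \<le> exp (Re (poly p' 0)) * (1 - exp (- e / 4))" using ex[of 0] e by (intro mult_right_mono) auto
      moreover have "exp (Re (poly p' 0)) * exp (- e / 4) = exp (cavg l - e / 2 - e / 4)"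
        by (simp add: p'_def p(2) flip: exp_add)
      moreover have "exp (cavg l - e) \<le> exp (cavg l - e / 2 - e / 4)" using e by simp
      ultimately show ?thesis by (simp only: right_diff_distrib mult_1_right)
    qed
    have star: "a + cscale (poly G 0) X \<in> \<Omega>" if X: "norm X \<le> 1" for X
    proof -
      define F where "F \<tau> w = a + cscale w b + cscale (poly (smult (of_real \<tau>) G) w) X" for \<tau> :: real and w
      have F: "F \<tau> w = a + cscale w b + \<tau> *\<^sub>R cscale (poly G w) X" for \<tau> w
        by (simp add: F_def cscale_of_real_mult cscale_scaleR_right)
      have cF: "continuous_on S (\<lambda>(\<tau>, w). F \<tau> w)" for S
        unfolding F split_beta by (intro continuous_intros)
      \<comment> \<open>The boundary circles for all \<tau> form one compact set in \<Omega>, which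
        yields a bound \<open>m\<close> of \<psi> independent of \<tau>.\<close>
      define B where "B = (\<lambda>(\<tau>, w). F \<tau> w) ` ({0..1} \<times> sphere 0 1)"
      have Bc: "compact B" unfolding B_def by (intro compact_continuous_image[OF cF] compact_Times) auto
      have B\<Omega>: "B \<subseteq> \<Omega>"
      proof
        fix z assume "z \<in> B"
        then obtain \<tau> w where *: "0 \<le> \<tau>" "\<tau> \<le> 1" "cmod w = 1" "z = F \<tau> w" by (auto simp: B_def)
        have "dist (a + cscale w b) z = \<tau> * (cmod (poly G w) * norm X)" using * by (simp add: F dist_norm)
        also have "\<dots> \<le> 1 * (cmod (poly G w) * 1)" using * X by (intro mult_mono mult_left_mono) auto
        also have "\<dots> < ?d (a + cscale w b)" using Gle[OF *(3)] by simp
        finally show "z \<in> \<Omega>" by (rule ball_infdist_subset)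
      qed
      obtain m where m: "\<And>z. z \<in> B \<Longrightarrow> \<psi> z \<le> m"
        using compact_imp_bounded[OF compact_continuous_image[OF continuous_on_subset[OF \<psi>(1) B\<Omega>] Bc]]
        unfolding bounded_real by (metis abs_le_D1 image_eqI)
      let ?A = "{z\<in>\<Omega>. \<psi> z \<le> m}"
      define T where "T = {\<tau>. 0 \<le> \<tau> \<and> \<tau> \<le> 1 \<and> (\<forall>w\<in>cball 0 1. F \<tau> w \<in> \<Omega>)}"
      have TA: "F \<tau> w \<in> ?A" if "\<tau> \<in> T" "cmod w \<le> 1" for \<tau> w
      proof -
        have "\<psi> (F \<tau> w) \<le> m"
          unfolding F_def
        proof (rule psh_disc_max[OF \<Omega>(1) \<psi>(1,2) _ _ that(2)])
          show "a + cscale v b + cscale (poly (smult (of_real \<tau>) G) v) X \<in> \<Omega>" if "cmod v \<le> 1" for v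
            using \<open>\<tau> \<in> T\<close> that by (simp add: T_def F_def del: poly_smult)
          show "\<psi> (a + cscale v b + cscale (poly (smult (of_real \<tau>) G) v) X) \<le> m" if "cmod v = 1" for v
          proof (rule m)
            have "(\<tau>, v) \<in> {0..1} \<times> sphere 0 1" using \<open>\<tau> \<in> T\<close> that by (simp add: T_def)
            then show "a + cscale v b + cscale (poly (smult (of_real \<tau>) G) v) X \<in> B"
              unfolding B_def F_def[symmetric] by (metis (no_types, lifting) case_prod_conv image_eqI)
          qed
        qed
        then show ?thesis using that by (simp add: T_def)
      qed
      \<comment> \<open>Continuity method: \<open>T\<close> is open since each disc is compact in
        \<Omega>, and closed because the discs stay in a compact sublevel set of \<psi>.\<close>
      have "T = {0..1}"
      proof (rule connected_clopen[THEN iffD1, OF connected_Icc, rule_format, THEN disjE])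
        show "openin (top_of_set {0..1}) T \<and> closedin (top_of_set {0..1}) T"
        proof
          show "openin (top_of_set {0..1}) T"
            unfolding openin_euclidean_subtopology_iff
          proof (intro conjI ballI)
            show "T \<subseteq> {0..1}" by (auto simp: T_def)
            fix \<tau> assume \<tau>: "\<tau> \<in> T"
            have "continuous_on (cball 0 1) (F \<tau>)" unfolding F by (intro continuous_intros)
            then have "compact (F \<tau> ` cball 0 1)" by (rule compact_continuous_image) simp
            moreover have "F \<tau> ` cball 0 1 \<subseteq> \<Omega>" using \<tau> by (auto simp: T_def)
            ultimately obtain e' where e': "e' > 0" "(\<Union>x\<in>F \<tau> ` cball 0 1. cball x e') \<subseteq> \<Omega>"
              using compact_subset_open_imp_cball_epsilon_subset[OF _ \<Omega>(1)] by blast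
            have "bounded (poly G ` cball 0 1)"
              by (intro compact_imp_bounded compact_continuous_image continuous_intros compact_cball)
            then obtain g where g: "g > 0" "\<And>w. cmod w \<le> 1 \<Longrightarrow> cmod (poly G w) \<le> g"
              unfolding bounded_pos by (metis image_eqI mem_cball_0)
            show "\<exists>e>0. \<forall>x'\<in>{0..1}. dist x' \<tau> < e \<longrightarrow> x' \<in> T"
            proof (intro exI[of _ "e' / g"] conjI ballI impI)
              show "e' / g > 0" using e' g by simp
              fix x' :: real assume x': "x' \<in> {0..1}" "dist x' \<tau> < e' / g"
              have "F x' w \<in> \<Omega>" if "cmod w \<le> 1" for w
              proof -
                have "F \<tau> w - F x' w = (\<tau> - x') *\<^sub>R cscale (poly G w) X" by (simp add: F scaleR_diff_left)
                then have "dist (F \<tau> w) (F x' w) = \<bar>\<tau> - x'\<bar> * (cmod (poly G w) * norm X)" by (simp add: dist_norm)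
                also have "\<dots> \<le> (e' / g) * (g * 1)"
                  using x' g(2)[OF that] X g(1) e' by (intro mult_mono) (auto simp: dist_real_def)
                also have "\<dots> = e'" using g by simp
                finally have "F x' w \<in> (\<Union>x\<in>F \<tau> ` cball 0 1. cball x e')" using that by (intro UN_I[of "F \<tau> w"]) auto
                then show ?thesis using e'(2) by (rule rev_subsetD)
              qed
              then show "x' \<in> T" using x' by (simp add: T_def)
            qed
          qed
          have "closed T"
            unfolding closed_sequential_limits
          proof (intro allI impI, elim conjE)
            fix f \<tau> assume f: "\<forall>n. f n \<in> T" "f \<longlonglongrightarrow> \<tau>"
            have "0 \<le> \<tau>" "\<tau> \<le> 1"
              using f by (auto simp: T_def intro: LIMSEQ_le_const[OF f(2)] LIMSEQ_le_const2[OF f(2)])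
            moreover have "F \<tau> w \<in> \<Omega>" if "cmod w \<le> 1" for w
            proof -
              have "(\<lambda>n. F (f n) w) \<longlonglongrightarrow> F \<tau> w" unfolding F by (intro tendsto_intros f(2))
              then have "F \<tau> w \<in> ?A"
                using closed_sequentially[OF compact_imp_closed[OF \<psi>(3)[of m]], of "\<lambda>n. F (f n) w"] TA f(1) that by blast
              then show ?thesis by simp
            qed
            ultimately show "\<tau> \<in> T" by (simp add: T_def)
          qed
          then show "closedin (top_of_set {0..1}) T"
            by (rule closed_subset[rotated]) (auto simp: T_def)
        qed
      next
        assume "T = {}"
        moreover have "0 \<in> T" using disc by (simp add: T_def F)
        ultimately show "T = {0..1}" by simp
      qed
      then have "1 \<in> T" by simp
      then have "F 1 0 \<in> \<Omega>" by (simp add: T_def)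
      then show ?thesis by (simp add: F)
    qed
    \<comment> \<open>The centres of the final discs, over all \<open>X\<close> in the unit ball,
      fill the closed ball of radius \<open>cmod (poly G 0)\<close> about \<open>a\<close>.\<close>
    have "cmod (poly G 0) \<le> ?d a"
    proof (rule le_infdist_complement[OF \<Omega>(1,3)])
      fix y assume y: "dist a y \<le> cmod (poly G 0)"
      have g0: "poly G 0 \<noteq> 0" using G0 by (metis exp_gt_zero norm_zero not_le)
      have "a + cscale (poly G 0) (cscale (inverse (poly G 0)) (y - a)) \<in> \<Omega>"
      proof (rule star)
        show "norm (cscale (inverse (poly G 0)) (y - a)) \<le> 1"
          using y g0 by (simp add: norm_inverse dist_norm norm_minus_commute[of y]) (simp add: inverse_eq_divide pos_divide_le_eq)
      qed
      then show "y \<in> \<Omega>" using g0 by (simp add: cscale_cscale)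
    qed
    with G0 have "exp (cavg l - e) \<le> ?d a" by simp
    then have "cavg l - e \<le> ln (?d a)" using dpos[of 0] by (simp add: ln_ge_iff)
    then show ?thesis by simp
  qed
  then have "cavg l \<le> ln (?d a)" by (rule field_le_epsilon)
  moreover have "cavg (\<lambda>w. - ln (?d (a + cscale w b))) = - cavg l"
    using cavg_cmult[of "-1" l] by (simp add: l_def)
  ultimately show ?thesis by simp
qed

section \<open>Extension of a function off a thin strip\<close>

lemma sdiff_add_norm_sq:
  assumes "sdiff u p"
  shows "sdiff (\<lambda>x. u x + k * (norm x)\<^sup>2) p"
proof -
  obtain A where A: "bounded_linear A" and Aeps: "\<And>\<epsilon>. \<epsilon> > 0 \<Longrightarrow> \<exists>\<eta>>0. \<forall>x\<in>ball p \<eta>. \<forall>y\<in>ball p \<eta>. \<bar>u y - u x - A (y - x)\<bar> \<le> \<epsilon> * norm (y - x)"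
    using assms unfolding sdiff_def by blast
  show ?thesis
    unfolding sdiff_def
  proof (rule exI[of _ "\<lambda>h. A h + (2 * k) * (p \<bullet> h)"], intro conjI allI impI)
    show "bounded_linear (\<lambda>h. A h + (2 * k) * (p \<bullet> h))"
      by (intro bounded_linear_add A bounded_linear_const_mult bounded_linear_inner_right)
    fix \<epsilon> :: real assume \<epsilon>: "\<epsilon> > 0"
    then obtain \<eta> where \<eta>: "\<eta> > 0" "\<And>x y. x \<in> ball p \<eta> \<Longrightarrow> y \<in> ball p \<eta> \<Longrightarrow> \<bar>u y - u x - A (y - x)\<bar> \<le> \<epsilon> / 2 * norm (y - x)"
      using Aeps[of "\<epsilon> / 2"] by (metis half_gt_zero)
    define \<eta>' where "\<eta>' = min \<eta> (\<epsilon> / (4 * (\<bar>k\<bar> + 1)))"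
    have \<eta>': "\<eta>' > 0" "\<eta>' \<le> \<eta>" using \<eta> \<epsilon> by (auto simp: \<eta>'_def)
    have k\<eta>: "\<bar>k\<bar> * (2 * \<eta>') \<le> \<epsilon> / 2"
    proof -
      have "(\<bar>k\<bar> + 1) * \<eta>' \<le> (\<bar>k\<bar> + 1) * (\<epsilon> / (4 * (\<bar>k\<bar> + 1)))"
        by (intro mult_left_mono) (auto simp: \<eta>'_def)
      also have "\<dots> = \<epsilon> / 4" by (simp add: divide_simps)
      finally show ?thesis using \<eta>' by (simp add: algebra_simps)
    qed
    have "\<bar>u y + k * (norm y)\<^sup>2 - (u x + k * (norm x)\<^sup>2) - (A (y - x) + (2 * k) * (p \<bullet> (y - x)))\<bar> \<le> \<epsilon> * norm (y - x)"
      if xy: "x \<in> ball p \<eta>'" "y \<in> ball p \<eta>'" for x y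
    proof -
      have 1: "\<bar>u y - u x - A (y - x)\<bar> \<le> \<epsilon> / 2 * norm (y - x)" using \<eta>(2) xy \<eta>' by simp
      have "(norm y)\<^sup>2 - (norm x)\<^sup>2 - 2 * (p \<bullet> (y - x)) = ((y - p) + (x - p)) \<bullet> (y - x)"
        by (simp add: power2_norm_eq_inner algebra_simps inner_commute)
      moreover have "\<bar>((y - p) + (x - p)) \<bullet> (y - x)\<bar> \<le> norm ((y - p) + (x - p)) * norm (y - x)"
        by (rule Cauchy_Schwarz_ineq2)
      moreover have "norm ((y - p) + (x - p)) \<le> 2 * \<eta>'"
        using norm_triangle_ineq[of "y - p" "x - p"] xy by (simp add: dist_norm norm_minus_commute)
      then have "norm ((y - p) + (x - p)) * norm (y - x) \<le> 2 * \<eta>' * norm (y - x)" by (rule mult_right_mono) simp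
      ultimately have "\<bar>(norm y)\<^sup>2 - (norm x)\<^sup>2 - 2 * (p \<bullet> (y - x))\<bar> \<le> 2 * \<eta>' * norm (y - x)" by linarith
      then have "\<bar>k\<bar> * \<bar>(norm y)\<^sup>2 - (norm x)\<^sup>2 - 2 * (p \<bullet> (y - x))\<bar> \<le> \<bar>k\<bar> * (2 * \<eta>' * norm (y - x))"
        by (rule mult_left_mono) simp
      also have "\<dots> \<le> \<epsilon> / 2 * norm (y - x)"
        using mult_right_mono[OF k\<eta>, of "norm (y - x)"] by (simp add: mult.assoc)
      finally have 2: "\<bar>k * ((norm y)\<^sup>2 - (norm x)\<^sup>2 - 2 * (p \<bullet> (y - x)))\<bar> \<le> \<epsilon> / 2 * norm (y - x)"
        by (simp add: abs_mult)
      have "u y + k * (norm y)\<^sup>2 - (u x + k * (norm x)\<^sup>2) - (A (y - x) + (2 * k) * (p \<bullet> (y - x))) =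
        (u y - u x - A (y - x)) + k * ((norm y)\<^sup>2 - (norm x)\<^sup>2 - 2 * (p \<bullet> (y - x)))"
        by (simp add: algebra_simps)
      with 1 2 show ?thesis by linarith
    qed
    with \<eta>'(1) show "\<exists>\<eta>>0. \<forall>x\<in>ball p \<eta>. \<forall>y\<in>ball p \<eta>. \<bar>u y + k * (norm y)\<^sup>2 - (u x + k * (norm x)\<^sup>2)
       - (A (y - x) + (2 * k) * (p \<bullet> (y - x)))\<bar> \<le> \<epsilon> * norm (y - x)" by blast
  qed
qed

text \<open>Subtracting \<open>c\<close> times the squared norm reduces to the bound 0; by
  Pythagoras the subtracted term gives back \<open>c\<close> times the mean square
  displacement.\<close>

lemma sm_submean_poly_disc:
  fixes a b X :: "complex^'n" and G :: "complex poly"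
  defines "F \<equiv> \<lambda>w. a + cscale w b + cscale (poly G w) X"
  assumes sd: "\<And>w. cmod w \<le> 1 \<Longrightarrow> sdiff u (F w)" and s: "\<And>w. cmod w \<le> 1 \<Longrightarrow> sm u c (F w)"
  shows "u (F 0) + c * cavg (\<lambda>w. (norm (F w - F 0))\<^sup>2) \<le> cavg (\<lambda>w. u (F w))"
    and "continuous_on (cball 0 1) (\<lambda>w. u (F w))"
proof -
  define g where "g x = u x + (- c) * (norm x)\<^sup>2" for x
  have cF: "continuous_on S F" for S unfolding F_def by (intro continuous_intros)
  have cu: "isCont u (F w)" if "cmod w \<le> 1" for w
  proof -
    from sdiff_cont_ball[OF sd[OF that]] obtain \<eta> where "\<eta> > 0" "continuous_on (ball (F w) \<eta>) u" .
    then show ?thesis using continuous_on_eq_continuous_at[OF open_ball] by force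
  qed
  show cuF: "continuous_on (cball 0 1) (\<lambda>w. u (F w))"
    by (rule continuous_on_compose2[OF _ cF subset_refl], rule continuous_at_imp_continuous_on) (use cu in auto)
  have cg: "continuous_on (cball 0 1) (\<lambda>w. g (F w))"
    unfolding g_def by (intro continuous_intros cuF cF)
  have "g (F 0) \<le> cavg (\<lambda>w. g (F w))"
  proof (rule asub_submean[OF cg])
    fix w assume w: "cmod w < 1"
    obtain \<eta> where \<eta>: "\<eta> > 0" "continuous_on (ball (F w) \<eta>) u"
      using sdiff_cont_ball[OF sd[of w]] w by (metis less_imp_le)
    have "sm (\<lambda>x. u x + (- c) * (norm (x - 0))\<^sup>2 + 0) (c + (- c)) (F w)"
      by (rule sm_add_norm_sq[OF s, of w "ball (F w) \<eta>"]) (use w \<eta> in auto)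
    then have "sm g 0 (F w)" by (simp add: g_def[abs_def])
    moreover have "sdiff g (F w)" unfolding g_def[abs_def] by (rule sdiff_add_norm_sq) (use sd w in simp)
    ultimately show "asub (\<lambda>w. g (F w)) w" using sm_asub_disc[of g a w b G X] w by (simp add: F_def)
  qed
  moreover have "cavg (\<lambda>w. g (F w)) = cavg (\<lambda>w. u (F w)) - c * cavg (\<lambda>w. (norm (F w))\<^sup>2)"
  proof -
    have "cavg (\<lambda>w. g (F w)) = cavg (\<lambda>w. u (F w) + (- c) * (norm (F w))\<^sup>2)" by (simp add: g_def)
    also have "\<dots> = cavg (\<lambda>w. u (F w)) + cavg (\<lambda>w. (- c) * (norm (F w))\<^sup>2)"
      by (rule cavg_add) (auto intro!: continuous_intros cF continuous_on_subset[OF cuF])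
    finally show ?thesis by (simp only: cavg_cmult)
  qed
  moreover have "cavg (\<lambda>w. (norm (F w))\<^sup>2) = (norm (F 0))\<^sup>2 + cavg (\<lambda>w. (norm (F w - F 0))\<^sup>2)"
    unfolding F_def by (rule cavg_norm_sq_poly_disc)
  ultimately show "u (F 0) + c * cavg (\<lambda>w. (norm (F w - F 0))\<^sup>2) \<le> cavg (\<lambda>w. u (F w))"
    by (simp add: g_def distrib_left)
qed

text \<open>With \<open>x\<close> the relative variation of \<open>E\<close>, this compares
  \<open>1 / E\<close> with \<open>- ln E\<close>, which satisfies the sub-mean inequality by Oka's
  lemma. Both agree to first order, and \<open>1 / (1 + x)\<close> has a larger quadratic part, of
  which \<open>x\<^sup>2 / 4\<close> survives for small \<open>x\<close>. The surplus pays for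
  squared oscillations.\<close>

lemma inverse_ge_one_minus_ln:
  fixes x :: real
  assumes "\<bar>x\<bar> \<le> 1 / 4"
  shows "1 - ln (1 + x) + x\<^sup>2 / 4 \<le> 1 / (1 + x)"
proof -
  define g where "g x = inverse (1 + x) + ln (1 + x) - x\<^sup>2 / 4" for x :: real
  have d: "DERIV g y :> y * (1 / (1 + y)\<^sup>2 - 1 / 2)" if "\<bar>y\<bar> \<le> 1/4" for y
  proof -
    have "1 + y > 0" using that by linarith
    then have "DERIV g y :> - (inverse (1 + y) * inverse (1 + y)) + inverse (1 + y) - y / 2"
    proof -
      have 0: "((\<lambda>x. 1 + x) has_real_derivative 1) (at y)" by (auto intro!: derivative_eq_intros)
      have 1: "((\<lambda>x. inverse (1 + x)) has_real_derivative - (inverse (1 + y) * inverse (1 + y))) (at y)"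
        using DERIV_inverse'[OF 0] \<open>1 + y > 0\<close> by simp
      have 2: "((\<lambda>x. ln (1 + x)) has_real_derivative inverse (1 + y)) (at y)"
        using DERIV_chain2[OF DERIV_ln[OF \<open>1 + y > 0\<close>] 0] by simp
      have 3: "((\<lambda>x. x\<^sup>2 / 4) has_real_derivative y / 2) (at y)"
        by (auto intro!: derivative_eq_intros)
      show ?thesis unfolding g_def by (rule DERIV_diff[OF DERIV_add[OF 1 2] 3])
    qed
    moreover have "- (inverse a * inverse a) + inverse a - (a - 1) / 2 = (a - 1) * (1 / a\<^sup>2 - 1 / 2)" if "a > 0" for a :: real
      using that by (simp add: field_simps power2_eq_square)
    from this[OF \<open>1 + y > 0\<close>] have "- (inverse (1 + y) * inverse (1 + y)) + inverse (1 + y) - y / 2 = y * (1 / (1 + y)\<^sup>2 - 1 / 2)"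
      by simp
    ultimately show ?thesis by simp
  qed
  have p: "1 / (1 + y)\<^sup>2 - 1 / 2 \<ge> 0" if "\<bar>y\<bar> \<le> 1/4" for y :: real
  proof -
    have "(1 + y)\<^sup>2 \<le> (5/4)\<^sup>2" using that by (intro power_mono) auto
    then have "(1 + y)\<^sup>2 \<le> 2" by (simp add: power2_eq_square)
    moreover have "(1 + y)\<^sup>2 > 0" using that by auto
    ultimately show ?thesis by (simp add: field_simps)
  qed
  have "g 0 \<le> g x"
  proof (cases "x \<ge> 0")
    case True
    show ?thesis
    proof (rule DERIV_nonneg_imp_nondecreasing[OF True])
      fix y assume "0 \<le> y" "y \<le> x"
      then have "\<bar>y\<bar> \<le> 1/4" using assms by linarith
      with d p \<open>0 \<le> y\<close> show "\<exists>l. DERIV g y :> l \<and> 0 \<le> l" by (meson mult_nonneg_nonneg)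
    qed
  next
    case False
    then have "x \<le> 0" by simp
    then show ?thesis
    proof (rule DERIV_nonpos_imp_nonincreasing)
      fix y assume "x \<le> y" "y \<le> 0"
      then have "\<bar>y\<bar> \<le> 1/4" using assms by linarith
      with d p \<open>y \<le> 0\<close> show "\<exists>l. DERIV g y :> l \<and> l \<le> 0" by (meson mult_nonpos_nonneg)
    qed
  qed
  moreover have "g 0 = 1" by (simp add: g_def)
  ultimately show ?thesis unfolding g_def inverse_eq_divide by linarith
qed

lemma poly_cmod_max:
  fixes p :: "complex poly"
  assumes "\<And>w. cmod w = 1 \<Longrightarrow> cmod (poly p w - k) \<le> m" "cmod w1 \<le> 1"
  shows "cmod (poly p w1 - k) \<le> m"
proof -
  let ?k = "poly p w1 - k"
  obtain \<alpha> where \<alpha>: "cmod \<alpha> = 1" "Re (\<alpha> * ?k) = cmod ?k" by (rule cmod_eq_Re_unimodular)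
  let ?q = "smult \<alpha> (p - [:k:])"
  have "Re (poly ?q w1) \<le> m"
  proof (rule asub_max_principle[where g = "\<lambda>w. Re (poly ?q w)", OF _ _ _ assms(2)])
    show "continuous_on (cball 0 1) (\<lambda>w. Re (poly ?q w))" by (intro continuous_intros)
    show "asub (\<lambda>w. Re (poly ?q w)) w" if "cmod w < 1" for w
      unfolding asub_def cavg_Re_poly_disc using dense[of 0 "1 - cmod w"] that
      by (auto intro!: exI[of _ "(1 - cmod w) / 2"])
    show "Re (poly ?q w) \<le> m" if "cmod w = 1" for w
      using assms(1)[OF that] complex_Re_le_cmod[of "poly ?q w"] \<alpha>(1) by (simp add: norm_mult)
  qed
  then show ?thesis using \<alpha>(2) by simp
qed

text \<open>The function \<open>\<phi>\<close> is only known on a thin strip \<open>S\<close>. Along a disc through \<open>z0\<close> the strip is followed by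
  the holomorphic translation \<open>T\<close> with real part \<open>\<tau>0 - E\<close> on the circle; supping over \<open>s\<close> absorbs the imaginary
  part of \<open>T\<close> at a cost proportional to the mean square oscillation of \<open>E\<close>, which the term \<open>B / E\<close> pays for.\<close>
lemma sm_strip_extension:
  fixes \<phi> E q :: "complex^'n \<Rightarrow> real"
  assumes S: "open S" and \<phi>: "\<And>x. x \<in> S \<Longrightarrow> sm \<phi> c x" "\<And>x. x \<in> S \<Longrightarrow> sdiff \<phi> x"
    and \<phi>L: "\<And>x. x \<in> S \<Longrightarrow> \<exists>\<eta>>0. \<forall>y\<in>ball x \<eta>. \<forall>y'\<in>ball x \<eta>. \<bar>\<phi> y - \<phi> y'\<bar> \<le> \<Lambda> * norm (y - y')"
    and \<nu>: "norm \<nu> = 1" and \<rho>: "\<rho> > 0"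
    and EL: "\<And>x y. \<bar>E x - E y\<bar> \<le> norm (x - y)" and Epos: "E z0 > 0"
    and oka: "\<And>b. norm b < \<rho> \<Longrightarrow> - ln (E z0) \<le> cavg (\<lambda>w. - ln (E (z0 + cscale w b)))"
    and X: "X > 0"
    and strip: "\<And>s. \<bar>s\<bar> \<le> X \<Longrightarrow> z0 + cscale (Complex (\<tau>0 - E z0) s) \<nu> \<in> S"
    and qge: "\<And>z s. z \<in> ball z0 \<rho> \<Longrightarrow> \<bar>s\<bar> \<le> X \<Longrightarrow> \<phi> (z + cscale (Complex (\<tau>0 - E z) s) \<nu>) - \<kappa> * s\<^sup>2 \<le> q z"
    and q0: "q z0 = \<phi> (z0 + cscale (Complex (\<tau>0 - E z0) s0) \<nu>) - \<kappa> * s0\<^sup>2" "\<bar>s0\<bar> \<le> X / 2"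
    and qc: "continuous_on (ball z0 \<rho>) q"
    and nn: "0 \<le> c" "0 \<le> \<kappa>" "0 \<le> \<Lambda>" "0 \<le> B"
    and cond1: "\<Lambda> * E z0 \<le> B / E z0"
    and cond2: "2 * c + \<kappa> + 2 * \<Lambda> / E z0 \<le> B / (4 * (E z0) ^ 3)"
  shows "sm (\<lambda>z. q z + B / E z) (c / 2) z0"
  unfolding sm_def
proof (intro allI impI)
  fix Y :: "complex^'n" and \<epsilon> :: real assume \<epsilon>: "\<epsilon> > 0"
  define N where "N = norm Y"
  have N0: "N \<ge> 0" by (simp add: N_def)
  define x0 where "x0 = z0 + cscale (Complex (\<tau>0 - E z0) s0) \<nu>"
  have x0S: "x0 \<in> S" unfolding x0_def using strip q0(2) X by simp
  obtain \<eta>1 where \<eta>1: "\<eta>1 > 0" "\<And>y y'. y \<in> ball x0 \<eta>1 \<Longrightarrow> y' \<in> ball x0 \<eta>1 \<Longrightarrow> \<bar>\<phi> y - \<phi> y'\<bar> \<le> \<Lambda> * norm (y - y')"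
    using \<phi>L[OF x0S] by blast
  obtain \<eta>2 where \<eta>2: "\<eta>2 > 0" "ball x0 \<eta>2 \<subseteq> S" using S x0S openE by blast
  define \<eta> where "\<eta> = min \<eta>1 \<eta>2"
  have \<eta>: "\<eta> > 0" "ball x0 \<eta> \<subseteq> S" "\<And>y y'. y \<in> ball x0 \<eta> \<Longrightarrow> y' \<in> ball x0 \<eta> \<Longrightarrow> \<bar>\<phi> y - \<phi> y'\<bar> \<le> \<Lambda> * norm (y - y')"
    using \<eta>1 \<eta>2 by (auto simp: \<eta>_def)
  define E0 where "E0 = E z0"
  have E0: "E0 > 0" using Epos by (simp add: E0_def)
  define err where "err = \<Lambda> + (2 * c + \<kappa>) * (4 * N + 1)"
  have e8: "E0 / 8 > 0" "X / 2 > 0" "(1::real) > 0" using E0 X by auto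
  show "\<forall>\<^sub>F t in at_right 0. q z0 + B / E z0 + (c / 2 * (norm Y)\<^sup>2 - \<epsilon>) * t\<^sup>2
      \<le> cavg (\<lambda>v. q (z0 + cscale (of_real t * v) Y) + B / E (z0 + cscale (of_real t * v) Y))"
    using eventually_small[OF \<rho>, of N] eventually_small[OF \<eta>(1), of "8 * N"] eventually_small[OF e8(1), of N]
      eventually_small[OF e8(2), of "6 * N"] eventually_small[OF e8(3), of 1] eventually_small[OF \<epsilon>, of err]
  proof eventually_elim
    case (elim t)
    then have t: "0 < t" "t \<le> 1" "t * N < \<rho>" "t * (8 * N) < \<eta>" "t * N < E0 / 8" "t * (6 * N) < X / 2" "t * err < \<epsilon>" by auto
    have tN: "0 \<le> t * N" using t N0 by simp
    let ?z = "\<lambda>w. z0 + cscale (of_real t * w) Y"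
    have nz: "norm (cscale (of_real t * w) Y) = t * N" if "cmod w = 1" for w
      using that t by (simp add: norm_mult N_def)
    have zb: "?z w \<in> ball z0 \<rho>" if "cmod w = 1" for w
      using nz[OF that] t by (simp add: dist_norm del: norm_cscale)
    define \<Delta> where "\<Delta> w = E (?z w) - E0" for w
    define b where "b w = \<tau>0 - E (?z w)" for w
    have \<Delta>: "\<bar>\<Delta> w\<bar> \<le> t * N" if "cmod w = 1" for w
      using EL[of "?z w" z0] nz[OF that] by (simp add: \<Delta>_def E0_def del: norm_cscale)
    have cE: "continuous_on A E" for A
    proof -
      have "1-lipschitz_on A E" by (rule lipschitz_onI) (use EL in \<open>auto simp: dist_norm\<close>)
      then show ?thesis by (rule lipschitz_on_continuous_on)
    qed
    have c\<Delta>: "continuous_on (sphere 0 1) \<Delta>" and cb: "continuous_on (sphere 0 1) b"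
      unfolding \<Delta>_def b_def
      by (intro continuous_intros continuous_on_compose2[OF cE[of UNIV]] subset_UNIV)+
    have bL: "\<bar>b v - b w\<bar> \<le> (t * N) * cmod (v - w)" for v w
    proof -
      have "\<bar>b v - b w\<bar> \<le> norm (?z w - ?z v)" using EL[of "?z w" "?z v"] by (simp add: b_def)
      also have "?z w - ?z v = cscale (of_real t * (w - v)) Y" by (simp add: right_diff_distrib cscale_diff_left)
      also have "norm \<dots> = (t * N) * cmod (v - w)" using t by (simp add: norm_mult N_def norm_minus_commute)
      finally show ?thesis .
    qed
    have t3: "t ^ 3 > 0" using t by simp
    \<comment> \<open>The holomorphic translation: its real part follows \<open>b\<close> up to
      \<open>t ^ 3\<close>, negligible against \<open>t\<^sup>2\<close>, and the Lipschitz clause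
      keeps all of \<open>T\<close> within order \<open>t\<close> of \<open>b\<close>, hence the
      disc inside a fixed ball about \<open>x0\<close>.\<close>
    obtain T where T: "\<And>w. cmod w = 1 \<Longrightarrow> \<bar>Re (poly T w) - b w\<bar> \<le> t ^ 3" "poly T 0 = complex_of_real (cavg b)"
      "\<And>w. cmod w = 1 \<Longrightarrow> cmod (poly T w - b w) \<le> 5 * (t * N)"
      using harmonic_approx[OF cb t3] bL by metis
    define m\<Delta> where "m\<Delta> = cavg \<Delta>"
    define V2 where "V2 = cavg (\<lambda>w. (\<Delta> w)\<^sup>2)"
    have bavg: "cavg b = \<tau>0 - E0 - m\<Delta>"
    proof -
      have "cavg b = cavg (\<lambda>w. (\<tau>0 - E0) - \<Delta> w)" by (rule cavg_cong) (simp add: b_def \<Delta>_def)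
      then show ?thesis using cavg_diff[OF continuous_on_const c\<Delta>] by (simp add: m\<Delta>_def)
    qed
    have T6: "cmod (poly T w - of_real (\<tau>0 - E0)) \<le> 6 * (t * N)" if w: "cmod w = 1" for w
    proof -
      have "cmod (poly T w - of_real (\<tau>0 - E0)) \<le> cmod (poly T w - b w) + cmod (of_real (b w) - of_real (\<tau>0 - E0))"
        using dist_triangle[of "poly T w" "of_real (\<tau>0 - E0)" "of_real (b w)"] by (simp only: dist_norm)
      moreover have "cmod (of_real (b w) - of_real (\<tau>0 - E0)) = \<bar>\<Delta> w\<bar>"
        unfolding of_real_diff[symmetric] norm_of_real by (simp add: b_def \<Delta>_def)
      ultimately show ?thesis using T(3)[OF w] \<Delta>[OF w] by linarith
    qed
    have T6': "cmod (poly T w - of_real (\<tau>0 - E0)) \<le> 6 * (t * N)" if "cmod w \<le> 1" for w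
      by (rule poly_cmod_max[OF T6 that])
    have ImT: "\<bar>Im (poly T w)\<bar> \<le> 6 * (t * N)" if "cmod w = 1" for w
      using T6[OF that] abs_Im_le_cmod[of "poly T w - of_real (\<tau>0 - E0)"] by simp
    \<comment> \<open>The imaginary constant \<open>s0\<close> puts the disc near \<open>x0\<close>,
      the point where the supremum \<open>q z0\<close> is attained.\<close>
    define G where "G = T + [:\<i> * of_real s0:]"
    define F where "F w = z0 + cscale w (t *\<^sub>R Y) + cscale (poly G w) \<nu>" for w
    have Fw: "F w = ?z w + cscale (poly T w + \<i> * of_real s0) \<nu>" for w
      by (simp add: F_def G_def cscale_of_real_mult)
    have cx: "Complex r s = of_real r + \<i> * of_real s" for r s by (simp add: complex_eq_iff)
    have Fx0: "F w - x0 = cscale (of_real t * w) Y + cscale (poly T w - of_real (\<tau>0 - E0)) \<nu>" for w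
      unfolding Fw x0_def cx E0_def[symmetric] by (simp add: cscale_add_left cscale_diff_left)
    have Fball: "F w \<in> ball x0 \<eta>" if "cmod w \<le> 1" for w
    proof -
      have "norm (F w - x0) \<le> norm (cscale (of_real t * w) Y) + norm (cscale (poly T w - of_real (\<tau>0 - E0)) \<nu>)"
        unfolding Fx0 by (rule norm_triangle_ineq)
      also have "\<dots> \<le> t * N + 6 * (t * N)"
        using T6'[OF that] that t \<nu> mult_right_mono[OF that tN] by (intro add_mono) (auto simp: norm_mult N_def mult_ac)
      also have "\<dots> < \<eta>" using t(4) tN by argo
      finally show ?thesis by (simp add: dist_norm norm_minus_commute)
    qed
    have FS: "F w \<in> S" if "cmod w \<le> 1" for w using Fball[OF that] \<eta>(2) by blast
    have sub: "\<phi> (F 0) + c * cavg (\<lambda>w. (norm (F w - F 0))\<^sup>2) \<le> cavg (\<lambda>w. \<phi> (F w))"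
      and cF\<phi>: "continuous_on (cball 0 1) (\<lambda>w. \<phi> (F w))"
      using sm_submean_poly_disc[of \<phi> z0 "t *\<^sub>R Y" G \<nu> c] \<phi> FS unfolding F_def by blast+
    define J where "J = cavg (\<lambda>w. (Im (poly T w))\<^sup>2)"
    have ImT0: "Im (poly T w - poly T 0) = Im (poly T w)" for w by (simp add: T(2))
    \<comment> \<open>Real and imaginary part of \<open>T\<close> have equal mean squares about
      \<open>poly T 0\<close>, so the imaginary displacement costs no more than the mean square of
      \<Delta>, up to fourth order in \<open>t\<close>.\<close>
    have J1: "cavg (\<lambda>w. (Re (poly T w - poly T 0))\<^sup>2) = J"
      using cavg_Re_Im_square[of T] unfolding ImT0 J_def by simp
    have J: "J \<le> V2 + t ^ 4 * (4 * N + 1)"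
    proof -
      have mD: "\<bar>m\<Delta>\<bar> \<le> t * N"
        unfolding m\<Delta>_def using cavg_abs_le[OF c\<Delta> continuous_on_const \<Delta>] by simp
      have "J \<le> cavg (\<lambda>w. (\<Delta> w)\<^sup>2 - 2 * m\<Delta> * \<Delta> w + (m\<Delta>\<^sup>2 + t ^ 4 * (4 * N + 1)))"
        unfolding J1[symmetric]
      proof (rule cavg_mono)
        fix w :: complex assume w: "cmod w = 1"
        define e where "e = Re (poly T w) - b w"
        have e: "\<bar>e\<bar> \<le> t ^ 3" using T(1)[OF w] by (simp add: e_def)
        have Re: "Re (poly T w - poly T 0) = (m\<Delta> - \<Delta> w) + e"
          by (simp add: T(2) bavg e_def b_def \<Delta>_def)
        have sq: "(Re (poly T w - poly T 0))\<^sup>2 = (\<Delta> w)\<^sup>2 - 2 * m\<Delta> * \<Delta> w + m\<Delta>\<^sup>2 + 2 * ((m\<Delta> - \<Delta> w) * e) + e\<^sup>2"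
          unfolding Re by (simp add: power2_eq_square algebra_simps)
        moreover have "(m\<Delta> - \<Delta> w) * e \<le> (2 * (t * N)) * t ^ 3"
        proof -
          have "\<bar>m\<Delta> - \<Delta> w\<bar> * \<bar>e\<bar> \<le> (2 * (t * N)) * t ^ 3"
            using mD \<Delta>[OF w] e tN by (intro mult_mono) auto
          then show ?thesis unfolding abs_mult[symmetric] by linarith
        qed
        moreover have "e\<^sup>2 \<le> t ^ 4"
        proof -
          have "e\<^sup>2 \<le> (t ^ 3)\<^sup>2" using power_mono[OF e, of 2] by simp
          also have "\<dots> = t ^ 6" by (simp flip: power_mult)
          also have "\<dots> \<le> t ^ 4" using t by (intro power_decreasing) auto
          finally show ?thesis .
        qed
        moreover have "(2 * (t * N)) * t ^ 3 = t ^ 4 * (2 * N)" by (simp add: power4_eq_xxxx power3_eq_cube)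
        ultimately show "(Re (poly T w - poly T 0))\<^sup>2 \<le> (\<Delta> w)\<^sup>2 - 2 * m\<Delta> * \<Delta> w + (m\<Delta>\<^sup>2 + t ^ 4 * (4 * N + 1))"
        proof -
          have "t ^ 4 * (4 * N + 1) = 2 * (t ^ 4 * (2 * N)) + t ^ 4" by (simp add: algebra_simps)
          with \<open>(m\<Delta> - \<Delta> w) * e \<le> (2 * (t * N)) * t ^ 3\<close> \<open>e\<^sup>2 \<le> t ^ 4\<close> \<open>(2 * (t * N)) * t ^ 3 = t ^ 4 * (2 * N)\<close> sq
          show ?thesis by linarith
        qed
      qed (auto intro!: continuous_intros c\<Delta>)
      also have "\<dots> = V2 - 2 * m\<Delta> * m\<Delta> + (m\<Delta>\<^sup>2 + t ^ 4 * (4 * N + 1))"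
        unfolding V2_def m\<Delta>_def
        by (subst cavg_add, (intro continuous_intros c\<Delta>)+, subst cavg_diff, (intro continuous_intros c\<Delta>)+)
           (simp add: cavg_cmult)
      also have "\<dots> \<le> V2 + t ^ 4 * (4 * N + 1)" by (simp add: power2_eq_square)
      finally show ?thesis .
    qed
    \<comment> \<open>Half of the squared displacement \<open>t * norm Y\<close> survives the
      bending of the disc by \<open>T\<close>. This is the source of \<open>c / 2\<close> in the
      conclusion.\<close>
    have FF: "cavg (\<lambda>w. (norm (F w - F 0))\<^sup>2) \<ge> t\<^sup>2 * N\<^sup>2 / 2 - 2 * J"
    proof -
      have "cavg (\<lambda>w. t\<^sup>2 * N\<^sup>2 / 2 - ((Re (poly T w - poly T 0))\<^sup>2 + (Im (poly T w - poly T 0))\<^sup>2)) \<le> cavg (\<lambda>w. (norm (F w - F 0))\<^sup>2)"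
      proof (rule cavg_mono)
        fix w :: complex assume w: "cmod w = 1"
        let ?a = "cscale (of_real t * w) Y" and ?c = "cscale (poly T w - poly T 0) \<nu>"
        have d: "F w - F 0 = ?a + ?c"
          unfolding Fw by (simp add: cscale_add_left cscale_diff_left)
        have "norm ?a \<le> norm (?a + ?c) + norm ?c" using norm_triangle_ineq4[of "?a + ?c" ?c] by simp
        then have "(norm ?a)\<^sup>2 \<le> (norm (?a + ?c) + norm ?c)\<^sup>2" by (rule power_mono) simp
        also have "\<dots> \<le> 2 * (norm (?a + ?c))\<^sup>2 + 2 * (norm ?c)\<^sup>2"
          using zero_le_power2[of "norm (?a + ?c) - norm ?c"] by (simp add: power2_eq_square algebra_simps)
        finally have "(t * N)\<^sup>2 \<le> 2 * (norm (F w - F 0))\<^sup>2 + 2 * (norm ?c)\<^sup>2" unfolding d nz[OF w] .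
        moreover have "(norm ?c)\<^sup>2 = (Re (poly T w - poly T 0))\<^sup>2 + (Im (poly T w - poly T 0))\<^sup>2"
          by (simp add: \<nu> cmod_power2)
        ultimately show "t\<^sup>2 * N\<^sup>2 / 2 - ((Re (poly T w - poly T 0))\<^sup>2 + (Im (poly T w - poly T 0))\<^sup>2) \<le> (norm (F w - F 0))\<^sup>2"
          by (simp add: power_mult_distrib)
      qed (auto intro!: continuous_intros simp: Fw)
      also have "cavg (\<lambda>w. t\<^sup>2 * N\<^sup>2 / 2 - ((Re (poly T w - poly T 0))\<^sup>2 + (Im (poly T w - poly T 0))\<^sup>2)) = t\<^sup>2 * N\<^sup>2 / 2 - (J + J)"
      proof -
        have c1: "continuous_on (sphere 0 1) (\<lambda>w. (Re (poly T w - poly T 0))\<^sup>2)"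
          and c2: "continuous_on (sphere 0 1) (\<lambda>w. (Im (poly T w - poly T 0))\<^sup>2)" by (intro continuous_intros)+
        have "cavg (\<lambda>w. (Im (poly T w - poly T 0))\<^sup>2) = J" unfolding ImT0 J_def ..
        then show ?thesis
          using cavg_diff[OF continuous_on_const[of _ "t\<^sup>2 * N\<^sup>2 / 2"] continuous_on_add[OF c1 c2]]
          unfolding cavg_add[OF c1 c2] J1 by simp
      qed
      finally show ?thesis by simp
    qed
    \<comment> \<open>The choice \<open>s = s0 + Im (poly T w)\<close> in the supremum puts the
      argument on the disc \<open>F\<close>, up to \<open>t ^ 3\<close>. Its cost expands into a
      constant, a linear term with mean zero because \<open>poly T 0\<close> is real, and \<kappa>
      times \<open>J\<close>.\<close>
    have qavg: "cavg (\<lambda>w. q (?z w)) \<ge> cavg (\<lambda>w. \<phi> (F w)) - \<Lambda> * t ^ 3 - \<kappa> * s0\<^sup>2 - \<kappa> * J"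
    proof -
      have cq: "continuous_on (sphere 0 1) (\<lambda>w. q (?z w))"
        by (rule continuous_on_compose2[OF qc]) (use zb in \<open>auto intro!: continuous_intros\<close>)
      have cF1: "continuous_on (sphere 0 1) (\<lambda>w. \<phi> (F w))" by (rule continuous_on_subset[OF cF\<phi>]) auto
      have cI: "continuous_on (sphere 0 1) (\<lambda>w. Im (poly T w))" by (intro continuous_intros)
      have "cavg (\<lambda>w. \<phi> (F w) - (\<Lambda> * t ^ 3 + \<kappa> * s0\<^sup>2 + (2 * \<kappa> * s0) * Im (poly T w) + \<kappa> * (Im (poly T w))\<^sup>2)) \<le> cavg (\<lambda>w. q (?z w))"
      proof (rule cavg_mono[OF _ cq])
        fix w :: complex assume w: "cmod w = 1"
        let ?s = "s0 + Im (poly T w)"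
        let ?x = "?z w + cscale (Complex (\<tau>0 - E (?z w)) ?s) \<nu>"
        have sX: "\<bar>?s\<bar> \<le> X" using ImT[OF w] q0(2) t(6) by linarith
        have "?x - x0 = cscale (of_real t * w) Y + cscale (Complex (- \<Delta> w) (Im (poly T w))) \<nu>"
          unfolding x0_def cx \<Delta>_def E0_def
          by (simp add: cscale_add_left cscale_diff_left cscale_minus_left algebra_simps)
        then have "norm (?x - x0) \<le> t * N + norm (cscale (Complex (- \<Delta> w) (Im (poly T w))) \<nu>)"
          using norm_triangle_ineq[of "cscale (of_real t * w) Y"] nz[OF w] by metis
        also have "norm (cscale (Complex (- \<Delta> w) (Im (poly T w))) \<nu>) \<le> \<bar>\<Delta> w\<bar> + \<bar>Im (poly T w)\<bar>"
          using cmod_le[of "Complex (- \<Delta> w) (Im (poly T w))"] \<nu> by simp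
        finally have xb: "?x \<in> ball x0 \<eta>"
          using \<Delta>[OF w] ImT[OF w] t(4) by (simp add: dist_norm norm_minus_commute)
        have "F w - ?x = cscale (of_real (Re (poly T w) - b w)) \<nu>"
        proof -
          have "poly T w + \<i> * of_real s0 - Complex (\<tau>0 - E (?z w)) ?s = of_real (Re (poly T w) - b w)"
            by (simp add: complex_eq_iff b_def)
          then show ?thesis unfolding Fw by (simp add: cscale_diff_left[symmetric])
        qed
        then have "norm (F w - ?x) \<le> t ^ 3" using T(1)[OF w] \<nu> by (simp only: norm_cscale norm_of_real mult_1_right)
        then have "\<Lambda> * norm (F w - ?x) \<le> \<Lambda> * t ^ 3" using nn by (intro mult_left_mono) auto
        moreover have "\<bar>\<phi> (F w) - \<phi> ?x\<bar> \<le> \<Lambda> * norm (F w - ?x)"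
          by (rule \<eta>(3)[OF Fball xb]) (use w in simp)
        moreover have "\<phi> ?x - \<kappa> * ?s\<^sup>2 \<le> q (?z w)" by (rule qge[OF zb[OF w] sX])
        moreover have "\<kappa> * ?s\<^sup>2 = \<kappa> * s0\<^sup>2 + (2 * \<kappa> * s0) * Im (poly T w) + \<kappa> * (Im (poly T w))\<^sup>2"
          by (simp add: power2_eq_square algebra_simps)
        ultimately show "\<phi> (F w) - (\<Lambda> * t ^ 3 + \<kappa> * s0\<^sup>2 + (2 * \<kappa> * s0) * Im (poly T w) + \<kappa> * (Im (poly T w))\<^sup>2) \<le> q (?z w)"
          by linarith
      qed (intro continuous_intros cF1)
      also have "cavg (\<lambda>w. \<phi> (F w) - (\<Lambda> * t ^ 3 + \<kappa> * s0\<^sup>2 + (2 * \<kappa> * s0) * Im (poly T w) + \<kappa> * (Im (poly T w))\<^sup>2))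
        = cavg (\<lambda>w. \<phi> (F w)) - (\<Lambda> * t ^ 3 + \<kappa> * s0\<^sup>2 + (2 * \<kappa> * s0) * cavg (\<lambda>w. Im (poly T w)) + \<kappa> * J)"
        unfolding J_def
        by (subst cavg_diff[OF cF1], (intro continuous_intros)+, subst cavg_add, (intro continuous_intros)+,
            subst cavg_add, (intro continuous_intros)+, simp only: cavg_cmult cavg_const)
      also have "cavg (\<lambda>w. Im (poly T w)) = 0"
        using cavg_Re_poly[of "smult (- \<i>) T"] by (simp add: T(2))
      finally show ?thesis by simp
    qed
    \<comment> \<open>The centre of the disc misses \<open>x0\<close> by the mean of \<Delta>, which
      is estimated below in terms of \<open>P\<close> and \<open>V2\<close>.\<close>
    have \<phi>0: "\<phi> (F 0) \<ge> \<phi> x0 - \<Lambda> * \<bar>m\<Delta>\<bar>"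
    proof -
      have "F 0 - x0 = cscale (of_real (- m\<Delta>)) \<nu>" unfolding Fx0 T(2) bavg by simp
      then have "norm (F 0 - x0) = \<bar>m\<Delta>\<bar>" using \<nu> by (simp only: norm_cscale norm_of_real abs_minus_cancel mult_1_right)
      moreover have "\<bar>\<phi> (F 0) - \<phi> x0\<bar> \<le> \<Lambda> * norm (F 0 - x0)" by (rule \<eta>(3)[OF Fball]) (use \<eta> in auto)
      ultimately show ?thesis by simp
    qed
    \<comment> \<open>The surplus in Oka's inequality. It controls the mean of \<Delta>:
      \<open>ln (1 + x) \<le> x\<close> gives \<open>- P \<le> m\<Delta> / E0\<close>, and the
      second order bound for \<open>ln\<close> gives the other side.\<close>
    define P where "P = - cavg (\<lambda>w. ln (1 + \<Delta> w / E0))"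
    have xs: "\<bar>\<Delta> w / E0\<bar> \<le> 1 / 8" if "cmod w = 1" for w
      using \<Delta>[OF that] t(5) E0 by (simp add: field_simps)
    have x1: "1 + \<Delta> w / E0 > 0" if "cmod w = 1" for w using xs[OF that] by linarith
    have Ez: "E (?z w) = E0 * (1 + \<Delta> w / E0)" for w using E0 by (simp add: \<Delta>_def field_simps)
    have cl: "continuous_on (sphere 0 1) (\<lambda>w. ln (1 + \<Delta> w / E0))"
    proof (intro continuous_intros c\<Delta> ballI)
      show "E0 \<noteq> 0" using E0 by simp
      show "1 + \<Delta> w / E0 \<noteq> 0" if "w \<in> sphere 0 1" for w using x1[of w] that by simp
    qed
    have P0: "P \<ge> 0"
    proof -
      have "norm (t *\<^sub>R Y) < \<rho>" using t by (simp add: N_def)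
      from oka[OF this] have "- ln E0 \<le> cavg (\<lambda>w. - ln (E (?z w)))" by (simp add: E0_def cscale_of_real_mult)
      also have "\<dots> = cavg (\<lambda>w. - ln E0 - ln (1 + \<Delta> w / E0))"
      proof (rule cavg_cong)
        fix w :: complex assume w: "cmod w = 1"
        have "ln (E0 * (1 + \<Delta> w / E0)) = ln E0 + ln (1 + \<Delta> w / E0)"
          by (rule ln_mult_pos[OF E0 x1[OF w]])
        then show "- ln (E (?z w)) = - ln E0 - ln (1 + \<Delta> w / E0)" unfolding Ez by linarith
      qed
      also have "\<dots> = - ln E0 + P" using cavg_diff[OF continuous_on_const cl] by (simp add: P_def)
      finally show ?thesis by simp
    qed
    have cx2: "continuous_on (sphere 0 1) (\<lambda>w. (\<Delta> w / E0)\<^sup>2)" "continuous_on (sphere 0 1) (\<lambda>w. \<Delta> w / E0)"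
      using E0 by (auto intro!: continuous_intros c\<Delta>)
    have ax: "cavg (\<lambda>w. \<Delta> w / E0) = m\<Delta> / E0" "cavg (\<lambda>w. (\<Delta> w / E0)\<^sup>2) = V2 / E0\<^sup>2"
      using cavg_cmult[of "1 / E0" \<Delta>] cavg_cmult[of "1 / E0\<^sup>2" "\<lambda>w. (\<Delta> w)\<^sup>2"] by (simp_all add: m\<Delta>_def V2_def power_divide)
    have mD: "\<bar>m\<Delta>\<bar> \<le> E0 * P + 2 * V2 / E0"
    proof -
      have "cavg (\<lambda>w. ln (1 + \<Delta> w / E0)) \<le> cavg (\<lambda>w. \<Delta> w / E0)"
      proof (rule cavg_mono[OF cl cx2(2)])
        fix w :: complex assume "cmod w = 1"
        from x1[OF this] show "ln (1 + \<Delta> w / E0) \<le> \<Delta> w / E0" using ln_le_minus_one[of "1 + \<Delta> w / E0"] by simp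
      qed
      then have l: "- P \<le> m\<Delta> / E0" unfolding ax P_def by simp
      have "cavg (\<lambda>w. \<Delta> w / E0 - 2 * (\<Delta> w / E0)\<^sup>2) \<le> cavg (\<lambda>w. ln (1 + \<Delta> w / E0))"
      proof (rule cavg_mono[OF _ cl])
        fix w :: complex assume "cmod w = 1"
        from xs[OF this] have "\<bar>\<Delta> w / E0\<bar> \<le> 1/2" by linarith
        from abs_ln_one_plus_x_minus_x_bound[OF this] show "\<Delta> w / E0 - 2 * (\<Delta> w / E0)\<^sup>2 \<le> ln (1 + \<Delta> w / E0)" by linarith
      qed (intro continuous_intros cx2)
      also have "cavg (\<lambda>w. \<Delta> w / E0 - 2 * (\<Delta> w / E0)\<^sup>2) = m\<Delta> / E0 - 2 * (V2 / E0\<^sup>2)"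
        using cavg_diff[OF cx2(2) continuous_on_mult_left[OF cx2(1)], of 2] unfolding cavg_cmult ax .
      finally have u: "m\<Delta> / E0 - 2 * (V2 / E0\<^sup>2) \<le> - P" by (simp add: P_def)
      have "V2 \<ge> 0" unfolding V2_def using cavg_mono[of "\<lambda>_. 0" "\<lambda>w. (\<Delta> w)\<^sup>2"] by (auto intro!: continuous_intros c\<Delta>)
      then have "0 \<le> V2 / E0\<^sup>2" by simp
      then have "\<bar>m\<Delta> / E0\<bar> \<le> P + 2 * (V2 / E0\<^sup>2)" using l u P0 unfolding abs_le_iff by linarith
      then have "E0 * \<bar>m\<Delta> / E0\<bar> \<le> E0 * (P + 2 * (V2 / E0\<^sup>2))" using E0 by (intro mult_left_mono) auto
      then show ?thesis using E0 by (simp add: distrib_left power2_eq_square)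
    qed
    have Bavg: "cavg (\<lambda>w. B / E (?z w)) \<ge> B / E0 * (1 + P + V2 / (4 * E0\<^sup>2))"
    proof -
      have cB: "continuous_on (sphere 0 1) (\<lambda>w. B / E (?z w))"
      proof (intro continuous_intros continuous_on_compose2[OF cE[of UNIV]] subset_UNIV ballI)
        show "E (?z w) \<noteq> 0" if "w \<in> sphere 0 1" for w unfolding Ez using x1[of w] that E0 by simp
      qed
      have "cavg (\<lambda>w. B / E0 * ((1 - ln (1 + \<Delta> w / E0)) + (1/4) * (\<Delta> w / E0)\<^sup>2)) \<le> cavg (\<lambda>w. B / E (?z w))"
      proof (rule cavg_mono[OF _ cB])
        fix w :: complex assume w: "cmod w = 1"
        have "1 - ln (1 + \<Delta> w / E0) + (\<Delta> w / E0)\<^sup>2 / 4 \<le> 1 / (1 + \<Delta> w / E0)"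
          by (rule inverse_ge_one_minus_ln) (use xs[OF w] in linarith)
        then have "B / E0 * (1 - ln (1 + \<Delta> w / E0) + (\<Delta> w / E0)\<^sup>2 / 4) \<le> B / E0 * (1 / (1 + \<Delta> w / E0))"
          using nn E0 by (intro mult_left_mono) auto
        then show "B / E0 * ((1 - ln (1 + \<Delta> w / E0)) + (1/4) * (\<Delta> w / E0)\<^sup>2) \<le> B / E (?z w)" by (simp add: Ez)
      qed (intro continuous_intros cx2 cl)
      also have "cavg (\<lambda>w. B / E0 * ((1 - ln (1 + \<Delta> w / E0)) + (1/4) * (\<Delta> w / E0)\<^sup>2)) = B / E0 * ((1 + P) + (1/4) * (V2 / E0\<^sup>2))"
        unfolding cavg_cmult cavg_add[OF continuous_on_diff[OF continuous_on_const cl] continuous_on_mult_left[OF cx2(1)]]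
          cavg_diff[OF continuous_on_const cl] ax by (simp add: P_def)
      finally show ?thesis by simp
    qed
    have V20: "V2 \<ge> 0" unfolding V2_def using cavg_mono[of "\<lambda>_. 0" "\<lambda>w. (\<Delta> w)\<^sup>2"] by (auto intro!: continuous_intros c\<Delta>)
    have tot: "cavg (\<lambda>v. q (?z v) + B / E (?z v)) = cavg (\<lambda>w. q (?z w)) + cavg (\<lambda>w. B / E (?z w))"
    proof (rule cavg_add)
      show "continuous_on (sphere 0 1) (\<lambda>w. q (?z w))"
        by (rule continuous_on_compose2[OF qc]) (use zb in \<open>auto intro!: continuous_intros\<close>)
      show "continuous_on (sphere 0 1) (\<lambda>w. B / E (?z w))"
      proof (intro continuous_intros continuous_on_compose2[OF cE[of UNIV]] subset_UNIV ballI)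
        show "E (?z w) \<noteq> 0" if "w \<in> sphere 0 1" for w unfolding Ez using x1[of w] that E0 by simp
      qed
    qed
    \<comment> \<open>Balance: \<open>cond1\<close> covers the terms in \<open>P\<close>,
      \<open>cond2\<close> those in \<open>V2\<close>, and the higher powers of \<open>t\<close> go
      into \<epsilon>.\<close>
    have A1: "c * cavg (\<lambda>w. (norm (F w - F 0))\<^sup>2) \<ge> c * (t\<^sup>2 * N\<^sup>2 / 2 - 2 * J)" using FF nn by (intro mult_left_mono) auto
    have A2: "\<Lambda> * \<bar>m\<Delta>\<bar> \<le> \<Lambda> * (E0 * P + 2 * V2 / E0)" using mD nn by (intro mult_left_mono) auto
    have A3: "(2 * c + \<kappa>) * J \<le> (2 * c + \<kappa>) * (V2 + t ^ 4 * (4 * N + 1))" using J nn by (intro mult_left_mono) auto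
    have A4: "\<Lambda> * E0 * P \<le> B / E0 * P" using cond1 P0 unfolding E0_def by (intro mult_right_mono) auto
    have A5: "(2 * c + \<kappa> + 2 * \<Lambda> / E0) * V2 \<le> B / (4 * E0 ^ 3) * V2" using cond2 V20 unfolding E0_def by (intro mult_right_mono) auto
    have A6: "B / E0 * (V2 / (4 * E0\<^sup>2)) = B / (4 * E0 ^ 3) * V2" by (simp add: power2_eq_square power3_eq_cube)
    have A7: "\<Lambda> * t ^ 3 + (2 * c + \<kappa>) * (t ^ 4 * (4 * N + 1)) \<le> \<epsilon> * t\<^sup>2"
    proof -
      have "t ^ 4 \<le> t ^ 3" using t by (intro power_decreasing) auto
      then have "(2 * c + \<kappa>) * (t ^ 4 * (4 * N + 1)) \<le> (2 * c + \<kappa>) * (t ^ 3 * (4 * N + 1))"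
        using nn N0 by (intro mult_left_mono mult_right_mono) auto
      then have "\<Lambda> * t ^ 3 + (2 * c + \<kappa>) * (t ^ 4 * (4 * N + 1)) \<le> t\<^sup>2 * (t * err)"
        by (simp add: err_def power2_eq_square power3_eq_cube algebra_simps)
      also have "\<dots> \<le> t\<^sup>2 * \<epsilon>" using t(7) by (intro mult_left_mono) auto
      finally show ?thesis by (simp add: mult.commute)
    qed
    have "cavg (\<lambda>v. q (?z v) + B / E (?z v)) \<ge> \<phi> x0 - \<Lambda> * \<bar>m\<Delta>\<bar> + c * (t\<^sup>2 * N\<^sup>2 / 2 - 2 * J) - \<Lambda> * t ^ 3 - \<kappa> * s0\<^sup>2 - \<kappa> * J
       + B / E0 * (1 + P + V2 / (4 * E0\<^sup>2))"
      unfolding tot using sub qavg \<phi>0 A1 Bavg by linarith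
    moreover have "\<phi> x0 - \<Lambda> * \<bar>m\<Delta>\<bar> + c * (t\<^sup>2 * N\<^sup>2 / 2 - 2 * J) - \<Lambda> * t ^ 3 - \<kappa> * s0\<^sup>2 - \<kappa> * J
       + B / E0 * (1 + P + V2 / (4 * E0\<^sup>2)) = (\<phi> x0 - \<kappa> * s0\<^sup>2 + B / E0) + c / 2 * N\<^sup>2 * t\<^sup>2 - \<Lambda> * \<bar>m\<Delta>\<bar>
       - (2 * c + \<kappa>) * J - \<Lambda> * t ^ 3 + B / E0 * P + B / E0 * (V2 / (4 * E0\<^sup>2))"
      by (simp add: algebra_simps)
    moreover have "\<Lambda> * (E0 * P + 2 * V2 / E0) = \<Lambda> * E0 * P + 2 * \<Lambda> / E0 * V2" by (simp add: algebra_simps)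
    moreover have "(2 * c + \<kappa>) * (V2 + t ^ 4 * (4 * N + 1)) = (2 * c + \<kappa>) * V2 + (2 * c + \<kappa>) * (t ^ 4 * (4 * N + 1))"
      by (simp add: distrib_left)
    moreover have "(2 * c + \<kappa> + 2 * \<Lambda> / E0) * V2 = (2 * c + \<kappa>) * V2 + 2 * \<Lambda> / E0 * V2" by (simp add: distrib_right)
    moreover have "q z0 = \<phi> x0 - \<kappa> * s0\<^sup>2" by (simp add: q0(1) x0_def)
    moreover have "(c / 2 * (norm Y)\<^sup>2 - \<epsilon>) * t\<^sup>2 = c / 2 * N\<^sup>2 * t\<^sup>2 - \<epsilon> * t\<^sup>2" by (simp add: N_def left_diff_distrib)
    ultimately show ?case
      using A2 A3 A4 A5 A6 A7 unfolding E0_def[symmetric] by linarith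
  qed
qed

section \<open>Domains with C2 boundary\<close>

definition grad :: "('a::euclidean_space \<Rightarrow> real) \<Rightarrow> 'a \<Rightarrow> 'a" where
  "grad r z = (\<Sum>b\<in>Basis. dirder UNIV r [b] z *\<^sub>R b)"

lemma inner_grad:
  fixes r :: "'a::euclidean_space \<Rightarrow> real"
  assumes "Ck_on 2 UNIV r"
  shows "grad r z \<bullet> v = dirder UNIV r [v] z"
proof -
  have lin: "linear (\<lambda>v. dirder UNIV r [v] z)"
    by (rule has_derivative_linear[OF Ck2_dirder(1)[OF open_UNIV assms UNIV_I]])
  have "dirder UNIV r [\<Sum>b\<in>Basis. (v \<bullet> b) *\<^sub>R b] z = (\<Sum>b\<in>Basis. (v \<bullet> b) *\<^sub>R dirder UNIV r [b] z)"
    using linear_sum[OF lin, of "\<lambda>b. (v \<bullet> b) *\<^sub>R b" Basis] linear_scale[OF lin] by (simp del: dirder.simps)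
  then have "dirder UNIV r [v] z = (\<Sum>b\<in>Basis. (v \<bullet> b) *\<^sub>R dirder UNIV r [b] z)"
    by (simp only: euclidean_representation)
  moreover have "grad r z \<bullet> v = (\<Sum>b\<in>Basis. dirder UNIV r [b] z * (b \<bullet> v))"
    by (simp only: grad_def inner_sum_left inner_scaleR_left)
  ultimately show ?thesis by (simp only: real_scaleR_def inner_commute[of _ v] mult.commute)
qed

text \<open>Uniform constants on a ball, whose convexity allows the mean value inequality along
  segments. Besides continuity of \<open>r\<close>, these estimates carry all the smoothness of the
  boundary into the construction.\<close>

lemma grad_bounds:
  fixes r :: "'a::euclidean_space \<Rightarrow> real"
  assumes r: "Ck_on 2 UNIV r"
  obtains C where "C \<ge> 1"
    "\<And>x y. x \<in> cball 0 R \<Longrightarrow> y \<in> cball 0 R \<Longrightarrow> norm (grad r x - grad r y) \<le> C * norm (x - y)"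
    "\<And>x y. x \<in> cball 0 R \<Longrightarrow> y \<in> cball 0 R \<Longrightarrow> \<bar>r x - r y - grad r y \<bullet> (x - y)\<bar> \<le> C * (norm (x - y))\<^sup>2"
    "\<And>x. x \<in> cball 0 R \<Longrightarrow> norm (grad r x) \<le> C"
proof -
  note d = Ck2_dirder[OF open_UNIV r UNIV_I]
  have bnd: "\<exists>M\<ge>0. \<forall>x\<in>cball 0 R. \<bar>g x\<bar> \<le> M" if "continuous_on UNIV g" for g :: "'a \<Rightarrow> real"
  proof -
    have "bounded (g ` cball 0 R)"
      by (intro compact_imp_bounded compact_continuous_image continuous_on_subset[OF that]) auto
    then show ?thesis unfolding bounded_pos by (metis image_eqI less_imp_le real_norm_def)
  qed
  have "continuous_on UNIV (\<lambda>x. \<Sum>b'\<in>Basis. \<Sum>b\<in>Basis. \<bar>dirder UNIV r [b, b'] x\<bar>)"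
    by (intro continuous_intros Ck2_dirder(3)[OF open_UNIV r UNIV_I])
  from bnd[OF this] obtain M where M: "M \<ge> 0" "\<And>x. x \<in> cball 0 R \<Longrightarrow> (\<Sum>b'\<in>Basis. \<Sum>b\<in>Basis. \<bar>dirder UNIV r [b, b'] x\<bar>) \<le> M"
    by (meson abs_ge_self order_trans)
  have "continuous_on UNIV (\<lambda>x. norm (grad r x))"
    unfolding grad_def by (intro continuous_intros Ck2_dirder_continuous(1)[OF open_UNIV r])
  from bnd[OF this] obtain M2 where M2: "M2 \<ge> 0" "\<And>x. x \<in> cball 0 R \<Longrightarrow> norm (grad r x) \<le> M2" by auto
  define M1 where "M1 = real DIM('a) * M"
  have M1: "M1 \<ge> 0" using M by (simp add: M1_def)
  have G1: "norm (grad r x - grad r y) \<le> M1 * norm (x - y)" if xy: "x \<in> cball 0 R" "y \<in> cball 0 R" for x y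
  proof -
    have b: "\<bar>dirder UNIV r [b'] x - dirder UNIV r [b'] y\<bar> \<le> M * norm (x - y)" if b': "b' \<in> Basis" for b'
    proof -
      have "norm (dirder UNIV r [b'] x - dirder UNIV r [b'] y) \<le> M * norm (x - y)"
      proof (rule differentiable_bound[where f' = "\<lambda>w v. dirder UNIV r [v, b'] w", OF convex_cball _ _ xy])
        fix w :: 'a assume w: "w \<in> cball 0 R"
        show "(dirder UNIV r [b'] has_derivative (\<lambda>v. dirder UNIV r [v, b'] w)) (at w within cball 0 R)"
          by (rule has_derivative_at_withinI[OF d(2)])
        have lin: "linear (\<lambda>v. dirder UNIV r [v, b'] w)" by (rule has_derivative_linear[OF d(2)])
        show "onorm (\<lambda>v. dirder UNIV r [v, b'] w) \<le> M"
        proof (rule onorm_le)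
          fix v :: 'a
          have "dirder UNIV r [v, b'] w = dirder UNIV r [\<Sum>b\<in>Basis. (v \<bullet> b) *\<^sub>R b, b'] w" by (simp add: euclidean_representation)
          also have "\<dots> = (\<Sum>b\<in>Basis. (v \<bullet> b) * dirder UNIV r [b, b'] w)"
            using linear_sum[OF lin, of "\<lambda>b. (v \<bullet> b) *\<^sub>R b" Basis] linear_scale[OF lin] by (simp del: dirder.simps)
          also have "norm \<dots> \<le> (\<Sum>b\<in>Basis. norm v * \<bar>dirder UNIV r [b, b'] w\<bar>)"
            by (rule sum_norm_le) (auto simp: abs_mult simp del: dirder.simps intro!: mult_right_mono Basis_le_norm)
          also have "\<dots> = norm v * (\<Sum>b\<in>Basis. \<bar>dirder UNIV r [b, b'] w\<bar>)" by (simp only: sum_distrib_left)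
          also have "\<dots> \<le> norm v * M"
          proof (rule mult_left_mono)
            have "(\<Sum>b\<in>Basis. \<bar>dirder UNIV r [b, b'] w\<bar>) \<le> (\<Sum>b'\<in>Basis. \<Sum>b\<in>Basis. \<bar>dirder UNIV r [b, b'] w\<bar>)"
              using member_le_sum[OF b', of "\<lambda>b'. \<Sum>b\<in>Basis. \<bar>dirder UNIV r [b, b'] w\<bar>"] by (simp add: sum_nonneg del: dirder.simps)
            also have "\<dots> \<le> M" by (rule M(2)[OF w])
            finally show "(\<Sum>b\<in>Basis. \<bar>dirder UNIV r [b, b'] w\<bar>) \<le> M" .
          qed simp
          finally show "norm (dirder UNIV r [v, b'] w) \<le> M * norm v" by (simp only: mult.commute[of M])
        qed
      qed
      then show ?thesis by (simp del: dirder.simps)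
    qed
    have "grad r x - grad r y = (\<Sum>b\<in>Basis. (dirder UNIV r [b] x - dirder UNIV r [b] y) *\<^sub>R b)"
      by (simp add: grad_def sum_subtractf scaleR_diff_left del: dirder.simps)
    also have "norm \<dots> \<le> (\<Sum>b\<in>(Basis::'a set). M * norm (x - y))"
      by (rule sum_norm_le) (use b in \<open>simp del: dirder.simps\<close>)
    also have "\<dots> = M1 * norm (x - y)" by (simp add: M1_def)
    finally show ?thesis .
  qed
  have G2: "\<bar>r x - r y - grad r y \<bullet> (x - y)\<bar> \<le> M1 * (norm (x - y))\<^sup>2" if xy: "x \<in> cball 0 R" "y \<in> cball 0 R" for x y
  proof -
    have seg: "closed_segment y x \<subseteq> cball 0 R" using xy by (simp add: closed_segment_subset)
    have "norm ((r x - grad r y \<bullet> x) - (r y - grad r y \<bullet> y)) \<le> (M1 * norm (x - y)) * norm (x - y)"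
    proof (rule differentiable_bound[where f' = "\<lambda>w v. dirder UNIV r [v] w - grad r y \<bullet> v", OF convex_closed_segment[of y x]])
      fix w assume w: "w \<in> closed_segment y x"
      show "((\<lambda>x. r x - grad r y \<bullet> x) has_derivative (\<lambda>v. dirder UNIV r [v] w - grad r y \<bullet> v)) (at w within closed_segment y x)"
        by (intro has_derivative_diff has_derivative_at_withinI[OF d(1)] has_derivative_inner_right has_derivative_ident)
      show "onorm (\<lambda>v. dirder UNIV r [v] w - grad r y \<bullet> v) \<le> M1 * norm (x - y)"
      proof (rule onorm_le)
        fix v
        have "dirder UNIV r [v] w - grad r y \<bullet> v = (grad r w - grad r y) \<bullet> v"
          by (simp only: inner_grad[OF r, symmetric] inner_diff_left)
        also have "norm \<dots> \<le> norm (grad r w - grad r y) * norm v"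
          using Cauchy_Schwarz_ineq2 by simp
        also have "\<dots> \<le> (M1 * norm (x - y)) * norm v"
        proof (rule mult_right_mono)
          have "norm (grad r w - grad r y) \<le> M1 * norm (w - y)" using G1[of w y] w seg xy by blast
          also have "\<dots> \<le> M1 * norm (x - y)"
            using segment_bound(1)[OF w] M1 by (intro mult_left_mono) auto
          finally show "norm (grad r w - grad r y) \<le> M1 * norm (x - y)" .
        qed simp
        finally show "norm (dirder UNIV r [v] w - grad r y \<bullet> v) \<le> M1 * norm (x - y) * norm v" .
      qed
    qed auto
    then show ?thesis by (simp add: inner_diff_right power2_eq_square algebra_simps)
  qed
  show ?thesis
  proof (rule that[of "M1 + M2 + 1"])
    show "M1 + M2 + 1 \<ge> 1" using M1 M2 by simp
    fix x y :: 'a assume xy: "x \<in> cball 0 R" "y \<in> cball 0 R"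
    have le: "M1 * s \<le> (M1 + M2 + 1) * s" if "s \<ge> 0" for s using that M2 by (intro mult_right_mono) auto
    show "norm (grad r x - grad r y) \<le> (M1 + M2 + 1) * norm (x - y)" using order_trans[OF G1[OF xy] le] by simp
    show "\<bar>r x - r y - grad r y \<bullet> (x - y)\<bar> \<le> (M1 + M2 + 1) * (norm (x - y))\<^sup>2" using order_trans[OF G2[OF xy] le] by simp
  next
    fix x :: 'a assume "x \<in> cball 0 R"
    from M2(2)[OF this] M1 show "norm (grad r x) \<le> M1 + M2 + 1" by linarith
  qed
qed

lemma norm_normalize_diff:
  fixes x y :: "'a::real_inner"
  assumes "x \<noteq> 0" "y \<noteq> 0"
  shows "norm (x /\<^sub>R norm x - y /\<^sub>R norm y) \<le> 2 * norm (x - y) / norm y"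
proof -
  have "x /\<^sub>R norm x - y /\<^sub>R norm y = (1 / norm y) *\<^sub>R ((x - y) + (norm y - norm x) *\<^sub>R (x /\<^sub>R norm x))"
    using assms by (simp add: algebra_simps divide_inverse)
  also have "norm \<dots> = (1 / norm y) * norm ((x - y) + (norm y - norm x) *\<^sub>R (x /\<^sub>R norm x))" by simp
  also have "\<dots> \<le> (1 / norm y) * (norm (x - y) + \<bar>norm y - norm x\<bar>)"
  proof (rule mult_left_mono)
    have "norm ((norm y - norm x) *\<^sub>R (x /\<^sub>R norm x)) = \<bar>norm y - norm x\<bar>" using assms by (simp add: abs_mult)
    then show "norm ((x - y) + (norm y - norm x) *\<^sub>R (x /\<^sub>R norm x)) \<le> norm (x - y) + \<bar>norm y - norm x\<bar>"
      by (metis norm_triangle_ineq)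
  qed simp
  also have "\<dots> \<le> (1 / norm y) * (2 * norm (x - y))"
    using norm_triangle_ineq3[of x y] by (intro mult_left_mono) auto
  finally show ?thesis by simp
qed

text \<open>\<open>G\<close> is the gradient of \<open>r\<close> in the application. The radius 4 in
  \<open>near\<close> leaves room for every translate of a point of \<Omega> that the construction
  visits, so that the Taylor estimates hold there.\<close>

locale c2_domain =
  fixes \<Omega> :: "(complex^'n) set" and r :: "complex^'n \<Rightarrow> real" and G :: "complex^'n \<Rightarrow> complex^'n"
    and C g0 R :: real
  assumes \<Omega>: "\<Omega> = {z. r z < 0}" "open \<Omega>" "- \<Omega> \<noteq> {}" and psc: "pseudoconvex \<Omega>"
    and near: "\<And>z x. z \<in> \<Omega> \<Longrightarrow> dist z x \<le> 4 \<Longrightarrow> x \<in> cball 0 R"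
    and C: "C \<ge> 1" and g0: "0 < g0" "g0 \<le> 1"
    and G1: "\<And>x y. x \<in> cball 0 R \<Longrightarrow> y \<in> cball 0 R \<Longrightarrow> norm (G x - G y) \<le> C * norm (x - y)"
    and G2: "\<And>x y. x \<in> cball 0 R \<Longrightarrow> y \<in> cball 0 R \<Longrightarrow> \<bar>r x - r y - G y \<bullet> (x - y)\<bar> \<le> C * (norm (x - y))\<^sup>2"
    and G3: "\<And>x. x \<in> cball 0 R \<Longrightarrow> norm (G x) \<le> C"
    and G4: "\<And>p. p \<in> frontier \<Omega> \<Longrightarrow> g0 \<le> norm (G p)"
    and r0: "\<And>p. p \<in> frontier \<Omega> \<Longrightarrow> r p = 0"
begin

abbreviation d :: "complex^'n \<Rightarrow> real" where "d z \<equiv> infdist z (- \<Omega>)"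

definition \<nu> :: "complex^'n \<Rightarrow> complex^'n" where "\<nu> p = - (G p /\<^sub>R norm (G p))"

lemma norm_\<nu>: "p \<in> frontier \<Omega> \<Longrightarrow> norm (\<nu> p) = 1"
proof -
  assume "p \<in> frontier \<Omega>"
  then have "norm (G p) > 0" using G4[of p] g0 by linarith
  then show ?thesis by (simp add: \<nu>_def)
qed

lemma d_lipschitz: "\<bar>d x - d y\<bar> \<le> norm (x - y)"
  using infdist_triangle[of x "- \<Omega>" y] infdist_triangle[of y "- \<Omega>" x]
  by (simp add: dist_norm norm_minus_commute abs_le_iff)

lemma d_pos: "z \<in> \<Omega> \<Longrightarrow> 0 < d z"
  by (rule infdist_complement_pos[OF \<Omega>(2,3)])

text \<open>Near \<open>p\<close> the derivative of \<open>r\<close> along \<open>\<nu> p\<close> is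
  at most \<open>- g0 + C * L\<close>, and the Taylor remainder adds at most \<open>C * L\<close>
  per unit length; \<open>2 * C * L \<le> g0\<close> then keeps \<open>r\<close> from
  growing.\<close>

lemma inward:
  assumes p: "p \<in> frontier \<Omega>" and z: "z \<in> \<Omega>" "norm (z - p) \<le> L" and h: "0 \<le> h" "h \<le> L" and L: "L \<le> 1" "2 * C * L \<le> g0"
  shows "z + h *\<^sub>R \<nu> p \<in> \<Omega>"
proof -
  have n: "norm (\<nu> p) = 1" by (rule norm_\<nu>[OF p])
  have zc: "z \<in> cball 0 R" using near[OF z(1), of z] by simp
  have pc: "p \<in> cball 0 R" using near[OF z(1), of p] z(2) L by (simp add: dist_norm)
  have xc: "z + h *\<^sub>R \<nu> p \<in> cball 0 R" using near[OF z(1), of "z + h *\<^sub>R \<nu> p"] h L n by (simp add: dist_norm)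
  have "\<bar>r (z + h *\<^sub>R \<nu> p) - r z - G z \<bullet> (z + h *\<^sub>R \<nu> p - z)\<bar> \<le> C * (norm (z + h *\<^sub>R \<nu> p - z))\<^sup>2"
    by (rule G2[OF xc zc])
  then have 1: "r (z + h *\<^sub>R \<nu> p) \<le> r z + h * (G z \<bullet> \<nu> p) + C * h\<^sup>2" using n by simp
  have "G z \<bullet> \<nu> p = G p \<bullet> \<nu> p + (G z - G p) \<bullet> \<nu> p" by (simp add: inner_diff_left)
  moreover have "G p \<bullet> \<nu> p = - norm (G p)"
  proof -
    have "norm (G p) > 0" using G4[OF p] g0 by linarith
    then show ?thesis by (simp add: \<nu>_def dot_square_norm power2_eq_square)
  qed
  moreover have "(G z - G p) \<bullet> \<nu> p \<le> C * L"
  proof -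
    have "(G z - G p) \<bullet> \<nu> p \<le> norm (G z - G p) * norm (\<nu> p)" by (rule norm_cauchy_schwarz)
    also have "\<dots> \<le> C * norm (z - p)" using G1[OF zc pc] n by simp
    also have "\<dots> \<le> C * L" using z(2) C by (intro mult_left_mono) auto
    finally show ?thesis .
  qed
  ultimately have "G z \<bullet> \<nu> p \<le> - g0 + C * L" using G4[OF p] by linarith
  then have "h * (G z \<bullet> \<nu> p) \<le> h * (- g0 + C * L)" using h by (intro mult_left_mono) auto
  moreover have "C * h\<^sup>2 \<le> h * (C * L)"
  proof -
    have "h * h \<le> h * L" using h by (intro mult_left_mono) auto
    then have "C * (h * h) \<le> C * (h * L)" by (rule mult_left_mono) (use C in auto)
    then show ?thesis by (simp add: power2_eq_square mult_ac)
  qed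
  moreover have "h * (- g0 + C * L) + h * (C * L) \<le> 0"
  proof -
    have "h * (- g0 + 2 * C * L) \<le> 0" using h L by (intro mult_nonneg_nonpos) auto
    then show ?thesis by (simp add: algebra_simps)
  qed
  ultimately have "r (z + h *\<^sub>R \<nu> p) \<le> r z" using 1 by linarith
  then show ?thesis using z(1) unfolding \<Omega>(1) by simp
qed

text \<open>The ball about \<open>c\<close> of radius \<open>d c\<close> lies in \<Omega> and
  touches the boundary at \<open>q\<close>. A direction \<open>v\<close> pointing into the ball with
  \<open>G q \<bullet> v > 0\<close> would give points of the ball with \<open>r > 0\<close>; hence
  the gradient is antiparallel to the radius.\<close>

lemma touching_gradient:
  assumes c: "c \<in> \<Omega>" "d c < 1" and q: "q \<notin> \<Omega>" "dist c q = d c" and \<xi>: "c - q = d c *\<^sub>R \<xi>"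
  shows "norm \<xi> = 1" "q \<in> frontier \<Omega>" "G q = - (norm (G q) *\<^sub>R \<xi>)"
proof -
  let ?E = "d c"
  have E: "?E > 0" by (rule d_pos[OF c(1)])
  have "norm (c - q) = ?E" using q(2) by (simp add: dist_norm)
  then show n: "norm \<xi> = 1" using E by (simp add: \<xi>)
  have ball: "x \<in> \<Omega>" if "dist c x < ?E" for x using ball_infdist_subset[OF that] .
  have "q \<in> closure (ball c ?E)" using E q(2) by simp
  moreover have "ball c ?E \<subseteq> \<Omega>" using ball by auto
  ultimately have "q \<in> closure \<Omega>" using closure_mono by blast
  then show qf: "q \<in> frontier \<Omega>" using q(1) \<Omega>(2) by (simp add: frontier_def interior_open)
  have qc: "q \<in> cball 0 R" using near[OF c(1), of q] q(2) c(2) by simp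
  have key: "G q \<bullet> v \<le> 0" if v: "v \<bullet> \<xi> > 0" for v
  proof (rule ccontr)
    assume "\<not> G q \<bullet> v \<le> 0"
    then have gv: "G q \<bullet> v > 0" by simp
    have v0: "norm v > 0" using v by auto
    \<comment> \<open>Small enough for the point to lie in the ball and for the linear term to beat
      the Taylor remainder; halving makes the inequalities strict.\<close>
    define \<mu>' where "\<mu>' = min (1 / norm v) (min (2 * ?E * (v \<bullet> \<xi>) / (norm v)\<^sup>2) (G q \<bullet> v / (C * (norm v)\<^sup>2)))"
    define \<mu> where "\<mu> = \<mu>' / 2"
    have "\<mu>' > 0" "\<mu>' \<le> 1 / norm v" "\<mu>' \<le> 2 * ?E * (v \<bullet> \<xi>) / (norm v)\<^sup>2" "\<mu>' \<le> G q \<bullet> v / (C * (norm v)\<^sup>2)"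
      using v0 v gv E C by (auto simp: \<mu>'_def)
    then have \<mu>: "\<mu> > 0" "\<mu> < 1 / norm v" "\<mu> < 2 * ?E * (v \<bullet> \<xi>) / (norm v)\<^sup>2" "\<mu> < G q \<bullet> v / (C * (norm v)\<^sup>2)"
      unfolding \<mu>_def by linarith+
    have m1: "\<mu> * norm v < 1" using \<mu>(2) v0 by (simp add: field_simps)
    have m2: "\<mu> * (norm v)\<^sup>2 < 2 * ?E * (v \<bullet> \<xi>)" using \<mu>(3) v0 by (simp add: pos_less_divide_eq)
    have m3: "\<mu> * (C * (norm v)\<^sup>2) < G q \<bullet> v" using \<mu>(4) v0 C by (simp add: pos_less_divide_eq)
    let ?x = "q + \<mu> *\<^sub>R v"
    have cx: "c - ?x = ?E *\<^sub>R \<xi> - \<mu> *\<^sub>R v" using \<xi> by (simp add: algebra_simps)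
    have "(norm (c - ?x))\<^sup>2 = ?E\<^sup>2 - \<mu> * (2 * ?E * (v \<bullet> \<xi>)) + \<mu> * (\<mu> * (norm v)\<^sup>2)"
    proof -
      have "(norm (e *\<^sub>R \<xi> - \<mu> *\<^sub>R v))\<^sup>2 = e\<^sup>2 * (norm \<xi>)\<^sup>2 - \<mu> * (2 * e * (v \<bullet> \<xi>)) + \<mu> * (\<mu> * (norm v)\<^sup>2)" for e
        unfolding power2_norm_eq_inner by (simp add: inner_diff_left inner_diff_right inner_commute power2_eq_square algebra_simps)
      then show ?thesis unfolding cx n by simp
    qed
    moreover have "\<mu> * (\<mu> * (norm v)\<^sup>2) < \<mu> * (2 * ?E * (v \<bullet> \<xi>))" using m2 \<mu>(1) by simp
    ultimately have "(norm (c - ?x))\<^sup>2 < ?E\<^sup>2" by linarith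
    then have "norm (c - ?x) < ?E" using E by (simp add: power_less_imp_less_base)
    then have xO: "?x \<in> \<Omega>" using ball by (simp add: dist_norm)
    have xc: "?x \<in> cball 0 R" using near[OF xO, of ?x] by simp
    have "\<bar>r ?x - r q - G q \<bullet> (?x - q)\<bar> \<le> C * (norm (?x - q))\<^sup>2" by (rule G2[OF xc qc])
    then have "r ?x \<ge> r q + \<mu> * (G q \<bullet> v) - C * (\<mu> * norm v)\<^sup>2" using \<mu>(1) by simp
    moreover have "C * (\<mu> * norm v)\<^sup>2 < \<mu> * (G q \<bullet> v)"
      using mult_strict_left_mono[OF m3 \<mu>(1)] by (simp add: power2_eq_square mult_ac)
    ultimately have "r ?x > 0" using r0[OF qf] by linarith
    then show False using xO \<Omega>(1) by simp
  qed
  define \<alpha> where "\<alpha> = G q \<bullet> \<xi>"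
  have \<xi>\<xi>: "\<xi> \<bullet> \<xi> = 1" using n by (simp add: norm_eq_1)
  have "\<alpha> \<le> 0" using key[of \<xi>] \<xi>\<xi> by (simp add: \<alpha>_def)
  \<comment> \<open>The component of \<open>G q\<close> orthogonal to \<xi>, tilted inward by \<mu>,
    is an admissible direction; small \<mu> forces the equality case of Cauchy-Schwarz, so
    \<open>G q\<close> is a multiple of \<xi>.\<close>
  have "(norm (G q))\<^sup>2 - \<alpha>\<^sup>2 \<le> e" if "e > 0" for e
  proof -
    define \<mu> where "\<mu> = e / (\<bar>\<alpha>\<bar> + 1)"
    have \<mu>: "\<mu> > 0" "\<mu> * \<bar>\<alpha>\<bar> \<le> e" using that by (auto simp: \<mu>_def divide_simps intro: mult_left_le)
    have "G q \<bullet> (G q - \<alpha> *\<^sub>R \<xi> + \<mu> *\<^sub>R \<xi>) \<le> 0"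
      by (rule key) (use \<mu> \<xi>\<xi> in \<open>simp add: inner_diff_left inner_add_left \<alpha>_def\<close>)
    then have "(norm (G q))\<^sup>2 - \<alpha> * \<alpha> + \<mu> * \<alpha> \<le> 0"
      by (simp add: inner_diff_right inner_add_right \<alpha>_def power2_norm_eq_inner)
    moreover have "- (\<mu> * \<alpha>) \<le> \<mu> * \<bar>\<alpha>\<bar>" using \<mu> \<open>\<alpha> \<le> 0\<close> by simp
    ultimately show ?thesis using \<mu>(2) by (simp add: power2_eq_square)
  qed
  from field_le_epsilon[of "(norm (G q))\<^sup>2 - \<alpha>\<^sup>2" 0, unfolded add_0_left, OF this]
  have "(norm (G q))\<^sup>2 - \<alpha>\<^sup>2 \<le> 0" .
  moreover have "(norm (G q - \<alpha> *\<^sub>R \<xi>))\<^sup>2 = (norm (G q))\<^sup>2 - \<alpha>\<^sup>2"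
  proof -
    have "(norm (x - b *\<^sub>R y))\<^sup>2 = (norm x)\<^sup>2 - 2 * b * (x \<bullet> y) + b\<^sup>2 * (norm y)\<^sup>2" for b and x y :: "complex^'n"
      unfolding power2_norm_eq_inner by (simp add: inner_diff_left inner_diff_right inner_commute power2_eq_square algebra_simps)
    from this[of "G q" \<alpha> \<xi>] show ?thesis unfolding \<alpha>_def[symmetric] n by (simp add: power2_eq_square)
  qed
  ultimately have "(norm (G q - \<alpha> *\<^sub>R \<xi>))\<^sup>2 \<le> 0" by linarith
  then have Gq: "G q = \<alpha> *\<^sub>R \<xi>" by simp
  then have "norm (G q) = - \<alpha>" using n \<open>\<alpha> \<le> 0\<close> by simp
  then show "G q = - (norm (G q) *\<^sub>R \<xi>)" using Gq by simp
qed

text \<open>Translating \<open>z\<close> by \<open>D - E z\<close> along the normal direction lands on the boundary up to second order.\<close>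
lemma boundary_translate:
  assumes p: "p \<in> frontier \<Omega>" and z: "z \<in> \<Omega>" "norm (z - p) \<le> L" "d z \<le> L" and D: "0 < D" "D \<le> L"
    and L: "L \<le> 1 / 8" "2 * C * L \<le> g0"
    and sg: "\<bar>\<sigma>\<bar> \<le> 1" "\<bar>s\<bar> \<le> 1"
  defines "E \<equiv> d (z + D *\<^sub>R \<nu> p)"
  obtains g where "g0 \<le> g" "g \<le> C" "E > 0" "E \<le> D + d z"
    "\<bar>r (z + cscale (Complex (D - E + \<sigma>) s) (\<nu> p)) + g * \<sigma>\<bar> \<le>
       C * ((\<bar>\<sigma>\<bar> + E) * (8 * C / g0 * L)\<^sup>2 + \<bar>s\<bar> * (8 * C / g0 * L)) + C * (E * (8 * C / g0 * L) + \<bar>\<sigma>\<bar> + \<bar>s\<bar>)\<^sup>2"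
    "z + cscale (Complex (D - E + \<sigma>) s) (\<nu> p) \<in> cball 0 R"
proof -
  let ?n = "\<nu> p" and ?c = "z + D *\<^sub>R \<nu> p" and ?K = "8 * C / g0 * L"
  have n: "norm ?n = 1" by (rule norm_\<nu>[OF p])
  have L0: "L > 0" "L \<le> 1" using D L by auto
  have c\<Omega>: "?c \<in> \<Omega>" by (rule inward[OF p z(1,2) _ D(2)]) (use D L in auto)
  have E0: "E > 0" unfolding E_def by (rule d_pos[OF c\<Omega>])
  have EdD: "E \<le> D + d z" using d_lipschitz[of ?c z] n D by (simp add: E_def)
  have E1: "E \<le> 2 * L" using EdD z(3) D(2) by simp
  \<comment> \<open>The point of the complement nearest to the inward translate of \<open>z\<close>;
    \<xi> will be the inner normal there.\<close>
  obtain q where q: "q \<in> - \<Omega>" "E = dist ?c q"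
    using infdist_attains_inf[of "- \<Omega>" ?c] \<Omega>(2,3) unfolding E_def by auto
  define \<xi> where "\<xi> = (1 / E) *\<^sub>R (?c - q)"
  have \<xi>: "?c - q = d ?c *\<^sub>R \<xi>" using E0 unfolding \<xi>_def E_def[symmetric] by simp
  have dc: "d ?c < 1" using E1 L unfolding E_def[symmetric] by simp
  note tg = touching_gradient[OF c\<Omega> dc, of q \<xi>]
  have n\<xi>: "norm \<xi> = 1" and qf: "q \<in> frontier \<Omega>" and Gq: "G q = - (norm (G q) *\<^sub>R \<xi>)"
    using tg q \<xi> unfolding E_def by auto
  have pc: "p \<in> cball 0 R" using near[OF z(1), of p] z(2) L0 by (simp add: dist_norm)
  have zq: "norm (z - q) \<le> 3 * L"
  proof -
    have "norm (z - q) \<le> norm (?c - q) + norm (D *\<^sub>R ?n)" using norm_triangle_ineq4[of "?c - q" "D *\<^sub>R ?n"] by simp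
    also have "norm (?c - q) = E" using q(2) by (simp add: dist_norm)
    finally show ?thesis using n D E1 by simp
  qed
  have qc: "q \<in> cball 0 R" using near[OF z(1), of q] zq L0 by (simp add: dist_norm)
  have qp: "norm (q - p) \<le> 4 * L"
    using norm_triangle_ineq[of "q - z" "z - p"] zq z(2) by (simp add: norm_minus_commute)
  have gq: "g0 \<le> norm (G q)" "norm (G q) \<le> C" using G4[OF qf] G3[OF qc] by auto
  have gp: "g0 \<le> norm (G p)" by (rule G4[OF p])
  have xn: "norm (\<xi> - ?n) \<le> ?K"
  proof -
    have ne: "G q \<noteq> 0" "G p \<noteq> 0" using gq gp g0 by auto
    have "\<xi> = - (G q /\<^sub>R norm (G q))" using ne by (subst Gq) (simp add: n\<xi>)
    then have "norm (\<xi> - ?n) = norm (G q /\<^sub>R norm (G q) - G p /\<^sub>R norm (G p))"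
      by (simp add: \<nu>_def norm_minus_commute)
    also have "\<dots> \<le> 2 * norm (G q - G p) / norm (G p)" by (rule norm_normalize_diff[OF ne])
    also have "\<dots> \<le> 2 * (C * (4 * L)) / g0"
    proof (rule frac_le)
      have "norm (G q - G p) \<le> C * norm (q - p)" by (rule G1[OF qc pc])
      also have "\<dots> \<le> C * (4 * L)" using qp C by (intro mult_left_mono) auto
      finally show "2 * norm (G q - G p) \<le> 2 * (C * (4 * L))" by simp
    qed (use gp g0 C L0 in auto)
    finally show ?thesis by (simp add: field_simps)
  qed
  have K0: "?K \<ge> 0" using C g0 L0 by simp
  let ?g = "norm (G q)"
  \<comment> \<open>The target point relative to \<open>q\<close>. For \<sigma> and \<open>s\<close>
    zero it is \<open>E\<close> times the difference of the inner normals at \<open>q\<close> and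
    \<open>p\<close>, points at distance at most \<open>4 * L\<close>: of first order in
    \<open>L\<close> and nearly tangential at \<open>q\<close>.\<close>
  define k where "k = E *\<^sub>R (\<xi> - ?n) + \<sigma> *\<^sub>R ?n + s *\<^sub>R cscale \<i> ?n"
  let ?x = "z + cscale (Complex (D - E + \<sigma>) s) ?n"
  have "Complex (D - E + \<sigma>) s = of_real D - of_real E + of_real \<sigma> + of_real s * \<i>" by (simp add: complex_eq_iff)
  then have "cscale (Complex (D - E + \<sigma>) s) ?n = D *\<^sub>R ?n - E *\<^sub>R ?n + \<sigma> *\<^sub>R ?n + s *\<^sub>R cscale \<i> ?n"
    by (simp add: cscale_add_left cscale_diff_left cscale_of_real cscale_of_real_mult cscale_scaleR_right)
  then have xq: "?x - q = k"
    using \<xi> unfolding E_def[symmetric] k_def by (simp add: algebra_simps)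
  have xc: "?x \<in> cball 0 R"
  proof (rule near[OF z(1)])
    have "norm (cscale (Complex (D - E + \<sigma>) s) ?n) \<le> \<bar>D - E + \<sigma>\<bar> + \<bar>s\<bar>"
      using cmod_le[of "Complex (D - E + \<sigma>) s"] n by simp
    then show "dist z ?x \<le> 4" using sg D E1 E0 L by (simp add: dist_norm del: norm_cscale)
  qed
  have nk: "norm k \<le> E * ?K + \<bar>\<sigma>\<bar> + \<bar>s\<bar>"
  proof -
    have "norm k \<le> norm (E *\<^sub>R (\<xi> - ?n)) + norm (\<sigma> *\<^sub>R ?n) + norm (s *\<^sub>R cscale \<i> ?n)"
      unfolding k_def by (intro order_trans[OF norm_triangle_ineq] add_mono) auto
    also have "\<dots> = E * norm (\<xi> - ?n) + \<bar>\<sigma>\<bar> + \<bar>s\<bar>" using n E0 by simp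
    also have "\<dots> \<le> E * ?K + \<bar>\<sigma>\<bar> + \<bar>s\<bar>" using mult_left_mono[OF xn less_imp_le[OF E0]] by linarith
    finally show ?thesis .
  qed
  have xx: "\<xi> \<bullet> \<xi> = 1" "?n \<bullet> ?n = 1" using n n\<xi> by (simp_all add: norm_eq_1)
  \<comment> \<open>The inner product of two unit vectors differs from 1 by half of their squared
    distance; this makes the normal part of the displacement second order.\<close>
  define \<beta> where "\<beta> = 1 - \<xi> \<bullet> ?n"
  have "(norm (\<xi> - ?n))\<^sup>2 = 2 * \<beta>"
    using xx by (simp add: power2_norm_eq_inner inner_diff_left inner_diff_right inner_commute \<beta>_def)
  moreover have "(norm (\<xi> - ?n))\<^sup>2 \<le> ?K\<^sup>2" by (rule power_mono[OF xn]) simp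
  ultimately have \<beta>: "0 \<le> \<beta>" "\<beta> \<le> ?K\<^sup>2" using zero_le_power2[of "norm (\<xi> - ?n)"] zero_le_power2[of ?K] by linarith+
  have xi: "\<bar>\<xi> \<bullet> cscale \<i> ?n\<bar> \<le> ?K"
  proof -
    have "\<xi> \<bullet> cscale \<i> ?n = (\<xi> - ?n) \<bullet> cscale \<i> ?n" by (simp add: inner_diff_left)
    also have "\<bar>\<dots>\<bar> \<le> norm (\<xi> - ?n) * norm (cscale \<i> ?n)" by (rule Cauchy_Schwarz_ineq2)
    finally show ?thesis using xn n by simp
  qed
  have "\<xi> \<bullet> k = E * (\<xi> \<bullet> \<xi> - \<xi> \<bullet> ?n) + \<sigma> * (\<xi> \<bullet> ?n) + s * (\<xi> \<bullet> cscale \<i> ?n)"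
    unfolding k_def by (simp add: inner_add_right inner_diff_right)
  also have "\<dots> = \<sigma> + (E - \<sigma>) * \<beta> + s * (\<xi> \<bullet> cscale \<i> ?n)"
    unfolding xx \<beta>_def by (simp add: algebra_simps)
  finally have \<xi>k: "\<xi> \<bullet> k = \<sigma> + (E - \<sigma>) * \<beta> + s * (\<xi> \<bullet> cscale \<i> ?n)" .
  have Gk: "G q \<bullet> k = - (?g * (\<xi> \<bullet> k))" by (subst Gq) simp
  have "\<bar>r ?x - r q - G q \<bullet> (?x - q)\<bar> \<le> C * (norm (?x - q))\<^sup>2" by (rule G2[OF xc qc])
  also have "(norm (?x - q))\<^sup>2 \<le> (E * ?K + \<bar>\<sigma>\<bar> + \<bar>s\<bar>)\<^sup>2" unfolding xq by (rule power_mono[OF nk]) simp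
  finally have e1: "\<bar>r ?x - G q \<bullet> k\<bar> \<le> C * (E * ?K + \<bar>\<sigma>\<bar> + \<bar>s\<bar>)\<^sup>2"
    using C r0[OF qf] unfolding xq by (simp add: mult_left_mono)
  have "\<bar>(E - \<sigma>) * \<beta> + s * (\<xi> \<bullet> cscale \<i> ?n)\<bar> \<le> (\<bar>\<sigma>\<bar> + E) * ?K\<^sup>2 + \<bar>s\<bar> * ?K"
  proof -
    have "\<bar>(E - \<sigma>) * \<beta>\<bar> \<le> (\<bar>\<sigma>\<bar> + E) * ?K\<^sup>2" unfolding abs_mult using \<beta> E0 by (intro mult_mono) auto
    moreover have "\<bar>s * (\<xi> \<bullet> cscale \<i> ?n)\<bar> \<le> \<bar>s\<bar> * ?K" unfolding abs_mult using xi by (intro mult_left_mono) auto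
    ultimately show ?thesis by linarith
  qed
  then have "?g * \<bar>(E - \<sigma>) * \<beta> + s * (\<xi> \<bullet> cscale \<i> ?n)\<bar> \<le> C * ((\<bar>\<sigma>\<bar> + E) * ?K\<^sup>2 + \<bar>s\<bar> * ?K)"
    using gq C by (intro mult_mono) auto
  moreover have "G q \<bullet> k + ?g * \<sigma> = - (?g * ((E - \<sigma>) * \<beta> + s * (\<xi> \<bullet> cscale \<i> ?n)))"
    unfolding Gk \<xi>k by (simp add: algebra_simps)
  ultimately have e2: "\<bar>G q \<bullet> k + ?g * \<sigma>\<bar> \<le> C * ((\<bar>\<sigma>\<bar> + E) * ?K\<^sup>2 + \<bar>s\<bar> * ?K)"
    by (simp only: abs_minus_cancel abs_mult abs_norm_cancel)
  show ?thesis
    by (rule that[OF gq E0 EdD _ xc]) (use e1 e2 in linarith)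
qed

end

section \<open>Boundary patches\<close>

lemma continuous_on_if_locally_lipschitz:
  fixes f :: "'a::real_normed_vector \<Rightarrow> real"
  assumes "e0 > 0" and lip: "\<And>x y. x \<in> S \<Longrightarrow> y \<in> S \<Longrightarrow> norm (x - y) < e0 \<Longrightarrow> \<bar>f x - f y\<bar> \<le> \<Lambda> * norm (x - y)"
  shows "continuous_on S f"
  unfolding continuous_on_iff
proof (intro ballI allI impI)
  fix x e assume x: "x \<in> S" and e: "(0::real) < e"
  have pos: "\<bar>\<Lambda>\<bar> + 1 > 0" by simp
  show "\<exists>d>0. \<forall>x'\<in>S. dist x' x < d \<longrightarrow> dist (f x') (f x) < e"
  proof (intro exI[of _ "min e0 (e / (\<bar>\<Lambda>\<bar> + 1))"] conjI ballI impI)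
    show "0 < min e0 (e / (\<bar>\<Lambda>\<bar> + 1))" using assms(1) e pos by simp
    fix x' assume x': "x' \<in> S" "dist x' x < min e0 (e / (\<bar>\<Lambda>\<bar> + 1))"
    then have n: "norm (x' - x) < e0" "norm (x' - x) * (\<bar>\<Lambda>\<bar> + 1) < e" using pos by (auto simp: dist_norm pos_less_divide_eq)
    have "\<bar>f x' - f x\<bar> \<le> \<Lambda> * norm (x' - x)" by (rule lip[OF x'(1) x n(1)])
    also have "\<dots> \<le> (\<bar>\<Lambda>\<bar> + 1) * norm (x' - x)" by (intro mult_right_mono) auto
    finally show "dist (f x') (f x) < e" using n(2) by (simp add: dist_real_def mult.commute)
  qed
qed

locale c2_patch = c2_domain +
  fixes c1 C1 F1 :: real
  assumes c1: "0 < c1" "c1 \<le> 1" and C1: "C1 \<ge> 1" and F1: "F1 \<ge> 1"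
begin

text \<open>\<open>K2 * L\<close> bounds the turning of the normal over a patch. \<open>N\<close>
  fixes \<open>L = N / F\<close> so that \<open>c1 * L\<^sup>2 = (64 + c1) * a\<close>; the lateral
  penalty then exceeds \<open>3 * a\<close>, the error of the lower bound in the gluing, already at
  distance \<open>3 / 4 * L\<close>.\<close>

definition "K2 = 8 * C / g0"
definition "N = sqrt (64 / c1 + 1)"
text \<open>With \<open>M \<ge> K * m\<close> the term \<open>M * D\<^sup>2 / E\<close> meets both
  conditions of \<open>sm_strip_extension\<close>. \<open>K\<close> is
  \<open>32 * (2 + 4 * C1)\<close>: 32 comes from \<open>E \<le> 2 * D\<close>, and the summands pay
  for \<open>2 * c1\<close>, \<kappa> and the Lipschitz constant of \<phi>.\<close>

definition "K = 64 * (1 + 2 * C1)"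
text \<open>\<open>cc * \<delta>\<close> is the accuracy to which \<open>E\<close> equals
  \<open>D + d\<close>; then \<open>M * D\<^sup>2 / E\<close> is off by at most
  \<open>4 * K * cc * a \<le> a\<close>. The next constant, \<open>cp\<close>, is the corresponding
  accuracy of \<open>r\<close> relative to \<delta>, with \<open>g0\<close> converting distance into
  \<open>r\<close>.\<close>

definition "cc = 1 / (8 * C * K)"
definition "cp = g0 * cc / 2"
text \<open>Bounds the imaginary translations by \<open>X = cx * \<delta> / L\<close>, so that both
  the tilt \<open>X * L\<close> and the square of \<open>X\<close> move \<open>r\<close> by a small
  part of \<open>cp * \<delta>\<close>.\<close>

definition "cx = cp / (24 * C * K2 * F1\<^sup>2)"
text \<open>The four entries ensure in turn: second order errors \<open>D * L\<^sup>2\<close> that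
  are a small part of \<delta>; \<kappa> at most \<open>m / D\<close>; \<open>2 * D \<le> m\<close>,
  which bounds \<open>2 * c1\<close> by \<open>m / D\<close>; and
  \<open>D \<le> L / 8\<close>.\<close>

definition "cD = Min {cp / (96 * C * K2\<^sup>2 * N\<^sup>2), cx\<^sup>2 / (4 * N\<^sup>2), 1 / (2 * F1 ^ 4), 1 / 8}"

lemma const_bounds:
  shows K2: "K2 \<ge> 1" and N: "N \<ge> 1" "N\<^sup>2 = 64 / c1 + 1" and K: "K \<ge> 64" and cc: "0 < cc" "cc \<le> 1 / 8"
    and cp: "0 < cp" "cp \<le> 1" "8 * C * cp \<le> g0" and cx: "0 < cx" "cx \<le> 1"
    and cD: "0 < cD" "cD \<le> cp / (96 * C * K2\<^sup>2 * N\<^sup>2)" "cD \<le> cx\<^sup>2 / (4 * N\<^sup>2)" "cD \<le> 1 / (2 * F1 ^ 4)" "cD \<le> 1 / 8"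
    and cx2: "C * K2 * cx \<le> cp / 4" "24 * C * F1\<^sup>2 * cx \<le> cp"
proof -
  show K2: "K2 \<ge> 1" using C g0 unfolding K2_def by (simp add: field_simps)
  have "64 / c1 + 1 \<ge> 1" using c1 by simp
  then show N: "N \<ge> 1" "N\<^sup>2 = 64 / c1 + 1" unfolding N_def by simp_all
  show K: "K \<ge> 64" using C1 by (simp add: K_def)
  have CK: "C * K \<ge> 1" using mult_mono[of 1 C 1 K] C K by simp
  then show cc: "0 < cc" "cc \<le> 1 / 8" unfolding cc_def using C K by (simp_all add: field_simps)
  have "g0 * cc \<le> 1 * (1/8)" using g0 cc by (intro mult_mono) auto
  then show cp: "0 < cp" "cp \<le> 1" using g0 cc by (simp_all add: cp_def)
  have "8 * C * cp = g0 * (1 / (2 * K))" using C K by (simp add: cp_def cc_def)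
  also have "\<dots> \<le> g0 * 1" using K g0 by (intro mult_left_mono) (auto simp: field_simps)
  finally show "8 * C * cp \<le> g0" by simp
  have F12: "F1\<^sup>2 \<ge> 1" using F1 by (simp add: one_le_power)
  have pos: "24 * C * K2 * F1\<^sup>2 > 0" using C K2 F1 by simp
  have CKF: "C * K2 * F1\<^sup>2 \<ge> 1" using mult_mono[of 1 "C * K2" 1 "F1\<^sup>2"] mult_mono[of 1 C 1 K2] C K2 F12 by simp
  show cx: "0 < cx" unfolding cx_def using cp pos by simp
  have cxe: "cx * (24 * (C * K2 * F1\<^sup>2)) = cp" 
  proof -
    have ne: "24 * C * K2 * F1\<^sup>2 \<noteq> 0" using pos by linarith
    have "24 * (C * K2 * F1\<^sup>2) = 24 * C * K2 * F1\<^sup>2" by (simp only: mult.assoc)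
    then show ?thesis unfolding cx_def using ne by (simp only: nonzero_eq_divide_eq[symmetric])
  qed
  have "cx * 1 \<le> cx * (24 * (C * K2 * F1\<^sup>2))" using cx CKF by (intro mult_left_mono) auto
  then show "cx \<le> 1" using cxe cp by simp
  have "(C * K2 * cx) * 1 \<le> (C * K2 * cx) * F1\<^sup>2" using cx C K2 F12 by (intro mult_left_mono) auto
  then show "C * K2 * cx \<le> cp / 4" using cxe cp by (simp add: mult_ac)
  have "(24 * C * F1\<^sup>2 * cx) * 1 \<le> (24 * C * F1\<^sup>2 * cx) * K2" using cx C K2 F12 by (intro mult_left_mono) auto
  then show "24 * C * F1\<^sup>2 * cx \<le> cp" using cxe by (simp add: mult_ac)
  show "0 < cD" unfolding cD_def using cp cx C K2 N(1) F1 by simp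
  show "cD \<le> cp / (96 * C * K2\<^sup>2 * N\<^sup>2)" "cD \<le> cx\<^sup>2 / (4 * N\<^sup>2)" "cD \<le> 1 / (2 * F1 ^ 4)" "cD \<le> 1 / 8"
    unfolding cD_def by (rule Min_le; simp)+
qed

end

text \<open>One patch size: \<delta> is the width of the strip, \<open>F\<close> is
  \<open>f (1 / \<delta>)\<close> in the application, \<open>a = m * \<delta>\<close> is the
  oscillation and \<open>m\<close> the slope of the normalised \<phi>. \<kappa> is chosen for
  \<open>\<kappa> * X\<^sup>2 = 4 * a\<close>; \<sigma>0 is the depth aimed at, well below \<delta>
  because gradients of \<open>r\<close> have norm at most \<open>C\<close>. \<open>M\<close> is free
  within a factor 2, for the increments made when gluing.\<close>

locale c2_scale = c2_patch +
  fixes \<delta> F M RU :: real and U :: "(complex^'a) set" and \<phi> :: "complex^'a \<Rightarrow> real" and m L D a X \<kappa> \<sigma>0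
  defines "m \<equiv> 1 / (\<delta> * F\<^sup>2)" and "L \<equiv> N / F" and "D \<equiv> cD * min (1 / m) L" and "a \<equiv> 1 / F\<^sup>2"
    and "X \<equiv> cx * \<delta> / L" and "\<kappa> \<equiv> 4 * N\<^sup>2 * m\<^sup>2 / cx\<^sup>2" and "\<sigma>0 \<equiv> \<delta> / (4 * C)"
  assumes \<delta>: "0 < \<delta>" "\<delta> \<le> cp / (24 * C)" and F: "F > 0" "\<delta> * F\<^sup>2 \<le> F1\<^sup>2" and \<delta>D: "16 * \<delta> \<le> D"
    and L: "L \<le> 1 / 8" "2 * C * L \<le> g0" "4 * L \<le> RU" and M: "K * m \<le> M" "M \<le> 2 * K * m"
    and U: "open U" "\<And>p. p \<in> frontier \<Omega> \<Longrightarrow> ball p RU \<subseteq> U"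
    and \<phi>: "\<And>x. x \<in> U \<Longrightarrow> - \<delta> < r x \<Longrightarrow> r x < 0 \<Longrightarrow> sm \<phi> c1 x"
      "\<And>x. x \<in> U \<Longrightarrow> - \<delta> < r x \<Longrightarrow> r x < 0 \<Longrightarrow> sdiff \<phi> x"
      "\<And>x. x \<in> U \<Longrightarrow> - \<delta> < r x \<Longrightarrow> r x < 0 \<Longrightarrow> - a \<le> \<phi> x \<and> \<phi> x \<le> 0"
      "\<And>x y. (\<And>w. w \<in> closed_segment x y \<Longrightarrow> w \<in> U \<and> - \<delta> < r w \<and> r w < 0) \<Longrightarrow> \<bar>\<phi> x - \<phi> y\<bar> \<le> C1 * m * norm (x - y)"
    and rcont: "continuous_on UNIV r"
begin

section \<open>Size relations between the scales of one patch\<close>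

definition "S = {x\<in>U. - \<delta> < r x \<and> r x < 0}"

lemma open_S: "open S"
proof -
  have "S = U \<inter> (r -` {- \<delta><..<0})" by (auto simp: S_def)
  moreover have "open (r -` {- \<delta><..<0})" by (rule open_vimage[OF open_greaterThanLessThan rcont])
  ultimately show ?thesis using U(1) by auto
qed

lemma m_pos: "m > 0" using \<delta> F by (simp add: m_def)

lemma m_a: "m * \<delta> = a" using \<delta> F by (simp add: m_def a_def)

lemma m_lower: "1 / F1\<^sup>2 \<le> m"
  unfolding m_def using \<delta> F F1 by (intro divide_left_mono) auto

lemma L_pos: "L > 0" using N F by (simp add: L_def)

lemma D_bounds: "D > 0" "D \<le> L / 8" "D \<le> cD / m"
proof -
  show "D > 0" using cD m_pos L_pos by (simp add: D_def)
  have "cD * min (1 / m) L \<le> (1/8) * L" using cD L_pos m_pos by (intro mult_mono) auto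
  then show "D \<le> L / 8" by (simp add: D_def)
  have "cD * min (1 / m) L \<le> cD * (1 / m)" using cD by (intro mult_left_mono) auto
  then show "D \<le> cD / m" by (simp add: D_def)
qed

text \<open>\<open>D * L\<^sup>2\<close> is the size of the turning error in
  \<open>boundary_translate\<close>; the restriction \<open>D \<le> cD / m\<close> is made for this
  bound.\<close>

lemma D_L2: "D * L\<^sup>2 \<le> cD * N\<^sup>2 * \<delta>"
proof -
  have "D * L\<^sup>2 \<le> cD / m * L\<^sup>2" using D_bounds(3) by (rule mult_right_mono) simp
  also have "\<dots> = cD * N\<^sup>2 * \<delta>" using F \<delta> by (simp add: m_def L_def power_divide)
  finally show ?thesis .
qed

lemma X_bounds: "X > 0" "X \<le> 1" "X * L = cx * \<delta>" "X\<^sup>2 \<le> cx * F1\<^sup>2 * \<delta>" "X \<le> L"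
proof -
  show "X > 0" "X * L = cx * \<delta>" using cx \<delta> L_pos by (simp_all add: X_def)
  have dL: "\<delta> / L \<le> 1 / 128" using \<delta>D D_bounds(2) L_pos by (simp add: field_simps)
  have "X = cx * (\<delta> / L)" by (simp add: X_def)
  also have "\<dots> \<le> 1 * (1 / 128)" using cx \<delta> L_pos dL by (intro mult_mono) auto
  finally show "X \<le> 1" by simp
  have "cx * \<delta> \<le> 1 * \<delta>" using cx \<delta> by (intro mult_right_mono) auto
  then have "X * L \<le> L * (1/128)" using \<open>X * L = cx * \<delta>\<close> dL L_pos by (simp add: field_simps)
  then have "X \<le> 1/128" using L_pos by simp
  have "X * X \<le> X * 1" using \<open>X > 0\<close> \<open>X \<le> 1\<close> by (intro mult_left_mono) auto
  have "X\<^sup>2 = cx\<^sup>2 * (\<delta> * (\<delta> * F\<^sup>2) / N\<^sup>2)"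
    using F N by (simp add: X_def L_def power_mult_distrib power_divide field_simps power2_eq_square)
  also have "\<dots> \<le> cx * (\<delta> * F1\<^sup>2 / 1)"
  proof (rule mult_mono)
    show "cx\<^sup>2 \<le> cx" using cx by (simp add: power2_eq_square mult_left_le)
    show "\<delta> * (\<delta> * F\<^sup>2) / N\<^sup>2 \<le> \<delta> * F1\<^sup>2 / 1"
      using F \<delta> N(1) by (intro frac_le mult_left_mono) (auto simp: one_le_power)
  qed (use cx \<delta> F in auto)
  finally show "X\<^sup>2 \<le> cx * F1\<^sup>2 * \<delta>" by (simp add: mult_ac)
  show "X \<le> L"
  proof -
    have "cx * \<delta> \<le> 1 * L\<^sup>2"
    proof -
      have eq: "cx * \<delta> = cx * (1/m) * a" using m_a m_pos by (simp add: field_simps)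
      have aL: "a \<le> L\<^sup>2" unfolding a_def L_def using N(1) F(1) by (simp add: power_divide divide_right_mono one_le_power)
      have "cx * (1/m) \<le> cx * F1\<^sup>2"
        using m_lower m_pos F1 cx by (intro mult_left_mono) (auto simp: field_simps)
      also have "\<dots> \<le> 1"
      proof -
        have "cx * F1\<^sup>2 * 1 \<le> cx * F1\<^sup>2 * (24 * C)" using cx C by (intro mult_left_mono) auto
        then show ?thesis using cx2(2) cp(2) by (simp add: mult_ac)
      qed
      finally show ?thesis unfolding eq using aL by (intro mult_mono) (auto simp: a_def)
    qed
    then have "X * L \<le> L * L" using \<open>X * L = cx * \<delta>\<close> by (simp add: power2_eq_square)
    then show ?thesis using L_pos by simp
  qed
qed

lemma delta_small: "128 * \<delta> \<le> L" "\<delta> \<le> 1 / 1024" "\<delta> \<le> D"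
  using \<delta>D D_bounds L(1) \<delta>(1) by auto

text \<open>\<open>P\<close> moves \<open>z\<close> into the strip, at depth about \<open>\<sigma>0\<close>, whatever the position of \<open>z\<close> in the patch.\<close>
definition "E p z = d (z + D *\<^sub>R \<nu> p)"
definition "P p z s = z + cscale (Complex (D + \<sigma>0 - E p z) s) (\<nu> p)"
definition "A p = {z\<in>\<Omega>. d z < D \<and> norm (z - p) < L}"

lemma open_A: "open (A p)"
proof -
  have "open {z. d z < D}" by (rule open_Collect_less) (auto intro!: continuous_intros)
  moreover have "open {z. norm (z - p) < L}" by (rule open_Collect_less) (auto intro!: continuous_intros)
  moreover have "A p = \<Omega> \<inter> {z. d z < D} \<inter> {z. norm (z - p) < L}" by (auto simp: A_def)
  ultimately show ?thesis using \<Omega>(2) by (simp add: open_Int)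
qed

text \<open>\<open>boundary_translate\<close> at the chosen scales: the errors from turning normals
  (\<open>D * L\<^sup>2\<close>), tilted imaginary translations (\<open>X * L\<close>) and the
  squared displacement add up to at most \<open>cp * \<delta>\<close>.\<close>

lemma strip_point:
  assumes p: "p \<in> frontier \<Omega>" and z: "z \<in> A p" and \<sigma>: "\<bar>\<sigma>\<bar> \<le> \<delta>" and s: "\<bar>s\<bar> \<le> X"
  obtains g where "g0 \<le> g" "g \<le> C" "0 < E p z" "E p z \<le> D + d z" "E p z \<le> 2 * D"
    "\<bar>r (z + cscale (Complex (D - E p z + \<sigma>) s) (\<nu> p)) + g * \<sigma>\<bar> \<le> cp * \<delta>"
    "z + cscale (Complex (D - E p z + \<sigma>) s) (\<nu> p) \<in> cball 0 R"
proof -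
  have z1: "z \<in> \<Omega>" "norm (z - p) \<le> L" "d z \<le> L" "d z < D" using z D_bounds L_pos by (auto simp: A_def)
  have DL: "D \<le> L" using D_bounds L_pos by simp
  have s1: "\<bar>\<sigma>\<bar> \<le> 1" "\<bar>s\<bar> \<le> 1" using \<sigma> s delta_small X_bounds by auto
  obtain g where g: "g0 \<le> g" "g \<le> C" "E p z > 0" "E p z \<le> D + d z"
    "\<bar>r (z + cscale (Complex (D - E p z + \<sigma>) s) (\<nu> p)) + g * \<sigma>\<bar> \<le>
       C * ((\<bar>\<sigma>\<bar> + E p z) * (K2 * L)\<^sup>2 + \<bar>s\<bar> * (K2 * L)) + C * (E p z * (K2 * L) + \<bar>\<sigma>\<bar> + \<bar>s\<bar>)\<^sup>2"
    "z + cscale (Complex (D - E p z + \<sigma>) s) (\<nu> p) \<in> cball 0 R"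
    using boundary_translate[OF p z1(1,2,3) D_bounds(1) DL L(1,2) s1] unfolding E_def K2_def by blast
  have E2: "E p z \<le> 2 * D" using g(4) z1(4) by simp
  let ?k = "K2 * L"
  have k0: "0 \<le> ?k" using K2 L_pos by simp
  have q: "C * K2\<^sup>2 * (D * L\<^sup>2) \<le> cp / 96 * \<delta>"
  proof -
    have "C * K2\<^sup>2 * (D * L\<^sup>2) \<le> C * K2\<^sup>2 * (cD * N\<^sup>2 * \<delta>)" using D_L2 C by (intro mult_left_mono) auto
    also have "\<dots> = (cD * (96 * C * K2\<^sup>2 * N\<^sup>2)) / 96 * \<delta>" by simp
    also have "\<dots> \<le> cp / 96 * \<delta>"
    proof (rule mult_right_mono[OF divide_right_mono])
      have "96 * C * K2\<^sup>2 * N\<^sup>2 > 0" using C K2 N(1) by simp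
      then show "cD * (96 * C * K2\<^sup>2 * N\<^sup>2) \<le> cp" using cD(2) by (simp add: pos_le_divide_eq)
    qed (use \<delta> in auto)
    finally show ?thesis .
  qed
  have t1: "C * ((\<bar>\<sigma>\<bar> + E p z) * ?k\<^sup>2) \<le> 3 * (cp / 96 * \<delta>)"
  proof -
    have "C * ((\<bar>\<sigma>\<bar> + E p z) * ?k\<^sup>2) \<le> C * ((3 * D) * ?k\<^sup>2)"
      using C \<sigma> delta_small(3) E2 by (intro mult_left_mono mult_right_mono) auto
    also have "\<dots> = 3 * (C * K2\<^sup>2 * (D * L\<^sup>2))" by (simp add: power_mult_distrib)
    finally show ?thesis using q by linarith
  qed
  have t2: "C * (\<bar>s\<bar> * ?k) \<le> cp / 4 * \<delta>"
  proof -
    have "C * (\<bar>s\<bar> * ?k) \<le> C * (X * ?k)" using C s k0 by (intro mult_left_mono mult_right_mono) auto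
    also have "\<dots> = (C * K2 * cx) * \<delta>" using X_bounds(3) by (simp add: mult_ac)
    also have "\<dots> \<le> cp / 4 * \<delta>" using cx2(1) \<delta> by (intro mult_right_mono) auto
    finally show ?thesis .
  qed
  have t3: "C * (E p z * ?k + \<bar>\<sigma>\<bar> + \<bar>s\<bar>)\<^sup>2 \<le> 3 / 8 * (cp * \<delta>)"
  proof -
    have sq: "(x + y + w)\<^sup>2 \<le> 3 * (x\<^sup>2 + y\<^sup>2 + w\<^sup>2)" for x y w :: real
      using sum_squares_bound[of x y] sum_squares_bound[of x w] sum_squares_bound[of y w]
      by (simp add: power2_eq_square algebra_simps)
    have "(E p z * ?k)\<^sup>2 \<le> (2 * D * ?k)\<^sup>2" using E2 g(3) k0 by (intro power_mono mult_right_mono) auto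
    also have "\<dots> = 4 * D * (K2\<^sup>2 * (D * L\<^sup>2))" by (simp add: power_mult_distrib power2_eq_square)
    also have "\<dots> \<le> 1 * (K2\<^sup>2 * (D * L\<^sup>2))"
      using D_bounds L L_pos by (intro mult_right_mono) auto
    finally have "C * (E p z * ?k)\<^sup>2 \<le> C * (K2\<^sup>2 * (D * L\<^sup>2))" using C by (intro mult_left_mono) auto
    then have a1: "C * (E p z * ?k)\<^sup>2 \<le> cp / 96 * \<delta>" using q by (simp add: mult.assoc)
    have "\<bar>\<sigma>\<bar>\<^sup>2 \<le> \<delta> * (cp / (24 * C))"
    proof -
      have "\<bar>\<sigma>\<bar> * \<bar>\<sigma>\<bar> \<le> \<delta> * (cp / (24 * C))" using \<sigma> \<delta> by (intro mult_mono) auto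
      then show ?thesis by (simp add: power2_eq_square)
    qed
    then have "C * \<bar>\<sigma>\<bar>\<^sup>2 \<le> C * (\<delta> * (cp / (24 * C)))" using C by (intro mult_left_mono) auto
    then have a2: "C * \<bar>\<sigma>\<bar>\<^sup>2 \<le> cp / 24 * \<delta>" using C by (simp add: field_simps)
    have "\<bar>s\<bar>\<^sup>2 \<le> X\<^sup>2" using s by (intro power_mono) auto
    then have "C * \<bar>s\<bar>\<^sup>2 \<le> C * (cx * F1\<^sup>2 * \<delta>)" using X_bounds(4) C by (intro mult_left_mono) auto
    also have "\<dots> = (24 * C * F1\<^sup>2 * cx) / 24 * \<delta>" by simp
    also have "\<dots> \<le> cp / 24 * \<delta>" using cx2(2) \<delta> by (intro mult_right_mono divide_right_mono) auto
    finally have a3: "C * \<bar>s\<bar>\<^sup>2 \<le> cp / 24 * \<delta>" .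
    have "C * (E p z * ?k + \<bar>\<sigma>\<bar> + \<bar>s\<bar>)\<^sup>2 \<le> C * (3 * ((E p z * ?k)\<^sup>2 + \<bar>\<sigma>\<bar>\<^sup>2 + \<bar>s\<bar>\<^sup>2))"
      using sq[of "E p z * ?k" "\<bar>\<sigma>\<bar>" "\<bar>s\<bar>"] C by (intro mult_left_mono) (auto simp: power2_abs)
    also have "\<dots> = 3 * (C * (E p z * ?k)\<^sup>2 + C * \<bar>\<sigma>\<bar>\<^sup>2 + C * \<bar>s\<bar>\<^sup>2)" by (simp only: distrib_left mult.left_commute)
    also have "\<dots> \<le> 3 * (cp / 96 * \<delta> + cp / 24 * \<delta> + cp / 24 * \<delta>)" using a1 a2 a3 by (intro mult_left_mono add_mono) simp_all
    also have "\<dots> \<le> 3 / 8 * (cp * \<delta>)" using cp \<delta> by simp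
    finally show ?thesis .
  qed
  have "C * ((\<bar>\<sigma>\<bar> + E p z) * ?k\<^sup>2 + \<bar>s\<bar> * ?k) = C * ((\<bar>\<sigma>\<bar> + E p z) * ?k\<^sup>2) + C * (\<bar>s\<bar> * ?k)" by (rule distrib_left)
  moreover have "0 < cp * \<delta>" using cp \<delta> by simp
  ultimately have "\<bar>r (z + cscale (Complex (D - E p z + \<sigma>) s) (\<nu> p)) + g * \<sigma>\<bar> \<le> cp * \<delta>"
    using g(5) t1 t2 t3 by (simp add: mult.commute[of \<delta>])
  then show ?thesis using that g E2 by blast
qed

text \<open>\<open>E \<le> D + d\<close> is the triangle inequality. For the lower bound, the
  translate overshooting by \<open>cc * \<delta>\<close> has \<open>r > 0\<close>, so it lies
  outside \<Omega>; by \<open>inward\<close> the total translation must then point outward, and its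
  length bounds \<open>d z\<close>.\<close>

lemma E_bounds:
  assumes p: "p \<in> frontier \<Omega>" and z: "z \<in> A p"
  shows "E p z \<le> D + d z" "D + d z - cc * \<delta> \<le> E p z" "D / 2 \<le> E p z" "E p z \<le> 2 * D" "0 < E p z"
proof -
  have z1: "z \<in> \<Omega>" "norm (z - p) \<le> L" using z by (auto simp: A_def)
  let ?\<mu> = "D - E p z - cc * \<delta>"
  have \<sigma>: "\<bar>- cc * \<delta>\<bar> \<le> \<delta>" using cc \<delta> by (simp add: abs_mult mult_left_le_one_le)
  have X0: "\<bar>0\<bar> \<le> X" using X_bounds by simp
  obtain g where g: "g0 \<le> g" "g \<le> C" "0 < E p z" "E p z \<le> D + d z" "E p z \<le> 2 * D"
    "\<bar>r (z + cscale (Complex (D - E p z + - cc * \<delta>) 0) (\<nu> p)) + g * (- cc * \<delta>)\<bar> \<le> cp * \<delta>"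
    using strip_point[OF p z \<sigma> X0] by blast
  show "E p z \<le> D + d z" "E p z \<le> 2 * D" "0 < E p z" by fact+
  have "Complex (D - E p z + - cc * \<delta>) 0 = of_real ?\<mu>" by (simp add: complex_eq_iff)
  then have r: "\<bar>r (z + ?\<mu> *\<^sub>R \<nu> p) - g * (cc * \<delta>)\<bar> \<le> cp * \<delta>" using g(6) by (simp only: cscale_of_real mult_minus_left mult_minus_right add_uminus_conv_diff diff_conv_add_uminus[symmetric] uminus_add_conv_diff)
  have "g0 * (cc * \<delta>) \<le> g * (cc * \<delta>)" using g(1) cc \<delta> by (intro mult_right_mono) auto
  moreover have "g0 * (cc * \<delta>) = 2 * (cp * \<delta>)" by (simp add: cp_def)
  moreover have "0 < cp * \<delta>" using cp \<delta> by simp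
  ultimately have "r (z + ?\<mu> *\<^sub>R \<nu> p) > 0" using r by linarith
  then have out: "z + ?\<mu> *\<^sub>R \<nu> p \<notin> \<Omega>" unfolding \<Omega>(1) by simp
  have "?\<mu> < 0"
  proof (rule ccontr)
    assume "\<not> ?\<mu> < 0"
    moreover have "?\<mu> \<le> L" using g(3) D_bounds L_pos mult_pos_pos[OF cc(1) \<delta>(1)] by simp
    ultimately show False using out inward[OF p z1 _ _ _ L(2), of ?\<mu>] L(1) by simp
  qed
  moreover have "d z \<le> \<bar>?\<mu>\<bar>"
    using infdist_le[of "z + ?\<mu> *\<^sub>R \<nu> p" "- \<Omega>" z] out norm_\<nu>[OF p] by (simp add: dist_norm)
  ultimately show low: "D + d z - cc * \<delta> \<le> E p z" by simp
  have "cc * \<delta> \<le> 1 * D" using cc delta_small \<delta> by (intro mult_mono) auto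
  moreover have "cc * \<delta> \<le> (1/8) * D" using cc delta_small \<delta> by (intro mult_mono) auto
  ultimately show "D / 2 \<le> E p z" using low d_pos[OF z1(1)] D_bounds by simp
qed

lemma P_margin:
  assumes p: "p \<in> frontier \<Omega>" and z: "z \<in> A p" and s: "\<bar>s\<bar> \<le> X"
  shows "r (P p z s) \<le> - cp * \<delta>" "- \<delta> + cp * \<delta> \<le> r (P p z s)" "norm (P p z s - p) \<le> 3 * L" "P p z s \<in> cball 0 R"
    "norm (P p z s - z) \<le> 2"
proof -
  have \<sigma>: "\<bar>\<sigma>0\<bar> \<le> \<delta>" using \<delta> C by (simp add: \<sigma>0_def abs_mult divide_le_eq)
  obtain g where g: "g0 \<le> g" "g \<le> C" "\<bar>r (z + cscale (Complex (D - E p z + \<sigma>0) s) (\<nu> p)) + g * \<sigma>0\<bar> \<le> cp * \<delta>"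
    "z + cscale (Complex (D - E p z + \<sigma>0) s) (\<nu> p) \<in> cball 0 R"
    using strip_point[OF p z \<sigma> s] by blast
  have P: "P p z s = z + cscale (Complex (D - E p z + \<sigma>0) s) (\<nu> p)" by (simp add: P_def algebra_simps)
  show "P p z s \<in> cball 0 R" unfolding P by fact
  have "g * \<sigma>0 \<le> C * \<sigma>0" using g(2) \<delta> C by (intro mult_right_mono) (auto simp: \<sigma>0_def)
  also have "\<dots> = \<delta> / 4" using C by (simp add: \<sigma>0_def)
  finally have u: "g * \<sigma>0 \<le> \<delta> / 4" .
  \<comment> \<open>\<sigma>0 is large enough for the level \<open>- g * \<sigma>0\<close> to stay
    \<open>cp * \<delta>\<close> away from 0 after the error, and small enough to use at most a
    quarter of the strip for all \<open>g \<le> C\<close>.\<close>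
  have "2 * cp * \<delta> = (8 * C * cp) * \<sigma>0" using C by (simp add: \<sigma>0_def)
  also have "\<dots> \<le> g * \<sigma>0" using cp(3) g(1) \<delta> C by (intro mult_right_mono) (auto simp: \<sigma>0_def)
  finally have l: "2 * cp * \<delta> \<le> g * \<sigma>0" .
  have "8 * cp \<le> 8 * C * cp" using C cp by simp
  then have "cp \<le> 1/8" using cp(3) g0 by simp
  then have "cp * \<delta> \<le> 1/8 * \<delta>" using \<delta> by (intro mult_right_mono) auto
  then show "r (P p z s) \<le> - cp * \<delta>" "- \<delta> + cp * \<delta> \<le> r (P p z s)" using g(3) u l \<delta> unfolding P by (simp_all add: abs_le_iff)
  have "norm (cscale (Complex (D - E p z + \<sigma>0) s) (\<nu> p)) \<le> \<bar>D - E p z + \<sigma>0\<bar> + \<bar>s\<bar>"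
    using cmod_le[of "Complex (D - E p z + \<sigma>0) s"] norm_\<nu>[OF p] by simp
  moreover have "\<bar>D - E p z + \<sigma>0\<bar> \<le> 2 * D"
    using E_bounds[OF p z] \<sigma> delta_small D_bounds by simp
  ultimately have n: "norm (P p z s - z) \<le> 2 * D + X" unfolding P using s by simp
  then show "norm (P p z s - z) \<le> 2" using D_bounds X_bounds L by simp
  have "norm (P p z s - p) \<le> norm (P p z s - z) + norm (z - p)"
    using norm_triangle_ineq[of "P p z s - z" "z - p"] by simp
  then show "norm (P p z s - p) \<le> 3 * L" using n z D_bounds X_bounds L_pos by (simp add: A_def)
qed

lemma E_lipschitz: "\<bar>E p x - E p y\<bar> \<le> norm (x - y)"
  using d_lipschitz[of "x + D *\<^sub>R \<nu> p" "y + D *\<^sub>R \<nu> p"] by (simp add: E_def)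

lemma P_lipschitz:
  assumes p: "p \<in> frontier \<Omega>"
  shows "norm (P p x s - P p y s) \<le> 2 * norm (x - y)"
proof -
  have "P p x s - P p y s = (x - y) + cscale (of_real (E p y - E p x)) (\<nu> p)"
  proof -
    have "Complex (D + \<sigma>0 - E p x) s - Complex (D + \<sigma>0 - E p y) s = of_real (E p y - E p x)" by (simp add: complex_eq_iff)
    then have "cscale (of_real (E p y - E p x)) (\<nu> p) = cscale (Complex (D + \<sigma>0 - E p x) s) (\<nu> p) - cscale (Complex (D + \<sigma>0 - E p y) s) (\<nu> p)"
      by (simp only: cscale_diff_left[symmetric])
    then show ?thesis by (simp add: P_def)
  qed
  then have "norm (P p x s - P p y s) \<le> norm (x - y) + norm (cscale (of_real (E p y - E p x)) (\<nu> p))"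
    by (simp only: norm_triangle_ineq)
  also have "norm (cscale (of_real (E p y - E p x)) (\<nu> p)) = \<bar>E p y - E p x\<bar>" by (simp only: norm_cscale norm_of_real norm_\<nu>[OF p] mult_1_right)
  finally show ?thesis using E_lipschitz[of p y x] by (simp add: norm_minus_commute)
qed

text \<open>Moving \<open>z\<close> by less than \<open>e0\<close> moves \<open>P p z s\<close> by
  less than \<open>2 * e0\<close>, which changes \<open>r\<close> by at most half of the margin
  \<open>cp * \<delta>\<close>; segments between such points stay in the strip.\<close>

definition "e0 = cp * \<delta> / (8 * C)"

lemma e0: "0 < e0" "e0 \<le> \<delta>" "8 * C * e0 = cp * \<delta>"
proof -
  show "0 < e0" "8 * C * e0 = cp * \<delta>" using cp \<delta> C by (simp_all add: e0_def)
  have "cp * \<delta> / (8 * C) \<le> 1 * \<delta> / 1" using cp \<delta> C by (intro frac_le mult_mono) auto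
  then show "e0 \<le> \<delta>" by (simp add: e0_def)
qed

lemma \<phi>_P_lipschitz:
  assumes p: "p \<in> frontier \<Omega>" and z: "z \<in> A p" "norm (z - z') < e0" and s: "\<bar>s\<bar> \<le> X"
  shows "\<bar>\<phi> (P p z s) - \<phi> (P p z' s)\<bar> \<le> 2 * C1 * m * norm (z - z')"
proof -
  have "\<bar>\<phi> (P p z s) - \<phi> (P p z' s)\<bar> \<le> C1 * m * norm (P p z s - P p z' s)"
  proof (rule \<phi>(4))
    fix w assume w: "w \<in> closed_segment (P p z s) (P p z' s)"
    note b = P_margin[OF p z(1) s]
    have "norm (w - P p z s) \<le> norm (P p z' s - P p z s)" using segment_bound(1)[OF w] .
    also have "\<dots> \<le> 2 * norm (z - z')" using P_lipschitz[OF p] by (simp add: norm_minus_commute)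
    also have "\<dots> < 2 * e0" using z(2) by simp
    finally have w1: "norm (w - P p z s) < 2 * e0" .
    have "norm (w - p) \<le> norm (w - P p z s) + norm (P p z s - p)" using norm_triangle_ineq[of "w - P p z s" "P p z s - p"] by simp
    then have "norm (w - p) < 4 * L" using w1 b(3) e0 delta_small \<delta> by simp
    then have wU: "w \<in> U" using U(2)[OF p] L(3) by (auto simp: dist_norm norm_minus_commute)
    have "norm (w - z) \<le> norm (w - P p z s) + norm (P p z s - z)" using norm_triangle_ineq[of "w - P p z s" "P p z s - z"] by simp
    then have "dist z w \<le> 4" using w1 b(5) e0 delta_small by (simp add: dist_norm norm_minus_commute)
    then have wc: "w \<in> cball 0 R" using near[of z w] z(1) by (simp add: A_def)
    let ?h = "w - P p z s"
    have "\<bar>r w - r (P p z s) - G (P p z s) \<bullet> ?h\<bar> \<le> C * (norm ?h)\<^sup>2" by (rule G2[OF wc b(4)])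
    moreover have "\<bar>G (P p z s) \<bullet> ?h\<bar> \<le> C * norm ?h"
      using Cauchy_Schwarz_ineq2[of "G (P p z s)" ?h] mult_right_mono[OF G3[OF b(4)], of "norm ?h"] by simp
    moreover have "C * (norm ?h)\<^sup>2 \<le> C * norm ?h"
    proof -
      have "norm ?h \<le> 1" using w1 e0 delta_small by simp
      then have "(norm ?h)\<^sup>2 \<le> norm ?h" by (simp add: power2_eq_square mult_left_le)
      then show ?thesis using C by (intro mult_left_mono) auto
    qed
    moreover have "C * norm ?h \<le> C * (2 * e0)" using w1 C by (intro mult_left_mono) auto
    moreover have "4 * (C * (2 * e0)) = cp * \<delta>" using e0(3) by simp
    ultimately have "\<bar>r w - r (P p z s)\<bar> \<le> cp * \<delta> / 2" unfolding abs_le_iff by linarith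
    moreover have "cp * \<delta> > 0" using cp \<delta> by simp
    moreover have "r (P p z s) \<le> - (cp * \<delta>)" "cp * \<delta> - \<delta> \<le> r (P p z s)" using b(1,2) by simp_all
    ultimately have "- \<delta> < r w" "r w < 0" unfolding abs_le_iff by linarith+
    then show "w \<in> U \<and> - \<delta> < r w \<and> r w < 0" using wU by blast
  qed
  also have "\<dots> \<le> C1 * m * (2 * norm (z - z'))"
    using P_lipschitz[OF p] C1 m_pos by (intro mult_left_mono) auto
  finally show ?thesis by simp
qed

lemma P_in_S:
  assumes p: "p \<in> frontier \<Omega>" and z: "z \<in> A p" and s: "\<bar>s\<bar> \<le> X"
  shows "P p z s \<in> S"
proof -
  note b = P_margin[OF p z s]
  have "P p z s \<in> ball p RU" using b(3) L(3) L_pos by (simp add: dist_norm norm_minus_commute)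
  then have "P p z s \<in> U" using U(2)[OF p] by blast
  then show ?thesis using b(1,2) mult_pos_pos[OF cp(1) \<delta>(1)] by (simp add: S_def)
qed

definition "q p z = (SUP s\<in>{- X..X}. \<phi> (P p z s) - \<kappa> * s\<^sup>2)"

lemma \<kappa>: "\<kappa> > 0" "\<kappa> * X\<^sup>2 = 4 * a"
proof -
  show "\<kappa> > 0" unfolding \<kappa>_def using N(1) m_pos cx(1) by simp
  have "\<kappa> * X\<^sup>2 = 4 * (m * \<delta>)\<^sup>2 * F\<^sup>2" using cx(1) N(1) F(1) by (simp add: \<kappa>_def X_def L_def power_mult_distrib power_divide)
  also have "\<dots> = 4 * a" unfolding m_a using F by (simp add: a_def power2_eq_square)
  finally show "\<kappa> * X\<^sup>2 = 4 * a" .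
qed

lemma q_ge:
  assumes p: "p \<in> frontier \<Omega>" and z: "z \<in> A p" and s: "\<bar>s\<bar> \<le> X"
  shows "\<phi> (P p z s) - \<kappa> * s\<^sup>2 \<le> q p z"
  unfolding q_def
proof (rule cSUP_upper)
  show "s \<in> {- X..X}" using s by auto
  have "\<phi> (P p z s) - \<kappa> * s\<^sup>2 \<le> 0" if "\<bar>s\<bar> \<le> X" for s
    using \<phi>(3)[of "P p z s"] P_in_S[OF p z that] mult_nonneg_nonneg[OF less_imp_le[OF \<kappa>(1)] zero_le_power2[of s]] by (simp add: S_def)
  then show "bdd_above ((\<lambda>s. \<phi> (P p z s) - \<kappa> * s\<^sup>2) ` {- X..X})" by (intro bdd_aboveI2[of _ _ 0]) auto
qed

text \<open>Beyond \<open>X / 2\<close> the cost exceeds \<kappa> times the square of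
  \<open>X / 2\<close>, that is \<open>a\<close>, while \<phi> oscillates by at most
  \<open>a\<close> on the strip. The room up to \<open>X\<close> is for varying \<open>s\<close>
  along a disc.\<close>

lemma q_attained:
  assumes p: "p \<in> frontier \<Omega>" and z: "z \<in> A p"
  obtains s0 where "\<bar>s0\<bar> \<le> X / 2" "q p z = \<phi> (P p z s0) - \<kappa> * s0\<^sup>2"
proof -
  have "continuous_on {- X..X} (\<lambda>s. \<phi> (P p z s) - \<kappa> * s\<^sup>2)"
  proof (intro continuous_intros)
    have cP: "continuous_on {- X..X} (\<lambda>s. P p z s)"
    proof -
      have "(\<lambda>s. P p z s) = (\<lambda>s. z + cscale (of_real (D + \<sigma>0 - E p z) + \<i> * of_real s) (\<nu> p))"
        by (auto simp: P_def fun_eq_iff intro!: arg_cong[where f = "\<lambda>c. cscale c (\<nu> p)"] complex_eqI)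
      then show ?thesis by (simp only:) (intro continuous_intros)
    qed
    show "continuous_on {- X..X} (\<lambda>s. \<phi> (P p z s))"
    proof (rule continuous_on_compose2[OF _ cP subset_refl], rule continuous_at_imp_continuous_on, rule ballI)
      fix x assume "x \<in> P p z ` {- X..X}"
      then have "x \<in> S" using P_in_S[OF p z] by auto
      then have "sdiff \<phi> x" using \<phi>(2) by (simp add: S_def)
      from sdiff_cont_ball[OF this] obtain \<eta> where "\<eta> > 0" "continuous_on (ball x \<eta>) \<phi>" .
      then show "isCont \<phi> x" using continuous_on_eq_continuous_at[OF open_ball] by force
    qed
  qed
  then obtain s0 where s0: "s0 \<in> {- X..X}" "\<And>s. s \<in> {- X..X} \<Longrightarrow> \<phi> (P p z s) - \<kappa> * s\<^sup>2 \<le> \<phi> (P p z s0) - \<kappa> * s0\<^sup>2"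
    using continuous_attains_sup[of "{- X..X}" "\<lambda>s. \<phi> (P p z s) - \<kappa> * s\<^sup>2"] X_bounds(1) by force
  have eq: "q p z = \<phi> (P p z s0) - \<kappa> * s0\<^sup>2"
    unfolding q_def by (rule cSup_eq_maximum) (use s0 in auto)
  have m: "\<bar>s0\<bar> \<le> X" "\<bar>0\<bar> \<le> X" using s0(1) X_bounds by auto
  have "\<phi> (P p z 0) - \<kappa> * 0\<^sup>2 \<le> \<phi> (P p z s0) - \<kappa> * s0\<^sup>2" by (rule s0(2)) (use X_bounds in simp)
  moreover have "- a \<le> \<phi> (P p z 0)" "\<phi> (P p z s0) \<le> 0"
    using \<phi>(3) P_in_S[OF p z m(1)] P_in_S[OF p z m(2)] by (auto simp: S_def)
  ultimately have "\<kappa> * s0\<^sup>2 \<le> a" by simp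
  then have "\<kappa> * s0\<^sup>2 \<le> \<kappa> * (X / 2)\<^sup>2" using \<kappa>(2) by (simp add: power_divide)
  then have "s0\<^sup>2 \<le> (X / 2)\<^sup>2" using \<kappa>(1) by simp
  then have "\<bar>s0\<bar> \<le> X / 2" using X_bounds(1) abs_le_square_iff[of s0 "X / 2"] by simp
  then show ?thesis using that eq by blast
qed

lemma q_bounds:
  assumes p: "p \<in> frontier \<Omega>" and z: "z \<in> A p"
  shows "- a \<le> q p z" "q p z \<le> 0"
proof -
  have m: "\<bar>0\<bar> \<le> X" using X_bounds by auto
  show "- a \<le> q p z" using q_ge[OF p z m] \<phi>(3)[of "P p z 0"] P_in_S[OF p z m] by (simp add: S_def)
  obtain s0 where s0: "\<bar>s0\<bar> \<le> X / 2" "q p z = \<phi> (P p z s0) - \<kappa> * s0\<^sup>2" by (rule q_attained[OF p z])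
  have "\<phi> (P p z s0) \<le> 0" using \<phi>(3)[of "P p z s0"] P_in_S[OF p z, of s0] s0(1) X_bounds by (simp add: S_def)
  moreover have "0 \<le> \<kappa> * s0\<^sup>2" using \<kappa> by simp
  ultimately show "q p z \<le> 0" using s0(2) by simp
qed

lemma q_lipschitz:
  assumes p: "p \<in> frontier \<Omega>" and z: "z \<in> A p" "z' \<in> A p" "norm (z - z') < e0"
  shows "\<bar>q p z - q p z'\<bar> \<le> 2 * C1 * m * norm (z - z')"
proof -
  have "q p x \<le> q p y + 2 * C1 * m * norm (x - y)" if x: "x \<in> A p" and y: "y \<in> A p" and xy: "norm (x - y) < e0" for x y
  proof -
    obtain s0 where s0: "\<bar>s0\<bar> \<le> X / 2" "q p x = \<phi> (P p x s0) - \<kappa> * s0\<^sup>2" by (rule q_attained[OF p x])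
    have sX: "\<bar>s0\<bar> \<le> X" using s0(1) X_bounds by simp
    show ?thesis using s0(2) q_ge[OF p y sX] \<phi>_P_lipschitz[OF p x xy sX] by simp
  qed
  from this[OF z] this[OF z(2,1)] z(3) show ?thesis by (simp add: norm_minus_commute abs_le_iff)
qed

text \<open>Since \<open>E\<close> is close to \<open>D + d\<close>, the terms in \<open>M\<close>
  are close to \<open>- M * D * d / (D + d)\<close>, which vanishes on the boundary and has slope
  \<open>- M\<close> there. The lateral weight \<open>c1 / 8\<close> consumes only part of the Levi
  bound \<open>c1 / 2\<close>.\<close>

definition "\<Psi> p z = q p z + M * D\<^sup>2 / E p z + (- (c1 / 8)) * (norm (z - p))\<^sup>2 + (- (M * D))"

lemma M_pos: "M > 0" using M K m_pos mult_pos_pos[of K m] by linarith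

lemma \<Psi>_bounds:
  assumes p: "p \<in> frontier \<Omega>" and z: "z \<in> A p"
  shows "- (M * D * d z / (D + d z)) - a \<le> \<Psi> p z + c1 / 8 * (norm (z - p))\<^sup>2"
    and "\<Psi> p z + c1 / 8 * (norm (z - p))\<^sup>2 \<le> - (M * D * d z / (D + d z)) + a"
proof -
  note e = E_bounds[OF p z] and qb = q_bounds[OF p z]
  have dz: "d z > 0" using d_pos z by (simp add: A_def)
  have D0: "D > 0" by (rule D_bounds)
  have B: "M * D\<^sup>2 / (D + d z) - M * D = - (M * D * d z / (D + d z))"
    using D0 dz by (simp add: field_simps power2_eq_square)
  have "M * D\<^sup>2 / (D + d z) \<le> M * D\<^sup>2 / E p z"
    using e M_pos D0 dz by (intro divide_left_mono) auto
  then show "- (M * D * d z / (D + d z)) - a \<le> \<Psi> p z + c1 / 8 * (norm (z - p))\<^sup>2"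
    using qb B by (simp add: \<Psi>_def)
  have "M * D\<^sup>2 / E p z - M * D\<^sup>2 / (D + d z) = M * D\<^sup>2 * (D + d z - E p z) / (E p z * (D + d z))"
    using e(5) D0 dz by (simp add: field_simps)
  also have "\<dots> \<le> M * D\<^sup>2 * (cc * \<delta>) / ((D / 2) * D)"
  proof (rule frac_le)
    show "D / 2 * D \<le> E p z * (D + d z)" using e D0 dz by (intro mult_mono) auto
    show "M * D\<^sup>2 * (D + d z - E p z) \<le> M * D\<^sup>2 * (cc * \<delta>)" using e M_pos by (intro mult_left_mono) auto
  qed (use M_pos cc \<delta> D0 in auto)
  also have "\<dots> = 2 * M * (cc * \<delta>)" using D0 by (simp add: power2_eq_square)
  also have "\<dots> \<le> 2 * (2 * K * m) * (cc * \<delta>)"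
    using M(2) cc(1) \<delta>(1) by (intro mult_right_mono mult_left_mono) (simp_all only: mult_nonneg_nonneg less_imp_le)
  also have "\<dots> = (4 * K * cc) * a" unfolding m_a[symmetric] by simp
  also have "\<dots> \<le> 1 * a"
  proof (rule mult_right_mono)
    have "4 * K * cc = 1 / (2 * C)" using K C by (simp add: cc_def)
    then show "4 * K * cc \<le> 1" using C by simp
  qed (simp add: a_def)
  finally show "\<Psi> p z + c1 / 8 * (norm (z - p))\<^sup>2 \<le> - (M * D * d z / (D + d z)) + a"
    using qb B by (simp add: \<Psi>_def)
qed

lemma \<Psi>_lipschitz:
  assumes p: "p \<in> frontier \<Omega>" and z: "z \<in> A p" "z' \<in> A p" "norm (z - z') < e0"
  shows "\<bar>\<Psi> p z - \<Psi> p z'\<bar> \<le> (2 * C1 + 8 * K + F1\<^sup>2) * m * norm (z - z')"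
proof -
  let ?n = "norm (z - z')"
  note e = E_bounds[OF p z(1)] and e' = E_bounds[OF p z(2)]
  have D0: "D > 0" by (rule D_bounds)
  have "M * D\<^sup>2 / E p z - M * D\<^sup>2 / E p z' = M * D\<^sup>2 * (E p z' - E p z) / (E p z * E p z')"
    using e(5) e'(5) by (simp add: field_simps)
  then have "\<bar>M * D\<^sup>2 / E p z - M * D\<^sup>2 / E p z'\<bar> = M * D\<^sup>2 * \<bar>E p z' - E p z\<bar> / (E p z * E p z')"
    using e(5) e'(5) M_pos by (simp add: abs_mult)
  also have "\<dots> \<le> M * D\<^sup>2 * ?n / ((D / 2) * (D / 2))"
    using E_lipschitz[of p z' z] M_pos D0 e e' by (intro frac_le mult_left_mono mult_mono) (auto simp: norm_minus_commute)
  also have "\<dots> = 4 * M * ?n" using D0 by (simp add: power2_eq_square)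
  also have "\<dots> \<le> 4 * (2 * K * m) * ?n" using M(2) by (intro mult_right_mono mult_left_mono) simp_all
  finally have 1: "\<bar>M * D\<^sup>2 / E p z - M * D\<^sup>2 / E p z'\<bar> \<le> 8 * K * m * ?n" by simp
  have 2: "c1 / 8 * \<bar>(norm (z - p))\<^sup>2 - (norm (z' - p))\<^sup>2\<bar> \<le> F1\<^sup>2 * m * ?n"
  proof -
    have "(norm (z - p))\<^sup>2 - (norm (z' - p))\<^sup>2 = (norm (z - p) + norm (z' - p)) * (norm (z - p) - norm (z' - p))"
      by (simp add: power2_eq_square algebra_simps)
    then have "\<bar>(norm (z - p))\<^sup>2 - (norm (z' - p))\<^sup>2\<bar> = (norm (z - p) + norm (z' - p)) * \<bar>norm (z - p) - norm (z' - p)\<bar>"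
      by (simp add: abs_mult)
    also have "\<dots> \<le> 2 * ?n"
      using z(1,2) L L_pos norm_triangle_ineq3[of "z - p" "z' - p"] by (intro mult_mono) (auto simp: A_def)
    finally have "c1 / 8 * \<bar>(norm (z - p))\<^sup>2 - (norm (z' - p))\<^sup>2\<bar> \<le> 1 / 8 * (2 * ?n)" using c1 by (intro mult_mono) auto
    also have "\<dots> \<le> 1 * ?n" by simp
    also have "\<dots> \<le> (F1\<^sup>2 * m) * ?n" using m_lower F1 by (intro mult_right_mono) (auto simp: field_simps)
    finally show ?thesis .
  qed
  have "\<Psi> p z - \<Psi> p z' = (q p z - q p z') + (M * D\<^sup>2 / E p z - M * D\<^sup>2 / E p z') - c1 / 8 * ((norm (z - p))\<^sup>2 - (norm (z' - p))\<^sup>2)"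
    by (simp add: \<Psi>_def algebra_simps)
  moreover have "\<bar>c1 / 8 * ((norm (z - p))\<^sup>2 - (norm (z' - p))\<^sup>2)\<bar> = c1 / 8 * \<bar>(norm (z - p))\<^sup>2 - (norm (z' - p))\<^sup>2\<bar>"
    using c1 by (simp add: abs_mult)
  moreover have "(2 * C1 + 8 * K + F1\<^sup>2) * m * ?n = 2 * C1 * m * ?n + 8 * K * m * ?n + F1\<^sup>2 * m * ?n" by (simp add: algebra_simps)
  ultimately show ?thesis using q_lipschitz[OF p z] 1 2 by linarith
qed

lemma q_continuous:
  assumes p: "p \<in> frontier \<Omega>"
  shows "continuous_on (A p) (q p)"
  by (rule continuous_on_if_locally_lipschitz[OF e0(1) q_lipschitz[OF p]])

lemma \<Psi>_sm:
  assumes p: "p \<in> frontier \<Omega>" and z: "z \<in> A p"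
  shows "sm (\<Psi> p) (c1 / 4) z"
proof -
  note e = E_bounds[OF p z]
  have D0: "D > 0" by (rule D_bounds)
  obtain \<rho>1 where \<rho>1: "\<rho>1 > 0" "ball z \<rho>1 \<subseteq> A p" using open_A z openE by blast
  define \<rho> where "\<rho> = min \<rho>1 (E p z)"
  have \<rho>: "\<rho> > 0" "ball z \<rho> \<subseteq> A p" using \<rho>1 e(5) by (auto simp: \<rho>_def)
  obtain s0 where s0: "\<bar>s0\<bar> \<le> X / 2" "q p z = \<phi> (P p z s0) - \<kappa> * s0\<^sup>2" by (rule q_attained[OF p z])
  have cont: "continuous_on (A p) (\<lambda>z. q p z + M * D\<^sup>2 / E p z)"
  proof (intro continuous_intros q_continuous[OF p] ballI)
    have "1-lipschitz_on (A p) (E p)" by (rule lipschitz_onI) (use E_lipschitz in \<open>auto simp: dist_norm\<close>)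
    then show "continuous_on (A p) (E p)" by (rule lipschitz_on_continuous_on)
    show "E p x \<noteq> 0" if "x \<in> A p" for x using E_bounds(5)[OF p that] by simp
  qed
  have "sm (\<lambda>z. q p z + M * D\<^sup>2 / E p z) (c1 / 2) z"
  proof (rule sm_strip_extension[where S = S and \<phi> = \<phi> and \<Lambda> = "C1 * m" and \<nu> = "\<nu> p" and \<rho> = \<rho>
        and X = X and \<kappa> = \<kappa> and ?\<tau>0.0 = "D + \<sigma>0" and ?s0.0 = s0])
    show "open S" by (rule open_S)
    show "sm \<phi> c1 x" "sdiff \<phi> x" if "x \<in> S" for x using \<phi>(1,2) that by (simp_all add: S_def)
    show "\<exists>\<eta>>0. \<forall>y\<in>ball x \<eta>. \<forall>y'\<in>ball x \<eta>. \<bar>\<phi> y - \<phi> y'\<bar> \<le> C1 * m * norm (y - y')" if x: "x \<in> S" for x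
    proof -
      obtain \<eta> where \<eta>: "\<eta> > 0" "ball x \<eta> \<subseteq> S" using open_S x openE by blast
      have "\<bar>\<phi> y - \<phi> y'\<bar> \<le> C1 * m * norm (y - y')" if "y \<in> ball x \<eta>" "y' \<in> ball x \<eta>" for y y'
      proof (rule \<phi>(4))
        fix w assume "w \<in> closed_segment y y'"
        then have "w \<in> S" using \<eta>(2) closed_segment_subset[OF that convex_ball] by blast
        then show "w \<in> U \<and> - \<delta> < r w \<and> r w < 0" by (simp add: S_def)
      qed
      with \<eta>(1) show ?thesis by blast
    qed
    show "norm (\<nu> p) = 1" by (rule norm_\<nu>[OF p])
    show "0 < \<rho>" by fact
    show "\<bar>E p x - E p y\<bar> \<le> norm (x - y)" for x y by (rule E_lipschitz)
    show "0 < E p z" by fact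
    \<comment> \<open>Discs of radius below \<open>E p z\<close> about the inward translate of
      \<open>z\<close> stay in \<Omega>, so Oka's lemma applies there.\<close>
    show "- ln (E p z) \<le> cavg (\<lambda>w. - ln (E p (z + cscale w b)))" if b: "norm b < \<rho>" for b
    proof -
      have "(z + D *\<^sub>R \<nu> p) + cscale w b \<in> \<Omega>" if "cmod w \<le> 1" for w
      proof (rule ball_infdist_subset)
        have "cmod w * norm b \<le> 1 * norm b" using that by (intro mult_right_mono) auto
        then show "dist (z + D *\<^sub>R \<nu> p) ((z + D *\<^sub>R \<nu> p) + cscale w b) < d (z + D *\<^sub>R \<nu> p)"
          using b by (simp add: dist_norm \<rho>_def E_def)
      qed
      from oka[OF \<Omega>(2) psc \<Omega>(3) this] show ?thesis by (simp add: E_def add_ac)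
    qed
    show "0 < X" by (rule X_bounds)
    show "z + cscale (Complex (D + \<sigma>0 - E p z) s) (\<nu> p) \<in> S" if "\<bar>s\<bar> \<le> X" for s
      using P_in_S[OF p z that] by (simp add: P_def)
    show "\<phi> (x + cscale (Complex (D + \<sigma>0 - E p x) s) (\<nu> p)) - \<kappa> * s\<^sup>2 \<le> q p x" if "x \<in> ball z \<rho>" "\<bar>s\<bar> \<le> X" for x s
      using q_ge[OF p _ that(2), of x] \<rho>(2) that(1) by (auto simp: P_def)
    show "q p z = \<phi> (z + cscale (Complex (D + \<sigma>0 - E p z) s0) (\<nu> p)) - \<kappa> * s0\<^sup>2" using s0(2) by (simp add: P_def)
    show "\<bar>s0\<bar> \<le> X / 2" by fact
    show "continuous_on (ball z \<rho>) (q p)" by (rule continuous_on_subset[OF q_continuous[OF p] \<rho>(2)])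
    show "0 \<le> c1" "0 \<le> \<kappa>" "0 \<le> C1 * m" "0 \<le> M * D\<^sup>2" using c1 \<kappa> C1 m_pos M_pos by auto
    show "C1 * m * E p z \<le> M * D\<^sup>2 / E p z"
    proof -
      have "C1 * m * E p z * E p z \<le> C1 * m * ((2 * D) * (2 * D))"
        unfolding mult.assoc[of "C1 * m"] using e C1 m_pos D0 by (intro mult_left_mono mult_mono) auto
      also have "\<dots> = (4 * C1 * m) * D\<^sup>2" by (simp add: power2_eq_square)
      also have "\<dots> \<le> M * D\<^sup>2"
      proof (rule mult_right_mono)
        have "4 * C1 * m \<le> K * m" using C1 m_pos by (intro mult_right_mono) (auto simp: K_def)
        then show "4 * C1 * m \<le> M" using M by simp
      qed simp
      finally show ?thesis using e(5) by (simp add: pos_le_divide_eq)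
    qed
    show "2 * c1 + \<kappa> + 2 * (C1 * m) / E p z \<le> M * D\<^sup>2 / (4 * E p z ^ 3)"
    proof -
      have "D * m \<le> cD" using D_bounds(3) m_pos by (simp add: pos_le_divide_eq)
      have F14: "F1 ^ 4 > 0" using F1 by simp
      have "1 / F1 ^ 4 \<le> m * m"
      proof -
        have "(1 / F1\<^sup>2) * (1 / F1\<^sup>2) \<le> m * m" using m_lower m_pos by (intro mult_mono) auto
        then show ?thesis by (simp add: power4_eq_xxxx power2_eq_square)
      qed
      moreover have "2 * (D * m) \<le> 1 / F1 ^ 4" using \<open>D * m \<le> cD\<close> cD(4) by simp
      ultimately have "(2 * D) * m \<le> m * m" by simp
      have "2 * D \<le> m" using \<open>(2 * D) * m \<le> m * m\<close> m_pos by simp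
      have "2 * c1 * D \<le> 2 * 1 * D" using c1 D0 by (intro mult_right_mono mult_left_mono) auto
      with \<open>2 * D \<le> m\<close> have "2 * c1 * D \<le> m" by linarith
      then have a1: "2 * c1 \<le> m / D" using D0 by (simp add: pos_le_divide_eq)
      have a2: "\<kappa> \<le> m / D"
      proof -
        have "\<kappa> * D = 4 * N\<^sup>2 / cx\<^sup>2 * m * (D * m)" by (simp add: \<kappa>_def power2_eq_square)
        also have "\<dots> \<le> 4 * N\<^sup>2 / cx\<^sup>2 * m * (cx\<^sup>2 / (4 * N\<^sup>2))"
          using \<open>D * m \<le> cD\<close> cD(3) m_pos by (intro mult_left_mono) auto
        also have "\<dots> = m" using cx(1) N(1) by simp
        finally show ?thesis using D0 by (simp add: pos_le_divide_eq)
      qed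
      have "2 * (C1 * m) / E p z \<le> 2 * (C1 * m) / (D / 2)" using e C1 m_pos D0 by (intro divide_left_mono) auto
      then have a3: "2 * (C1 * m) / E p z \<le> 4 * C1 * (m / D)" by simp
      have "M * D\<^sup>2 / (4 * (2 * D) ^ 3) \<le> M * D\<^sup>2 / (4 * E p z ^ 3)"
        using e M_pos D0 by (intro divide_left_mono mult_left_mono power_mono mult_pos_pos) auto
      moreover have "M * D\<^sup>2 / (4 * (2 * D) ^ 3) = M / (32 * D)" using D0 by (simp add: power2_eq_square power3_eq_cube)
      moreover have "K * m / (32 * D) \<le> M / (32 * D)" using M D0 by (intro divide_right_mono) auto
      moreover have "K * m / (32 * D) = (2 + 4 * C1) * (m / D)" using D0 by (simp add: K_def field_simps)
      ultimately have "(2 + 4 * C1) * (m / D) \<le> M * D\<^sup>2 / (4 * E p z ^ 3)" by linarith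
      moreover have "(2 + 4 * C1) * (m / D) = 2 * (m / D) + 4 * C1 * (m / D)" by (rule distrib_right)
      ultimately show ?thesis using a1 a2 a3 by linarith
    qed
  qed
  from sm_add_norm_sq[OF this open_A z cont, of "- (c1 / 8)" p "- (M * D)"]
  have "sm (\<Psi> p) (c1 / 2 + - (c1 / 8)) z" unfolding \<Psi>_def[abs_def] .
  then show ?thesis by (rule sm_weaken) (use c1 in simp)
qed

end

section \<open>The distributional inequality\<close>

lemma sm_cmult:
  assumes "sm u c z" "k > 0"
  shows "sm (\<lambda>x. k * u x) (k * c) z"
  unfolding sm_def
proof (intro allI impI)
  fix Y and \<epsilon> :: real assume "\<epsilon> > 0"
  then have "\<epsilon> / k > 0" using assms(2) by simp
  then have "\<forall>\<^sub>F t in at_right 0. u z + (c * (norm Y)\<^sup>2 - \<epsilon> / k) * t\<^sup>2 \<le> cavg (\<lambda>v. u (z + cscale (of_real t * v) Y))"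
    using assms(1) unfolding sm_def by blast
  then show "\<forall>\<^sub>F t in at_right 0. k * u z + (k * c * (norm Y)\<^sup>2 - \<epsilon>) * t\<^sup>2 \<le> cavg (\<lambda>v. k * u (z + cscale (of_real t * v) Y))"
  proof eventually_elim
    case (elim t)
    have "k * (u z + (c * (norm Y)\<^sup>2 - \<epsilon> / k) * t\<^sup>2) \<le> k * cavg (\<lambda>v. u (z + cscale (of_real t * v) Y))"
      using elim assms(2) by (intro mult_left_mono) auto
    moreover have "k * (u z + (c * (norm Y)\<^sup>2 - \<epsilon> / k) * t\<^sup>2) = k * u z + (k * c * (norm Y)\<^sup>2 - \<epsilon>) * t\<^sup>2"
      using assms(2) by (simp add: algebra_simps)
    ultimately show ?case by (simp only: cavg_cmult)
  qed
qed

lemma sdiff_cmult: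
  assumes "sdiff u p"
  shows "sdiff (\<lambda>x. k * u x) p"
proof -
  obtain A where A: "bounded_linear A" "\<And>\<epsilon>. \<epsilon> > 0 \<Longrightarrow> \<exists>\<eta>>0. \<forall>x\<in>ball p \<eta>. \<forall>y\<in>ball p \<eta>. \<bar>u y - u x - A (y - x)\<bar> \<le> \<epsilon> * norm (y - x)"
    using assms unfolding sdiff_def by blast
  show ?thesis unfolding sdiff_def
  proof (intro exI[of _ "\<lambda>v. k * A v"] conjI allI impI)
    show "bounded_linear (\<lambda>v. k * A v)" by (rule bounded_linear_const_mult[OF A(1)])
    fix \<epsilon> :: real assume \<epsilon>: "\<epsilon> > 0"
    then have "\<epsilon> / (\<bar>k\<bar> + 1) > 0" by simp
    from A(2)[OF this] obtain \<eta> where \<eta>: "\<eta> > 0"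
      "\<And>x y. x \<in> ball p \<eta> \<Longrightarrow> y \<in> ball p \<eta> \<Longrightarrow> \<bar>u y - u x - A (y - x)\<bar> \<le> \<epsilon> / (\<bar>k\<bar> + 1) * norm (y - x)" by blast
    have "\<bar>k * u y - k * u x - k * A (y - x)\<bar> \<le> \<epsilon> * norm (y - x)" if "x \<in> ball p \<eta>" "y \<in> ball p \<eta>" for x y
    proof -
      have "k * u y - k * u x - k * A (y - x) = k * (u y - u x - A (y - x))" by (simp add: algebra_simps)
      then have "\<bar>k * u y - k * u x - k * A (y - x)\<bar> = \<bar>k\<bar> * \<bar>u y - u x - A (y - x)\<bar>" by (simp only: abs_mult)
      also have "\<dots> \<le> (\<bar>k\<bar> + 1) * (\<epsilon> / (\<bar>k\<bar> + 1) * norm (y - x))"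
        using \<eta>(2)[OF that] by (intro mult_mono) auto
      also have "\<dots> = \<epsilon> * norm (y - x)" by simp
      finally show ?thesis .
    qed
    with \<eta>(1) show "\<exists>\<eta>>0. \<forall>x\<in>ball p \<eta>. \<forall>y\<in>ball p \<eta>. \<bar>k * u y - k * u x - k * A (y - x)\<bar> \<le> \<epsilon> * norm (y - x)" by blast
  qed
qed

section \<open>Exchanging circle averages with Lebesgue integrals\<close>

lemma lborel_integral_translation:
  fixes g :: "'a::euclidean_space \<Rightarrow> real"
  assumes "g \<in> borel_measurable borel"
  shows "(LINT x|lborel. g (x + c)) = (LINT x|lborel. g x)"
proof -
  have "(LINT x|lborel. g x) = (LINT x|distr lborel borel ((+) c). g x)" by (simp only: lborel_distr_plus)
  also have "\<dots> = (LINT x|lborel. g (c + x))" using assms by (subst integral_distr) auto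
  finally show ?thesis by (simp add: add.commute)
qed

text \<open>Links the two integrals in play: the gauge integral over boxes, which can be swapped
  with \<open>cavg\<close>, and the Lebesgue integral of the distributional inequality.\<close>

lemma lborel_integral_cbox:
  fixes g :: "'a::euclidean_space \<Rightarrow> real"
  assumes "continuous_on UNIV g" "\<And>x. x \<notin> cbox a b \<Longrightarrow> g x = 0"
  shows "integrable lborel g" and "(LINT x|lborel. g x) = integral (cbox a b) g"
proof -
  have eq: "(\<lambda>x. indicator (cbox a b) x *\<^sub>R g x) = g" using assms(2) by (auto simp: indicator_def fun_eq_iff)
  have "integrable lborel (\<lambda>x. indicator (cbox a b) x *\<^sub>R g x)"
    by (rule borel_integrable_compact) (auto intro: continuous_on_subset[OF assms(1)])
  then show i: "integrable lborel g" unfolding eq .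
  have "(LINT x|lborel. g x) = integral UNIV g" using has_integral_integral_lborel[OF i] by (simp add: integral_unique)
  also have "\<dots> = integral UNIV (\<lambda>x. if x \<in> cbox a b then g x else 0)" by (rule arg_cong2[of _ _ _ _ integral]) (use assms(2) in auto)
  also have "\<dots> = integral (cbox a b) g" by (rule integral_restrict_UNIV)
  finally show "(LINT x|lborel. g x) = integral (cbox a b) g" .
qed

lemma continuous_on_uncurried:
  assumes "continuous_on UNIV (\<lambda>(x, y). h x y)" "continuous_on A f" "continuous_on A g"
  shows "continuous_on A (\<lambda>x. h (f x) (g x))"
  using continuous_on_compose2[OF assms(1) continuous_on_Pair[OF assms(2,3)] subset_UNIV] by simp

lemma continuous_cavg:
  fixes h :: "complex \<Rightarrow> 'a::euclidean_space \<Rightarrow> real"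
  assumes "continuous_on UNIV (\<lambda>(w, z). h w z)"
  shows "continuous_on UNIV (\<lambda>z. cavg (\<lambda>v. h v z))"
proof -
  have "continuous_on (UNIV \<times> cbox 0 (2*pi)) (\<lambda>x. h (cis (snd x)) (fst x))"
    by (rule continuous_on_uncurried[OF assms]) (intro continuous_intros)+
  then have "continuous_on UNIV (\<lambda>z. integral (cbox 0 (2*pi)) (\<lambda>\<theta>. h (cis \<theta>) z))"
    by (intro integral_continuous_on_param) (simp add: split_beta)
  then show ?thesis unfolding cavg_def by (intro continuous_intros) simp
qed

lemma integral_circle_swap:
  fixes H :: "complex \<Rightarrow> 'a::euclidean_space \<Rightarrow> real"
  assumes c: "continuous_on UNIV (\<lambda>(w, z). H w z)" and s: "\<And>w z. cmod w = 1 \<Longrightarrow> z \<notin> cbox a b \<Longrightarrow> H w z = 0"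
  shows "(LINT z|lborel. cavg (\<lambda>w. H w z)) = cavg (\<lambda>w. LINT z|lborel. H w z)"
proof -
  have cc': "continuous_on A (\<lambda>(z, \<theta>). H (cis \<theta>) z)" for A
    unfolding split_beta by (rule continuous_on_uncurried[OF c]) (intro continuous_intros)+
  have cz: "continuous_on UNIV (H w)" for w
    by (rule continuous_on_uncurried[OF c]) (intro continuous_intros)+
  have cI: "continuous_on UNIV (\<lambda>z. cavg (\<lambda>w. H w z))" by (rule continuous_cavg[OF c])
  have "(LINT z|lborel. cavg (\<lambda>w. H w z)) = integral (cbox a b) (\<lambda>z. cavg (\<lambda>w. H w z))"
  proof (rule lborel_integral_cbox(2)[OF cI])
    fix z assume "z \<notin> cbox a b"
    then have "cavg (\<lambda>w. H w z) = cavg (\<lambda>w. 0)" by (intro cavg_cong s)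
    then show "cavg (\<lambda>w. H w z) = 0" by simp
  qed
  also have "\<dots> = (1 / (2 * pi)) * integral (cbox a b) (\<lambda>z. integral (cbox 0 (2*pi)) (\<lambda>\<theta>. H (cis \<theta>) z))"
    by (simp add: cavg_def)
  also have "integral (cbox a b) (\<lambda>z. integral (cbox 0 (2*pi)) (\<lambda>\<theta>. H (cis \<theta>) z)) =
      integral (cbox 0 (2*pi)) (\<lambda>\<theta>. integral (cbox a b) (H (cis \<theta>)))"
    by (rule integral_swap_continuous[OF cc'])
  also have "(1 / (2 * pi)) * \<dots> = cavg (\<lambda>w. integral (cbox a b) (H w))" by (simp add: cavg_def)
  also have "\<dots> = cavg (\<lambda>w. LINT z|lborel. H w z)"
    by (rule cavg_cong) (use lborel_integral_cbox(2)[OF cz s] in simp)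
  finally show ?thesis .
qed

text \<open>Weigh the sub-mean inequality on circles of radius \<open>t * norm X\<close> with
  \<open>tf\<close>, integrate, and shift the circle average from \<rho> to \<open>tf\<close> by
  translation invariance. After division by \<open>t\<^sup>2\<close>, the average of
  \<open>tf\<close> minus \<open>tf\<close> tends to its Levi form. The extension of \<rho> by zero
  makes all integrals global.\<close>

lemma submean_distribution:
  fixes \<rho> tf :: "complex^'n \<Rightarrow> real"
  assumes \<rho>: "continuous_on UNIV \<rho>" "\<And>z. z \<notin> \<Omega> \<Longrightarrow> \<rho> z = 0" and \<Omega>: "open \<Omega>" "bounded \<Omega>"
    and sub: "\<And>a b. (\<And>w. cmod w \<le> 1 \<Longrightarrow> a + cscale w b \<in> \<Omega>) \<Longrightarrow> \<rho> a + (norm b)\<^sup>2 \<le> cavg (\<lambda>w. \<rho> (a + cscale w b))"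
    and tf: "Ck_on 2 UNIV tf" "\<And>z. tf z \<ge> 0" and K: "compact K" "K \<subseteq> \<Omega>" "\<And>z. z \<notin> K \<Longrightarrow> tf z = 0"
  shows "(norm X)\<^sup>2 * (LINT z:\<Omega>|lborel. tf z) \<le> (LINT z:\<Omega>|lborel. \<rho> z * levi UNIV tf z X)"
proof -
  have ctf: "continuous_on UNIV tf" by (rule Ck2_dirder_continuous(2)[OF open_UNIV tf(1)])
  have clev: "continuous_on UNIV (\<lambda>z. levi UNIV tf z X)"
    unfolding levi_def by (intro continuous_intros Ck2_dirder(3)[OF open_UNIV tf(1) UNIV_I]) simp
  obtain bx where bx: "\<Omega> \<subseteq> cbox (- bx) bx" using bounded_subset_cbox_symmetric[OF \<Omega>(2)] by blast
  have s1: "(LINT z:\<Omega>|lborel. tf z) = (LINT z|lborel. tf z)"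
    unfolding set_lebesgue_integral_def using K(2,3) by (intro Bochner_Integration.integral_cong) (auto simp: indicator_def)
  have s2: "(LINT z:\<Omega>|lborel. \<rho> z * levi UNIV tf z X) = (LINT z|lborel. \<rho> z * levi UNIV tf z X)"
    unfolding set_lebesgue_integral_def using \<rho>(2) by (intro Bochner_Integration.integral_cong) (auto simp: indicator_def)
  have tf0: "tf z = 0" if "z \<notin> cbox (- bx) bx" for z using K(2,3) bx that by blast
  have itf: "integrable lborel tf" by (rule lborel_integral_cbox(1)[OF ctf tf0])
  have i\<rho>: "integrable lborel (\<lambda>z. \<rho> z * levi UNIV tf z X)"
    by (rule lborel_integral_cbox(1)[of _ "- bx" bx]) (use \<rho> bx clev in \<open>auto intro!: continuous_intros\<close>)
  have ia: "integrable lborel (\<lambda>z. \<bar>\<rho> z\<bar>)"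
    by (rule lborel_integral_cbox(1)[of _ "- bx" bx]) (use \<rho> bx in \<open>auto intro!: continuous_intros\<close>)
  obtain R0 where R0: "R0 > 0" "\<And>x y. x \<in> K \<Longrightarrow> dist x y \<le> R0 \<Longrightarrow> y \<in> \<Omega>"
  proof (cases "K = {}")
    case True then show ?thesis using that[of 1] by simp
  next
    case False
    show ?thesis
    proof (cases "- \<Omega> = {}")
      case True then show ?thesis using that[of 1] by auto
    next
      case F: False
      have "setdist K (- \<Omega>) > 0" using K \<Omega> False F setdist_gt_0_compact_closed[of K "- \<Omega>"] by auto
      moreover have "y \<in> \<Omega>" if "x \<in> K" "dist x y \<le> setdist K (- \<Omega>) / 2" for x y
        using setdist_le_dist[OF that(1), of y "- \<Omega>"] that(2) \<open>setdist K (- \<Omega>) > 0\<close> by (rule_tac ccontr) simp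
      ultimately show ?thesis using that[of "setdist K (- \<Omega>) / 2"] by auto
    qed
  qed
  let ?J = "LINT z|lborel. tf z"
  have swap: "(norm (t *\<^sub>R X))\<^sup>2 * ?J \<le> (LINT z|lborel. \<rho> z * (cavg (\<lambda>v. tf (z + cscale v (t *\<^sub>R X))) - tf z))"
    if t: "norm (t *\<^sub>R X) \<le> R0" for t
  proof -
    let ?Y = "t *\<^sub>R X"
    define H where "H v z = tf z * \<rho> (z - cscale v ?Y)" for v z
    define H' where "H' v z = \<rho> z * tf (z + cscale v ?Y)" for v z
    have cH: "continuous_on UNIV (\<lambda>(w, z). H w z)" unfolding H_def split_beta
      by (intro continuous_intros continuous_on_compose2[OF ctf] continuous_on_compose2[OF \<rho>(1)]) auto
    have cH': "continuous_on UNIV (\<lambda>(w, z). H' w z)" unfolding H'_def split_beta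
      by (intro continuous_intros continuous_on_compose2[OF ctf] continuous_on_compose2[OF \<rho>(1)]) auto
    have cz: "continuous_on UNIV (H w)" for w
      by (rule continuous_on_uncurried[OF cH]) (intro continuous_intros)+
    note cHI = continuous_cavg[OF cH] and cHI' = continuous_cavg[OF cH']
    have sH: "z \<notin> cbox (- bx) bx \<Longrightarrow> H w z = 0" and sH': "z \<notin> cbox (- bx) bx \<Longrightarrow> H' w z = 0" for w z
      using K bx \<rho>(2) by (auto simp: H_def H'_def)
    have sHI: "z \<notin> cbox (- bx) bx \<Longrightarrow> cavg (\<lambda>v. H v z) = 0" and sHI': "z \<notin> cbox (- bx) bx \<Longrightarrow> cavg (\<lambda>v. H' v z) = 0" for z
      using sH[of z] sH'[of z] by simp_all
    have c0: "continuous_on UNIV (\<lambda>z. tf z * \<rho> z + (norm ?Y)\<^sup>2 * tf z)" using ctf \<rho>(1) by (intro continuous_intros)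
    have "(LINT z|lborel. tf z * \<rho> z + (norm ?Y)\<^sup>2 * tf z) \<le> (LINT z|lborel. cavg (\<lambda>v. H v z))"
    proof (rule integral_mono)
      show "integrable lborel (\<lambda>z. tf z * \<rho> z + (norm ?Y)\<^sup>2 * tf z)"
        by (rule lborel_integral_cbox(1)[OF c0, of "- bx" bx]) (simp add: tf0)
      show "integrable lborel (\<lambda>z. cavg (\<lambda>v. H v z))" by (rule lborel_integral_cbox(1)[OF cHI sHI])
      fix z
      show "tf z * \<rho> z + (norm ?Y)\<^sup>2 * tf z \<le> cavg (\<lambda>v. H v z)"
      proof (cases "z \<in> K")
        case True
        \<comment> \<open>The opposite direction \<open>- ?Y\<close> is used so that translation
          produces \<open>tf\<close> at \<open>z + cscale v ?Y\<close>.\<close>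
        have "\<rho> z + (norm (- ?Y))\<^sup>2 \<le> cavg (\<lambda>w. \<rho> (z + cscale w (- ?Y)))"
        proof (rule sub)
          fix w assume w: "cmod w \<le> 1"
          have "cmod w * norm ?Y \<le> 1 * norm ?Y" using w by (intro mult_right_mono) auto
          also have "\<dots> \<le> R0" using t by simp
          finally show "z + cscale w (- ?Y) \<in> \<Omega>"
            by (intro R0(2)[OF True]) (simp only: dist_norm cscale_minus_right norm_minus_cancel add_uminus_conv_diff diff_diff_eq2 add_diff_cancel_left' norm_cscale)
        qed
        then have "tf z * (\<rho> z + (norm ?Y)\<^sup>2) \<le> tf z * cavg (\<lambda>w. \<rho> (z - cscale w ?Y))"
          using tf(2) by (intro mult_left_mono) (simp_all only: cscale_minus_right add_uminus_conv_diff norm_minus_cancel)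
        then show ?thesis unfolding H_def cavg_cmult by (simp only: distrib_left mult.commute)
      next
        case False
        then show ?thesis using K(3) by (simp add: H_def)
      qed
    qed
    also have "\<dots> = cavg (\<lambda>v. LINT z|lborel. H v z)" by (rule integral_circle_swap[OF cH sH])
    also have "\<dots> = cavg (\<lambda>v. LINT z|lborel. H' v z)"
    proof (rule cavg_cong)
      fix v
      have "(LINT z|lborel. H v z) = (LINT z|lborel. H v (z + cscale v ?Y))"
        by (rule lborel_integral_translation[symmetric]) (rule borel_measurable_continuous_onI[OF cz])
      then show "(LINT z|lborel. H v z) = (LINT z|lborel. H' v z)" by (simp add: H_def H'_def mult.commute)
    qed
    also have "\<dots> = (LINT z|lborel. cavg (\<lambda>v. H' v z))" by (rule integral_circle_swap[OF cH' sH', symmetric])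
    finally have "(LINT z|lborel. tf z * \<rho> z + (norm ?Y)\<^sup>2 * tf z) \<le> (LINT z|lborel. cavg (\<lambda>v. H' v z))" .
    moreover have it: "integrable lborel (\<lambda>z. tf z * \<rho> z)"
      by (rule lborel_integral_cbox(1)[of _ "- bx" bx]) (use ctf \<rho>(1) K bx in \<open>auto intro!: continuous_intros\<close>)
    moreover have "(LINT z|lborel. tf z * \<rho> z + (norm ?Y)\<^sup>2 * tf z) = (LINT z|lborel. tf z * \<rho> z) + (norm ?Y)\<^sup>2 * ?J"
      using it itf by simp
    moreover have "(LINT z|lborel. cavg (\<lambda>v. H' v z) - tf z * \<rho> z) = (LINT z|lborel. cavg (\<lambda>v. H' v z)) - (LINT z|lborel. tf z * \<rho> z)"
      using it lborel_integral_cbox(1)[OF cHI' sHI'] by (rule_tac Bochner_Integration.integral_diff)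
    moreover have "(\<lambda>z. cavg (\<lambda>v. H' v z) - tf z * \<rho> z) = (\<lambda>z. \<rho> z * (cavg (\<lambda>v. tf (z + cscale v ?Y)) - tf z))"
      unfolding H'_def cavg_cmult by (simp add: algebra_simps)
    ultimately show ?thesis by simp
  qed
  have main: "(norm X)\<^sup>2 * ?J \<le> (LINT z|lborel. \<rho> z * levi UNIV tf z X) + \<epsilon> * (LINT z|lborel. \<bar>\<rho> z\<bar>)" if \<epsilon>: "\<epsilon> > 0" for \<epsilon>
  proof -
    obtain R where "\<forall>x\<in>\<Omega>. norm x \<le> R" using \<Omega>(2) unfolding bounded_iff ..
    then have R: "\<Omega> \<subseteq> cball 0 R" by auto
    have "uniformly_continuous_on (cball 0 (R + 1)) (dirder UNIV tf [a, b])" for a b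
      by (rule compact_uniformly_continuous[OF continuous_on_subset[OF Ck2_dirder(3)[OF open_UNIV tf(1) UNIV_I] subset_UNIV] compact_cball])
    then have "\<exists>\<eta>>0. \<forall>x\<in>cball 0 (R + 1). \<forall>y\<in>cball 0 (R + 1). dist y x < \<eta> \<longrightarrow> dist (dirder UNIV tf [a, b] y) (dirder UNIV tf [a, b] x) < \<epsilon>" for a b
      using \<epsilon> unfolding uniformly_continuous_on_def by (simp only:)
    then obtain \<eta> where \<eta>: "\<And>a b. \<eta> a b > 0"
       "\<And>a b x y. x \<in> cball 0 (R + 1) \<Longrightarrow> y \<in> cball 0 (R + 1) \<Longrightarrow> dist y x < \<eta> a b \<Longrightarrow> dist (dirder UNIV tf [a, b] y) (dirder UNIV tf [a, b] x) < \<epsilon>"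
      unfolding choice_iff by (simp only: Ball_def) metis
    let ?S = "{X, cscale \<i> X}"
    \<comment> \<open>A common modulus for the four second derivatives entering the Taylor
      estimate.\<close>
    define h where "h = Min ((\<lambda>(a, b). \<eta> a b) ` (?S \<times> ?S))"
    have h: "h > 0" "\<And>a b. a \<in> ?S \<Longrightarrow> b \<in> ?S \<Longrightarrow> h \<le> \<eta> a b"
    proof -
      show "h > 0" unfolding h_def by (subst Min_gr_iff) (auto simp: \<eta>(1))
      fix a b assume "a \<in> ?S" "b \<in> ?S"
      then have "(\<lambda>(a, b). \<eta> a b) (a, b) \<in> (\<lambda>(a, b). \<eta> a b) ` (?S \<times> ?S)" by (intro imageI) blast
      then have "h \<le> (\<lambda>(a, b). \<eta> a b) (a, b)" unfolding h_def by (intro Min_le) auto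
      then show "h \<le> \<eta> a b" by simp
    qed
    \<comment> \<open>The \<open>+ 1\<close> allows \<open>X = 0\<close>; the minimum keeps the
      circle within the room \<open>R0\<close>, the ball of radius \<open>R + 1\<close> and the
      modulus \<open>h\<close>.\<close>
    define t where "t = min R0 (min 1 (h / 2)) / (norm X + 1)"
    have nX: "norm X + 1 > 0" by (simp add: add_nonneg_pos)
    have t: "t > 0" using R0 h nX by (simp add: t_def)
    have "t * norm X \<le> t * (norm X + 1)" using t by simp
    also have "\<dots> = min R0 (min 1 (h / 2))" using nX by (simp add: t_def)
    finally have tX: "t * norm X \<le> R0" "t * norm X \<le> 1" "t * norm X < h" using h by auto
    have tay: "\<bar>cavg (\<lambda>v. tf (z + cscale v (t *\<^sub>R X))) - tf z - levi UNIV tf z X * t\<^sup>2\<bar> \<le> \<epsilon> * t\<^sup>2" if z: "z \<in> \<Omega>" for z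
    proof -
      have "\<bar>cavg (\<lambda>v. tf (z + cscale (of_real t * v) X)) - tf z - levi UNIV tf z X * t\<^sup>2\<bar> \<le> \<epsilon> * t\<^sup>2"
      proof (rule cavg_taylor[OF open_UNIV tf(1) t UNIV_I])
        fix x a b assume x: "norm (x - z) \<le> t * norm X" and ab: "a \<in> ?S" "b \<in> ?S"
        have z1: "norm z \<le> R" using z R by auto
        have "norm x \<le> norm (x - z) + norm z" using norm_triangle_ineq[of "x - z" z] by simp
        then have "x \<in> cball 0 (R + 1)" "z \<in> cball 0 (R + 1)" using x tX z1 by auto
        moreover have "dist x z < \<eta> a b" using x tX(3) h(2)[OF ab] by (simp add: dist_norm)
        ultimately show "\<bar>dirder UNIV tf [a, b] x - dirder UNIV tf [a, b] z\<bar> \<le> \<epsilon>"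
          using \<eta>(2)[of z x a b] unfolding dist_real_def by (simp del: dirder.simps)
      qed
      then show ?thesis by (simp only: cscale_of_real_mult)
    qed
    have "norm (t *\<^sub>R X) \<le> R0" using tX t by simp
    from swap[OF this] have "(norm (t *\<^sub>R X))\<^sup>2 * ?J \<le> (LINT z|lborel. \<rho> z * (cavg (\<lambda>v. tf (z + cscale v (t *\<^sub>R X))) - tf z))" .
    also have "\<dots> \<le> (LINT z|lborel. t\<^sup>2 * (\<rho> z * levi UNIV tf z X) + (\<epsilon> * t\<^sup>2) * \<bar>\<rho> z\<bar>)"
    proof (rule integral_mono)
      have cav: "continuous_on UNIV (\<lambda>z. cavg (\<lambda>v. tf (z + cscale v (t *\<^sub>R X))))"
        by (rule continuous_cavg) (auto simp: split_beta intro!: continuous_intros continuous_on_compose2[OF ctf])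
      show "integrable lborel (\<lambda>z. \<rho> z * (cavg (\<lambda>v. tf (z + cscale v (t *\<^sub>R X))) - tf z))"
        by (rule lborel_integral_cbox(1)[of _ "- bx" bx]) (use \<rho> bx ctf cav in \<open>auto intro!: continuous_intros\<close>)
      show "integrable lborel (\<lambda>z. t\<^sup>2 * (\<rho> z * levi UNIV tf z X) + (\<epsilon> * t\<^sup>2) * \<bar>\<rho> z\<bar>)"
        using i\<rho> ia by (intro Bochner_Integration.integrable_add integrable_mult_right)
      fix z
      show "\<rho> z * (cavg (\<lambda>v. tf (z + cscale v (t *\<^sub>R X))) - tf z) \<le> t\<^sup>2 * (\<rho> z * levi UNIV tf z X) + (\<epsilon> * t\<^sup>2) * \<bar>\<rho> z\<bar>"
      proof (cases "z \<in> \<Omega>")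
        case True
        let ?e = "cavg (\<lambda>v. tf (z + cscale v (t *\<^sub>R X))) - tf z - levi UNIV tf z X * t\<^sup>2"
        have "\<rho> z * ?e \<le> \<bar>\<rho> z\<bar> * \<bar>?e\<bar>" by (simp only: abs_mult[symmetric] abs_ge_self)
        also have "\<dots> \<le> \<bar>\<rho> z\<bar> * (\<epsilon> * t\<^sup>2)" using tay[OF True] by (intro mult_left_mono) auto
        finally show ?thesis by (simp add: algebra_simps)
      next
        case False
        then show ?thesis using \<rho>(2) by simp
      qed
    qed
    also have "\<dots> = t\<^sup>2 * ((LINT z|lborel. \<rho> z * levi UNIV tf z X) + \<epsilon> * (LINT z|lborel. \<bar>\<rho> z\<bar>))"
      using i\<rho> ia by (subst Bochner_Integration.integral_add) (simp_all add: distrib_left)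
    also have "(norm (t *\<^sub>R X))\<^sup>2 * ?J = t\<^sup>2 * ((norm X)\<^sup>2 * ?J)" by (simp add: power_mult_distrib)
    finally show ?thesis using t by simp
  qed
  have "(norm X)\<^sup>2 * ?J \<le> (LINT z|lborel. \<rho> z * levi UNIV tf z X) + e" if e: "e > 0" for e
  proof -
    define I where "I = (LINT z|lborel. \<bar>\<rho> z\<bar>)"
    have I0: "I \<ge> 0" by (simp add: I_def)
    have "e / (I + 1) > 0" using e I0 by simp
    from main[OF this] have "(norm X)\<^sup>2 * ?J \<le> (LINT z|lborel. \<rho> z * levi UNIV tf z X) + e / (I + 1) * I" by (simp add: I_def)
    moreover have "e / (I + 1) * I \<le> e" using e I0 by (simp add: field_simps)
    ultimately show ?thesis by linarith
  qed
  then show ?thesis unfolding s1 s2 by (rule field_le_epsilon)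
qed

section \<open>The growth function\<close>

locale growth =
  fixes f :: "real \<Rightarrow> real"
  assumes f1: "\<And>t. t \<ge> 1 \<Longrightarrow> f t \<ge> 1" and f_mono: "\<And>s t. 1 \<le> s \<Longrightarrow> s \<le> t \<Longrightarrow> f s \<le> f t"
    and f_sqrt: "\<And>s t. 1 \<le> s \<Longrightarrow> s \<le> t \<Longrightarrow> f t / sqrt t \<le> f s / sqrt s"
    and f_int: "set_integrable lborel {1..} (\<lambda>a. 1 / (a * f a))"
begin

lemma f_double: "t \<ge> 1 \<Longrightarrow> f (2 * t) \<le> sqrt 2 * f t"
  using f_sqrt[of t "2 * t"] by (simp add: real_sqrt_mult field_simps)

lemma f_sq_le: "t \<ge> 1 \<Longrightarrow> (f t)\<^sup>2 \<le> (f 1)\<^sup>2 * t"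
proof -
  assume t: "t \<ge> 1"
  have "f t \<le> f 1 * sqrt t" using f_sqrt[of 1 t] t by (simp add: field_simps)
  then have "(f t)\<^sup>2 \<le> (f 1 * sqrt t)\<^sup>2" using f1[OF t] by (intro power_mono) auto
  then show ?thesis using t by (simp add: power_mult_distrib)
qed

lemma gfun_nonneg: "t \<ge> 1 \<Longrightarrow> 0 \<le> (LINT a:{t..}|lborel. 1 / (a * f a))"
proof -
  assume t: "t \<ge> 1"
  have "0 \<le> 1 / (a * f a)" if "a \<in> {t..}" for a using f1[of a] that t by auto
  then show ?thesis unfolding set_lebesgue_integral_def
    by (intro Bochner_Integration.integral_nonneg) (auto simp: indicator_def)
qed

text \<open>On a dyadic block \<open>a * f a \<le> 2 * t * sqrt 2 * f t \<le> 3 * t * f t\<close>,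
  by the decrease of \<open>f t / sqrt t\<close>. The step yields both the domination of
  \<open>1 / f\<close> by \<open>1 / g\<close> and, by telescoping, the summability of
  \<open>1 / f (2 ^ k)\<close>.\<close>

lemma gfun_step:
  assumes t: "t \<ge> 1"
  shows "(LINT a:{2 * t..}|lborel. 1 / (a * f a)) + 1 / (3 * f t) \<le> (LINT a:{t..}|lborel. 1 / (a * f a))"
proof -
  have un: "{t..} = {t..<2 * t} \<union> {2 * t..}" using t by auto
  have i1: "set_integrable lborel {t..<2 * t} (\<lambda>a. 1 / (a * f a))" by (rule set_integrable_subset[OF f_int]) (use t in auto)
  have i2: "set_integrable lborel {2 * t..} (\<lambda>a. 1 / (a * f a))" by (rule set_integrable_subset[OF f_int]) (use t in auto)
  have "(LINT a:{t..}|lborel. 1 / (a * f a)) = (LINT a:{t..<2 * t}|lborel. 1 / (a * f a)) + (LINT a:{2 * t..}|lborel. 1 / (a * f a))"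
    unfolding un by (rule set_integral_Un[OF _ i1 i2]) auto
  moreover have "1 / (3 * f t) \<le> (LINT a:{t..<2 * t}|lborel. 1 / (a * f a))"
  proof -
    have "1 / (3 * f t) = (LINT a:{t..<2 * t}|lborel. 1 / (3 * t * f t))"
      using t by (simp add: set_lebesgue_integral_def)
    also have "\<dots> \<le> (LINT a:{t..<2 * t}|lborel. 1 / (a * f a))"
    proof (rule set_integral_mono[OF _ i1])
      show "set_integrable lborel {t..<2 * t} (\<lambda>a. 1 / (3 * t * f t))" unfolding set_integrable_def
        using t by (intro integrable_scaleR_left integrable_real_indicator) auto
      fix a assume a: "a \<in> {t..<2 * t}"
      have "a * f a \<le> (2 * t) * (sqrt 2 * f t)"
        using a t f_mono[of a "2 * t"] f_double[OF t] f1[of a] by (intro mult_mono) auto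
      also have "\<dots> = (2 * sqrt 2) * (t * f t)" by simp
      also have "\<dots> \<le> 3 * (t * f t)"
      proof (rule mult_right_mono)
        have "sqrt 2 \<le> 3 / 2" by (rule real_le_lsqrt) (auto simp: power2_eq_square)
        then show "2 * sqrt 2 \<le> (3::real)" by simp
      qed (use t f1[OF t] in auto)
      finally show "1 / (3 * t * f t) \<le> 1 / (a * f a)"
        using a t f1[of a] f1[OF t] by (intro divide_left_mono mult_pos_pos) auto
    qed
    finally show ?thesis .
  qed
  ultimately show ?thesis by simp
qed

text \<open>The construction produces the modulus \<open>1 / f\<^sup>2\<close>; this inequality
  passes from it to the weaker one in \<open>g\<close>.\<close>

lemma inverse_f_le_gfun: "t \<ge> 1 \<Longrightarrow> 1 / (3 * f t) \<le> 1 / gfun f t"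
  using gfun_step[of t] gfun_nonneg[of "2 * t"] by (simp add: gfun_def)

definition "F k = f (2 ^ k)"

lemma F_bounds: "F k \<ge> 1" "F k \<le> F (Suc k)" "F (Suc k) \<le> sqrt 2 * F k" "(F k)\<^sup>2 \<le> (f 1)\<^sup>2 * 2 ^ k"
  using f1[of "2 ^ k"] f_mono[of "2 ^ k" "2 ^ Suc k"] f_double[of "2 ^ k"] f_sq_le[of "2 ^ k"] by (auto simp: F_def)

lemma summable_inverse_F: "summable (\<lambda>k. 1 / F k)"
proof (rule summableI_nonneg_bounded)
  let ?I = "\<lambda>t. LINT a:{t..}|lborel. 1 / (a * f a)"
  show "0 \<le> 1 / F k" for k using F_bounds(1)[of k] by simp
  have "(\<Sum>k<n. 1 / F k) \<le> 3 * (?I 1 - ?I (2 ^ n))" for n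
  proof (induction n)
    case 0 then show ?case by simp
  next
    case (Suc n)
    have "?I (2 * 2 ^ n) + 1 / (3 * f (2 ^ n)) \<le> ?I (2 ^ n)" by (rule gfun_step) simp
    moreover have "1 / (3 * f (2 ^ n)) = (1 / F n) / 3" by (simp add: F_def)
    ultimately have "1 / F n \<le> 3 * (?I (2 ^ n) - ?I (2 ^ Suc n))" by simp
    then show ?case using Suc by simp
  qed
  moreover have "0 \<le> ?I (2 ^ n)" for n by (rule gfun_nonneg) simp
  ultimately show "(\<Sum>k<n. 1 / F k) \<le> 3 * ?I 1" for n by (smt (verit))
qed

text \<open>\<open>F k\<close> grows at most like the square root of \<open>2 ^ k\<close>, so the
  terms decay geometrically. They measure \<open>sqrt (\<delta> k / D k)\<close> on levels where
  \<open>D k\<close> is limited by the patch size.\<close>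

lemma summable_sqrt_F: "summable (\<lambda>k. sqrt (F k / 2 ^ k))"
proof (rule summable_ratio_test[of "sqrt (sqrt 2 / 2)" 0])
  have "sqrt 2 < 2" by (rule real_less_lsqrt) auto
  then show "sqrt (sqrt 2 / 2) < 1" by simp
  fix k
  have "F (Suc k) / 2 ^ Suc k \<le> sqrt 2 * F k / 2 ^ Suc k" using F_bounds(3) by (intro divide_right_mono) auto
  also have "\<dots> = (sqrt 2 / 2) * (F k / 2 ^ k)" by simp
  finally have "sqrt (F (Suc k) / 2 ^ Suc k) \<le> sqrt ((sqrt 2 / 2) * (F k / 2 ^ k))" by (rule real_sqrt_le_mono)
  then show "norm (sqrt (F (Suc k) / 2 ^ Suc k)) \<le> sqrt (sqrt 2 / 2) * norm (sqrt (F k / 2 ^ k))"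
    using F_bounds(1)[of k] F_bounds(1)[of "Suc k"] by (simp only: real_sqrt_mult) simp
qed

end

section \<open>Gluing the patches\<close>

text \<open>What gluing uses of the patches: the profile in the depth up to \<open>a k\<close>, a
  Lipschitz bound at distances below \<open>e1 * \<delta> k\<close>, and the Levi bound.
  \<open>\<eta>_sum\<close> keeps every \<open>M k\<close> within a factor 2 of
  \<open>K * m k\<close> although the correction factors increase with \<open>k\<close>.\<close>

locale glue =
  fixes \<Omega> :: "(complex^'n) set" and \<delta> m a D L M :: "nat \<Rightarrow> real" and \<Psi> :: "nat \<Rightarrow> complex^'n \<Rightarrow> complex^'n \<Rightarrow> real"
    and K c1 e1 \<Lambda> R m0 :: real
  assumes \<Omega>: "open \<Omega>" "- \<Omega> \<noteq> {}" "\<Omega> \<subseteq> cball 0 R" and R: "R > 0"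
    and \<delta>: "\<And>k. \<delta> k > 0" "\<And>k. \<delta> k = 2 * \<delta> (Suc k)"
    and m: "\<And>k. m0 \<le> m k" "\<And>k. m k \<le> m (Suc k)" "m0 > 0"
    and ma: "\<And>k. m k * \<delta> k = a k" and a: "\<And>k. a k \<le> 2 * a (Suc k)" "\<And>k. a (Suc k) \<le> a k" "a \<longlonglongrightarrow> 0"
    and D: "\<And>k. D k > 0" "\<And>k. D (Suc k) \<le> D k" "\<And>k. D k \<le> 1" "\<And>k. D k \<le> L k / 8"
    and c1: "0 < c1" "c1 \<le> 1" and L: "\<And>k. c1 * (L k)\<^sup>2 = (64 + c1) * a k"
    and K: "K \<ge> 64" and e1: "e1 > 0" and \<Lambda>: "\<Lambda> > 0"
    and \<eta>_sum: "\<And>k. (\<Sum>j\<le>k. sqrt (\<delta> j / D j)) \<le> 1 / 4"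
    and M: "\<And>k. M k = K * m k * (1 + 4 * (\<Sum>j\<le>k. sqrt (\<delta> j / D j)))"
    and \<Psi>_lower: "\<And>k p z. p \<in> frontier \<Omega> \<Longrightarrow> z \<in> \<Omega> \<Longrightarrow> infdist z (- \<Omega>) < D k \<Longrightarrow> norm (z - p) < L k \<Longrightarrow>
        - (M k * D k * infdist z (- \<Omega>) / (D k + infdist z (- \<Omega>))) - a k \<le> \<Psi> k p z + c1 / 8 * (norm (z - p))\<^sup>2"
    and \<Psi>_upper: "\<And>k p z. p \<in> frontier \<Omega> \<Longrightarrow> z \<in> \<Omega> \<Longrightarrow> infdist z (- \<Omega>) < D k \<Longrightarrow> norm (z - p) < L k \<Longrightarrow>
        \<Psi> k p z + c1 / 8 * (norm (z - p))\<^sup>2 \<le> - (M k * D k * infdist z (- \<Omega>) / (D k + infdist z (- \<Omega>))) + a k"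
    and \<Psi>_lip: "\<And>k p z z'. p \<in> frontier \<Omega> \<Longrightarrow> z \<in> \<Omega> \<Longrightarrow> infdist z (- \<Omega>) < D k \<Longrightarrow> norm (z - p) < L k \<Longrightarrow>
        z' \<in> \<Omega> \<Longrightarrow> infdist z' (- \<Omega>) < D k \<Longrightarrow> norm (z' - p) < L k \<Longrightarrow> norm (z - z') < e1 * \<delta> k \<Longrightarrow>
        \<bar>\<Psi> k p z - \<Psi> k p z'\<bar> \<le> \<Lambda> * m k * norm (z - z')"
    and \<Psi>_sm: "\<And>k p z. p \<in> frontier \<Omega> \<Longrightarrow> z \<in> \<Omega> \<Longrightarrow> infdist z (- \<Omega>) < D k \<Longrightarrow> norm (z - p) < L k \<Longrightarrow>
        sm (\<Psi> k p) (c1 / 4) z"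
begin

abbreviation d :: "complex^'n \<Rightarrow> real" where "d z \<equiv> infdist z (- \<Omega>)"

text \<open>\<eta> is the relative error of level \<open>k\<close> at depth \<open>D' k\<close>:
  there \<open>D / (D + d)\<close> differs from 1 by at most \<eta>, and
  \<open>a k = m k * \<eta> k * D' k\<close>. The geometric mean \<open>D'\<close> of \<delta> and
  \<open>D\<close> balances these two errors.\<close>

definition "\<eta> k = sqrt (\<delta> k / D k)"
definition "D' k = sqrt (\<delta> k * D k)"

section \<open>Order relations between the scales of all levels\<close>

lemma d_pos: "z \<in> \<Omega> \<Longrightarrow> 0 < d z"
  by (rule infdist_complement_pos[OF \<Omega>(1,2)])

lemma d_out [simp]: "z \<notin> \<Omega> \<Longrightarrow> d z = 0"
  by (simp add: infdist_zero)

lemma d_nonneg: "0 \<le> d z" by (rule infdist_nonneg)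

lemma d_lip: "d x \<le> d y + norm (x - y)"
  using infdist_triangle[of x "- \<Omega>" y] by (simp add: dist_norm)

lemma m_pos: "m k > 0" using m(1)[of k] m(3) by linarith

lemma a_pos: "a k > 0" using m_pos \<delta>(1) unfolding ma[symmetric] by simp

lemma L_pos: "L k > 0" using D(1)[of k] D(4)[of k] by linarith

lemma \<eta>: "0 < \<eta> k" "\<eta> k \<le> 1 / 4" "16 * \<delta> k \<le> D k"
proof -
  show "0 < \<eta> k" using \<delta>(1) D(1) by (simp add: \<eta>_def)
  have "sqrt (\<delta> k / D k) \<le> (\<Sum>j\<le>k. sqrt (\<delta> j / D j))"
    by (rule member_le_sum) (use \<delta>(1) D(1) in \<open>auto intro: less_imp_le\<close>)
  then show 1: "\<eta> k \<le> 1 / 4" using \<eta>_sum[of k] by (simp add: \<eta>_def)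
  have "(sqrt (\<delta> k / D k))\<^sup>2 \<le> (1 / 4)\<^sup>2" using 1 \<open>0 < \<eta> k\<close> unfolding \<eta>_def by (intro power_mono) auto
  then show "16 * \<delta> k \<le> D k" using \<delta>(1)[of k] D(1)[of k] by (simp add: power2_eq_square field_simps)
qed

lemma D': "0 < D' k" "\<eta> k * D' k = \<delta> k" "D' k = \<eta> k * D k" "D' k \<le> D k / 4" "4 * \<delta> k \<le> D' k" "(D' k)\<^sup>2 \<le> \<delta> k" "D' (Suc k) \<le> D' k"
proof -
  have p: "\<delta> k > 0" "D k > 0" "\<delta> (Suc k) > 0" "D (Suc k) > 0" by (rule \<delta> D)+
  show "0 < D' k" using p by (simp add: D'_def)
  show "\<eta> k * D' k = \<delta> k" using p by (simp add: \<eta>_def D'_def real_sqrt_mult[symmetric] del: real_sqrt_mult)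
  show e: "D' k = \<eta> k * D k"
  proof -
    have "sqrt (\<delta> k / D k) * sqrt (D k * D k) = sqrt (\<delta> k * D k)" using p by (simp only: real_sqrt_mult[symmetric]) simp
    then show ?thesis using p by (simp add: \<eta>_def D'_def)
  qed
  show "D' k \<le> D k / 4" unfolding e using mult_right_mono[OF \<eta>(2), of "D k" k] p by simp
  have "4 * \<delta> k = sqrt (\<delta> k * (16 * \<delta> k))" using p by (simp add: real_sqrt_mult)
  also have "\<dots> \<le> D' k" unfolding D'_def using \<eta>(3)[of k] p by (intro real_sqrt_le_mono mult_left_mono) auto
  finally show "4 * \<delta> k \<le> D' k" .
  have "(D' k)\<^sup>2 = \<delta> k * D k" using p by (simp add: D'_def)
  also have "\<dots> \<le> \<delta> k * 1" using D(3) p by (intro mult_left_mono) auto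
  finally show "(D' k)\<^sup>2 \<le> \<delta> k" by simp
  show "D' (Suc k) \<le> D' k" unfolding D'_def
    using \<delta>(2)[of k] p D(2)[of k] by (intro real_sqrt_le_mono mult_mono) auto
qed

lemma M_bounds: "K * m k \<le> M k" "M k \<le> 2 * K * m k" "0 < M k"
proof -
  have s: "0 \<le> (\<Sum>j\<le>k. sqrt (\<delta> j / D j))" by (intro sum_nonneg) (use \<delta>(1) D(1) in \<open>auto intro: less_imp_le\<close>)
  have Km: "0 < K * m k" using K m_pos[of k] by simp
  have "K * m k * 1 \<le> M k" unfolding M using s Km by (intro mult_left_mono) auto
  then show "K * m k \<le> M k" by simp
  with Km show "0 < M k" by linarith
  have "M k \<le> K * m k * 2" unfolding M using \<eta>_sum[of k] Km by (intro mult_left_mono) auto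
  then show "M k \<le> 2 * K * m k" by simp
qed

text \<open>The gain \<open>1 + 4 \<eta>\<close> in slope makes level \<open>k + 1\<close> lose against level \<open>k\<close> at depths between \<open>D' / 2\<close> and \<open>D'\<close>.\<close>
lemma M_step: "M k + 12 * m (Suc k) * \<eta> (Suc k) < M (Suc k) * (1 - \<eta> (Suc k))"
proof -
  define s where "s = 1 + 4 * (\<Sum>j\<le>k. sqrt (\<delta> j / D j))"
  define h where "h = \<eta> (Suc k)"
  have s: "1 \<le> s" "s + 4 * h \<le> 2"
  proof -
    have "0 \<le> (\<Sum>j\<le>k. sqrt (\<delta> j / D j))" by (intro sum_nonneg) (use \<delta>(1) D(1) in \<open>auto intro: less_imp_le\<close>)
    then show "1 \<le> s" by (simp add: s_def)
    show "s + 4 * h \<le> 2" using \<eta>_sum[of "Suc k"] by (simp add: s_def h_def \<eta>_def)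
  qed
  have h: "0 < h" using \<eta> by (simp add: h_def)
  have Mk: "M k = K * m k * s" "M (Suc k) = K * m (Suc k) * (s + 4 * h)"
    by (simp_all add: M s_def h_def \<eta>_def)
  have "h * (s + 4 * h) \<le> h * 2" using h s by (intro mult_left_mono) auto
  then have "s + 2 * h \<le> (s + 4 * h) * (1 - h)" by (simp add: algebra_simps)
  moreover have Km: "0 < K * m (Suc k)" using K m_pos by simp
  ultimately have "K * m (Suc k) * (s + 2 * h) \<le> K * m (Suc k) * ((s + 4 * h) * (1 - h))" by (intro mult_left_mono) auto
  then have "K * m (Suc k) * s + 2 * (K * m (Suc k) * h) \<le> M (Suc k) * (1 - h)" unfolding Mk by (simp add: algebra_simps)
  moreover have "M k \<le> K * m (Suc k) * s" unfolding Mk using m(2)[of k] K s by (intro mult_right_mono mult_left_mono) auto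
  moreover have "12 * (m (Suc k) * h) < 2 * (K * m (Suc k) * h)"
  proof -
    have "64 * (m (Suc k) * h) \<le> K * (m (Suc k) * h)" using K m_pos[of "Suc k"] h by (intro mult_right_mono) auto
    moreover have "0 < m (Suc k) * h" using m_pos h by simp
    ultimately show ?thesis by (simp only: mult.assoc)
  qed
  ultimately show ?thesis unfolding h_def by (simp add: mult_ac)
qed

definition "V k t = M k * D k * t / (D k + t)"

lemma V_bounds:
  assumes "0 \<le> t"
  shows "V k t \<le> M k * t" "t < D' k \<Longrightarrow> M k * t * (1 - \<eta> k) \<le> V k t" "t < D' k \<Longrightarrow> M k * t / 2 \<le> V k t" "0 \<le> V k t"
proof -
  have p: "D k > 0" "M k > 0" by (rule D M_bounds)+
  have q: "D k + t > 0" using p assms by simp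
  show "0 \<le> V k t" unfolding V_def using p assms by simp
  have "M k * t * D k \<le> M k * t * (D k + t)" using p assms by (intro mult_left_mono) auto
  then show "V k t \<le> M k * t" unfolding V_def using q by (simp add: pos_divide_le_eq mult_ac)
  assume t: "t < D' k"
  have "(1 - \<eta> k) * (D k + t) \<le> D k"
  proof -
    have "0 \<le> \<eta> k * t" using \<eta>(1)[of k] assms by (intro mult_nonneg_nonneg) auto
    then show ?thesis using t D'(3)[of k] by (simp add: algebra_simps)
  qed
  then have "M k * t * ((1 - \<eta> k) * (D k + t)) \<le> M k * t * D k" using p assms by (intro mult_left_mono) auto
  then show 1: "M k * t * (1 - \<eta> k) \<le> V k t" unfolding V_def using q by (simp add: pos_le_divide_eq mult_ac)
  have "M k * t * (1 / 2) \<le> M k * t * (1 - \<eta> k)" using \<eta>(2)[of k] p assms by (intro mult_left_mono) auto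
  with 1 show "M k * t / 2 \<le> V k t" by simp
qed

text \<open>\<open>Q\<close> will be the floor of the maximum deep inside. \<beta> is chosen so that
  level 0 at depth \<open>D' 0 / 2\<close>, where it is at most \<open>- (3 / 2 * \<beta>)\<close>,
  has fallen below the range of \<open>Q\<close>; \<epsilon> makes \<open>Q\<close> vary by at most
  \<open>\<beta> / 4\<close>.\<close>

definition "\<beta> = M 0 * D' 0 / 4"
definition "\<epsilon> = \<beta> / (4 * R\<^sup>2)"
definition "Q z = \<epsilon> * (norm z)\<^sup>2 - \<epsilon> * R\<^sup>2 - \<beta> / 2"

lemma \<beta>: "\<beta> > 0" "\<epsilon> > 0" "\<epsilon> * R\<^sup>2 = \<beta> / 4"
proof -
  show "\<beta> > 0" using M_bounds(3) D'(1) by (simp add: \<beta>_def)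
  then show "\<epsilon> > 0" "\<epsilon> * R\<^sup>2 = \<beta> / 4" using R by (simp_all add: \<epsilon>_def)
qed

lemma Q_bounds: "z \<in> \<Omega> \<Longrightarrow> - (3 / 4 * \<beta>) \<le> Q z" "z \<in> \<Omega> \<Longrightarrow> Q z \<le> - \<beta> / 2"
proof -
  show "- (3 / 4 * \<beta>) \<le> Q z"
  proof -
    have "0 \<le> \<epsilon> * (norm z)\<^sup>2" using \<beta> by simp
    then show ?thesis using \<beta>(3) unfolding Q_def by linarith
  qed
  assume "z \<in> \<Omega>"
  then have "norm z \<le> R" using \<Omega>(3) by auto
  then have "(norm z)\<^sup>2 \<le> R\<^sup>2" by (intro power_mono) auto
  then have "\<epsilon> * (norm z)\<^sup>2 \<le> \<epsilon> * R\<^sup>2" using \<beta>(2) by (intro mult_left_mono) auto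
  then show "Q z \<le> - \<beta> / 2" by (simp add: Q_def)
qed

lemma Q_lip: "x \<in> \<Omega> \<Longrightarrow> y \<in> \<Omega> \<Longrightarrow> \<bar>Q x - Q y\<bar> \<le> 2 * \<epsilon> * R * norm (x - y)"
proof -
  assume "x \<in> \<Omega>" "y \<in> \<Omega>"
  then have n: "norm x \<le> R" "norm y \<le> R" using \<Omega>(3) by auto
  have "Q x - Q y = \<epsilon> * ((norm x + norm y) * (norm x - norm y))" by (simp add: Q_def power2_eq_square algebra_simps)
  then have "\<bar>Q x - Q y\<bar> = \<epsilon> * ((norm x + norm y) * \<bar>norm x - norm y\<bar>)" using \<beta>(2) by (simp add: abs_mult)
  also have "\<dots> \<le> \<epsilon> * ((2 * R) * norm (x - y))"
    using n \<beta>(2) R norm_triangle_ineq3[of x y] by (intro mult_left_mono mult_mono) auto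
  finally show ?thesis by simp
qed

definition "T k = (SOME T. finite T \<and> T \<subseteq> frontier \<Omega> \<and> frontier \<Omega> \<subseteq> (\<Union>x\<in>T. ball x (L k / 8)))"

lemma T: "finite (T k)" "T k \<subseteq> frontier \<Omega>" "frontier \<Omega> \<subseteq> (\<Union>x\<in>T k. ball x (L k / 8))"
proof -
  have "bounded \<Omega>" using \<Omega>(3) bounded_cball bounded_subset by blast
  then have "compact (frontier \<Omega>)" by (rule compact_frontier_bounded)
  then have "\<exists>T. finite T \<and> T \<subseteq> frontier \<Omega> \<and> frontier \<Omega> \<subseteq> (\<Union>x\<in>T. ball x (L k / 8))"
    using seq_compact_imp_totally_bounded[of "frontier \<Omega>"] L_pos[of k] by (auto simp: compact_eq_seq_compact_metric)
  from someI_ex[OF this] show "finite (T k)" "T k \<subseteq> frontier \<Omega>" "frontier \<Omega> \<subseteq> (\<Union>x\<in>T k. ball x (L k / 8))"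
    unfolding T_def[symmetric] by blast+
qed

text \<open>The segment to the nearest outside point meets the boundary within
  \<open>d z < L k / 8\<close>, and the net has mesh \<open>L k / 8\<close>. So near the boundary
  some patch is always available well inside its lateral range.\<close>

lemma near_T:
  assumes z: "z \<in> \<Omega>" "d z < D' k"
  obtains p where "p \<in> T k" "norm (z - p) < L k / 4"
proof -
  have "closed (- \<Omega>)" using \<Omega>(1) by (simp add: closed_Compl)
  then obtain y where y: "y \<in> - \<Omega>" "d z = dist z y" using infdist_attains_inf[OF _ \<Omega>(2)] by metis
  have "closed_segment z y \<inter> frontier \<Omega> \<noteq> {}"
    by (rule connected_Int_frontier) (use z(1) y(1) in auto)
  then obtain x where x: "x \<in> closed_segment z y" "x \<in> frontier \<Omega>" by blast
  have "norm (x - z) \<le> norm (y - z)" by (rule segment_bound(1)[OF x(1)])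
  then have "norm (z - x) \<le> d z" using y(2) by (simp add: dist_norm norm_minus_commute)
  also have "\<dots> < L k / 8" using z(2) D'(4)[of k] D(4)[of k] L_pos[of k] by linarith
  finally have zx: "norm (z - x) < L k / 8" .
  obtain p where p: "p \<in> T k" "dist p x < L k / 8" using T(3)[of k] x(2) by auto
  have "norm (z - p) \<le> norm (z - x) + norm (x - p)" using norm_triangle_ineq[of "z - x" "x - p"] by simp
  then have "norm (z - p) < L k / 4" using zx p(2) by (simp add: dist_norm norm_minus_commute)
  with p(1) show ?thesis by (rule that)
qed

definition "valid z k p \<longleftrightarrow> p \<in> T k \<and> d z < D' k \<and> norm (z - p) < L k"
text \<open>Subtracting \<open>a k\<close> compensates the error in the upper profile bound, so that
  each piece is at most \<open>- V k (d z)\<close> and \<rho> is negative in \<Omega>.\<close>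

definition "vals z = insert (Q z) {\<Psi> k p z - a k | k p. valid z k p}"
definition "\<rho> z = (if z \<in> \<Omega> then Max (vals z) else 0)"

lemma valid_D:
  assumes "valid z k p"
  shows "p \<in> frontier \<Omega>" "d z < D k" "norm (z - p) < L k" "d z < D' k" "p \<in> T k"
  using assms T(2)[of k] D'(4)[of k] D(1)[of k] by (auto simp: valid_def)

lemma \<delta>_pow: "\<delta> k = \<delta> 0 / 2 ^ k"
proof (induction k)
  case (Suc k) then show ?case using \<delta>(2)[of k] by simp
qed simp

text \<open>At a given depth only finitely many levels take part, because \<open>D' k\<close> tends
  to 0; this is what makes the maximum meaningful.\<close>

lemma finite_vals: assumes z: "z \<in> \<Omega>" shows "finite (vals z)"
proof -
  have "((\<lambda>k. \<delta> 0 / 2 ^ k) \<longlongrightarrow> 0) sequentially" by (rule LIMSEQ_divide_realpow_zero) simp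
  then have "\<forall>\<^sub>F k in sequentially. \<delta> 0 / 2 ^ k < (d z)\<^sup>2" using d_pos[OF z] by (intro order_tendstoD(2)) auto
  then obtain n where n: "\<And>k. k \<ge> n \<Longrightarrow> \<delta> k < (d z)\<^sup>2" unfolding eventually_sequentially \<delta>_pow[symmetric] by blast
  have "k < n" if "valid z k p" for k p
  proof (rule ccontr)
    assume "\<not> k < n"
    then have "\<delta> k < (d z)\<^sup>2" using n by simp
    moreover have "(d z)\<^sup>2 \<le> (D' k)\<^sup>2" using valid_D(4)[OF that] d_nonneg by (intro power_mono) auto
    ultimately show False using D'(6)[of k] by linarith
  qed
  then have "{\<Psi> k p z - a k | k p. valid z k p} \<subseteq> (\<lambda>(k, p). \<Psi> k p z - a k) ` (SIGMA k:{..<n}. T k)"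
    using valid_D(5) by force
  moreover have "finite ((\<lambda>(k, p). \<Psi> k p z - a k) ` (SIGMA k:{..<n}. T k))" using T(1) by (intro finite_imageI finite_SigmaI) auto
  ultimately show ?thesis unfolding vals_def by (simp add: finite_subset)
qed

lemma \<rho>_ge:
  assumes z: "z \<in> \<Omega>"
  shows "Q z \<le> \<rho> z" "valid z k p \<Longrightarrow> \<Psi> k p z - a k \<le> \<rho> z"
  using Max_ge[OF finite_vals[OF z]] z by (auto simp: \<rho>_def vals_def)

lemma \<rho>_attained:
  assumes z: "z \<in> \<Omega>"
  obtains "\<rho> z = Q z" | k p where "valid z k p" "\<rho> z = \<Psi> k p z - a k"
proof -
  have "\<rho> z \<in> vals z" unfolding \<rho>_def using z Max_in[OF finite_vals[OF z]] by (auto simp: vals_def)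
  then show ?thesis using that by (auto simp: vals_def)
qed

text \<open>A patch centred within \<open>L k / 4\<close> loses at most \<open>a k\<close> through
  the lateral term; with the error of the profile and the shift in \<open>vals\<close> this makes
  \<open>3 * a k\<close>.\<close>

lemma \<rho>_lower:
  assumes z: "z \<in> \<Omega>" "d z < D' k"
  shows "- V k (d z) - 3 * a k \<le> \<rho> z"
proof -
  obtain p where p: "p \<in> T k" "norm (z - p) < L k / 4" using near_T[OF z] .
  have v: "valid z k p" using p z L_pos[of k] by (simp add: valid_def)
  note vD = valid_D[OF v]
  have "(norm (z - p))\<^sup>2 \<le> (L k / 4)\<^sup>2" using p(2) by (intro power_mono) auto
  then have "c1 * (norm (z - p))\<^sup>2 \<le> c1 * (L k / 4)\<^sup>2" using c1 by (intro mult_left_mono) auto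
  also have "\<dots> = (c1 * (L k)\<^sup>2) / 16" by (simp add: power_divide)
  also have "\<dots> = (64 + c1) * a k / 16" by (simp only: L)
  also have "\<dots> \<le> 65 * a k / 16" using c1 a_pos[of k] by (intro divide_right_mono mult_right_mono) auto
  finally have "c1 / 8 * (norm (z - p))\<^sup>2 \<le> a k" using a_pos[of k] by simp
  moreover have "- V k (d z) - a k \<le> \<Psi> k p z + c1 / 8 * (norm (z - p))\<^sup>2"
    unfolding V_def by (rule \<Psi>_lower[OF vD(1) z(1) vD(2,3)])
  ultimately show ?thesis using \<rho>_ge(2)[OF z(1) v] by linarith
qed

lemma \<Psi>_le:
  assumes z: "z \<in> \<Omega>" and v: "valid z k p"
  shows "\<Psi> k p z - a k \<le> - V k (d z) - c1 / 8 * (norm (z - p))\<^sup>2"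
  using \<Psi>_upper[OF valid_D(1)[OF v] z valid_D(2,3)[OF v]] unfolding V_def by linarith

text \<open>A piece attaining the maximum does so strictly inside its region, both laterally and in
  depth. Hence the maximum over pieces with different domains is continuous across their
  edges.\<close>

lemma active:
  assumes z: "z \<in> \<Omega>" and v: "valid z k p" "\<rho> z = \<Psi> k p z - a k"
  shows "norm (z - p) < 3 / 4 * L k" "d z < D' k / 2" "\<rho> z \<le> - (M k * d z / 2)"
proof -
  note vD = valid_D[OF v(1)]
  have up: "\<rho> z \<le> - V k (d z) - c1 / 8 * (norm (z - p))\<^sup>2" using \<Psi>_le[OF z v(1)] v(2) by simp
  have sq: "0 \<le> c1 / 8 * (norm (z - p))\<^sup>2" using c1 by simp
  show "\<rho> z \<le> - (M k * d z / 2)" using up sq V_bounds(3)[OF d_nonneg vD(4)] by linarith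
  show "norm (z - p) < 3 / 4 * L k"
  proof (rule ccontr)
    \<comment> \<open>At this distance the lateral term is at least \<open>36 / 8 * a k\<close>,
      more than the gap \<open>3 * a k\<close> to the lower bound.\<close>
    assume "\<not> norm (z - p) < 3 / 4 * L k"
    then have "(3 / 4 * L k)\<^sup>2 \<le> (norm (z - p))\<^sup>2" using L_pos[of k] by (intro power_mono) auto
    then have "c1 * (3 / 4 * L k)\<^sup>2 \<le> c1 * (norm (z - p))\<^sup>2" using c1 by (intro mult_left_mono) auto
    moreover have "c1 * (3 / 4 * L k)\<^sup>2 = 9 / 16 * (c1 * (L k)\<^sup>2)" by (simp add: power_mult_distrib power2_eq_square)
    moreover have "64 * a k \<le> (64 + c1) * a k" using c1 a_pos[of k] by (intro mult_right_mono) auto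
    ultimately have "36 * a k \<le> c1 * (norm (z - p))\<^sup>2" unfolding L by simp
    then show False using up \<rho>_lower[OF z vD(4)] a_pos[of k] by simp
  qed
  show "d z < D' k / 2"
  proof (rule ccontr)
    assume n: "\<not> d z < D' k / 2"
    have up': "\<rho> z \<le> - (M k * d z * (1 - \<eta> k))" using up sq V_bounds(2)[OF d_nonneg vD(4)] by linarith
    show False
    proof (cases k)
      \<comment> \<open>Level 0 has no predecessor and loses against \<open>Q\<close>
        instead.\<close>
      case 0
      have "M 0 * d z * (3 / 4) \<le> M 0 * d z * (1 - \<eta> 0)" using \<eta>(2)[of 0] M_bounds(3)[of 0] d_nonneg[of z] by (intro mult_left_mono) auto
      moreover have "M 0 * (D' 0 / 2) \<le> M 0 * d z" using n 0 M_bounds(3)[of 0] by (intro mult_left_mono) auto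
      moreover have "M 0 * (D' 0 / 2) = 2 * \<beta>" by (simp add: \<beta>_def)
      ultimately have "\<rho> z \<le> - (3 / 2 * \<beta>)" using up' 0 by simp
      then show False using \<rho>_ge(1)[OF z] Q_bounds(1)[OF z] \<beta>(1) by simp
    next
      case (Suc j)
      have "d z < D' j" using vD(4) D'(7)[of j] Suc by simp
      from \<rho>_lower[OF z this] have lo: "- (M j * d z) - 3 * a j \<le> \<rho> z" using V_bounds(1)[OF d_nonneg, of j z] by linarith
      \<comment> \<open>The error \<open>3 * a j\<close> of the previous level in terms of the
        present one: \<open>a j \<le> 2 * a k\<close> and \<open>D' k \<le> 2 * d z\<close> turn it
        into \<open>12 * m k * \<eta> k * d z\<close>, the term that \<open>M_step\<close> allows
        for.\<close>
      have "a j \<le> 2 * a k" using a(1)[of j] Suc by simp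
      also have "a k = m k * (\<eta> k * D' k)" unfolding ma[symmetric] D'(2) ..
      also have "2 * (m k * (\<eta> k * D' k)) \<le> 2 * (m k * (\<eta> k * (2 * d z)))"
        using n m_pos[of k] \<eta>(1)[of k] by (intro mult_left_mono) auto
      finally have "3 * a j \<le> 12 * m k * \<eta> k * d z" by (simp add: mult_ac)
      moreover have "(M j + 12 * m k * \<eta> k) * d z < (M k * (1 - \<eta> k)) * d z"
        using M_step[of j] Suc d_pos[OF z] by (intro mult_strict_right_mono) auto
      ultimately show False using lo up' by (simp add: algebra_simps)
    qed
  qed
qed

lemma \<rho>_neg:
  assumes z: "z \<in> \<Omega>"
  shows "\<rho> z < 0"
proof (rule \<rho>_attained[OF z])
  assume "\<rho> z = Q z" then show ?thesis using Q_bounds(2)[OF z] \<beta>(1) by simp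
next
  fix k p assume v: "valid z k p" "\<rho> z = \<Psi> k p z - a k"
  have "0 < M k * d z" using M_bounds(3) d_pos[OF z] by simp
  then show ?thesis using active(3)[OF z v] by simp
qed

lemma \<rho>_bound: "\<bar>\<rho> z\<bar> \<le> \<beta>"
proof (cases "z \<in> \<Omega>")
  case True
  then show ?thesis using \<rho>_neg[OF True] \<rho>_ge(1)[OF True] Q_bounds(1)[OF True] \<beta>(1) by simp
qed (use \<beta> in \<open>simp add: \<rho>_def\<close>)

lemma \<rho>_near_boundary:
  assumes "d z < 2 * \<delta> k"
  shows "\<bar>\<rho> z\<bar> \<le> (4 * K + 3) * a k"
proof (cases "z \<in> \<Omega>")
  case True
  have "d z < D' k" using assms D'(5)[of k] \<delta>(1)[of k] by linarith
  then have "- V k (d z) - 3 * a k \<le> \<rho> z" by (rule \<rho>_lower[OF True])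
  moreover have "V k (d z) \<le> M k * d z" by (rule V_bounds(1)[OF d_nonneg])
  moreover have "M k * d z \<le> (2 * K * m k) * (2 * \<delta> k)"
    using M_bounds(2,3)[of k] assms d_nonneg[of z] K m_pos[of k] by (intro mult_mono) auto
  moreover have "(2 * K * m k) * (2 * \<delta> k) = 4 * K * a k" unfolding ma[symmetric] by simp
  ultimately show ?thesis using \<rho>_neg[OF True] by (simp add: distrib_right)
qed (use K a_pos[of k] in \<open>simp add: \<rho>_def\<close>)

text \<open>The first summand is for the slope of \<open>Q\<close>, the second for the slopes of
  active pieces by \<open>active_slope\<close>; both are measured in units of
  \<open>m k \<ge> m0\<close>.\<close>

definition "B = 2 * \<epsilon> * R / m0 + \<Lambda> * (9 + \<beta> / \<delta> 0 / m0)"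

lemma B_pos: "B > 0"
proof -
  have "0 \<le> 2 * \<epsilon> * R / m0" "0 \<le> \<beta> / \<delta> 0 / m0" using \<beta> R m(3) \<delta>(1)[of 0] by simp_all
  then have "0 < 9 + \<beta> / \<delta> 0 / m0" by linarith
  then show ?thesis unfolding B_def by (rule add_nonneg_pos[OF \<open>0 \<le> 2 * \<epsilon> * R / m0\<close> mult_pos_pos[OF \<Lambda>]])
qed

section \<open>The modulus of continuity of the glued function\<close>

lemma m_mono: "i \<le> j \<Longrightarrow> m i \<le> m j" by (rule lift_Suc_mono_le[of m]) (use m(2) in auto)

lemma a_anti: "i \<le> j \<Longrightarrow> a j \<le> a i" by (rule lift_Suc_antimono_le[of a]) (use a(2) in auto)

lemma \<delta>_anti: "i \<le> j \<Longrightarrow> \<delta> j \<le> \<delta> i" 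
proof (rule lift_Suc_antimono_le[of \<delta>])
  show "\<delta> (Suc k) \<le> \<delta> k" for k using \<delta>(1)[of "Suc k"] \<delta>(2)[of k] by linarith
qed

lemma ex_level:
  assumes "0 < t" "t < \<delta> 0"
  obtains k where "\<delta> (Suc k) \<le> t" "t < \<delta> k"
proof -
  have "((\<lambda>k. \<delta> 0 / 2 ^ k) \<longlongrightarrow> 0) sequentially" by (rule LIMSEQ_divide_realpow_zero) simp
  then have "\<forall>\<^sub>F k in sequentially. \<delta> 0 / 2 ^ k < t" using assms(1) by (intro order_tendstoD(2)) auto
  then obtain n where "\<forall>i\<ge>n. \<delta> i < t" unfolding eventually_sequentially \<delta>_pow[symmetric] ..
  then have n: "\<delta> n \<le> t" by (simp add: less_imp_le)
  define k where "k = (LEAST n. \<delta> n \<le> t)"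
  have k: "\<delta> k \<le> t" unfolding k_def by (rule LeastI[of "\<lambda>n. \<delta> n \<le> t"]) (rule n)
  then have "k \<noteq> 0" using assms(2) by (intro notI) simp
  then obtain j where j: "k = Suc j" using not0_implies_Suc by blast
  then have "\<not> \<delta> j \<le> t" using not_less_Least[of j "\<lambda>n. \<delta> n \<le> t"] by (simp add: k_def)
  then show ?thesis using that[of j] k j by simp
qed

text \<open>An active piece at depth at least \<open>\<delta> k\<close> has a level \<open>j\<close> with \<open>m j\<close> comparable to \<open>m k\<close>, since otherwise its value
  would be below the lower bound for \<open>\<rho>\<close> at that depth.\<close>
lemma active_slope:
  assumes z: "z \<in> \<Omega>" "\<delta> k \<le> d z" and v: "valid z j p" "\<rho> z = \<Psi> j p z - a j"
  shows "m j \<le> (9 + \<beta> / \<delta> 0 / m0) * m k"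
proof -
  have up: "\<rho> z \<le> - (M j * d z / 2)" by (rule active(3)[OF z(1) v])
  have dz: "d z > 0" by (rule d_pos[OF z(1)])
  have "64 * (m j * d z) \<le> K * (m j * d z)" using K m_pos[of j] dz by (intro mult_right_mono) auto
  moreover have "K * m j * d z \<le> M j * d z" using M_bounds(1)[of j] dz by (intro mult_right_mono) auto
  ultimately have lo: "64 * (m j * d z) \<le> M j * d z" by (simp add: mult_ac)
  have nn: "0 \<le> \<beta> / \<delta> 0 / m0" using \<beta> m(3) \<delta>(1)[of 0] by simp
  show ?thesis
  proof (cases "d z < \<delta> 0")
    case False
    have "m j * \<delta> 0 \<le> m j * d z" using False m_pos[of j] by (intro mult_left_mono) auto
    also have "\<dots> \<le> \<beta>"
    proof -
      have "- \<beta> \<le> \<rho> z" using \<rho>_bound[of z] by simp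
      moreover have "0 < m j * d z" using m_pos[of j] dz by simp
      ultimately show ?thesis using up lo by linarith
    qed
    finally have "m j \<le> \<beta> / \<delta> 0" using \<delta>(1)[of 0] by (simp add: pos_le_divide_eq)
    also have "\<dots> = \<beta> / \<delta> 0 / m0 * m0" using m(3) by simp
    also have "\<dots> \<le> (9 + \<beta> / \<delta> 0 / m0) * m k" using m(1)[of k] m(3) nn by (intro mult_mono) auto
    finally show ?thesis .
  next
    case True
    obtain i where i: "\<delta> (Suc i) \<le> d z" "d z < \<delta> i" using ex_level[OF dz True] .
    have "\<not> k \<le> i"
    proof
      assume "k \<le> i" then have "\<delta> i \<le> \<delta> k" by (rule \<delta>_anti)
      then show False using i(2) z(2) by simp
    qed
    then have ik: "Suc i \<le> k" by simp
    have "\<bar>\<rho> z\<bar> \<le> (4 * K + 3) * a (Suc i)" by (rule \<rho>_near_boundary) (use i(2) \<delta>(2)[of i] in simp)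
    then have "M j * d z / 2 \<le> (4 * K + 3) * a (Suc i)" using up by linarith
    moreover have "K * m j * d z \<le> M j * d z" using M_bounds(1)[of j] dz by (intro mult_right_mono) auto
    moreover have "a (Suc i) \<le> m k * d z"
      unfolding ma[symmetric] using m_mono[OF ik] i(1) m_pos[of k] \<delta>(1)[of "Suc i"] by (intro mult_mono) auto
    then have "(4 * K + 3) * a (Suc i) \<le> (4 * K + 3) * (m k * d z)" using K by (intro mult_left_mono) auto
    ultimately have "K * (m j * d z) \<le> (8 * K + 6) * (m k * d z)" by (simp add: mult.assoc) (simp add: algebra_simps)
    also have "\<dots> \<le> (9 * K) * (m k * d z)" using K m_pos[of k] dz by (intro mult_right_mono) auto
    finally have "K * d z * (m j) \<le> K * d z * (9 * m k)" by (simp add: mult_ac)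
    moreover have "0 < K * d z" using K dz by simp
    ultimately have "m j \<le> 9 * m k" by (rule mult_left_le_imp_le)
    also have "\<dots> \<le> (9 + \<beta> / \<delta> 0 / m0) * m k" using nn m_pos[of k] by (intro mult_right_mono) auto
    finally show ?thesis .
  qed
qed

text \<open>The piece active at \<open>x\<close> is still valid at \<open>y\<close>, since active
  pieces keep off their edges, and bounds \<rho> from below there. The radius depends on
  \<open>k\<close> alone, as chaining along a segment requires.\<close>

lemma \<rho>_one_sided:
  "\<exists>r>0. \<forall>x\<in>\<Omega>. \<forall>y. \<delta> k \<le> d x \<longrightarrow> norm (x - y) < r \<longrightarrow> \<rho> x - B * m k * norm (x - y) \<le> \<rho> y"
proof (intro exI conjI ballI allI impI)
  \<comment> \<open>A piece of level \<open>j\<close> active at depth at least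
    \<open>\<delta> k\<close> has \<open>D' j > \<delta> k\<close>, hence
    \<open>\<delta> j \<ge> (\<delta> k)\<^sup>2\<close>; so the Lipschitz range
    \<open>e1 * \<delta> j\<close> is at least this radius, whatever \<open>j\<close> is.\<close>
  define r where "r = min (\<delta> k) (e1 * (\<delta> k)\<^sup>2)"
  show "r > 0" using \<delta>(1)[of k] e1 by (simp add: r_def)
  fix x y assume x: "x \<in> \<Omega>" "\<delta> k \<le> d x" and xy: "norm (x - y) < r"
  have y: "y \<in> \<Omega>" by (rule ball_infdist_subset[of x]) (use x xy in \<open>simp add: dist_norm r_def\<close>)
  have nn: "0 \<le> norm (x - y)" by simp
  show "\<rho> x - B * m k * norm (x - y) \<le> \<rho> y"
  proof (rule \<rho>_attained[OF x(1)])
    assume "\<rho> x = Q x"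
    moreover have "2 * \<epsilon> * R \<le> B * m k"
    proof -
      have "2 * \<epsilon> * R = 2 * \<epsilon> * R / m0 * m0" using m(3) by simp
      also have "\<dots> \<le> B * m k"
        using m(1)[of k] m(3) \<beta> R B_pos \<Lambda> \<delta>(1)[of 0] by (intro mult_mono) (auto simp: B_def)
      finally show ?thesis .
    qed
    then have "2 * \<epsilon> * R * norm (x - y) \<le> B * m k * norm (x - y)" by (rule mult_right_mono) simp
    ultimately show ?thesis using Q_lip[OF x(1) y] \<rho>_ge(1)[OF y] by linarith
  next
    fix j p assume v: "valid x j p" "\<rho> x = \<Psi> j p x - a j"
    note vD = valid_D[OF v(1)] and ac = active[OF x(1) v]
    have dk: "d x \<le> D' j" using vD(4) by simp
    have "(\<delta> k)\<^sup>2 \<le> (D' j)\<^sup>2" using x(2) dk \<delta>(1)[of k] by (intro power_mono) auto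
    then have "e1 * (\<delta> k)\<^sup>2 \<le> e1 * \<delta> j" using D'(6)[of j] e1 by (intro mult_left_mono) auto
    then have n1: "norm (x - y) < e1 * \<delta> j" using xy by (simp add: r_def)
    have n2: "norm (x - y) < d x" using xy x(2) by (simp add: r_def)
    have dy: "d y < D' j" using d_lip[of y x] n2 ac(2) by (simp add: norm_minus_commute)
    have "norm (y - p) \<le> norm (x - y) + norm (x - p)" using norm_triangle_ineq[of "y - x" "x - p"] by (simp add: norm_minus_commute)
    then have "norm (y - p) < L j" using n2 ac(1,2) D'(4)[of j] D(4)[of j] L_pos[of j] by linarith
    then have vy: "valid y j p" using vD(5) dy by (simp add: valid_def)
    note wD = valid_D[OF vy]
    have "\<bar>\<Psi> j p x - \<Psi> j p y\<bar> \<le> \<Lambda> * m j * norm (x - y)"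
      by (rule \<Psi>_lip[OF vD(1) x(1) vD(2,3) y wD(2,3) n1])
    moreover have "\<Lambda> * m j * norm (x - y) \<le> B * m k * norm (x - y)"
    proof (rule mult_right_mono)
      have "\<Lambda> * m j \<le> \<Lambda> * ((9 + \<beta> / \<delta> 0 / m0) * m k)" using active_slope[OF x v] \<Lambda> by (intro mult_left_mono) auto
      also have "\<dots> = (\<Lambda> * (9 + \<beta> / \<delta> 0 / m0)) * m k" by simp
      also have "\<dots> \<le> B * m k" using m_pos[of k] \<beta> R m(3) by (intro mult_right_mono) (auto simp: B_def)
      finally show "\<Lambda> * m j \<le> B * m k" .
    qed simp
    ultimately show ?thesis using v(2) \<rho>_ge(2)[OF y vy] by linarith
  qed
qed

text \<open>The one-sided estimate in both directions, chained over equal steps shorter than its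
  radius.\<close>

lemma \<rho>_segment:
  assumes seg: "\<And>w. w \<in> closed_segment x y \<Longrightarrow> \<delta> k \<le> d w"
  shows "\<bar>\<rho> x - \<rho> y\<bar> \<le> B * m k * norm (x - y)"
proof -
  obtain r where r: "r > 0" "\<And>x y. x \<in> \<Omega> \<Longrightarrow> \<delta> k \<le> d x \<Longrightarrow> norm (x - y) < r \<Longrightarrow> \<rho> x - B * m k * norm (x - y) \<le> \<rho> y"
    using \<rho>_one_sided[of k] by blast
  obtain n :: nat where n: "norm (x - y) < n * r" using reals_Archimedean3[OF r(1)] by blast
  then have n0: "n > 0" using norm_ge_zero[of "x - y"] by (intro Nat.gr0I) auto
  define g where "g i = x + (real i / n) *\<^sub>R (y - x)" for i :: nat
  have gs: "g i \<in> closed_segment x y" if "i \<le> n" for i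
    using that n0 unfolding closed_segment_def g_def
    by (intro CollectI exI[of _ "real i / n"]) (auto simp: algebra_simps)
  have g\<Omega>: "g i \<in> \<Omega>" "\<delta> k \<le> d (g i)" if "i \<le> n" for i
  proof -
    show 1: "\<delta> k \<le> d (g i)" by (rule seg[OF gs[OF that]])
    show "g i \<in> \<Omega>" by (rule ccontr) (use 1 \<delta>(1)[of k] in simp)
  qed
  have gd: "norm (g i - g (Suc i)) = norm (x - y) / n" for i
  proof -
    have "g i - g (Suc i) = (1 / n) *\<^sub>R (x - y)" by (simp add: g_def algebra_simps add_divide_distrib)
    then show ?thesis using n0 by simp
  qed
  have step: "\<bar>\<rho> (g i) - \<rho> (g (Suc i))\<bar> \<le> B * m k * (norm (x - y) / n)" if "Suc i \<le> n" for i
  proof -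
    have "norm (g i - g (Suc i)) < r" using n n0 unfolding gd by (simp add: pos_divide_less_eq mult.commute)
    then show ?thesis
      using r(2)[of "g i" "g (Suc i)"] r(2)[of "g (Suc i)" "g i"] g\<Omega>[of i] g\<Omega>[of "Suc i"] that gd[of i]
      by (simp add: norm_minus_commute abs_le_iff)
  qed
  have "\<bar>\<rho> (g 0) - \<rho> (g i)\<bar> \<le> i * (B * m k * (norm (x - y) / n))" if "i \<le> n" for i
    using that
  proof (induction i)
    case (Suc i)
    have "\<bar>\<rho> (g 0) - \<rho> (g i)\<bar> \<le> i * (B * m k * (norm (x - y) / n))" using Suc by simp
    moreover have "real (Suc i) * (B * m k * (norm (x - y) / n)) = i * (B * m k * (norm (x - y) / n)) + B * m k * (norm (x - y) / n)"
      by (simp only: of_nat_Suc distrib_right mult_1_left add.commute)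
    ultimately show ?case using step[OF Suc.prems] by linarith
  qed simp
  from this[of n] have "\<bar>\<rho> (g 0) - \<rho> (g n)\<bar> \<le> n * (B * m k * (norm (x - y) / n))" by simp
  then show ?thesis using n0 by (simp add: g_def)
qed

definition "C' = max (max (4 * (4 * K + 3)) (2 * B)) (2 * \<beta> / a 1)"

text \<open>If one point has depth at least \<open>8 * \<delta> k\<close>, the whole segment has
  depth at least \<open>\<delta> k\<close> and the slope \<open>B * m k\<close> applies. Otherwise
  both values are small: \<open>8 * \<delta> k\<close> is \<open>2 * \<delta> (k - 2)\<close>, and
  two levels change \<open>a\<close> by a factor of at most 4. For \<open>k < 2\<close> the global
  bound \<beta> takes over.\<close>

lemma \<rho>_modulus:
  assumes s: "norm (x - y) < 2 * \<delta> k"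
  shows "\<bar>\<rho> x - \<rho> y\<bar> \<le> 2 * C' * a k"
proof -
  have deep: "\<bar>\<rho> x - \<rho> y\<bar> \<le> 2 * C' * a k" if s: "norm (x - y) < 2 * \<delta> k" and dx: "8 * \<delta> k \<le> d x" for x y
  proof -
    have "\<bar>\<rho> x - \<rho> y\<bar> \<le> B * m k * norm (x - y)"
    proof (rule \<rho>_segment)
      fix w assume "w \<in> closed_segment x y"
      then have "norm (w - x) \<le> norm (y - x)" by (rule segment_bound(1))
      then show "\<delta> k \<le> d w" using d_lip[of x w] s dx \<delta>(1)[of k] by (simp add: norm_minus_commute)
    qed
    also have "\<dots> \<le> B * m k * (2 * \<delta> k)" using s B_pos m_pos[of k] by (intro mult_left_mono) auto
    also have "\<dots> = 2 * B * a k" unfolding ma[symmetric] by simp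
    also have "\<dots> \<le> (2 * C') * a k" using a_pos[of k] B_pos by (intro mult_right_mono) (auto simp: C'_def)
    finally show ?thesis .
  qed
  consider "8 * \<delta> k \<le> d x" | "8 * \<delta> k \<le> d y" | "d x < 8 * \<delta> k" "d y < 8 * \<delta> k" by linarith
  then show ?thesis
  proof cases
    case 1 then show ?thesis by (rule deep[OF s])
  next
    case 2
    have "norm (y - x) < 2 * \<delta> k" using s by (simp add: norm_minus_commute)
    from deep[OF this 2] show ?thesis by (simp add: abs_minus_commute)
  next
    case 3
    have "\<bar>\<rho> z\<bar> \<le> C' * a k" if z: "d z < 8 * \<delta> k" for z
    proof (cases "k \<ge> 2")
      case True
      then obtain j where j: "k = Suc (Suc j)" by (metis add_2_eq_Suc le_Suc_ex)
      have "\<bar>\<rho> z\<bar> \<le> (4 * K + 3) * a j"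
        by (rule \<rho>_near_boundary) (use z \<delta>(2)[of j] \<delta>(2)[of "Suc j"] j in simp)
      also have "\<dots> \<le> (4 * K + 3) * (4 * a k)" using a(1)[of j] a(1)[of "Suc j"] j K by (intro mult_left_mono) auto
      also have "\<dots> = (4 * (4 * K + 3)) * a k" by simp
      also have "\<dots> \<le> C' * a k" using a_pos[of k] by (intro mult_right_mono) (auto simp: C'_def)
      finally show ?thesis .
    next
      case False
      have "\<bar>\<rho> z\<bar> \<le> \<beta>" by (rule \<rho>_bound)
      also have "\<dots> \<le> 2 * \<beta> / a 1 * a 1" using a_pos[of 1] \<beta>(1) by simp
      also have "\<dots> \<le> C' * a k"
        using a_anti[of k 1] False a_pos[of 1] a_pos[of k] K \<beta>(1) by (intro mult_mono) (auto simp: C'_def)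
      finally show ?thesis .
    qed
    from this[OF 3(1)] this[OF 3(2)] show ?thesis by linarith
  qed
qed

lemma C'_pos: "C' > 0" using K by (simp add: C'_def less_max_iff_disj)

lemma \<rho>_continuous: "continuous_on UNIV \<rho>"
  unfolding continuous_on_iff
proof (intro ballI allI impI)
  fix x and e :: real assume e: "0 < e"
  have "((\<lambda>k. 2 * C' * a k) \<longlongrightarrow> 2 * C' * 0) sequentially" by (intro tendsto_intros a(3))
  then have "\<forall>\<^sub>F k in sequentially. 2 * C' * a k < e" using e by (intro order_tendstoD(2)) auto
  then obtain k where k: "2 * C' * a k < e" unfolding eventually_sequentially by blast
  show "\<exists>d>0. \<forall>x'\<in>UNIV. dist x' x < d \<longrightarrow> dist (\<rho> x') (\<rho> x) < e"
  proof (intro exI[of _ "2 * \<delta> k"] conjI ballI impI)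
    show "0 < 2 * \<delta> k" using \<delta>(1) by simp
    fix x' assume "dist x' x < 2 * \<delta> k"
    then have "\<bar>\<rho> x' - \<rho> x\<bar> \<le> 2 * C' * a k" by (intro \<rho>_modulus) (simp add: dist_norm)
    then show "dist (\<rho> x') (\<rho> x) < e" using k by (simp add: dist_real_def)
  qed
qed

definition "c0 = min (c1 / 4) \<epsilon>"

lemma c0: "c0 > 0" using c1 \<beta> by (simp add: c0_def)

lemma sm_Q: "sm Q \<epsilon> z"
proof -
  have "sm (\<lambda>_. 0) 0 z" unfolding sm_def
    by (intro allI impI always_eventually) (simp add: mult_nonneg_nonneg)
  from sm_add_norm_sq[OF this open_UNIV UNIV_I continuous_on_const, of \<epsilon> 0 "- \<epsilon> * R\<^sup>2 - \<beta> / 2"]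
  show ?thesis unfolding Q_def[abs_def] by (simp add: algebra_simps)
qed

text \<open>The attaining piece touches \<rho> from below at \<open>z\<close> on an open set where
  it stays valid, and \<open>sm\<close> passes upward at a point of contact.\<close>

lemma \<rho>_sm:
  assumes z: "z \<in> \<Omega>"
  shows "sm \<rho> c0 z"
proof (rule \<rho>_attained[OF z])
  assume eq: "\<rho> z = Q z"
  have cQ: "continuous_on \<Omega> Q" unfolding Q_def by (intro continuous_intros)
  have "sm \<rho> \<epsilon> z"
    by (rule sm_mono_at[OF sm_Q \<Omega>(1) z cQ continuous_on_subset[OF \<rho>_continuous subset_UNIV] eq[symmetric] \<rho>_ge(1)])
  then show ?thesis by (rule sm_weaken) (simp add: c0_def)
next
  fix k p assume v: "valid z k p" "\<rho> z = \<Psi> k p z - a k"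
  define V where "V = {x\<in>\<Omega>. d x < D' k \<and> norm (x - p) < L k}"
  have zV: "z \<in> V" using z valid_D[OF v(1)] by (simp add: V_def)
  have "open V"
  proof -
    have "open {x. d x < D' k}" by (rule open_Collect_less) (auto intro!: continuous_intros)
    moreover have "open {x. norm (x - p) < L k}" by (rule open_Collect_less) (auto intro!: continuous_intros)
    moreover have "V = \<Omega> \<inter> {x. d x < D' k} \<inter> {x. norm (x - p) < L k}" by (auto simp: V_def)
    ultimately show ?thesis using \<Omega>(1) by (simp add: open_Int)
  qed
  have val: "valid x k p" if "x \<in> V" for x using that valid_D(5)[OF v(1)] by (simp add: V_def valid_def)
  have "e1 * \<delta> k > 0" using e1 \<delta>(1) by simp
  then have c\<Psi>: "continuous_on V (\<Psi> k p)"
  proof (rule continuous_on_if_locally_lipschitz)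
    fix x y assume xy: "x \<in> V" "y \<in> V" "norm (x - y) < e1 * \<delta> k"
    note xD = valid_D[OF val[OF xy(1)]] and yD = valid_D[OF val[OF xy(2)]]
    show "\<bar>\<Psi> k p x - \<Psi> k p y\<bar> \<le> \<Lambda> * m k * norm (x - y)"
      by (rule \<Psi>_lip[OF xD(1) _ xD(2,3) _ yD(2,3) xy(3)]) (use xy in \<open>auto simp: V_def\<close>)
  qed
  note zD = valid_D[OF v(1)]
  have "sm (\<lambda>x. \<Psi> k p x + 0 * (norm (x - 0))\<^sup>2 + (- a k)) (c1 / 4 + 0) z"
    by (rule sm_add_norm_sq[OF \<Psi>_sm[OF zD(1) z zD(2,3)] \<open>open V\<close> zV c\<Psi>])
  then have s: "sm (\<lambda>x. \<Psi> k p x - a k) (c1 / 4) z" by simp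
  have "sm \<rho> (c1 / 4) z"
  proof (rule sm_mono_at[OF s \<open>open V\<close> zV _ continuous_on_subset[OF \<rho>_continuous subset_UNIV] v(2)[symmetric]])
    show "continuous_on V (\<lambda>x. \<Psi> k p x - a k)" by (intro continuous_intros c\<Psi>)
    show "\<Psi> k p x - a k \<le> \<rho> x" if "x \<in> V" for x by (rule \<rho>_ge(2)[OF _ val[OF that]]) (use that in \<open>simp add: V_def\<close>)
  qed
  then show ?thesis by (rule sm_weaken) (simp add: c0_def)
qed

end

section \<open>The defining function\<close>

text \<open>\<open>\<phi> k\<close> is the function of the f-Property for the strip width
  \<open>1 / 2 ^ k\<close>, divided by the square of \<open>F k\<close>; levels start at 1 because
  the property concerns widths below 1.\<close>

locale f_scale = c2_patch \<Omega> r G C g0 R c1 C1 F1 + growth f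
  for \<Omega> :: "(complex^'n) set" and r G C g0 R c1 C1 F1 and f +
  fixes RU :: real and U :: "(complex^'n) set" and \<phi> :: "nat \<Rightarrow> complex^'n \<Rightarrow> real"
  assumes F1f: "F1 = f 1" and RU: "RU > 0"
    and U: "open U" "\<And>p. p \<in> frontier \<Omega> \<Longrightarrow> ball p RU \<subseteq> U" and rcont: "continuous_on UNIV r"
    and \<phi>: "\<And>k x. k \<ge> 1 \<Longrightarrow> x \<in> U \<Longrightarrow> - (1 / 2 ^ k) < r x \<Longrightarrow> r x < 0 \<Longrightarrow> sm (\<phi> k) c1 x"
      "\<And>k x. k \<ge> 1 \<Longrightarrow> x \<in> U \<Longrightarrow> - (1 / 2 ^ k) < r x \<Longrightarrow> r x < 0 \<Longrightarrow> sdiff (\<phi> k) x"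
      "\<And>k x. k \<ge> 1 \<Longrightarrow> x \<in> U \<Longrightarrow> - (1 / 2 ^ k) < r x \<Longrightarrow> r x < 0 \<Longrightarrow> - (1 / (F k)\<^sup>2) \<le> \<phi> k x \<and> \<phi> k x \<le> 0"
      "\<And>k x y. k \<ge> 1 \<Longrightarrow> (\<And>w. w \<in> closed_segment x y \<Longrightarrow> w \<in> U \<and> - (1 / 2 ^ k) < r w \<and> r w < 0) \<Longrightarrow>
         \<bar>\<phi> k x - \<phi> k y\<bar> \<le> C1 * (1 / (1 / 2 ^ k * (F k)\<^sup>2)) * norm (x - y)"
begin

definition "\<mu> k = 1 / (1 / 2 ^ k * (F k)\<^sup>2)"
definition "Dk k = cD * min (1 / \<mu> k) (N / F k)"

lemma F_pos: "F k > 0" using F_bounds(1)[of k] by linarith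

lemma F_sq_double: "(F (Suc k))\<^sup>2 \<le> 2 * (F k)\<^sup>2"
proof -
  have "(F (Suc k))\<^sup>2 \<le> (sqrt 2 * F k)\<^sup>2" using F_bounds(3)[of k] F_pos[of "Suc k"] by (intro power_mono) auto
  then show ?thesis by (simp add: power_mult_distrib)
qed

lemma \<mu>: "\<mu> k > 0" "1 / F1\<^sup>2 \<le> \<mu> k" "\<mu> k \<le> \<mu> (Suc k)" "\<mu> k * (1 / 2 ^ k) = 1 / (F k)\<^sup>2"
proof -
  have p: "(F k)\<^sup>2 > 0" "(F (Suc k))\<^sup>2 > 0" "F1\<^sup>2 > 0" using F_pos[of k] F_pos[of "Suc k"] F1 by simp_all
  have e: "\<mu> k = 2 ^ k / (F k)\<^sup>2" for k by (simp add: \<mu>_def)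
  show "\<mu> k > 0" "\<mu> k * (1 / 2 ^ k) = 1 / (F k)\<^sup>2" unfolding e using p by simp_all
  show "1 / F1\<^sup>2 \<le> \<mu> k" unfolding e using F_bounds(4)[of k] p F1f by (simp add: field_simps)
  have "2 ^ k * (F (Suc k))\<^sup>2 \<le> 2 ^ k * (2 * (F k)\<^sup>2)" by (rule mult_left_mono[OF F_sq_double]) simp
  then show "\<mu> k \<le> \<mu> (Suc k)" unfolding e using p by (simp add: field_simps)
qed

lemma N_F_pos: "N / F k > 0" using N(1) F_pos by simp

lemma Dk: "Dk k > 0" "Dk k \<le> N / F k / 8" "Dk (Suc k) \<le> Dk k"
proof -
  show "Dk k > 0" using cD \<mu>(1) N_F_pos by (simp add: Dk_def)
  have "cD * min (1 / \<mu> k) (N / F k) \<le> (1 / 8) * (N / F k)" using cD N_F_pos[of k] \<mu>(1)[of k] by (intro mult_mono) auto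
  then show "Dk k \<le> N / F k / 8" by (simp add: Dk_def)
  have "1 / \<mu> (Suc k) \<le> 1 / \<mu> k" using \<mu>(1,3)[of k] \<mu>(1)[of "Suc k"] by (intro divide_left_mono) auto
  moreover have "N / F (Suc k) \<le> N / F k" using F_bounds(2)[of k] F_pos[of k] F_pos[of "Suc k"] N(1) by (intro divide_left_mono) auto
  ultimately show "Dk (Suc k) \<le> Dk k" unfolding Dk_def using cD by (intro mult_left_mono) auto
qed

text \<open>Up to the factor \<open>cD\<close>, \<open>1 / Dk k\<close> is at most
  \<open>\<mu> k + F k / N\<close>, and \<open>\<mu> k / 2 ^ k\<close> is the square of
  \<open>1 / F k\<close>. After the square root the first part is summable by the integrability of
  \<open>1 / (a * f a)\<close>, and the second decays geometrically.\<close>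

lemma summable_ratio: "summable (\<lambda>k. sqrt (1 / 2 ^ k / Dk k))"
proof (rule summable_comparison_test')
  show "summable (\<lambda>k. sqrt (1 / cD) * (1 / F k + sqrt (F k / 2 ^ k)))"
    by (intro summable_mult summable_add summable_inverse_F summable_sqrt_F)
  fix k :: nat
  have p: "1 / \<mu> k > 0" "N / F k > 0" using \<mu>(1) N_F_pos by simp_all
  have "1 / 2 ^ k / Dk k = 1 / cD * (1 / 2 ^ k * (1 / min (1 / \<mu> k) (N / F k)))" by (simp add: Dk_def)
  also have "\<dots> \<le> 1 / cD * ((1 / F k)\<^sup>2 + F k / 2 ^ k)"
  proof (intro mult_left_mono)
    have "1 / min (1 / \<mu> k) (N / F k) \<le> \<mu> k + F k / N" using p \<mu>(1)[of k] F_pos[of k] N(1) by (simp add: min_def)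
    then have "1 / 2 ^ k * (1 / min (1 / \<mu> k) (N / F k)) \<le> 1 / 2 ^ k * (\<mu> k + F k / N)" by (intro mult_left_mono) auto
    also have "\<dots> = (1 / F k)\<^sup>2 + F k / 2 ^ k / N" using \<mu>(4)[of k] by (simp add: distrib_left mult.commute power_divide)
    also have "F k / 2 ^ k / N \<le> F k / 2 ^ k / 1" using N(1) F_pos[of k] by (intro divide_left_mono) auto
    finally show "1 / 2 ^ k * (1 / min (1 / \<mu> k) (N / F k)) \<le> (1 / F k)\<^sup>2 + F k / 2 ^ k" by simp
  qed (use cD in simp)
  finally have "sqrt (1 / 2 ^ k / Dk k) \<le> sqrt (1 / cD * ((1 / F k)\<^sup>2 + F k / 2 ^ k))" by (rule real_sqrt_le_mono)
  also have "\<dots> = sqrt (1 / cD) * sqrt ((1 / F k)\<^sup>2 + F k / 2 ^ k)" by (rule real_sqrt_mult)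
  also have "\<dots> \<le> sqrt (1 / cD) * (sqrt ((1 / F k)\<^sup>2) + sqrt (F k / 2 ^ k))"
    using cD F_pos[of k] by (intro mult_left_mono sqrt_add_le_add_sqrt) auto
  also have "sqrt ((1 / F k)\<^sup>2) = 1 / F k" using F_pos[of k] by simp
  finally show "norm (sqrt (1 / 2 ^ k / Dk k)) \<le> sqrt (1 / cD) * (1 / F k + sqrt (F k / 2 ^ k))" using Dk(1)[of k] by simp
qed

lemma F_tendsto: "(\<lambda>k. 1 / F k) \<longlonglongrightarrow> 0"
  by (rule summable_LIMSEQ_zero[OF summable_inverse_F])

text \<open>All smallness conditions hold from some level on, and the partial sums of a tail of the
  convergent series are at most 1/4; the gluing starts at such a level.\<close>

lemma ex_start:
  obtains k0 where "k0 \<ge> 1" "\<And>k. k \<ge> k0 \<Longrightarrow> 1 / 2 ^ k \<le> cp / (24 * C)" "\<And>k. k \<ge> k0 \<Longrightarrow> N / F k \<le> 1 / 8"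
    "\<And>k. k \<ge> k0 \<Longrightarrow> 2 * C * (N / F k) \<le> g0" "\<And>k. k \<ge> k0 \<Longrightarrow> 4 * (N / F k) \<le> RU"
    "\<And>n. (\<Sum>j\<le>n. sqrt (1 / 2 ^ (k0 + j) / Dk (k0 + j))) \<le> 1 / 4"
proof -
  define l where "l = min (1 / 8) (min (g0 / (2 * C)) (RU / 4))"
  have l: "l > 0" using g0 C RU by (simp add: l_def)
  have "(\<lambda>k. N * (1 / F k)) \<longlonglongrightarrow> N * 0" by (intro tendsto_intros F_tendsto)
  then have "\<forall>\<^sub>F k in sequentially. N * (1 / F k) < l" using l by (intro order_tendstoD(2)) auto
  moreover have "(\<lambda>k. 1 / 2 ^ k :: real) \<longlonglongrightarrow> 0" by (rule LIMSEQ_divide_realpow_zero) simp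
  then have "\<forall>\<^sub>F k in sequentially. 1 / 2 ^ k < cp / (24 * C)" using cp C by (intro order_tendstoD(2)) auto
  ultimately have "\<forall>\<^sub>F k in sequentially. N * (1 / F k) < l \<and> 1 / 2 ^ k < cp / (24 * C)" by eventually_elim simp
  then obtain n1 where n1: "\<And>k. k \<ge> n1 \<Longrightarrow> N * (1 / F k) < l \<and> 1 / 2 ^ k < cp / (24 * C)" unfolding eventually_sequentially by blast
  have "(0::real) < 1 / 4" by simp
  from summable_partial_sum_bound[OF summable_ratio this]
  obtain n2 where n2: "\<And>i j. i \<ge> n2 \<Longrightarrow> norm (\<Sum>k=i..j. sqrt (1 / 2 ^ k / Dk k)) < 1 / 4" by metis
  let ?k = "max 1 (max n1 n2)"
  have sh: "(\<Sum>j\<le>n. h (?k + j)) = (\<Sum>k=?k..?k + n. h k)" for n and h :: "nat \<Rightarrow> real" by (induction n) auto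
  have s: "(\<Sum>j\<le>n. sqrt (1 / 2 ^ (?k + j) / Dk (?k + j))) \<le> 1 / 4" for n
  proof -
    have "norm (\<Sum>k=?k..?k + n. sqrt (1 / 2 ^ k / Dk k)) < 1 / 4" by (rule n2) simp
    then show ?thesis unfolding sh[of "\<lambda>k. sqrt (1 / 2 ^ k / Dk k)"] real_norm_def by linarith
  qed
  show ?thesis
  proof (rule that[of ?k])
    fix k assume k: "k \<ge> ?k"
    have n: "N / F k < l" "1 / 2 ^ k < cp / (24 * C)" using n1[of k] k by auto
    show "1 / 2 ^ k \<le> cp / (24 * C)" "N / F k \<le> 1 / 8" "4 * (N / F k) \<le> RU" using n unfolding l_def by linarith+
    have "N / F k \<le> g0 / (2 * C)" using n by (simp add: l_def)
    then have "N / F k * (2 * C) \<le> g0" using C by (simp add: pos_le_divide_eq)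
    then show "2 * C * (N / F k) \<le> g0" by (simp add: mult.commute)
  qed (use s in auto)
qed

lemma exists_glue:
  obtains k0 D L M \<Psi> e1 \<Lambda> R' m0 where
    "glue \<Omega> (\<lambda>k. 1 / 2 ^ (k0 + k)) (\<lambda>k. \<mu> (k0 + k)) (\<lambda>k. 1 / (F (k0 + k))\<^sup>2) D L M \<Psi> K c1 e1 \<Lambda> R' m0"
proof -
  obtain k0 where k0: "k0 \<ge> 1" "\<And>k. k \<ge> k0 \<Longrightarrow> 1 / 2 ^ k \<le> cp / (24 * C)" "\<And>k. k \<ge> k0 \<Longrightarrow> N / F k \<le> 1 / 8"
    "\<And>k. k \<ge> k0 \<Longrightarrow> 2 * C * (N / F k) \<le> g0" "\<And>k. k \<ge> k0 \<Longrightarrow> 4 * (N / F k) \<le> RU"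
    "\<And>n. (\<Sum>j\<le>n. sqrt (1 / 2 ^ (k0 + j) / Dk (k0 + j))) \<le> 1 / 4"
    by (rule ex_start) (rule that; blast)
  define M where "M k = K * \<mu> (k0 + k) * (1 + 4 * (\<Sum>j\<le>k. sqrt (1 / 2 ^ (k0 + j) / Dk (k0 + j))))" for k
  define \<Psi> where "\<Psi> k = c2_scale.\<Psi> \<Omega> G C g0 c1 C1 F1 (1 / 2 ^ (k0 + k)) (F (k0 + k)) (M k) (\<phi> (k0 + k))" for k
  have nn: "0 \<le> sqrt (1 / 2 ^ j / Dk j)" for j using Dk(1)[of j] by simp
  have Mb: "K * \<mu> (k0 + k) \<le> M k" "M k \<le> 2 * K * \<mu> (k0 + k)" for k
  proof -
    have Km: "0 \<le> K * \<mu> (k0 + k)" using K \<mu>(1)[of "k0 + k"] by simp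
    have "0 \<le> (\<Sum>j\<le>k. sqrt (1 / 2 ^ (k0 + j) / Dk (k0 + j)))" by (intro sum_nonneg nn)
    then have "K * \<mu> (k0 + k) * 1 \<le> M k" unfolding M_def using Km by (intro mult_left_mono) auto
    then show "K * \<mu> (k0 + k) \<le> M k" by simp
    have "M k \<le> K * \<mu> (k0 + k) * 2" unfolding M_def using k0(6)[of k] Km by (intro mult_left_mono) auto
    then show "M k \<le> 2 * K * \<mu> (k0 + k)" by simp
  qed
  have D16: "16 * (1 / 2 ^ (k0 + k)) \<le> Dk (k0 + k)" for k
  proof -
    have "sqrt (1 / 2 ^ (k0 + k) / Dk (k0 + k)) \<le> (\<Sum>j\<le>k. sqrt (1 / 2 ^ (k0 + j) / Dk (k0 + j)))"
      by (rule member_le_sum[of k "{..k}" "\<lambda>j. sqrt (1 / 2 ^ (k0 + j) / Dk (k0 + j))"]) (use nn in auto)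
    then have "sqrt (1 / 2 ^ (k0 + k) / Dk (k0 + k)) \<le> 1 / 4" using k0(6)[of k] by linarith
    then have "(sqrt (1 / 2 ^ (k0 + k) / Dk (k0 + k)))\<^sup>2 \<le> (1 / 4)\<^sup>2" using nn by (intro power_mono) auto
    then have "1 / 2 ^ (k0 + k) / Dk (k0 + k) \<le> 1 / 16" using Dk(1)[of "k0 + k"] by (simp add: power2_eq_square)
    then show ?thesis using Dk(1)[of "k0 + k"] by (simp add: pos_divide_le_eq mult.commute)
  qed
  have sc: "c2_scale \<Omega> r G C g0 R c1 C1 F1 (1 / 2 ^ (k0 + k)) (F (k0 + k)) (M k) RU U (\<phi> (k0 + k))" for k
  proof (intro c2_scale.intro c2_scale_axioms.intro c2_patch_axioms)
    have k: "k0 + k \<ge> k0" "k0 + k \<ge> 1" using k0(1) by auto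
    show "0 < (1::real) / 2 ^ (k0 + k)" by simp
    show "1 / 2 ^ (k0 + k) \<le> cp / (24 * C)" by (rule k0(2)[OF k(1)])
    show "0 < F (k0 + k)" by (rule F_pos)
    show "1 / 2 ^ (k0 + k) * (F (k0 + k))\<^sup>2 \<le> F1\<^sup>2" using F_bounds(4)[of "k0 + k"] by (simp add: F1f pos_divide_le_eq)
    show "16 * (1 / 2 ^ (k0 + k)) \<le> cD * min (1 / (1 / (1 / 2 ^ (k0 + k) * (F (k0 + k))\<^sup>2))) (N / F (k0 + k))"
      using D16[of k] unfolding Dk_def \<mu>_def .
    show "N / F (k0 + k) \<le> 1 / 8" "2 * C * (N / F (k0 + k)) \<le> g0" "4 * (N / F (k0 + k)) \<le> RU"
      by (rule k0(3-5)[OF k(1)])+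
    show "K * (1 / (1 / 2 ^ (k0 + k) * (F (k0 + k))\<^sup>2)) \<le> M k" "M k \<le> 2 * K * (1 / (1 / 2 ^ (k0 + k) * (F (k0 + k))\<^sup>2))"
      using Mb[of k] unfolding \<mu>_def .
    show "open U" "\<And>p. p \<in> frontier \<Omega> \<Longrightarrow> ball p RU \<subseteq> U" "continuous_on UNIV r" by (rule U rcont, assumption?)+
    show "sm (\<phi> (k0 + k)) c1 x" "sdiff (\<phi> (k0 + k)) x" "- (1 / (F (k0 + k))\<^sup>2) \<le> \<phi> (k0 + k) x \<and> \<phi> (k0 + k) x \<le> 0"
      if "x \<in> U" "- (1 / 2 ^ (k0 + k)) < r x" "r x < 0" for x
      by (rule \<phi>(1-3)[OF k(2) that])+
    show "\<bar>\<phi> (k0 + k) x - \<phi> (k0 + k) y\<bar> \<le> C1 * (1 / (1 / 2 ^ (k0 + k) * (F (k0 + k))\<^sup>2)) * norm (x - y)"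
      if "\<And>w. w \<in> closed_segment x y \<Longrightarrow> w \<in> U \<and> - (1 / 2 ^ (k0 + k)) < r w \<and> r w < 0" for x y
      by (rule \<phi>(4)[OF k(2) that])
  qed
  have A: "z \<in> c2_scale.A \<Omega> C g0 c1 C1 F1 (1 / 2 ^ (k0 + k)) (F (k0 + k)) p"
    if "z \<in> \<Omega>" "infdist z (- \<Omega>) < Dk (k0 + k)" "norm (z - p) < N / F (k0 + k)" for z k p
    using that unfolding c2_scale.A_def[OF sc] Dk_def \<mu>_def by blast
  have "glue \<Omega> (\<lambda>k. 1 / 2 ^ (k0 + k)) (\<lambda>k. \<mu> (k0 + k)) (\<lambda>k. 1 / (F (k0 + k))\<^sup>2) (\<lambda>k. Dk (k0 + k)) (\<lambda>k. N / F (k0 + k))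
      M \<Psi> K c1 (cp / (8 * C)) (2 * C1 + 8 * K + F1\<^sup>2) (max 1 R) (1 / F1\<^sup>2)"
  proof (rule glue.intro)
    show "open \<Omega>" "- \<Omega> \<noteq> {}" by (rule \<Omega>)+
    show "\<Omega> \<subseteq> cball 0 (max 1 R)" using near[of _ _] by (fastforce simp: le_max_iff_disj)
    show "0 < max 1 R" "\<And>k. 0 < (1::real) / 2 ^ (k0 + k)" "\<And>k. (1::real) / 2 ^ (k0 + k) = 2 * (1 / 2 ^ (k0 + Suc k))" by simp_all
    show "1 / F1\<^sup>2 \<le> \<mu> (k0 + k)" for k by (rule \<mu>)
    show "\<mu> (k0 + k) \<le> \<mu> (k0 + Suc k)" for k using \<mu>(3)[of "k0 + k"] by simp
    show "0 < 1 / F1\<^sup>2" using F1 by simp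
    show "\<mu> (k0 + k) * (1 / 2 ^ (k0 + k)) = 1 / (F (k0 + k))\<^sup>2" for k by (rule \<mu>)
    show "1 / (F (k0 + k))\<^sup>2 \<le> 2 * (1 / (F (k0 + Suc k))\<^sup>2)" for k
      using F_sq_double[of "k0 + k"] F_pos[of "k0 + k"] F_pos[of "Suc (k0 + k)"] by (simp add: field_simps)
    show "1 / (F (k0 + Suc k))\<^sup>2 \<le> 1 / (F (k0 + k))\<^sup>2" for k
      using F_bounds(2)[of "k0 + k"] F_pos[of "k0 + k"] F_pos[of "Suc (k0 + k)"]
      by (intro divide_left_mono power_mono mult_pos_pos zero_less_power) auto
    show "(\<lambda>k. 1 / (F (k0 + k))\<^sup>2) \<longlonglongrightarrow> 0"
    proof -
      have "(\<lambda>k. (1 / F (k + k0))\<^sup>2) \<longlonglongrightarrow> 0\<^sup>2" by (intro tendsto_power LIMSEQ_ignore_initial_segment[OF F_tendsto])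
      then show ?thesis by (simp add: power_divide add.commute)
    qed
    show "0 < Dk (k0 + k)" "Dk (k0 + k) \<le> N / F (k0 + k) / 8" for k by (rule Dk)+
    show "Dk (k0 + Suc k) \<le> Dk (k0 + k)" for k using Dk(3)[of "k0 + k"] by simp
    show "Dk (k0 + k) \<le> 1" for k 
    proof -
      have "Dk (k0 + k) \<le> x / 8 \<Longrightarrow> x \<le> 1 / 8 \<Longrightarrow> Dk (k0 + k) \<le> 1" for x by linarith
      from this[OF Dk(2) k0(3)[OF le_add1]] show ?thesis .
    qed
    show "0 < c1" "c1 \<le> 1" "64 \<le> K" by (rule c1 K)+
    show "c1 * (N / F (k0 + k))\<^sup>2 = (64 + c1) * (1 / (F (k0 + k))\<^sup>2)" for k
    proof -
      have "c1 * N\<^sup>2 = 64 + c1" unfolding N(2) using c1 by (simp add: field_simps)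
      then show ?thesis by (simp add: power_divide)
    qed
    show "0 < cp / (8 * C)" using cp C by simp
    show "0 < 2 * C1 + 8 * K + F1\<^sup>2" using C1 K by (simp add: add_pos_nonneg)
    show "(\<Sum>j\<le>k. sqrt (1 / 2 ^ (k0 + j) / Dk (k0 + j))) \<le> 1 / 4" for k by (rule k0(6))
    show "M k = K * \<mu> (k0 + k) * (1 + 4 * (\<Sum>j\<le>k. sqrt (1 / 2 ^ (k0 + j) / Dk (k0 + j))))" for k by (rule M_def)
    fix k p z assume z: "p \<in> frontier \<Omega>" "z \<in> \<Omega>" "infdist z (- \<Omega>) < Dk (k0 + k)" "norm (z - p) < N / F (k0 + k)"
    note zA = A[OF z(2-4)]
    show "- (M k * Dk (k0 + k) * infdist z (- \<Omega>) / (Dk (k0 + k) + infdist z (- \<Omega>))) - 1 / (F (k0 + k))\<^sup>2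
        \<le> \<Psi> k p z + c1 / 8 * (norm (z - p))\<^sup>2"
      "\<Psi> k p z + c1 / 8 * (norm (z - p))\<^sup>2
        \<le> - (M k * Dk (k0 + k) * infdist z (- \<Omega>) / (Dk (k0 + k) + infdist z (- \<Omega>))) + 1 / (F (k0 + k))\<^sup>2"
      using c2_scale.\<Psi>_bounds[OF sc z(1) zA] unfolding Dk_def \<mu>_def \<Psi>_def .
    show "sm (\<Psi> k p) (c1 / 4) z" unfolding \<Psi>_def by (rule c2_scale.\<Psi>_sm[OF sc z(1) zA])
    fix z' assume z': "z' \<in> \<Omega>" "infdist z' (- \<Omega>) < Dk (k0 + k)" "norm (z' - p) < N / F (k0 + k)"
      and n: "norm (z - z') < cp / (8 * C) * (1 / 2 ^ (k0 + k))"
    show "\<bar>\<Psi> k p z - \<Psi> k p z'\<bar> \<le> (2 * C1 + 8 * K + F1\<^sup>2) * \<mu> (k0 + k) * norm (z - z')"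
      unfolding \<Psi>_def \<mu>_def
      by (rule c2_scale.\<Psi>_lipschitz[OF sc z(1) zA A[OF z']]) (use n in \<open>simp add: c2_scale.e0_def[OF sc] mult_ac\<close>)
  qed
  then show ?thesis by (rule that)
qed

end

text \<open>Division by \<open>c0\<close> normalises the Levi bound to 1; the infinitesimal bounds
  \<open>sm\<close> then integrate to sub-mean inequalities on all closed discs in \<Omega>.\<close>

lemma (in glue) solution:
  obtains \<rho> C B where "C > 0" "continuous_on UNIV \<rho>" "\<And>z. z \<in> \<Omega> \<Longrightarrow> \<rho> z < 0" "\<And>z. z \<notin> \<Omega> \<Longrightarrow> \<rho> z = 0"
    "\<And>a b. (\<And>w. cmod w \<le> 1 \<Longrightarrow> a + cscale w b \<in> \<Omega>) \<Longrightarrow> \<rho> a + (norm b)\<^sup>2 \<le> cavg (\<lambda>w. \<rho> (a + cscale w b))"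
    "\<And>k x y. norm (x - y) < 2 * \<delta> k \<Longrightarrow> \<bar>\<rho> x - \<rho> y\<bar> \<le> C * a k" "\<And>x. \<bar>\<rho> x\<bar> \<le> B"
proof (rule that[of "2 * C' / c0" "\<lambda>z. 1 / c0 * \<rho> z" "\<beta> / c0"])
  show "2 * C' / c0 > 0" using C'_pos c0 by simp
  show "continuous_on UNIV (\<lambda>z. 1 / c0 * \<rho> z)" by (intro continuous_intros \<rho>_continuous)
  show "1 / c0 * \<rho> z < 0" if "z \<in> \<Omega>" for z using \<rho>_neg[OF that] c0 by (simp add: divide_less_0_iff)
  show "1 / c0 * \<rho> z = 0" if "z \<notin> \<Omega>" for z using that by (simp add: \<rho>_def)
  show "\<bar>1 / c0 * \<rho> x\<bar> \<le> \<beta> / c0" for x using \<rho>_bound[of x] c0 by (simp add: abs_mult divide_right_mono)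
  show "\<bar>1 / c0 * \<rho> x - 1 / c0 * \<rho> y\<bar> \<le> 2 * C' / c0 * a k" if "norm (x - y) < 2 * \<delta> k" for k x y
  proof -
    have "\<bar>1 / c0 * \<rho> x - 1 / c0 * \<rho> y\<bar> = \<bar>\<rho> x - \<rho> y\<bar> / c0" using c0 by (simp add: diff_divide_distrib[symmetric])
    also have "\<dots> \<le> 2 * C' * a k / c0" using \<rho>_modulus[OF that] c0 by (intro divide_right_mono) auto
    finally show ?thesis by simp
  qed
  fix a b :: "complex^'n" assume "\<And>w. cmod w \<le> 1 \<Longrightarrow> a + cscale w b \<in> \<Omega>"
  from sm_submean_disc[OF \<Omega>(1) continuous_on_subset[OF \<rho>_continuous subset_UNIV] \<rho>_sm this]
  have "\<rho> a + c0 * (norm b)\<^sup>2 \<le> cavg (\<lambda>w. \<rho> (a + cscale w b))" .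
  then have "1 / c0 * (\<rho> a + c0 * (norm b)\<^sup>2) \<le> 1 / c0 * cavg (\<lambda>w. \<rho> (a + cscale w b))"
    using c0 by (intro mult_left_mono) auto
  moreover have "1 / c0 * (\<rho> a + c0 * (norm b)\<^sup>2) = 1 / c0 * \<rho> a + (norm b)\<^sup>2" using c0 by (simp add: distrib_left)
  ultimately show "1 / c0 * \<rho> a + (norm b)\<^sup>2 \<le> cavg (\<lambda>w. 1 / c0 * \<rho> (a + cscale w b))" by (simp only: cavg_cmult)
qed

section \<open>From the hypotheses of the theorem to the locales, and the theorem\<close>

lemma exists_c2_domain:
  fixes \<Omega> :: "(complex^'n) set"
  assumes r: "defining_function \<Omega> r" and dom: "domain \<Omega>" "bounded \<Omega>" "pseudoconvex \<Omega>"
  obtains C g0 R where "c2_domain \<Omega> r (grad r) C g0 R"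
proof -
  have Ck: "Ck_on 2 UNIV r" and \<Omega>: "\<Omega> = {z. r z < 0}" and nd: "\<And>z. z \<in> frontier \<Omega> \<Longrightarrow> \<exists>v. dirder UNIV r [v] z \<noteq> 0"
    using r unfolding defining_function_def by blast+
  have op: "open \<Omega>" "\<Omega> \<noteq> {}" using dom(1) by (auto simp: domain_def)
  have nU: "\<Omega> \<noteq> UNIV" using dom(2) not_bounded_UNIV by metis
  have rc: "continuous_on UNIV r" by (rule Ck2_dirder_continuous(2)[OF open_UNIV Ck])
  obtain R0 where R0: "\<forall>z\<in>\<Omega>. norm z \<le> R0" using dom(2) unfolding bounded_iff ..
  have cl: "closure \<Omega> \<subseteq> cball 0 R0" by (rule closure_minimal) (use R0 in auto)
  obtain C where C: "C \<ge> 1"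
    "\<And>x y. x \<in> cball 0 (R0 + 4) \<Longrightarrow> y \<in> cball 0 (R0 + 4) \<Longrightarrow> norm (grad r x - grad r y) \<le> C * norm (x - y)"
    "\<And>x y. x \<in> cball 0 (R0 + 4) \<Longrightarrow> y \<in> cball 0 (R0 + 4) \<Longrightarrow> \<bar>r x - r y - grad r y \<bullet> (x - y)\<bar> \<le> C * (norm (x - y))\<^sup>2"
    "\<And>x. x \<in> cball 0 (R0 + 4) \<Longrightarrow> norm (grad r x) \<le> C"
    by (rule grad_bounds[OF Ck, of "R0 + 4"]) (rule that; blast)
  have fr: "frontier \<Omega> \<subseteq> cball 0 (R0 + 4)" using cl by (fastforce simp: frontier_def)
  have "C-lipschitz_on (cball 0 (R0 + 4)) (grad r)"
    by (rule lipschitz_onI) (use C in \<open>auto simp: dist_norm\<close>)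
  then have cg: "continuous_on (frontier \<Omega>) (grad r)"
    using lipschitz_on_continuous_on continuous_on_subset fr by blast
  have "frontier \<Omega> \<noteq> {}" using op nU by (simp add: frontier_eq_empty)
  \<comment> \<open>Compactness of the boundary turns the nonvanishing gradient into a uniform lower
    bound \<open>g0\<close>.\<close>
  then obtain p0 where p0: "p0 \<in> frontier \<Omega>" "\<And>p. p \<in> frontier \<Omega> \<Longrightarrow> norm (grad r p0) \<le> norm (grad r p)"
    using continuous_attains_inf[OF compact_frontier_bounded[OF dom(2)] _ continuous_on_norm[OF cg]] by blast
  have "grad r p0 \<noteq> 0"
  proof
    assume "grad r p0 = 0"
    then have "dirder UNIV r [v] p0 = 0" for v using inner_grad[OF Ck, of p0 v] by (metis inner_zero_left)
    then show False using nd[OF p0(1)] by metis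
  qed
  then have g0: "0 < min 1 (norm (grad r p0))" by simp
  have "c2_domain \<Omega> r (grad r) C (min 1 (norm (grad r p0))) (R0 + 4)"
  proof (rule c2_domain.intro)
    show "x \<in> cball 0 (R0 + 4)" if "z \<in> \<Omega>" "dist z x \<le> 4" for z x
    proof -
      have "norm x \<le> norm z + norm (x - z)" using norm_triangle_ineq[of z "x - z"] by simp
      then show ?thesis using R0 that by (fastforce simp: dist_norm norm_minus_commute)
    qed
    show "min 1 (norm (grad r p0)) \<le> norm (grad r p)" if "p \<in> frontier \<Omega>" for p using p0(2)[OF that] by simp
    show "r p = 0" if p: "p \<in> frontier \<Omega>" for p
    proof -
      have "closure \<Omega> \<subseteq> {z. r z \<le> 0}"
        by (rule closure_minimal) (use \<Omega> rc in \<open>auto intro!: closed_Collect_le continuous_intros\<close>)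
      then have "r p \<le> 0" using p by (auto simp: frontier_def)
      moreover have "p \<notin> \<Omega>" using p op(1) by (simp add: frontier_def interior_open)
      then have "\<not> r p < 0" using \<Omega> by blast
      ultimately show ?thesis by simp
    qed
    show "- \<Omega> \<noteq> {}" using nU by blast
  qed (use \<Omega> op dom(3) C g0 in blast | simp)+
  then show ?thesis by (rule that)
qed

lemma exists_f_scale:
  fixes \<Omega> :: "(complex^'n) set"
  assumes "c2_domain \<Omega> r G C g0 R" "growth f" "bounded \<Omega>" "f_property \<Omega> r f" "continuous_on UNIV r"
  obtains c1 C1 RU U \<phi> where "f_scale \<Omega> r G C g0 R c1 C1 (f 1) f RU U \<phi>"
proof -
  interpret c2_domain \<Omega> r G C g0 R by fact
  interpret growth f by fact
  obtain U c C0 \<phi> where U: "open U" "frontier \<Omega> \<subseteq> U" and c: "c > 0" and C0: "C0 > 0"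
    and P: "\<forall>\<delta>::real. 0 < \<delta> \<and> \<delta> < 1 \<longrightarrow>
           psh U (\<phi> \<delta>) \<and> Ck_on 2 U (\<phi> \<delta>) \<and> (\<forall>z\<in>U. -1 \<le> \<phi> \<delta> z \<and> \<phi> \<delta> z \<le> 0) \<and>
           (\<forall>z\<in>U \<inter> {z\<in>\<Omega>. - \<delta> < r z \<and> r z < 0}.
              (\<forall>X. levi U (\<phi> \<delta>) z X \<ge> c * (f (1 / \<delta>))\<^sup>2 * (norm X)\<^sup>2) \<and>
              (\<forall>v. \<bar>dirder U (\<phi> \<delta>) [v] z\<bar> \<le> C0 / \<delta> * norm v))"
    using assms(4) unfolding f_property_def by blast
  have compact: "compact (frontier \<Omega>)" by (rule compact_frontier_bounded[OF assms(3)])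
  obtain RU where RU: "RU > 0" "(\<Union>x\<in>frontier \<Omega>. ball x RU) \<subseteq> U"
    using compact_subset_open_imp_ball_epsilon_subset[OF compact U] by metis
  define c1 C1 where "c1 = min 1 c" and "C1 = max 1 C0"
  \<comment> \<open>Division by the square of \<open>F k\<close> makes the Levi bound
    \<open>c\<close> on every level and turns the gradient bound \<open>C0 / \<delta>\<close> into
    \<open>C0\<close> times the slope of that level.\<close>
  define \<psi> where "\<psi> k x = 1 / (F k)\<^sup>2 * \<phi> (1 / 2 ^ k) x" for k :: nat and x
  have F0: "F k > 0" for k using F_bounds(1)[of k] by linarith
  have small: "0 < (1::real) / 2 ^ k" "(1::real) / 2 ^ k < 1" if "k \<ge> 1" for k :: nat
    using one_less_power[of "2::real" k] that by simp_all
  note P1 = P[rule_format, OF conjI[OF small]]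
  have Ck: "Ck_on 2 U (\<phi> (1 / 2 ^ k))" and rng: "\<And>z. z \<in> U \<Longrightarrow> -1 \<le> \<phi> (1 / 2 ^ k) z \<and> \<phi> (1 / 2 ^ k) z \<le> 0" if "k \<ge> 1" for k
    using P1[OF that that] by (simp_all only: Ball_def)
  have lev: "c * (F k)\<^sup>2 * (norm X)\<^sup>2 \<le> levi U (\<phi> (1 / 2 ^ k)) z X"
    and grd: "\<bar>dirder U (\<phi> (1 / 2 ^ k)) [v] z\<bar> \<le> C0 / (1 / 2 ^ k) * norm v"
    if "k \<ge> 1" "z \<in> U" "- (1 / 2 ^ k) < r z" "r z < 0" for k z X v
  proof -
    have "z \<in> U \<inter> {z\<in>\<Omega>. - (1 / 2 ^ k) < r z \<and> r z < 0}" using that \<Omega>(1) by blast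
    then have 1: "(\<forall>X. levi U (\<phi> (1 / 2 ^ k)) z X \<ge> c * (f (1 / (1 / 2 ^ k)))\<^sup>2 * (norm X)\<^sup>2) \<and>
              (\<forall>v. \<bar>dirder U (\<phi> (1 / 2 ^ k)) [v] z\<bar> \<le> C0 / (1 / 2 ^ k) * norm v)"
      by (rule P1[OF that(1) that(1), THEN conjunct2, THEN conjunct2, THEN conjunct2, THEN bspec])
    then have "levi U (\<phi> (1 / 2 ^ k)) z X \<ge> c * (f (1 / (1 / 2 ^ k)))\<^sup>2 * (norm X)\<^sup>2" by (simp only:)
    then show "c * (F k)\<^sup>2 * (norm X)\<^sup>2 \<le> levi U (\<phi> (1 / 2 ^ k)) z X" by (simp add: F_def del: dirder.simps)
    show "\<bar>dirder U (\<phi> (1 / 2 ^ k)) [v] z\<bar> \<le> C0 / (1 / 2 ^ k) * norm v" using 1 by (simp only:)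
  qed
  have "f_scale \<Omega> r G C g0 R c1 C1 (f 1) f RU U \<psi>"
  proof (intro f_scale.intro c2_patch.intro c2_patch_axioms.intro f_scale_axioms.intro assms(1,2))
    show "0 < c1" "c1 \<le> 1" "1 \<le> C1" using c by (auto simp: c1_def C1_def)
    show "1 \<le> f 1" using f1[of 1] by simp
    show "f 1 = f 1" "RU > 0" "open U" "continuous_on UNIV r" by (rule refl RU U assms)+
    show "ball p RU \<subseteq> U" if "p \<in> frontier \<Omega>" for p using RU(2) that by blast
    show "sm (\<psi> k) c1 x" if x: "k \<ge> 1" "x \<in> U" "- (1 / 2 ^ k) < r x" "r x < 0" for k x
    proof -
      have "sm (\<phi> (1 / 2 ^ k)) (c * (F k)\<^sup>2) x" by (rule sm_levi[OF U(1) Ck[OF x(1)] x(2) lev[OF x]])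
      then have "sm (\<lambda>x. 1 / (F k)\<^sup>2 * \<phi> (1 / 2 ^ k) x) (1 / (F k)\<^sup>2 * (c * (F k)\<^sup>2)) x"
        by (rule sm_cmult) (use F0[of k] in simp)
      then show ?thesis unfolding \<psi>_def by (rule sm_weaken) (use F0[of k] in \<open>simp add: c1_def\<close>)
    qed
    show "sdiff (\<psi> k) x" if x: "k \<ge> 1" "x \<in> U" for k x
      unfolding \<psi>_def by (rule sdiff_cmult[OF sdiff_Ck2[OF U(1) Ck[OF x(1)] x(2)]])
    show "- (1 / (F k)\<^sup>2) \<le> \<psi> k x \<and> \<psi> k x \<le> 0" if x: "k \<ge> 1" "x \<in> U" for k x
    proof -
      have "1 / (F k)\<^sup>2 * -1 \<le> 1 / (F k)\<^sup>2 * \<phi> (1 / 2 ^ k) x" "1 / (F k)\<^sup>2 * \<phi> (1 / 2 ^ k) x \<le> 1 / (F k)\<^sup>2 * 0"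
        using rng[OF x] by (intro mult_left_mono; simp)+
      then show ?thesis by (simp add: \<psi>_def)
    qed
    show "\<bar>\<psi> k x - \<psi> k y\<bar> \<le> C1 * (1 / (1 / 2 ^ k * (F k)\<^sup>2)) * norm (x - y)"
      if k: "k \<ge> 1" and seg: "\<And>w. w \<in> closed_segment x y \<Longrightarrow> w \<in> U \<and> - (1 / 2 ^ k) < r w \<and> r w < 0" for k x y
    proof -
      have "norm (\<phi> (1 / 2 ^ k) x - \<phi> (1 / 2 ^ k) y) \<le> C0 / (1 / 2 ^ k) * norm (x - y)"
      proof (rule differentiable_bound[where S = "closed_segment x y" and f' = "\<lambda>x v. dirder U (\<phi> (1 / 2 ^ k)) [v] x"])
        fix w assume "w \<in> closed_segment x y"
        note w = seg[OF this]
        have wU: "w \<in> U" using w by blast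
        show "(\<phi> (1 / 2 ^ k) has_derivative (\<lambda>v. dirder U (\<phi> (1 / 2 ^ k)) [v] w)) (at w within closed_segment x y)"
          by (rule has_derivative_at_withinI[OF Ck2_dirder(1)[OF U(1) Ck[OF k] wU]])
        show "onorm (\<lambda>v. dirder U (\<phi> (1 / 2 ^ k)) [v] w) \<le> C0 / (1 / 2 ^ k)"
          by (rule onorm_le, unfold real_norm_def, rule grd) (use k w in auto)
      qed auto
      then have "1 / (F k)\<^sup>2 * \<bar>\<phi> (1 / 2 ^ k) x - \<phi> (1 / 2 ^ k) y\<bar> \<le> 1 / (F k)\<^sup>2 * (C0 / (1 / 2 ^ k) * norm (x - y))"
        unfolding real_norm_def by (intro mult_left_mono) auto
      also have "\<dots> = C0 * (1 / (1 / 2 ^ k * (F k)\<^sup>2)) * norm (x - y)" by simp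
      also have "\<dots> \<le> C1 * (1 / (1 / 2 ^ k * (F k)\<^sup>2)) * norm (x - y)" by (intro mult_right_mono) (auto simp: C1_def)
      also have "1 / (F k)\<^sup>2 * \<bar>\<phi> (1 / 2 ^ k) x - \<phi> (1 / 2 ^ k) y\<bar> = \<bar>\<psi> k x - \<psi> k y\<bar>"
        by (simp add: \<psi>_def diff_divide_distrib[symmetric])
      finally show ?thesis .
    qed
  qed
  then show ?thesis by (rule that)
qed

theorem theorem2p1:
  fixes f :: "real \<Rightarrow> real" and \<Omega> :: "(complex^'n) set"
  assumes f_range: "\<forall>t\<ge>1. f t \<ge> 1"
    and f_smooth: "smooth_on {1..} f"
    and f_mono: "mono_on {1..} f"
    and f_sqrt: "antimono_on {1..} (\<lambda>t. f t / sqrt t)"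
    and f_int: "set_integrable lborel {1..} (\<lambda>a. 1 / (a * f a))"
    and dom: "domain \<Omega>" and bdd: "bounded \<Omega>" and pscvx: "pseudoconvex \<Omega>"
    and fprop: "\<exists>r. defining_function \<Omega> r \<and> f_property \<Omega> r f"
  shows "\<exists>\<rho>. continuous_on (closure \<Omega>) \<rho> \<and> psh \<Omega> \<rho> \<and>
           (\<forall>z\<in>closure \<Omega>. z \<in> \<Omega> \<longleftrightarrow> \<rho> z < 0) \<and>
           frontier \<Omega> = {z\<in>closure \<Omega>. \<rho> z = 0} \<and>
           (\<forall>X tf. smooth_on UNIV tf \<and> (\<forall>z. tf z \<ge> 0) \<and>
                  (\<exists>K. compact K \<and> K \<subseteq> \<Omega> \<and> (\<forall>z. z \<notin> K \<longrightarrow> tf z = 0)) \<longrightarrow>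
              (LINT z:\<Omega>|lborel. \<rho> z * levi UNIV tf z X) \<ge> (norm X)\<^sup>2 * (LINT z:\<Omega>|lborel. tf z)) \<and>
           (\<exists>C>0. \<forall>z\<in>closure \<Omega>. \<forall>z'\<in>closure \<Omega>. 0 < dist z z' \<and> dist z z' \<le> 1 \<longrightarrow>
              \<bar>\<rho> z - \<rho> z'\<bar> \<le> C / (gfun f (1 / dist z z'))\<^sup>2)"
proof -
  obtain r where r: "defining_function \<Omega> r" "f_property \<Omega> r f" using fprop by blast
  have gr: "growth f"
  proof (rule growth.intro)
    show "set_integrable lborel {1..} (\<lambda>a. 1 / (a * f a))" by (rule f_int)
    show "1 \<le> f t" if "1 \<le> t" for t using f_range that by blast
    show "f s \<le> f t" if "1 \<le> s" "s \<le> t" for s t using f_mono that by (auto simp: mono_on_def)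
    show "f t / sqrt t \<le> f s / sqrt s" if "1 \<le> s" "s \<le> t" for s t
      using monotone_onD[OF f_sqrt, of s t] that by simp
  qed
  interpret growth f by (rule gr)
  have rc: "continuous_on UNIV r"
    using r(1) unfolding defining_function_def by (intro Ck2_dirder_continuous(2)[OF open_UNIV]) blast
  obtain C g0 R where c2: "c2_domain \<Omega> r (grad r) C g0 R" by (rule exists_c2_domain[OF r(1) dom bdd pscvx])
  obtain c1 C1 RU U \<phi> where fs: "f_scale \<Omega> r (grad r) C g0 R c1 C1 (f 1) f RU U \<phi>"
    by (rule exists_f_scale[OF c2 gr bdd r(2) rc])
  obtain k0 D L M \<Psi> K e1 \<Lambda> R' m0 m where gl:
    "glue \<Omega> (\<lambda>k. 1 / 2 ^ (k0 + k)) m (\<lambda>k. 1 / (F (k0 + k))\<^sup>2) D L M \<Psi> K c1 e1 \<Lambda> R' m0"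
    by (rule f_scale.exists_glue[OF fs]) (erule that)
  obtain \<rho> C' B where C': "C' > 0" and \<rho>: "continuous_on UNIV \<rho>" "\<And>z. z \<in> \<Omega> \<Longrightarrow> \<rho> z < 0" "\<And>z. z \<notin> \<Omega> \<Longrightarrow> \<rho> z = 0"
    and sub: "\<And>a b. (\<And>w. cmod w \<le> 1 \<Longrightarrow> a + cscale w b \<in> \<Omega>) \<Longrightarrow> \<rho> a + (norm b)\<^sup>2 \<le> cavg (\<lambda>w. \<rho> (a + cscale w b))"
    and mod: "\<And>k x y. norm (x - y) < 2 * (1 / 2 ^ (k0 + k)) \<Longrightarrow> \<bar>\<rho> x - \<rho> y\<bar> \<le> C' * (1 / (F (k0 + k))\<^sup>2)"
    and B: "\<And>x. \<bar>\<rho> x\<bar> \<le> B"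
  proof (rule glue.solution[OF gl])
    fix \<rho> C B
    assume s: "C > 0" "continuous_on UNIV \<rho>" "\<And>z. z \<in> \<Omega> \<Longrightarrow> \<rho> z < 0" "\<And>z. z \<notin> \<Omega> \<Longrightarrow> \<rho> z = 0"
      "\<And>a b. (\<And>w. cmod w \<le> 1 \<Longrightarrow> a + cscale w b \<in> \<Omega>) \<Longrightarrow> \<rho> a + (norm b)\<^sup>2 \<le> cavg (\<lambda>w. \<rho> (a + cscale w b))"
      "\<And>k x y. norm (x - y) < 2 * (1 / 2 ^ (k0 + k)) \<Longrightarrow> \<bar>\<rho> x - \<rho> y\<bar> \<le> C * (1 / (F (k0 + k))\<^sup>2)" "\<And>x. \<bar>\<rho> x\<bar> \<le> B"
    show thesis by (rule that[OF s])
  qed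
  have op: "open \<Omega>" using dom by (simp add: domain_def)
  \<comment> \<open>\<open>C'\<close> handles distances below \<open>1 / 2 ^ k0\<close>; larger ones
    are covered by the oscillation \<open>2 * B\<close>, since there \<open>f (1 / s)\<close> is at
    most \<open>F k0\<close>.\<close>
  let ?C = "C' + 2 * B * (F k0)\<^sup>2"
  have "psh \<Omega> \<rho>" unfolding psh_def
  proof (intro conjI allI impI)
    show "usc_on \<Omega> \<rho>" unfolding usc_on_def
    proof (intro ballI allI impI)
      fix x and e :: real assume "x \<in> \<Omega>" "0 < e"
      have "(\<rho> \<longlongrightarrow> \<rho> x) (at x within \<Omega>)" using continuous_on_subset[OF \<rho>(1) subset_UNIV] \<open>x \<in> \<Omega>\<close> by (simp add: continuous_on_def)
      then show "\<forall>\<^sub>F y in at x within \<Omega>. \<rho> y < \<rho> x + e" by (rule order_tendstoD(2)) (use \<open>0 < e\<close> in simp)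
    qed
    fix a b assume "\<forall>w. cmod w \<le> 1 \<longrightarrow> a + cscale w b \<in> \<Omega>"
    then have "\<rho> a + (norm b)\<^sup>2 \<le> cavg (\<lambda>w. \<rho> (a + cscale w b))" by (intro sub) blast
    then show "\<rho> a \<le> (1 / (2 * pi)) * integral {0..2 * pi} (\<lambda>\<theta>. \<rho> (a + cscale (cis \<theta>) b))"
      unfolding cavg_def using zero_le_power2[of "norm b"] by linarith
  qed
  moreover have "\<forall>z\<in>closure \<Omega>. z \<in> \<Omega> \<longleftrightarrow> \<rho> z < 0" using \<rho>(2,3) by (metis less_irrefl)
  moreover have "frontier \<Omega> = {z\<in>closure \<Omega>. \<rho> z = 0}"
    unfolding frontier_def interior_open[OF op] using \<rho>(2,3) by force
  moreover have "\<forall>X tf. smooth_on UNIV tf \<and> (\<forall>z. tf z \<ge> 0) \<and>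
                  (\<exists>K. compact K \<and> K \<subseteq> \<Omega> \<and> (\<forall>z. z \<notin> K \<longrightarrow> tf z = 0)) \<longrightarrow>
              (LINT z:\<Omega>|lborel. \<rho> z * levi UNIV tf z X) \<ge> (norm X)\<^sup>2 * (LINT z:\<Omega>|lborel. tf z)"
  proof (intro allI impI, elim conjE exE)
    fix X tf K assume tf: "smooth_on UNIV tf" "\<forall>z. tf z \<ge> 0" and K: "compact K" "K \<subseteq> \<Omega>" "\<forall>z. z \<notin> K \<longrightarrow> tf z = 0"
    have Ck: "Ck_on 2 UNIV tf" using tf(1) unfolding smooth_on_def ..
    show "(norm X)\<^sup>2 * (LINT z:\<Omega>|lborel. tf z) \<le> (LINT z:\<Omega>|lborel. \<rho> z * levi UNIV tf z X)"
      by (rule submean_distribution[OF \<rho>(1,3) op bdd sub Ck tf(2)[rule_format] K(1,2) K(3)[rule_format]])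
  qed
  moreover have "\<exists>C>0. \<forall>z\<in>closure \<Omega>. \<forall>z'\<in>closure \<Omega>. 0 < dist z z' \<and> dist z z' \<le> 1 \<longrightarrow>
              \<bar>\<rho> z - \<rho> z'\<bar> \<le> C / (gfun f (1 / dist z z'))\<^sup>2"
  \<comment> \<open>The factor 9 is the square of the 3 in
    \<open>1 / (3 * f t) \<le> 1 / gfun f t\<close>.\<close>
  proof (intro exI[of _ "9 * ?C"] conjI ballI impI)
    have B0: "0 \<le> B" using B[of 0] by linarith
    show "0 < 9 * ?C" using C' B0 by (simp add: add_pos_nonneg)
    fix z z' :: "complex^'n" assume s: "0 < dist z z' \<and> dist z z' \<le> 1"
    define s where "s = dist z z'"
    have s1: "0 < s" "1 \<le> 1 / s" using s by (simp_all add: s_def)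
    have f0: "f (1 / s) \<ge> 1" by (rule f1[OF s1(2)])
    have "\<bar>\<rho> z - \<rho> z'\<bar> \<le> ?C / (f (1 / s))\<^sup>2"
    proof (cases "s < 1 / 2 ^ k0")
      case True
      have "((\<lambda>k. (1::real) / 2 ^ k) \<longlongrightarrow> 0) sequentially" by (rule LIMSEQ_divide_realpow_zero) simp
      then have "\<forall>\<^sub>F k in sequentially. (1::real) / 2 ^ k < s" using s1(1) by (intro order_tendstoD(2)) auto
      then obtain n where "\<forall>k\<ge>n. (1::real) / 2 ^ k < s" unfolding eventually_sequentially ..
      then have n: "(1::real) / 2 ^ (k0 + n) \<le> s" by (simp add: less_imp_le)
      \<comment> \<open>The first dyadic level not above \<open>s\<close>: then \<open>s\<close> is
        less than twice that level, so \<open>mod\<close> applies, and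
        \<open>1 / s \<le> 2 ^ (k0 + k)\<close>, so monotonicity bounds \<open>f (1 / s)\<close> by
        \<open>F (k0 + k)\<close>.\<close>
      define k where "k = (LEAST n. (1::real) / 2 ^ (k0 + n) \<le> s)"
      have k: "(1::real) / 2 ^ (k0 + k) \<le> s" unfolding k_def by (rule LeastI[of "\<lambda>n. (1::real) / 2 ^ (k0 + n) \<le> s"]) (rule n)
      have "k \<noteq> 0" using k True by (intro notI) simp
      then obtain j where j: "k = Suc j" using not0_implies_Suc by blast
      then have "\<not> (1::real) / 2 ^ (k0 + j) \<le> s" using not_less_Least[of j "\<lambda>n. (1::real) / 2 ^ (k0 + n) \<le> s"] by (simp add: k_def)
      then have "norm (z - z') < 2 * (1 / 2 ^ (k0 + k))" by (simp add: j s_def dist_norm)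
      then have 1: "\<bar>\<rho> z - \<rho> z'\<bar> \<le> C' * (1 / (F (k0 + k))\<^sup>2)" by (rule mod)
      have "1 / s \<le> 2 ^ (k0 + k)" using k s1(1) by (simp add: field_simps)
      then have fF: "f (1 / s) \<le> F (k0 + k)" unfolding F_def by (rule f_mono[OF s1(2)])
      have "1 / (F (k0 + k))\<^sup>2 \<le> 1 / (f (1 / s))\<^sup>2" using f0 fF by (intro divide_left_mono power_mono mult_pos_pos) auto
      then have "C' * (1 / (F (k0 + k))\<^sup>2) \<le> ?C * (1 / (f (1 / s))\<^sup>2)" using C' B0 by (intro mult_mono) auto
      with 1 show ?thesis by simp
    next
      case False
      then have "1 / s \<le> 2 ^ k0" using s1(1) by (simp add: field_simps)
      then have fF: "f (1 / s) \<le> F k0" unfolding F_def by (rule f_mono[OF s1(2)])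
      have "(f (1 / s))\<^sup>2 \<le> (F k0)\<^sup>2" using f0 fF by (intro power_mono) auto
      then have "2 * B * (f (1 / s))\<^sup>2 \<le> 2 * B * (F k0)\<^sup>2" using B0 by (intro mult_left_mono) auto
      also have "\<dots> \<le> ?C" using C' by simp
      finally have "2 * B \<le> ?C / (f (1 / s))\<^sup>2" using f0 by (simp add: pos_le_divide_eq)
      moreover have "\<bar>\<rho> z - \<rho> z'\<bar> \<le> 2 * B" using B[of z] B[of z'] by linarith
      ultimately show ?thesis by linarith
    qed
    also have "\<dots> = 9 * ?C * (1 / (3 * f (1 / s)))\<^sup>2"
    proof -
      have "x / y\<^sup>2 = 9 * x * (1 / (3 * y))\<^sup>2" for x y :: real by (simp add: power2_eq_square)
      then show ?thesis .
    qed
    also have "\<dots> \<le> 9 * ?C * (1 / gfun f (1 / s))\<^sup>2"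
      using inverse_f_le_gfun[OF s1(2)] f0 C' B0 by (intro mult_left_mono power_mono) auto
    finally show "\<bar>\<rho> z - \<rho> z'\<bar> \<le> 9 * ?C / (gfun f (1 / dist z z'))\<^sup>2" by (simp add: s_def power_divide)
  qed
  ultimately show ?thesis using continuous_on_subset[OF \<rho>(1) subset_UNIV] by blast
qed

end
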